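(* Let $C$ be a smooth irreducible projective curve over $\mathbb{C}$, $n\geq 3$ an integer, $g\in H^1(C,\mathcal{G}_n)$, $L=H^1(\xi_n)(g)\in\mathrm{Pic}(C)$, and $g_2$ the image of $g$ in $H^1(C,\mathcal{G}_2)$. Let $(T_C\oplus\mathcal{O}_C)^g$ be the sheaf obtained from $T_C\oplus\mathcal{O}_C\simeq\ker(\mathcal{G}_n\to\mathcal{G}_{n-1})$ by twisting by $g$ (for the conjugation action of $\mathcal{G}_n$). Then $$(T_C\oplus\mathcal{O}_C)^g\simeq E(g_2)\otimes L^{n-1}.$$
   Context: For $m\geq 2$ let $\mathcal{G}_m$ be the sheaf of groups on $C$ such that for a proper open subset $U$, $\mathcal{G}_m(U)$ is the group of $\mathbb{C}$-algebra automorphisms of $\mathcal{O}_C(U)[t]/(t^m)$ commuting with the projection $t\mapsto 0$ to $\mathcal{O}_C(U)$. If $T_{C|U}$ is trivial, generated by a section $\frac{d}{dx}$, the elements of $\mathcal{G}_m(U)$ are the automorphisms $\phi_{\mu\nu}$ with $\mu,\nu\in\mathcal{O}_C(U)[t]/(t^{m-1})$, $\nu$ invertible, defined by $\phi_{\mu\nu}(\alpha)=\sum_{k\geq 0}\frac{1}{k!}(\mu t)^k\frac{d^k\alpha}{dx^k}$ for $\alpha\in\mathcal{O}_C(U)$ and $\phi_{\mu\nu}(t)=\nu t$. $H^1(C,\mathcal{G}_m)$ is the nonabelian Čech cohomology set: classes of cocycles $(g_{ij})$, $g_{ij}g_{jk}=g_{ik}$, modulo $g_{ij}\sim h_ig_{ij}h_j^{-1}$.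 The morphism $\xi_m:\mathcal{G}_m\to\mathcal{O}_C^*$ sends $\phi$ with $\phi(t)=\nu t$ to $\nu|_{t=0}$, and $H^1(\xi_m):H^1(C,\mathcal{G}_m)\to H^1(C,\mathcal{O}_C^* )=\mathrm{Pic}(C)$ is the induced map. The kernel of the restriction morphism $\mathcal{G}_n\to\mathcal{G}_{n-1}$ is a sheaf of abelian groups isomorphic to $T_C\oplus\mathcal{O}_C$: locally it consists of the $\lambda_{\theta\beta}=\phi_{\theta t^{n-2},\,1+\beta t^{n-2}}$, which corresponds to $(\theta\frac{d}{dx},\beta)$. Twisting: if $g$ is represented by a cocycle $(g_{ij})$ for an open cover $(U_i)$ and $\mathcal{G}_n$ acts on a sheaf of groups $\Gamma$, then $\Gamma^g$ is the sheaf obtained by gluing the $\Gamma_{|U_i}$ by means of the automorphisms $g_{ij}$ of $\Gamma_{|U_{ij}}$ (sections are families $(\gamma_i)$, $\gamma_i\in\Gamma(U_i)$, with $\gamma_i=g_{ij}\cdot\gamma_j$). Definition of $E(g_2)$: an element of $\mathcal{G}_2$ is locally given by a pair $(\mu,\nu)$ with $\mu$ a section of $T_C$ and $\nu$ a section of $\mathcal{O}_C^*$ (acting by $\alpha\mapsto\alpha+\mu(\alpha)t$, $t\mapsto\nu t$). Let $g_2$ be represented by a cocycle $(\mu_{ij},\nu_{ij})$. Then $(\nu_{ij})$ represents $L$, and $(\mu_{ij})$, which satisfies $\mu_{ij}+\nu_{ij}\mu_{jk}=\mu_{ik}$, represents an element $u\in H^1(C,T_C\otimes L)=\mathrm{Ext}^1_{\mathcal{O}_C}(L^*,T_C)$,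 whose orbit under multiplication by $\mathbb{C}^*$ depends only on $g_2$. $E(g_2)$ is the rank 2 vector bundle in the corresponding extension $0\to T_C\to E(g_2)\to L^*\to 0$. *)

theory Defs
  imports
    "HOL-Analysis.Analysis"
    "HOL-Algebra.Free_Abelian_Groups"
    "HOL-Algebra.QuotRing"
    "HOL-Algebra.Module"
begin

section \<open>Smooth irreducible projective curves over the complex numbers\<close>

text \<open>Classical projective varieties.  The ambient space is the projective space of lines in
  \<open>complex ^ 'n\<close>, of dimension \<open>CARD('n) - 1\<close>; a point is a line through the origin, as a set of
  vectors.\<close>

type_synonym 'n pt = "(complex ^ 'n) set"

definition proj_space :: "'n::finite pt set"
  where "proj_space = {vec.span {x} | x. x \<noteq> 0}"

text \<open>As the field is infinite, a polynomial is identified with the function it induces.\<close>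

definition hom_poly :: "nat \<Rightarrow> (complex ^ 'n::finite \<Rightarrow> complex) \<Rightarrow> bool"
  where "hom_poly d f \<longleftrightarrow>
    (\<exists>c :: ('n \<Rightarrow> nat) \<Rightarrow> complex.
       f = (\<lambda>x. \<Sum>m \<in> {m. (\<Sum>i\<in>UNIV. m i) = d}. c m * (\<Prod>i\<in>UNIV. (x $ i) ^ m i)))"

definition zero_locus :: "(complex ^ 'n::finite \<Rightarrow> complex) set \<Rightarrow> 'n pt set"
  where "zero_locus S = {l \<in> proj_space. \<forall>f\<in>S. \<forall>x\<in>l. f x = 0}"

definition zclosed :: "'n::finite pt set \<Rightarrow> bool"
  where "zclosed Z \<longleftrightarrow> (\<exists>S. (\<forall>f\<in>S. \<exists>d. hom_poly d f) \<and> Z = zero_locus S)"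

definition zirreducible :: "'n::finite pt set \<Rightarrow> bool"
  where "zirreducible Z \<longleftrightarrow> Z \<noteq> {} \<and>
    (\<forall>A B. zclosed A \<and> zclosed B \<and> Z \<subseteq> A \<union> B \<longrightarrow> Z \<subseteq> A \<or> Z \<subseteq> B)"

definition has_chain :: "'n::finite pt set \<Rightarrow> nat \<Rightarrow> bool"
  where "has_chain X d \<longleftrightarrow> (\<exists>Z :: nat \<Rightarrow> 'n pt set.
    (\<forall>i\<le>d. zclosed (Z i) \<and> zirreducible (Z i) \<and> Z i \<subseteq> X) \<and> (\<forall>i<d. Z i \<subset> Z (Suc i)))"

definition krull_dim_eq :: "'n::finite pt set \<Rightarrow> nat \<Rightarrow> bool"
  where "krull_dim_eq X d \<longleftrightarrow> has_chain X d \<and> \<not> has_chain X (Suc d)"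

text \<open>The kernel of the Jacobian matrix, at \<open>x\<close>, of the homogeneous ideal of \<open>X\<close>.  The Jacobian
  criterion for smoothness at the point spanned by \<open>x\<close> is that this kernel, the tangent space of
  the affine cone over \<open>X\<close>, has dimension \<open>dim X + 1\<close>.\<close>

definition cone_tangent_space :: "'n::finite pt set \<Rightarrow> complex ^ 'n \<Rightarrow> (complex ^ 'n) set"
  where "cone_tangent_space X x =
    {v. \<forall>d f. hom_poly d f \<and> (\<forall>l\<in>X. \<forall>y\<in>l. f y = 0) \<longrightarrow> deriv (\<lambda>z. f (x + z *s v)) 0 = 0}"

definition smooth_irreducible_projective_curve :: "'n::finite pt set \<Rightarrow> bool"
  where "smooth_irreducible_projective_curve C \<longleftrightarrow>
    zclosed C \<and> zirreducible C \<and> krull_dim_eq C 1 \<and>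
    (\<forall>l\<in>C. \<forall>x\<in>l - {0}. vec.dim (cone_tangent_space C x) = 2)"

definition zopen :: "'n::finite pt set \<Rightarrow> 'n pt set \<Rightarrow> bool"
  where "zopen C U \<longleftrightarrow> (\<exists>Z. zclosed Z \<and> U = C - Z)"

definition opens :: "'n::finite pt set \<Rightarrow> 'n pt set \<Rightarrow> 'n pt set set"
  where "opens C U = {V. zopen C V \<and> V \<subseteq> U}"

definition regular :: "'n::finite pt set \<Rightarrow> 'n pt set \<Rightarrow> ('n pt \<Rightarrow> complex) \<Rightarrow> bool"
  where "regular C U f \<longleftrightarrow> f \<in> extensional U \<and>
    (\<forall>l\<in>U. \<exists>V\<in>opens C U. \<exists>d a b. l \<in> V \<and> hom_poly d a \<and> hom_poly d b \<and>
       (\<forall>m\<in>V. \<forall>x\<in>m - {0}. b x \<noteq> 0 \<and> f m = a x / b x))"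

definition struct_sheaf :: "'n::finite pt set \<Rightarrow> 'n pt set \<Rightarrow> ('n pt \<Rightarrow> complex) ring"
  where "struct_sheaf C U =
    \<lparr> carrier = {f. regular C U f},
      monoid.mult = (\<lambda>f g. \<lambda>p\<in>U. f p * g p), one = (\<lambda>p\<in>U. 1),
      zero = (\<lambda>p\<in>U. 0), add = (\<lambda>f g. \<lambda>p\<in>U. f p + g p) \<rparr>"


section \<open>Sheaves of groups and sheaves of modules\<close>

text \<open>The records hold the data of a presheaf; the values on sets that are not open in \<open>C\<close> are
  irrelevant.  \<open>gres F U V\<close> and \<open>mres F U V\<close> are the restriction maps from \<open>U\<close> to \<open>V\<close>.  The fields
  \<open>mult\<close> and \<open>one\<close>, which the library's \<open>module\<close> record inherits from \<open>ring\<close>, play no role in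
  \<open>msec F U\<close>.\<close>

record ('p, 'g) group_sheaf =
  gsec :: "'p set \<Rightarrow> 'g monoid"
  gres :: "'p set \<Rightarrow> 'p set \<Rightarrow> 'g \<Rightarrow> 'g"

record ('p, 'e) module_sheaf =
  msec :: "'p set \<Rightarrow> ('p \<Rightarrow> complex, 'e) module"
  mres :: "'p set \<Rightarrow> 'p set \<Rightarrow> 'e \<Rightarrow> 'e"

definition is_module_sheaf :: "'n::finite pt set \<Rightarrow> ('n pt, 'e) module_sheaf \<Rightarrow> bool"
  where "is_module_sheaf C F \<longleftrightarrow>
    (\<forall>U\<in>opens C C. module (struct_sheaf C U) (msec F U)) \<and>
    (\<forall>U\<in>opens C C. \<forall>x\<in>carrier (msec F U). mres F U U x = x) \<and>
    (\<forall>U\<in>opens C C. \<forall>V\<in>opens C U. \<forall>x\<in>carrier (msec F U).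
       mres F U V x \<in> carrier (msec F V) \<and>
       (\<forall>W\<in>opens C V. mres F V W (mres F U V x) = mres F U W x) \<and>
       (\<forall>y\<in>carrier (msec F U).
          mres F U V (x \<oplus>\<^bsub>msec F U\<^esub> y) = mres F U V x \<oplus>\<^bsub>msec F V\<^esub> mres F U V y) \<and>
       (\<forall>f\<in>carrier (struct_sheaf C U).
          mres F U V (f \<odot>\<^bsub>msec F U\<^esub> x) = restrict f V \<odot>\<^bsub>msec F V\<^esub> mres F U V x)) \<and>
    (\<forall>\<U> s. \<U> \<subseteq> opens C C \<and> (\<forall>V\<in>\<U>. s V \<in> carrier (msec F V)) \<and>
       (\<forall>V\<in>\<U>. \<forall>W\<in>\<U>. mres F V (V \<inter> W) (s V) = mres F W (V \<inter> W) (s W)) \<longrightarrow>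
       (\<exists>!x. x \<in> carrier (msec F (\<Union>\<U>)) \<and> (\<forall>V\<in>\<U>. mres F (\<Union>\<U>) V x = s V)))"

text \<open>Morphisms of sheaves of modules over the open subset \<open>A\<close>, from \<open>F\<close> to \<open>G\<close>.\<close>

definition module_sheaf_hom ::
  "'n::finite pt set \<Rightarrow> 'n pt set \<Rightarrow> ('n pt, 'a) module_sheaf \<Rightarrow> ('n pt, 'b) module_sheaf
    \<Rightarrow> ('n pt set \<Rightarrow> 'a \<Rightarrow> 'b) \<Rightarrow> bool"
  where "module_sheaf_hom C A F G h \<longleftrightarrow>
    (\<forall>U\<in>opens C A. \<forall>x\<in>carrier (msec F U).
       h U x \<in> carrier (msec G U) \<and>
       (\<forall>y\<in>carrier (msec F U). h U (x \<oplus>\<^bsub>msec F U\<^esub> y) = h U x \<oplus>\<^bsub>msec G U\<^esub> h U y) \<and>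
       (\<forall>f\<in>carrier (struct_sheaf C U). h U (f \<odot>\<^bsub>msec F U\<^esub> x) = f \<odot>\<^bsub>msec G U\<^esub> h U x) \<and>
       (\<forall>V\<in>opens C U. h V (mres F U V x) = mres G U V (h U x)))"

definition module_sheaf_iso ::
  "'n::finite pt set \<Rightarrow> ('n pt, 'a) module_sheaf \<Rightarrow> ('n pt, 'b) module_sheaf \<Rightarrow> bool"
  where "module_sheaf_iso C F G \<longleftrightarrow>
    (\<exists>h. module_sheaf_hom C C F G h \<and>
       (\<forall>U\<in>opens C C. bij_betw (h U) (carrier (msec F U)) (carrier (msec G U))))"

definition structure_module :: "'n::finite pt set \<Rightarrow> ('n pt, 'n pt \<Rightarrow> complex) module_sheaf"
  where "structure_module C =
    \<lparr> msec = (\<lambda>U. \<lparr> carrier = carrier (struct_sheaf C U),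
        monoid.mult = (\<otimes>\<^bsub>struct_sheaf C U\<^esub>), one = \<one>\<^bsub>struct_sheaf C U\<^esub>,
        zero = \<zero>\<^bsub>struct_sheaf C U\<^esub>, add = (\<oplus>\<^bsub>struct_sheaf C U\<^esub>),
        smult = (\<otimes>\<^bsub>struct_sheaf C U\<^esub>) \<rparr>),
      mres = (\<lambda>U V f. restrict f V) \<rparr>"

definition module_sheaf_sum ::
  "('p, 'a) module_sheaf \<Rightarrow> ('p, 'b) module_sheaf \<Rightarrow> ('p, 'a \<times> 'b) module_sheaf"
  where "module_sheaf_sum F G =
    \<lparr> msec = (\<lambda>U. \<lparr> carrier = carrier (msec F U) \<times> carrier (msec G U),
        monoid.mult = undefined, one = undefined,
        zero = (\<zero>\<^bsub>msec F U\<^esub>, \<zero>\<^bsub>msec G U\<^esub>),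
        add = (\<lambda>(x, y) (x', y'). (x \<oplus>\<^bsub>msec F U\<^esub> x', y \<oplus>\<^bsub>msec G U\<^esub> y')),
        smult = (\<lambda>f (x, y). (f \<odot>\<^bsub>msec F U\<^esub> x, f \<odot>\<^bsub>msec G U\<^esub> y)) \<rparr>),
      mres = (\<lambda>U V (x, y). (mres F U V x, mres G U V y)) \<rparr>"

text \<open>The tangent sheaf is the sheaf of complex derivations of the structure sheaf.  A section over
  \<open>U\<close> is a family of derivations, one over each open subset of \<open>U\<close>, compatible with restriction.\<close>

definition derivations ::
  "'n::finite pt set \<Rightarrow> 'n pt set \<Rightarrow> (('n pt \<Rightarrow> complex) \<Rightarrow> ('n pt \<Rightarrow> complex)) set"
  where "derivations C U =
    {D \<in> carrier (struct_sheaf C U) \<rightarrow>\<^sub>E carrier (struct_sheaf C U).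
       (\<forall>c. D (\<lambda>p\<in>U. c) = (\<lambda>p\<in>U. 0)) \<and>
       (\<forall>f\<in>carrier (struct_sheaf C U). \<forall>g\<in>carrier (struct_sheaf C U).
          D (f \<oplus>\<^bsub>struct_sheaf C U\<^esub> g) = D f \<oplus>\<^bsub>struct_sheaf C U\<^esub> D g \<and>
          D (f \<otimes>\<^bsub>struct_sheaf C U\<^esub> g) =
            (f \<otimes>\<^bsub>struct_sheaf C U\<^esub> D g) \<oplus>\<^bsub>struct_sheaf C U\<^esub> (g \<otimes>\<^bsub>struct_sheaf C U\<^esub> D f))}"

type_synonym 'n vfield = "'n pt set \<Rightarrow> ('n pt \<Rightarrow> complex) \<Rightarrow> ('n pt \<Rightarrow> complex)"

definition tangent_sheaf :: "'n::finite pt set \<Rightarrow> ('n pt, 'n vfield) module_sheaf"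
  where "tangent_sheaf C =
    \<lparr> msec = (\<lambda>U. \<lparr>
        carrier = {D \<in> (\<Pi>\<^sub>E V\<in>opens C U. derivations C V).
          \<forall>V\<in>opens C U. \<forall>W\<in>opens C V. \<forall>f\<in>carrier (struct_sheaf C V).
            restrict (D V f) W = D W (restrict f W)},
        monoid.mult = undefined, one = undefined,
        zero = (\<lambda>V\<in>opens C U. \<lambda>f\<in>carrier (struct_sheaf C V). \<lambda>p\<in>V. 0),
        add = (\<lambda>D D'. \<lambda>V\<in>opens C U. \<lambda>f\<in>carrier (struct_sheaf C V). \<lambda>p\<in>V. D V f p + D' V f p),
        smult = (\<lambda>a D. \<lambda>V\<in>opens C U. \<lambda>f\<in>carrier (struct_sheaf C V). \<lambda>p\<in>V. a p * D V f p) \<rparr>),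
      mres = (\<lambda>U V D. restrict D (opens C V)) \<rparr>"


section \<open>Tensor product of sheaves of modules\<close>

definition tensor_relations ::
  "('a, 'k) ring_scheme \<Rightarrow> ('a, 'e, 'm) module_scheme \<Rightarrow> ('a, 'f, 'l) module_scheme
    \<Rightarrow> ('e \<times> 'f \<Rightarrow>\<^sub>0 int) set"
  where "tensor_relations R M N =
    {frag_of (x \<oplus>\<^bsub>M\<^esub> x', y) - frag_of (x, y) - frag_of (x', y) | x x' y.
       x \<in> carrier M \<and> x' \<in> carrier M \<and> y \<in> carrier N} \<union>
    {frag_of (x, y \<oplus>\<^bsub>N\<^esub> y') - frag_of (x, y) - frag_of (x, y') | x y y'.
       x \<in> carrier M \<and> y \<in> carrier N \<and> y' \<in> carrier N} \<union>
    {frag_of (a \<odot>\<^bsub>M\<^esub> x, y) - frag_of (x, a \<odot>\<^bsub>N\<^esub> y) | a x y.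
       a \<in> carrier R \<and> x \<in> carrier M \<and> y \<in> carrier N}"

definition tensor_kernel ::
  "('a, 'k) ring_scheme \<Rightarrow> ('a, 'e, 'm) module_scheme \<Rightarrow> ('a, 'f, 'l) module_scheme
    \<Rightarrow> ('e \<times> 'f \<Rightarrow>\<^sub>0 int) set"
  where "tensor_kernel R M N =
    generate (free_Abelian_group (carrier M \<times> carrier N)) (tensor_relations R M N)"

definition tensor_class ::
  "('a, 'k) ring_scheme \<Rightarrow> ('a, 'e, 'm) module_scheme \<Rightarrow> ('a, 'f, 'l) module_scheme
    \<Rightarrow> ('e \<times> 'f \<Rightarrow>\<^sub>0 int) \<Rightarrow> ('e \<times> 'f \<Rightarrow>\<^sub>0 int) set"
  where "tensor_class R M N c =
    tensor_kernel R M N #>\<^bsub>free_Abelian_group (carrier M \<times> carrier N)\<^esub> c"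

definition tensor_module ::
  "('a, 'k) ring_scheme \<Rightarrow> ('a, 'e, 'm) module_scheme \<Rightarrow> ('a, 'f, 'l) module_scheme
    \<Rightarrow> ('a, ('e \<times> 'f \<Rightarrow>\<^sub>0 int) set) module"
  where "tensor_module R M N =
    (let Q = free_Abelian_group (carrier M \<times> carrier N) Mod tensor_kernel R M N in
     \<lparr> carrier = carrier Q,
       monoid.mult = undefined, one = undefined,
       zero = \<one>\<^bsub>Q\<^esub>, add = (\<otimes>\<^bsub>Q\<^esub>),
       smult = (\<lambda>a X. \<Union>c\<in>X. tensor_class R M N
                  (frag_extend (\<lambda>(x, y). frag_of (a \<odot>\<^bsub>M\<^esub> x, y)) c)) \<rparr>)"

definition tensor_presheaf ::
  "'n::finite pt set \<Rightarrow> ('n pt, 'e) module_sheaf \<Rightarrow> ('n pt, 'f) module_sheaf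
    \<Rightarrow> ('n pt, ('e \<times> 'f \<Rightarrow>\<^sub>0 int) set) module_sheaf"
  where "tensor_presheaf C F G =
    \<lparr> msec = (\<lambda>U. tensor_module (struct_sheaf C U) (msec F U) (msec G U)),
      mres = (\<lambda>U V X. \<Union>c\<in>X. tensor_class (struct_sheaf C V) (msec F V) (msec G V)
                (frag_extend (\<lambda>(x, y). frag_of (mres F U V x, mres G U V y)) c)) \<rparr>"

text \<open>Sheafification: sections are functions to germs that are locally induced by sections of the
  presheaf.\<close>

definition germ ::
  "'n::finite pt set \<Rightarrow> ('n pt, 'e) module_sheaf \<Rightarrow> 'n pt \<Rightarrow> 'n pt set \<Rightarrow> 'e
    \<Rightarrow> ('n pt set \<times> 'e) set"
  where "germ C P p V s =
    {(W, r). W \<in> opens C C \<and> p \<in> W \<and> r \<in> carrier (msec P W) \<and>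
       (\<exists>Z\<in>opens C (V \<inter> W). p \<in> Z \<and> mres P V Z s = mres P W Z r)}"

definition sheafification ::
  "'n::finite pt set \<Rightarrow> ('n pt, 'e) module_sheaf
    \<Rightarrow> ('n pt, 'n pt \<Rightarrow> ('n pt set \<times> 'e) set) module_sheaf"
  where "sheafification C P =
    \<lparr> msec = (\<lambda>U. \<lparr>
        carrier = {\<sigma> \<in> extensional U. \<forall>p\<in>U. \<exists>V\<in>opens C U. p \<in> V \<and>
          (\<exists>s\<in>carrier (msec P V). \<forall>q\<in>V. \<sigma> q = germ C P q V s)},
        monoid.mult = undefined, one = undefined,
        zero = (\<lambda>p\<in>U. germ C P p U \<zero>\<^bsub>msec P U\<^esub>),
        add = (\<lambda>\<sigma> \<tau>. \<lambda>p\<in>U. \<Union>(V, s)\<in>\<sigma> p. \<Union>(W, r)\<in>\<tau> p.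
          germ C P p (V \<inter> W)
            (mres P V (V \<inter> W) s \<oplus>\<^bsub>msec P (V \<inter> W)\<^esub> mres P W (V \<inter> W) r)),
        smult = (\<lambda>f \<sigma>. \<lambda>p\<in>U. \<Union>(V, s)\<in>\<sigma> p.
          germ C P p (U \<inter> V) (restrict f (U \<inter> V) \<odot>\<^bsub>msec P (U \<inter> V)\<^esub> mres P V (U \<inter> V) s)) \<rparr>),
      mres = (\<lambda>U V \<sigma>. restrict \<sigma> V) \<rparr>"

definition tensor_sheaf ::
  "'n::finite pt set \<Rightarrow> ('n pt, 'e) module_sheaf \<Rightarrow> ('n pt, 'f) module_sheaf
    \<Rightarrow> ('n pt, 'n pt \<Rightarrow> ('n pt set \<times> ('e \<times> 'f \<Rightarrow>\<^sub>0 int) set) set) module_sheaf"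
  where "tensor_sheaf C F G = sheafification C (tensor_presheaf C F G)"


section \<open>Nonabelian Cech cohomology and twisting\<close>

text \<open>A cochain consists of a family \<open>(U i)\<close> of open sets indexed by the type \<open>'i\<close> and of the
  sections \<open>g i j\<close> over \<open>U i \<inter> U j\<close>.\<close>

type_synonym ('i, 'p, 'g) cochain = "('i \<Rightarrow> 'p set) \<times> ('i \<Rightarrow> 'i \<Rightarrow> 'g)"

definition cocycles ::
  "'n::finite pt set \<Rightarrow> ('n pt, 'g) group_sheaf \<Rightarrow> ('i, 'n pt, 'g) cochain set"
  where "cocycles C S =
    {(U, g). (\<forall>i. U i \<in> opens C C) \<and> (\<Union>i. U i) = C \<and>
       (\<forall>i j. g i j \<in> carrier (gsec S (U i \<inter> U j))) \<and>
       (\<forall>i j k. let W = U i \<inter> U j \<inter> U k in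
          gres S (U i \<inter> U j) W (g i j) \<otimes>\<^bsub>gsec S W\<^esub> gres S (U j \<inter> U k) W (g j k)
            = gres S (U i \<inter> U k) W (g i k))}"

text \<open>Two cocycles, possibly for different covers, have the same class if they become cohomologous
  on a common refinement.  Any common refinement has a refinement \<open>(W x)\<close> indexed by the points of
  \<open>C\<close>, with \<open>x \<in> W x\<close>; \<open>a\<close> and \<open>b\<close> are the refinement maps.\<close>

definition cohomologous ::
  "'n::finite pt set \<Rightarrow> ('n pt, 'g) group_sheaf
    \<Rightarrow> (('i, 'n pt, 'g) cochain \<times> ('i, 'n pt, 'g) cochain) set"
  where "cohomologous C S =
    {((U, g), (U', g')). (U, g) \<in> cocycles C S \<and> (U', g') \<in> cocycles C S \<and>
       (\<exists>W a b h.
          (\<forall>x\<in>C. x \<in> W x \<and> W x \<in> opens C (U (a x) \<inter> U' (b x)) \<and> h x \<in> carrier (gsec S (W x))) \<and>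
          (\<forall>x\<in>C. \<forall>y\<in>C. let V = W x \<inter> W y in
             gres S (U (a x) \<inter> U (a y)) V (g (a x) (a y)) =
               gres S (W x) V (h x)
                 \<otimes>\<^bsub>gsec S V\<^esub> gres S (U' (b x) \<inter> U' (b y)) V (g' (b x) (b y))
                 \<otimes>\<^bsub>gsec S V\<^esub> inv\<^bsub>gsec S V\<^esub> (gres S (W y) V (h y))))}"

text \<open>Covers are indexed by the type \<open>'i\<close>; as \<open>C\<close> is quasi-compact, every infinite \<open>'i\<close> gives the
  whole cohomology set.\<close>

definition H1 ::
  "'n::finite pt set \<Rightarrow> ('n pt, 'g) group_sheaf \<Rightarrow> ('i, 'n pt, 'g) cochain set set"
  where "H1 C S = cocycles C S // cohomologous C S"

definition map_cochain ::
  "('p set \<Rightarrow> 'g \<Rightarrow> 'k) \<Rightarrow> ('i, 'p, 'g) cochain \<Rightarrow> ('i, 'p, 'k) cochain"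
  where "map_cochain f = (\<lambda>(U, g). (U, \<lambda>i j. f (U i \<inter> U j) (g i j)))"

text \<open>The map \<open>H1 C S \<Rightarrow> H1 C S'\<close> induced by a morphism \<open>f\<close> from \<open>S\<close> to \<open>S'\<close>.\<close>

definition H1_map ::
  "'n::finite pt set \<Rightarrow> ('n pt, 'k) group_sheaf \<Rightarrow> ('n pt set \<Rightarrow> 'g \<Rightarrow> 'k)
    \<Rightarrow> ('i, 'n pt, 'g) cochain set \<Rightarrow> ('i, 'n pt, 'k) cochain set"
  where "H1_map C S' f X = (\<Union>c\<in>X. cohomologous C S' `` {map_cochain f c})"

text \<open>The twist of the sheaf \<open>F\<close>, on which the sheaf of groups \<open>S\<close> acts linearly by \<open>act\<close>, by a
  cocycle \<open>(U, g)\<close> of \<open>S\<close>.\<close>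

definition twist ::
  "('p, 'g) group_sheaf \<Rightarrow> ('p set \<Rightarrow> 'g \<Rightarrow> 'e \<Rightarrow> 'e) \<Rightarrow> ('p, 'e) module_sheaf
    \<Rightarrow> ('i, 'p, 'g) cochain \<Rightarrow> ('p, 'i \<Rightarrow> 'e) module_sheaf"
  where "twist S act F = (\<lambda>(U, g).
    \<lparr> msec = (\<lambda>W. \<lparr>
        carrier = {s. (\<forall>i. s i \<in> carrier (msec F (W \<inter> U i))) \<and>
          (\<forall>i j. let V = W \<inter> U i \<inter> U j in
             mres F (W \<inter> U i) V (s i) =
               act V (gres S (U i \<inter> U j) V (g i j)) (mres F (W \<inter> U j) V (s j)))},
        monoid.mult = undefined, one = undefined,
        zero = (\<lambda>i. \<zero>\<^bsub>msec F (W \<inter> U i)\<^esub>),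
        add = (\<lambda>s t i. s i \<oplus>\<^bsub>msec F (W \<inter> U i)\<^esub> t i),
        smult = (\<lambda>f s i. restrict f (W \<inter> U i) \<odot>\<^bsub>msec F (W \<inter> U i)\<^esub> s i) \<rparr>),
      mres = (\<lambda>W W' s i. mres F (W \<inter> U i) (W' \<inter> U i) (s i)) \<rparr>)"

definition units_sheaf :: "'n::finite pt set \<Rightarrow> ('n pt, 'n pt \<Rightarrow> complex) group_sheaf"
  where "units_sheaf C =
    \<lparr> gsec = (\<lambda>U. units_of (struct_sheaf C U)), gres = (\<lambda>U V f. restrict f V) \<rparr>"

definition line_bundle ::
  "'n::finite pt set \<Rightarrow> ('i, 'n pt, 'n pt \<Rightarrow> complex) cochain
    \<Rightarrow> ('n pt, 'i \<Rightarrow> 'n pt \<Rightarrow> complex) module_sheaf"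
  where "line_bundle C = twist (units_sheaf C) (\<lambda>V. (\<otimes>\<^bsub>struct_sheaf C V\<^esub>)) (structure_module C)"

text \<open>The class of the \<open>k\<close>-th tensor power, that is, the \<open>k\<close>-th power in the group
  \<open>H1 C (units_sheaf C)\<close>, the Picard group.\<close>

definition pic_power ::
  "'n::finite pt set \<Rightarrow> ('i, 'n pt, 'n pt \<Rightarrow> complex) cochain set \<Rightarrow> nat
    \<Rightarrow> ('i, 'n pt, 'n pt \<Rightarrow> complex) cochain set"
  where "pic_power C L k =
    H1_map C (units_sheaf C) (\<lambda>V \<nu>. \<nu> [^]\<^bsub>gsec (units_sheaf C) V\<^esub> k) L"

definition dual_line_bundle ::
  "'n::finite pt set \<Rightarrow> ('i, 'n pt, 'n pt \<Rightarrow> complex) cochain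
    \<Rightarrow> ('n pt, 'i \<Rightarrow> 'n pt \<Rightarrow> complex) module_sheaf"
  where "dual_line_bundle C l =
    line_bundle C (map_cochain (\<lambda>V \<nu>. inv\<^bsub>gsec (units_sheaf C) V\<^esub> \<nu>) l)"


section \<open>The sheaves of groups of automorphisms\<close>

text \<open>The ring \<open>O(U)[t]/(t^m)\<close>: an element \<open>x\<close> is represented by the family of the
  coefficients \<open>x k\<close> of \<open>t^k\<close>, \<open>k < m\<close>.\<close>

type_synonym 'n jet = "nat \<Rightarrow> 'n pt \<Rightarrow> complex"

definition jets :: "'n::finite pt set \<Rightarrow> nat \<Rightarrow> 'n pt set \<Rightarrow> 'n jet ring"
  where "jets C m U =
    \<lparr> carrier = {..<m} \<rightarrow>\<^sub>E carrier (struct_sheaf C U),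
      monoid.mult = (\<lambda>x y. \<lambda>k\<in>{..<m}. \<lambda>p\<in>U. \<Sum>i\<le>k. x i p * y (k - i) p),
      one = (\<lambda>k\<in>{..<m}. \<lambda>p\<in>U. if k = 0 then 1 else 0),
      zero = (\<lambda>k\<in>{..<m}. \<lambda>p\<in>U. 0),
      add = (\<lambda>x y. \<lambda>k\<in>{..<m}. \<lambda>p\<in>U. x k p + y k p) \<rparr>"

definition jet_const :: "nat \<Rightarrow> 'n pt set \<Rightarrow> ('n pt \<Rightarrow> complex) \<Rightarrow> 'n jet"
  where "jet_const m U f = (\<lambda>k\<in>{..<m}. \<lambda>p\<in>U. if k = 0 then f p else 0)"

definition jet_t :: "nat \<Rightarrow> 'n pt set \<Rightarrow> 'n jet"
  where "jet_t m U = (\<lambda>k\<in>{..<m}. \<lambda>p\<in>U. if k = 1 then 1 else 0)"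

definition jet_res :: "nat \<Rightarrow> 'n pt set \<Rightarrow> 'n jet \<Rightarrow> 'n jet"
  where "jet_res m V x = (\<lambda>k\<in>{..<m}. restrict (x k) V)"

definition jet_auts :: "'n::finite pt set \<Rightarrow> nat \<Rightarrow> 'n pt set \<Rightarrow> ('n jet \<Rightarrow> 'n jet) set"
  where "jet_auts C m U =
    {\<phi> \<in> extensional (carrier (jets C m U)).
       \<phi> \<in> ring_iso (jets C m U) (jets C m U) \<and>
       (\<forall>c. \<phi> (jet_const m U (\<lambda>p\<in>U. c)) = jet_const m U (\<lambda>p\<in>U. c)) \<and>
       (\<forall>x\<in>carrier (jets C m U). \<phi> x 0 = x 0)}"

text \<open>A section over \<open>U\<close> is an automorphism of the sheaf of algebras \<open>O[t]/(t^m)\<close> over \<open>U\<close>,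
  recorded as the family of the automorphisms that it induces over the open subsets of \<open>U\<close>.  For a
  proper open subset \<open>U\<close> (which is affine) the whole family is determined by its component at \<open>U\<close>,
  which is an arbitrary element of \<open>jet_auts C m U\<close>.\<close>

type_synonym 'n jet_aut = "'n pt set \<Rightarrow> 'n jet \<Rightarrow> 'n jet"

definition aut_sheaf :: "'n::finite pt set \<Rightarrow> nat \<Rightarrow> ('n pt, 'n jet_aut) group_sheaf"
  where "aut_sheaf C m =
    \<lparr> gsec = (\<lambda>U. \<lparr>
        carrier = {\<phi> \<in> (\<Pi>\<^sub>E V\<in>opens C U. jet_auts C m V).
          \<forall>V\<in>opens C U. \<forall>W\<in>opens C V. \<forall>x\<in>carrier (jets C m V).
            jet_res m W (\<phi> V x) = \<phi> W (jet_res m W x)},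
        monoid.mult = (\<lambda>\<phi> \<psi>. \<lambda>V\<in>opens C U. compose (carrier (jets C m V)) (\<phi> V) (\<psi> V)),
        one = (\<lambda>V\<in>opens C U. \<lambda>x\<in>carrier (jets C m V). x) \<rparr>),
      gres = (\<lambda>U V \<phi>. restrict \<phi> (opens C V)) \<rparr>"

text \<open>The morphism \<open>\<xi>\<close> with \<open>\<phi>(t) = \<nu> t \<mapsto> \<nu>|\<^bsub>t=0\<^esub>\<close>.\<close>

definition xi :: "nat \<Rightarrow> 'n pt set \<Rightarrow> 'n jet_aut \<Rightarrow> ('n pt \<Rightarrow> complex)"
  where "xi m U \<phi> = \<phi> U (jet_t m U) 1"

text \<open>The restriction morphism from \<open>aut_sheaf C n\<close> to \<open>aut_sheaf C k\<close>, for \<open>k \<le> n\<close>: reduction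
  modulo \<open>t^k\<close>, computed on the lift of \<open>x\<close> with vanishing coefficients in degrees \<open>\<ge> k\<close>.\<close>

definition aut_reduce ::
  "'n::finite pt set \<Rightarrow> nat \<Rightarrow> nat \<Rightarrow> 'n pt set \<Rightarrow> 'n jet_aut \<Rightarrow> 'n jet_aut"
  where "aut_reduce C n k U \<phi> =
    (\<lambda>V\<in>opens C U. \<lambda>x\<in>carrier (jets C k V).
       restrict (\<phi> V (\<lambda>i\<in>{..<n}. if i < k then x i else (\<lambda>p\<in>V. 0))) {..<k})"

text \<open>The isomorphism \<open>(\<theta>, \<beta>) \<mapsto> \<lambda>\<^bsub>\<theta>\<beta>\<^esub>\<close> from the direct sum of the tangent sheaf and the
  structure sheaf to the kernel of the restriction from level \<open>n\<close> to level \<open>n - 1\<close>, for \<open>n \<ge> 3\<close>.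
  The automorphism with \<open>\<alpha> \<mapsto> \<alpha> + \<theta>(\<alpha>) t^(n-1)\<close> and \<open>t \<mapsto> t + \<beta> t^(n-1)\<close> maps
  \<open>x = \<Sum> x\<^sub>k t^k\<close> to \<open>x + (\<theta>(x\<^sub>0) + \<beta> x\<^sub>1) t^(n-1)\<close>.\<close>

definition tangent_plus_structure ::
  "'n::finite pt set \<Rightarrow> ('n pt, 'n vfield \<times> ('n pt \<Rightarrow> complex)) module_sheaf"
  where "tangent_plus_structure C = module_sheaf_sum (tangent_sheaf C) (structure_module C)"

definition kernel_iso ::
  "'n::finite pt set \<Rightarrow> nat \<Rightarrow> 'n pt set \<Rightarrow> 'n vfield \<times> ('n pt \<Rightarrow> complex) \<Rightarrow> 'n jet_aut"
  where "kernel_iso C n U = (\<lambda>(\<theta>, \<beta>). \<lambda>V\<in>opens C U. \<lambda>x\<in>carrier (jets C n V).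
    \<lambda>k\<in>{..<n}. \<lambda>p\<in>V. x k p + (if k = n - 1 then \<theta> V (x 0) p + \<beta> p * x 1 p else 0))"

text \<open>The conjugation action on the kernel, transported along \<open>kernel_iso\<close>.\<close>

definition conj_action ::
  "'n::finite pt set \<Rightarrow> nat \<Rightarrow> 'n pt set \<Rightarrow> 'n jet_aut
    \<Rightarrow> 'n vfield \<times> ('n pt \<Rightarrow> complex) \<Rightarrow> 'n vfield \<times> ('n pt \<Rightarrow> complex)"
  where "conj_action C n U \<phi> x =
    (THE y. y \<in> carrier (msec (tangent_plus_structure C) U) \<and>
       kernel_iso C n U y =
         \<phi> \<otimes>\<^bsub>gsec (aut_sheaf C n) U\<^esub> kernel_iso C n U x
           \<otimes>\<^bsub>gsec (aut_sheaf C n) U\<^esub> inv\<^bsub>gsec (aut_sheaf C n) U\<^esub> \<phi>)"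

definition twisted_kernel ::
  "'n::finite pt set \<Rightarrow> nat \<Rightarrow> ('i, 'n pt, 'n jet_aut) cochain
    \<Rightarrow> ('n pt, 'i \<Rightarrow> 'n vfield \<times> ('n pt \<Rightarrow> complex)) module_sheaf"
  where "twisted_kernel C n =
    twist (aut_sheaf C n) (conj_action C n) (tangent_plus_structure C)"


section \<open>The vector bundle \<open>E(g\<^sub>2)\<close>\<close>

definition short_exact ::
  "'n::finite pt set \<Rightarrow> ('n pt, 'a) module_sheaf \<Rightarrow> ('n pt, 'e) module_sheaf
    \<Rightarrow> ('n pt, 'b) module_sheaf \<Rightarrow> ('n pt set \<Rightarrow> 'a \<Rightarrow> 'e) \<Rightarrow> ('n pt set \<Rightarrow> 'e \<Rightarrow> 'b) \<Rightarrow> bool"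
  where "short_exact C A E B \<iota> \<pi> \<longleftrightarrow>
    module_sheaf_hom C C A E \<iota> \<and> module_sheaf_hom C C E B \<pi> \<and>
    (\<forall>W\<in>opens C C. inj_on (\<iota> W) (carrier (msec A W)) \<and>
       \<iota> W ` carrier (msec A W) = {e \<in> carrier (msec E W). \<pi> W e = \<zero>\<^bsub>msec B W\<^esub>} \<and>
       (\<forall>f\<in>carrier (msec B W). \<forall>p\<in>W. \<exists>V\<in>opens C W. p \<in> V \<and>
          (\<exists>e\<in>carrier (msec E V). \<pi> V e = mres B W V f)))"

text \<open>\<open>E\<close> is the middle term of an extension of \<open>B\<close> by \<open>A\<close> whose class in \<open>Ext\<^sup>1(B, A)\<close> is given by
  the Cech cocycle \<open>(u i j)\<close> for the cover \<open>(U i)\<close>, with values in \<open>Hom(B, A)\<close>: it has splittings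
  \<open>s i\<close> over the \<open>U i\<close> whose differences are the \<open>u i j\<close>.  (With the opposite sign convention for
  this correspondence one gets the same sheaves \<open>E\<close>: replace \<open>\<iota>\<close> by \<open>-\<iota>\<close>.)\<close>

definition extension_of_class ::
  "'n::finite pt set \<Rightarrow> ('n pt, 'a) module_sheaf \<Rightarrow> ('n pt, 'b) module_sheaf
    \<Rightarrow> ('i \<Rightarrow> 'n pt set) \<Rightarrow> ('i \<Rightarrow> 'i \<Rightarrow> 'n pt set \<Rightarrow> 'b \<Rightarrow> 'a) \<Rightarrow> ('n pt, 'e) module_sheaf \<Rightarrow> bool"
  where "extension_of_class C A B U u E \<longleftrightarrow>
    is_module_sheaf C E \<and>
    (\<exists>\<iota> \<pi> s. short_exact C A E B \<iota> \<pi> \<and>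
       (\<forall>i. module_sheaf_hom C (U i) B E (s i) \<and>
          (\<forall>W\<in>opens C (U i). \<forall>f\<in>carrier (msec B W). \<pi> W (s i W f) = f)) \<and>
       (\<forall>i j. \<forall>W\<in>opens C (U i \<inter> U j). \<forall>f\<in>carrier (msec B W).
          s i W f = s j W f \<oplus>\<^bsub>msec E W\<^esub> \<iota> W (u i j W f)))"

text \<open>The component \<open>\<mu>\<close> of the section \<open>\<alpha> \<mapsto> \<alpha> + \<mu>(\<alpha>) t\<close>, \<open>t \<mapsto> \<nu> t\<close> of \<open>aut_sheaf C 2\<close>; the
  component \<open>\<nu>\<close> is given by \<open>xi 2\<close>.\<close>

definition aut2_mu :: "'n::finite pt set \<Rightarrow> 'n pt set \<Rightarrow> 'n jet_aut \<Rightarrow> 'n vfield"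
  where "aut2_mu C U \<psi> =
    (\<lambda>V\<in>opens C U. \<lambda>f\<in>carrier (struct_sheaf C V). \<psi> V (jet_const 2 V f) 1)"

text \<open>Let \<open>e i\<close> be the generator over \<open>U i\<close> of the line bundle \<open>L\<close> with cocycle \<open>(\<nu> i j)\<close>.  The
  section of \<open>T \<otimes> L = Hom(L\<^sup>*, T)\<close> over \<open>U i \<inter> U j\<close> with coordinate \<open>\<mu> i j\<close> is \<open>\<mu> i j \<otimes> e i\<close>,
  which maps the section \<open>(f i)\<close> of \<open>L\<^sup>*\<close> to \<open>f i \<cdot> \<mu> i j\<close>.\<close>

definition is_E_bundle ::
  "'n::finite pt set \<Rightarrow> ('i, 'n pt, 'n jet_aut) cochain set \<Rightarrow> ('n pt, 'e) module_sheaf \<Rightarrow> bool"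
  where "is_E_bundle C g2 E \<longleftrightarrow>
    (\<exists>(U, \<psi>)\<in>g2.
       extension_of_class C (tangent_sheaf C) (dual_line_bundle C (map_cochain (xi 2) (U, \<psi>))) U
         (\<lambda>i j W f. restrict (f i) W \<odot>\<^bsub>msec (tangent_sheaf C) W\<^esub>
            mres (tangent_sheaf C) (U i \<inter> U j) W (aut2_mu C (U i \<inter> U j) (\<psi> i j))) E)"

end

theory Submission
  imports Defs
begin

text \<open>
  Why the two sheaves agree.  Let an automorphism \<open>\<phi>\<close> of \<open>O[t]/(t\<^sup>n)\<close> have the components
  \<open>\<mu>\<close> (the vector field with \<open>\<phi>(\<alpha>) = \<alpha> + \<mu>(\<alpha>) t + \<dots>\<close>) and \<open>\<nu>\<close> (with \<open>\<phi>(t) = \<nu> t + \<dots>\<close>).  An element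
  of the kernel changes a jet \<open>x\<close> only in degree \<open>n - 1\<close>, by \<open>\<theta>(x\<^sub>0) + \<beta> x\<^sub>1\<close>.  Conjugating by \<open>\<phi>\<close>
  multiplies this by the factor \<open>\<nu>\<^sup>n\<^sup>-\<^sup>1\<close> that \<open>\<phi>\<close> produces on \<open>t\<^sup>n\<^sup>-\<^sup>1\<close>, and expresses \<open>x\<^sub>1\<close> through the
  coefficients of \<open>\<phi>(x)\<close>, which are \<open>x\<^sub>0\<close> and \<open>\<mu>(x\<^sub>0) + \<nu> x\<^sub>1\<close> in degrees 0 and 1.  Hence
  \<open>\<phi> \<cdot> (\<theta>, \<beta>) = \<nu>\<^sup>n\<^sup>-\<^sup>1 (\<theta> - \<beta> \<mu> / \<nu>, \<beta> / \<nu>)\<close>: the conjugation action is the scalar \<open>\<nu>\<^sup>n\<^sup>-\<^sup>1\<close> times the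
  linear action of the affine group of pairs \<open>(\<mu>, \<nu>)\<close> on \<open>T \<oplus> O\<close> (lemma \<open>conj_action_eq\<close>).  In
  particular it sees only the image of \<open>\<phi>\<close> at level two.

  The affine action is also the transition rule of \<open>E(g\<^sub>2)\<close>.  Over \<open>U\<^sub>i\<close> the splitting \<open>s\<^sub>i\<close> identifies
  \<open>E\<close> with \<open>T \<oplus> O\<close>, by \<open>(\<theta>, \<beta>) \<mapsto> \<iota>(\<theta>) + s\<^sub>i(\<beta> e\<^sub>i)\<close> with \<open>e\<^sub>i\<close> the generator of \<open>L\<^sup>*\<close>, and the condition
  \<open>s\<^sub>i = s\<^sub>j + \<iota>(u\<^sub>i\<^sub>j)\<close> on the class of the extension says precisely that two such charts differ by the
  affine action of \<open>(\<mu>\<^sub>i\<^sub>j, \<nu>\<^sub>i\<^sub>j)\<close> (lemma \<open>\<Theta>_transition\<close>).  The remaining scalars \<open>\<nu>\<^sub>i\<^sub>j\<^sup>n\<^sup>-\<^sup>1\<close> form the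
  cocycle of the power \<open>L\<^sup>n\<^sup>-\<^sup>1\<close>.

  The cocycles for \<open>g\<close>, for \<open>E(g\<^sub>2)\<close> and for \<open>L\<^sup>n\<^sup>-\<^sup>1\<close> live on unrelated covers.  Near each point \<open>x\<close> of
  \<open>C\<close>, cohomology supplies an affine section \<open>h\<^sub>x\<close> comparing the first two and a unit \<open>k\<^sub>x\<close> comparing
  the first and the third.  Correcting by these gives an isomorphism from the twisted kernel to the
  presheaf \<open>W \<mapsto> E(W) \<otimes> L\<^sup>n\<^sup>-\<^sup>1(W)\<close> over small open sets (a tensor product with a free module of rank
  one is computed in lemma \<open>tensor_free_factor\<close>), and the cocycle relations make these isomorphisms
  agree on overlaps (lemma \<open>\<beta>_compat\<close>).  As the twisted kernel is a sheaf (lemma \<open>twist_sheaf\<close>),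
  it is then isomorphic to the sheafification of that presheaf (lemma \<open>sheafification_iso\<close>).
\<close>


section \<open>The Zariski topology and regular functions\<close>

lemma finite_multidegrees: "finite {m :: 'n::finite \<Rightarrow> nat. (\<Sum>i\<in>UNIV. m i) = d}"
proof (rule finite_subset)
  show "{m :: 'n \<Rightarrow> nat. (\<Sum>i\<in>UNIV. m i) = d} \<subseteq> UNIV \<rightarrow>\<^sub>E {..d}"
    by (auto simp: PiE_def) (metis member_le_sum UNIV_I finite zero_le)
qed (intro finite_PiE, auto)

lemma hom_poly_const: "hom_poly 0 (\<lambda>x :: complex ^ 'n::finite. c)"
proof -
  have "{m :: 'n \<Rightarrow> nat. (\<Sum>i\<in>UNIV. m i) = 0} = {\<lambda>_. 0}"
    by auto
  then show ?thesis
    unfolding hom_poly_def by (intro exI[of _ "\<lambda>_. c"]) simp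
qed

lemma hom_poly_add:
  assumes "hom_poly d f" "hom_poly d g"
  shows "hom_poly d (\<lambda>x. f x + g x)"
  using assms unfolding hom_poly_def
  by (elim exE, rename_tac b c, intro exI[of _ "\<lambda>m. b m + c m" for b c])
     (simp add: distrib_right sum.distrib)

lemma hom_poly_mult:
  fixes f g :: "complex ^ 'n::finite \<Rightarrow> complex"
  assumes "hom_poly d f" "hom_poly e g"
  shows "hom_poly (d + e) (\<lambda>x. f x * g x)"
proof -
  obtain b c where
    f: "f = (\<lambda>x. \<Sum>m | sum m UNIV = d. b m * (\<Prod>i\<in>UNIV. (x $ i) ^ m i))" and
    g: "g = (\<lambda>x. \<Sum>m | sum m UNIV = e. c m * (\<Prod>i\<in>UNIV. (x $ i) ^ m i))"
    using assms unfolding hom_poly_def by blast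
  let ?A = "{m :: 'n \<Rightarrow> nat. sum m UNIV = d}" and ?B = "{m :: 'n \<Rightarrow> nat. sum m UNIV = e}"
  let ?T = "{m :: 'n \<Rightarrow> nat. sum m UNIV = d + e}"
  let ?s = "\<lambda>(m, m') i. m i + m' i :: nat"
  let ?mon = "\<lambda>(x :: complex ^ 'n) m. \<Prod>i\<in>UNIV. (x $ i) ^ m i"
  have "f x * g x = (\<Sum>m\<in>?T. (\<Sum>q | q \<in> ?A \<times> ?B \<and> ?s q = m. b (fst q) * c (snd q)) * ?mon x m)"
    for x
  proof -
    have "f x * g x = (\<Sum>q\<in>?A \<times> ?B. b (fst q) * c (snd q) * ?mon x (?s q))"
      unfolding f g sum_product sum.cartesian_product
      by (intro sum.cong) (auto simp: power_add prod.distrib)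
    also have "\<dots> = (\<Sum>m\<in>?T. \<Sum>q | q \<in> ?A \<times> ?B \<and> ?s q = m. b (fst q) * c (snd q) * ?mon x (?s q))"
      by (intro sum.group[symmetric]) (auto simp: finite_multidegrees sum.distrib)
    also have "\<dots> = (\<Sum>m\<in>?T. (\<Sum>q | q \<in> ?A \<times> ?B \<and> ?s q = m. b (fst q) * c (snd q)) * ?mon x m)"
      by (intro sum.cong) (auto simp: sum_distrib_right intro!: sum.cong)
    finally show ?thesis .
  qed
  then show ?thesis
    unfolding hom_poly_def by (intro exI[of _ "\<lambda>m. \<Sum>q | q \<in> ?A \<times> ?B \<and> ?s q = m. b (fst q) * c (snd q)"]) auto
qed

text \<open>A homogeneous polynomial that vanishes somewhere on a line, away from the origin, vanishes on all
  of it; so a product vanishes on a line only if one of the factors does.\<close>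

lemma hom_poly_scale:
  assumes "hom_poly d f"
  shows "f (a *s x) = a ^ d * f x"
proof -
  obtain c where f: "f = (\<lambda>x. \<Sum>m | sum m UNIV = d. c m * (\<Prod>i\<in>UNIV. (x $ i) ^ m i))"
    using assms unfolding hom_poly_def by blast
  show ?thesis
    unfolding f sum_distrib_left
    by (intro sum.cong) (auto simp: power_mult_distrib prod.distrib power_sum)
qed

lemma zero_locus_Un:
  assumes S: "\<forall>f\<in>S. \<exists>d. hom_poly d f" and T: "\<forall>f\<in>T. \<exists>d. hom_poly d f"
  shows "zero_locus S \<union> zero_locus T = zero_locus {\<lambda>x. f x * g x | f g. f \<in> S \<and> g \<in> T}"
    (is "?L = ?R")
proof
  show "?L \<subseteq> ?R"
    unfolding zero_locus_def by auto
  show "?R \<subseteq> ?L"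
  proof
    fix l assume l: "l \<in> ?R"
    show "l \<in> ?L"
    proof (rule ccontr)
      assume "l \<notin> ?L"
      with l obtain f g x y where fg: "f \<in> S" "g \<in> T" "x \<in> l" "y \<in> l" "f x \<noteq> 0" "g y \<noteq> 0"
        unfolding zero_locus_def by blast
      obtain v where v: "l = vec.span {v}"
        using l unfolding zero_locus_def proj_space_def by auto
      obtain a b where "x = a *s v" "y = b *s v"
        using fg v by (auto simp: vec.span_singleton)
      moreover obtain d e where "hom_poly d f" "hom_poly e g"
        using S T fg by blast
      ultimately have "f v \<noteq> 0" "g v \<noteq> 0"
        using fg hom_poly_scale by (metis mult_zero_right)+
      moreover have "v \<in> l"
        using v by (simp add: vec.span_base)
      moreover have "\<forall>h\<in>{\<lambda>x. f x * g x | f g. f \<in> S \<and> g \<in> T}. \<forall>x\<in>l. h x = 0"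
        using l unfolding zero_locus_def mem_Collect_eq by (rule conjunct2)
      then have "\<forall>x\<in>l. f x * g x = 0"
        by (rule bspec) (use fg(1,2) in blast)
      ultimately show False
        by auto
    qed
  qed
qed

lemma zclosed_Un: "zclosed A \<Longrightarrow> zclosed B \<Longrightarrow> zclosed (A \<union> B)"
  unfolding zclosed_def
  by (elim exE conjE, simp add: zero_locus_Un, intro exI conjI[rotated], rule refl)
     (auto, metis hom_poly_mult)

lemma opens_iff [simp]: "V \<in> opens C U \<longleftrightarrow> zopen C V \<and> V \<subseteq> U"
  by (simp add: opens_def)

lemma zopen_subset: "zopen C U \<Longrightarrow> U \<subseteq> C"
  by (auto simp: zopen_def)

lemma zopen_Int [intro]: "zopen C U \<Longrightarrow> zopen C V \<Longrightarrow> zopen C (U \<inter> V)"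
  unfolding zopen_def by (metis Diff_Un zclosed_Un)

lemma regular_cong: "regular C U f \<Longrightarrow> f = g \<Longrightarrow> regular C U g"
  by simp

lemma regular_extensional: "regular C U f \<Longrightarrow> f \<in> extensional U"
  unfolding regular_def by (rule conjunct1)

lemma regular_ext: "regular C U f \<Longrightarrow> regular C U g \<Longrightarrow> (\<And>p. p \<in> U \<Longrightarrow> f p = g p) \<Longrightarrow> f = g"
  by (rule extensionalityI[of _ U]) (simp_all add: regular_extensional)

lemma regularE:
  assumes "regular C U f" "p \<in> U"
  obtains V d a b where "zopen C V" "V \<subseteq> U" "p \<in> V" "hom_poly d a" "hom_poly d b"
    "\<forall>m\<in>V. \<forall>x\<in>m - {0}. b x \<noteq> 0 \<and> f m = a x / b x"
proof -
  from assms have "\<exists>V\<in>opens C U. \<exists>d a b. p \<in> V \<and> hom_poly d a \<and> hom_poly d b \<and>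
      (\<forall>m\<in>V. \<forall>x\<in>m - {0}. b x \<noteq> 0 \<and> f m = a x / b x)"
    unfolding regular_def by blast
  then show ?thesis
    unfolding opens_iff Bex_def by (elim exE conjE) (rule that)
qed

lemma regularI:
  assumes "f \<in> extensional U"
    and "\<And>p. p \<in> U \<Longrightarrow> \<exists>V d a b. zopen C V \<and> V \<subseteq> U \<and> p \<in> V \<and> hom_poly d a \<and> hom_poly d b \<and>
      (\<forall>m\<in>V. \<forall>x\<in>m - {0}. b x \<noteq> 0 \<and> f m = a x / b x)"
  shows "regular C U f"
  unfolding regular_def
proof (intro conjI ballI)
  fix p assume "p \<in> U"
  from assms(2)[OF this] show "\<exists>V\<in>opens C U. \<exists>d a b. p \<in> V \<and> hom_poly d a \<and> hom_poly d b \<and>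
      (\<forall>m\<in>V. \<forall>x\<in>m - {0}. b x \<noteq> 0 \<and> f m = a x / b x)"
    unfolding Bex_def opens_iff by (simp only: conj_assoc ex_simps)
qed (rule assms(1))

lemma local_fractionI:
  assumes "zopen C V" "V \<subseteq> U" "p \<in> V" "hom_poly d a" "hom_poly d b"
    and "\<forall>m\<in>V. \<forall>x\<in>m - {0}. b x \<noteq> 0 \<and> f m = a x / b x"
  shows "\<exists>V d a b. zopen C V \<and> V \<subseteq> U \<and> p \<in> V \<and> hom_poly d a \<and> hom_poly d b \<and>
      (\<forall>m\<in>V. \<forall>x\<in>m - {0}. b x \<noteq> 0 \<and> f m = a x / b x)"
  by (rule exI[of _ V], rule exI[of _ d], rule exI[of _ a], rule exI[of _ b]) (intro conjI assms)

lemma regular_local: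
  assumes "f \<in> extensional U"
    and "\<And>p. p \<in> U \<Longrightarrow> \<exists>V. zopen C V \<and> V \<subseteq> U \<and> p \<in> V \<and> regular C V (restrict f V)"
  shows "regular C U f"
proof (rule regularI)
  fix p assume p: "p \<in> U"
  obtain V where V: "V \<subseteq> U" "p \<in> V" "regular C V (restrict f V)"
    using assms(2)[OF p] by blast
  from V(3,2) obtain V' d a b where *: "zopen C V'" "V' \<subseteq> V" "p \<in> V'" "hom_poly d a" "hom_poly d b"
      "\<forall>m\<in>V'. \<forall>x\<in>m - {0}. b x \<noteq> 0 \<and> restrict f V m = a x / b x"
    by (rule regularE)
  have "\<forall>m\<in>V'. \<forall>x\<in>m - {0}. b x \<noteq> 0 \<and> f m = a x / b x"
  proof (intro ballI)
    fix m x assume m: "m \<in> V'" "x \<in> m - {0}"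
    then have "m \<in> V" using *(2) by blast
    then show "b x \<noteq> 0 \<and> f m = a x / b x"
      using bspec[OF bspec[OF *(6) m(1)] m(2)] by simp
  qed
  moreover have "V' \<subseteq> U"
    using *(2) V(1) by blast
  ultimately show "\<exists>V d a b. zopen C V \<and> V \<subseteq> U \<and> p \<in> V \<and> hom_poly d a \<and> hom_poly d b \<and>
      (\<forall>m\<in>V. \<forall>x\<in>m - {0}. b x \<noteq> 0 \<and> f m = a x / b x)"
    by (intro local_fractionI[OF *(1) _ *(3-5)])
qed (rule assms(1))

lemma regular_restrict:
  assumes f: "regular C U f" and V: "zopen C V" "V \<subseteq> U"
  shows "regular C V (restrict f V)"
proof (rule regularI)
  fix p assume p: "p \<in> V"
  with V have "p \<in> U" by blast
  with f obtain V' d a b where *: "zopen C V'" "V' \<subseteq> U" "p \<in> V'" "hom_poly d a" "hom_poly d b"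
      "\<forall>m\<in>V'. \<forall>x\<in>m - {0}. b x \<noteq> 0 \<and> f m = a x / b x"
    by (rule regularE)
  have "\<forall>m\<in>V' \<inter> V. \<forall>x\<in>m - {0}. b x \<noteq> 0 \<and> restrict f V m = a x / b x"
  proof (intro ballI)
    fix m x assume m: "m \<in> V' \<inter> V" "x \<in> m - {0}"
    then show "b x \<noteq> 0 \<and> restrict f V m = a x / b x"
      using bspec[OF bspec[OF *(6), of m] m(2)] by simp
  qed
  moreover have "zopen C (V' \<inter> V)" "V' \<inter> V \<subseteq> V" "p \<in> V' \<inter> V"
    using *(1-3) V p by auto
  ultimately show "\<exists>V' d a b. zopen C V' \<and> V' \<subseteq> V \<and> p \<in> V' \<and> hom_poly d a \<and> hom_poly d b \<and>
      (\<forall>m\<in>V'. \<forall>x\<in>m - {0}. b x \<noteq> 0 \<and> restrict f V m = a x / b x)"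
    by (intro local_fractionI[OF _ _ _ *(4,5)])
qed auto

lemma regular_const:
  assumes "zopen C U"
  shows "regular C U (\<lambda>p\<in>U. c)"
proof (rule regularI)
  have "\<forall>m\<in>U. \<forall>x\<in>m - {0}. (1 :: complex) \<noteq> 0 \<and> (\<lambda>p\<in>U. c) m = c / 1"
    by simp
  then show "\<exists>V d a b. zopen C V \<and> V \<subseteq> U \<and> p \<in> V \<and> hom_poly d a \<and> hom_poly d b \<and>
      (\<forall>m\<in>V. \<forall>x\<in>m - {0}. b x \<noteq> 0 \<and> (\<lambda>p\<in>U. c) m = a x / b x)" if "p \<in> U" for p
    by (rule local_fractionI[OF assms subset_refl that hom_poly_const[of c] hom_poly_const[of 1]])
qed auto

text \<open>Sums and products of fractions of forms of equal degree are again such fractions; the operation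
  is a parameter in order to treat both at once.\<close>

lemma regular_binop:
  fixes C :: "'n::finite pt set"
  assumes "regular C U f" "regular C U g"
    and op: "\<And>d d' (a :: complex ^ 'n \<Rightarrow> complex) b a' b'. hom_poly d a \<Longrightarrow> hom_poly d b \<Longrightarrow> hom_poly d' a' \<Longrightarrow> hom_poly d' b' \<Longrightarrow>
      \<exists>e c q. hom_poly e c \<and> hom_poly e q \<and>
        (\<forall>x. b x \<noteq> 0 \<longrightarrow> b' x \<noteq> 0 \<longrightarrow> q x \<noteq> 0 \<and> F (a x / b x) (a' x / b' x) = c x / q x)"
  shows "regular C U (\<lambda>p\<in>U. F (f p) (g p))"
proof (rule regularI)
  fix p assume p: "p \<in> U"
  obtain V d a b where V: "zopen C V" "V \<subseteq> U" "p \<in> V" "hom_poly d a" "hom_poly d b"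
      "\<forall>m\<in>V. \<forall>x\<in>m - {0}. b x \<noteq> 0 \<and> f m = a x / b x"
    by (rule regularE[OF assms(1) p])
  obtain V' d' a' b' where V': "zopen C V'" "V' \<subseteq> U" "p \<in> V'" "hom_poly d' a'" "hom_poly d' b'"
      "\<forall>m\<in>V'. \<forall>x\<in>m - {0}. b' x \<noteq> 0 \<and> g m = a' x / b' x"
    by (rule regularE[OF assms(2) p])
  obtain e c q where ecq: "hom_poly e c" "hom_poly e q"
     "\<forall>x. b x \<noteq> 0 \<longrightarrow> b' x \<noteq> 0 \<longrightarrow> q x \<noteq> 0 \<and> F (a x / b x) (a' x / b' x) = c x / q x"
    using op[OF V(4,5) V'(4,5)] by blast
  have "\<forall>m\<in>V \<inter> V'. \<forall>x\<in>m - {0}. q x \<noteq> 0 \<and> (\<lambda>p\<in>U. F (f p) (g p)) m = c x / q x"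
  proof (intro ballI)
    fix m x assume m: "m \<in> V \<inter> V'" "x \<in> m - {0}"
    then have "m \<in> U" using V by blast
    then show "q x \<noteq> 0 \<and> (\<lambda>p\<in>U. F (f p) (g p)) m = c x / q x"
      using spec[OF ecq(3), of x] bspec[OF bspec[OF V(6), of m] m(2)] bspec[OF bspec[OF V'(6), of m] m(2)] m(1) by simp
  qed
  then show "\<exists>V d a b. zopen C V \<and> V \<subseteq> U \<and> p \<in> V \<and> hom_poly d a \<and> hom_poly d b \<and>
      (\<forall>m\<in>V. \<forall>x\<in>m - {0}. b x \<noteq> 0 \<and> (\<lambda>p\<in>U. F (f p) (g p)) m = a x / b x)"
    by (rule local_fractionI[OF zopen_Int[OF V(1) V'(1)] le_infI1[OF V(2)] IntI[OF V(3) V'(3)] ecq(1,2)])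
qed auto

lemma regular_add:
  fixes C :: "'n::finite pt set"
  shows "regular C U f \<Longrightarrow> regular C U g \<Longrightarrow> regular C U (\<lambda>p\<in>U. f p + g p)"
proof (rule regular_binop[where F = "(+)"], assumption+)
  fix d e and a b a' b' :: "complex ^ 'n \<Rightarrow> complex"
  assume *: "hom_poly d a" "hom_poly d b" "hom_poly e a'" "hom_poly e b'"
  have "hom_poly (d + e) (\<lambda>x. a x * b' x + b x * a' x)"
    by (rule hom_poly_add[OF hom_poly_mult[OF *(1,4)] hom_poly_mult[OF *(2,3)]])
  moreover have "hom_poly (d + e) (\<lambda>x. b x * b' x)"
    by (rule hom_poly_mult[OF *(2,4)])
  moreover have "\<forall>x. b x \<noteq> 0 \<longrightarrow> b' x \<noteq> 0 \<longrightarrow>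
      b x * b' x \<noteq> 0 \<and> a x / b x + a' x / b' x = (a x * b' x + b x * a' x) / (b x * b' x)"
    by (simp add: divide_simps)
  ultimately show "\<exists>e c q. hom_poly e c \<and> hom_poly e q \<and>
        (\<forall>x. b x \<noteq> 0 \<longrightarrow> b' x \<noteq> 0 \<longrightarrow> q x \<noteq> 0 \<and> a x / b x + a' x / b' x = c x / q x)"
    by blast
qed

lemma regular_mult:
  fixes C :: "'n::finite pt set"
  shows "regular C U f \<Longrightarrow> regular C U g \<Longrightarrow> regular C U (\<lambda>p\<in>U. f p * g p)"
proof (rule regular_binop[where F = "(*)"], assumption+)
  fix d e and a b a' b' :: "complex ^ 'n \<Rightarrow> complex"
  assume *: "hom_poly d a" "hom_poly d b" "hom_poly e a'" "hom_poly e b'"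
  have "hom_poly (d + e) (\<lambda>x. a x * a' x)" "hom_poly (d + e) (\<lambda>x. b x * b' x)"
    by (rule hom_poly_mult[OF *(1,3)], rule hom_poly_mult[OF *(2,4)])
  moreover have "\<forall>x. b x \<noteq> 0 \<longrightarrow> b' x \<noteq> 0 \<longrightarrow>
      b x * b' x \<noteq> 0 \<and> (a x / b x) * (a' x / b' x) = (a x * a' x) / (b x * b' x)"
    by simp
  ultimately show "\<exists>e c q. hom_poly e c \<and> hom_poly e q \<and>
        (\<forall>x. b x \<noteq> 0 \<longrightarrow> b' x \<noteq> 0 \<longrightarrow> q x \<noteq> 0 \<and> (a x / b x) * (a' x / b' x) = c x / q x)"
    by blast
qed

lemma regular_inverse:
  assumes f: "regular C U f" and nz: "\<And>p. p \<in> U \<Longrightarrow> f p \<noteq> 0"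
  shows "regular C U (\<lambda>p\<in>U. inverse (f p))"
proof (rule regularI)
  fix p assume p: "p \<in> U"
  obtain V d a b where V: "zopen C V" "V \<subseteq> U" "p \<in> V" "hom_poly d a" "hom_poly d b"
      "\<forall>m\<in>V. \<forall>x\<in>m - {0}. b x \<noteq> 0 \<and> f m = a x / b x"
    by (rule regularE[OF f p])
  have "\<forall>m\<in>V. \<forall>x\<in>m - {0}. a x \<noteq> 0 \<and> (\<lambda>p\<in>U. inverse (f p)) m = b x / a x"
  proof (intro ballI)
    fix m x assume m: "m \<in> V" "x \<in> m - {0}"
    then have "m \<in> U" using V by blast
    with nz[of m] bspec[OF bspec[OF V(6) m(1)] m(2)] show "a x \<noteq> 0 \<and> (\<lambda>p\<in>U. inverse (f p)) m = b x / a x"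
      by auto
  qed
  then show "\<exists>V d a b. zopen C V \<and> V \<subseteq> U \<and> p \<in> V \<and> hom_poly d a \<and> hom_poly d b \<and>
      (\<forall>m\<in>V. \<forall>x\<in>m - {0}. b x \<noteq> 0 \<and> (\<lambda>p\<in>U. inverse (f p)) m = a x / b x)"
    by (rule local_fractionI[OF V(1-3,5,4)])
qed auto

lemma regular_power:
  assumes "zopen C U" "regular C U f"
  shows "regular C U (\<lambda>p\<in>U. f p ^ k)"
proof (induction k)
  case 0
  show ?case
    using regular_const[OF assms(1), of 1] by (simp only: power_0)
next
  case (Suc k)
  show ?case
    using regular_mult[OF assms(2) Suc] by (rule regular_cong) auto
qed

lemma regular_uminus:
  assumes "zopen C U" "regular C U f"
  shows "regular C U (\<lambda>p\<in>U. - f p)"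
  using regular_mult[OF regular_const[OF assms(1), of "-1"] assms(2)]
  by (rule regular_cong) (auto simp: restrict_def)

lemma struct_sheaf_simps [simp]:
  "f \<in> carrier (struct_sheaf C U) \<longleftrightarrow> regular C U f"
  "f \<otimes>\<^bsub>struct_sheaf C U\<^esub> g = (\<lambda>p\<in>U. f p * g p)"
  "f \<oplus>\<^bsub>struct_sheaf C U\<^esub> g = (\<lambda>p\<in>U. f p + g p)"
  "\<one>\<^bsub>struct_sheaf C U\<^esub> = (\<lambda>p\<in>U. 1)"
  "\<zero>\<^bsub>struct_sheaf C U\<^esub> = (\<lambda>p\<in>U. 0)"
  by (simp_all add: struct_sheaf_def)

lemma regular_eta: "regular C U f \<Longrightarrow> (\<lambda>p\<in>U. f p) = f"
  by (rule extensional_restrict[OF regular_extensional])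

lemma cring_struct_sheaf:
  assumes U: "zopen C U"
  shows "cring (struct_sheaf C U)"
proof (rule cringI)
  show "abelian_group (struct_sheaf C U)"
  proof (rule abelian_groupI)
    fix f assume "f \<in> carrier (struct_sheaf C U)"
    then show "\<exists>g\<in>carrier (struct_sheaf C U). g \<oplus>\<^bsub>struct_sheaf C U\<^esub> f = \<zero>\<^bsub>struct_sheaf C U\<^esub>"
      using regular_uminus[OF U, of f] by (intro bexI[of _ "\<lambda>p\<in>U. - f p"]) auto
  next
    fix f assume "f \<in> carrier (struct_sheaf C U)"
    then show "\<zero>\<^bsub>struct_sheaf C U\<^esub> \<oplus>\<^bsub>struct_sheaf C U\<^esub> f = f"
      by (intro regular_ext[of C U]) (auto simp: regular_eta cong: restrict_cong)
  qed (auto simp: regular_add regular_const[OF U] add_ac cong: restrict_cong)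
  show "comm_monoid (struct_sheaf C U)"
    by (rule comm_monoidI)
       (auto simp: regular_mult regular_const[OF U] mult_ac regular_eta cong: restrict_cong)
qed (auto simp: distrib_right cong: restrict_cong)

lemma Units_struct_sheaf:
  assumes U: "zopen C U"
  shows "f \<in> Units (struct_sheaf C U) \<longleftrightarrow> regular C U f \<and> (\<forall>p\<in>U. f p \<noteq> 0)"
proof safe
  assume f: "f \<in> Units (struct_sheaf C U)"
  then show "regular C U f"
    by (auto simp: Units_def)
  fix p assume p: "p \<in> U" "f p = 0"
  obtain g where "(\<lambda>p\<in>U. g p * f p) = (\<lambda>p\<in>U. 1)"
    using f unfolding Units_def by auto
  from fun_cong[OF this, of p] p show False
    by simp
next
  assume f: "regular C U f" "\<forall>p\<in>U. f p \<noteq> 0"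
  then have "regular C U (\<lambda>p\<in>U. inverse (f p))"
    by (intro regular_inverse) auto
  moreover have "(\<lambda>p\<in>U. inverse (f p) * f p) = (\<lambda>p\<in>U. 1)" "(\<lambda>p\<in>U. f p * inverse (f p)) = (\<lambda>p\<in>U. 1)"
    using f by (auto intro!: restrict_ext)
  ultimately show "f \<in> Units (struct_sheaf C U)"
    using f unfolding Units_def
    by (intro CollectI conjI bexI[of _ "\<lambda>p\<in>U. inverse (f p)"]) (simp_all cong: restrict_cong)
qed

lemma units_sheaf_simps [simp]:
  "gsec (units_sheaf C) U = units_of (struct_sheaf C U)"
  "gres (units_sheaf C) U V f = restrict f V"
  by (simp_all add: units_sheaf_def)

lemma units_of_struct_sheaf_simps [simp]:
  "f \<otimes>\<^bsub>units_of (struct_sheaf C U)\<^esub> g = (\<lambda>p\<in>U. f p * g p)"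
  "\<one>\<^bsub>units_of (struct_sheaf C U)\<^esub> = (\<lambda>p\<in>U. 1)"
  "zopen C U \<Longrightarrow> f \<in> carrier (units_of (struct_sheaf C U)) \<longleftrightarrow> regular C U f \<and> (\<forall>p\<in>U. f p \<noteq> 0)"
  by (simp_all add: units_of_mult units_of_one units_of_carrier Units_struct_sheaf)

lemma group_units_struct_sheaf: "zopen C U \<Longrightarrow> comm_group (units_of (struct_sheaf C U))"
  by (rule comm_monoid.units_comm_group, rule cring.axioms(2), rule cring_struct_sheaf)

lemma inv_units_struct_sheaf:
  assumes U: "zopen C U" and f: "regular C U f" "\<And>p. p \<in> U \<Longrightarrow> f p \<noteq> 0"
  shows "inv\<^bsub>units_of (struct_sheaf C U)\<^esub> f = (\<lambda>p\<in>U. inverse (f p))"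
proof -
  interpret comm_group "units_of (struct_sheaf C U)"
    by (rule group_units_struct_sheaf[OF U])
  show ?thesis
  proof (rule inv_equality)
    show "(\<lambda>p\<in>U. inverse (f p)) \<otimes>\<^bsub>units_of (struct_sheaf C U)\<^esub> f = \<one>\<^bsub>units_of (struct_sheaf C U)\<^esub>"
      using f(2) by (auto intro!: restrict_ext)
    show "f \<in> carrier (units_of (struct_sheaf C U))"
      using U f by simp
    have "regular C U (\<lambda>p\<in>U. inverse (f p))"
      by (rule regular_inverse[OF f])
    then show "(\<lambda>p\<in>U. inverse (f p)) \<in> carrier (units_of (struct_sheaf C U))"
      using U f(2) by simp
  qed
qed

lemma pow_units_struct_sheaf:
  fixes k :: nat
  assumes U: "zopen C U" and f: "regular C U f"
  shows "f [^]\<^bsub>units_of (struct_sheaf C U)\<^esub> k = (\<lambda>p\<in>U. f p ^ k)"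
proof (induction k)
  case 0
  show ?case by (simp add: Group.nat_pow_0)
next
  case (Suc k)
  show ?case
    unfolding Group.nat_pow_Suc Suc units_of_struct_sheaf_simps(1) by (rule restrict_ext) simp
qed

section \<open>Sheafification of a presheaf that is locally isomorphic to a sheaf\<close>


locale module_presheaf =
  fixes C :: "'n::finite pt set" and F :: "('n pt, 'e) module_sheaf"
  assumes add_closed: "\<lbrakk>zopen C U; x \<in> carrier (msec F U); y \<in> carrier (msec F U)\<rbrakk>
      \<Longrightarrow> x \<oplus>\<^bsub>msec F U\<^esub> y \<in> carrier (msec F U)"
    and smult_closed: "\<lbrakk>zopen C U; regular C U f; x \<in> carrier (msec F U)\<rbrakk>
      \<Longrightarrow> f \<odot>\<^bsub>msec F U\<^esub> x \<in> carrier (msec F U)"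
    and res_closed: "\<lbrakk>zopen C U; zopen C V; V \<subseteq> U; x \<in> carrier (msec F U)\<rbrakk>
      \<Longrightarrow> mres F U V x \<in> carrier (msec F V)"
    and res_res: "\<lbrakk>zopen C U; zopen C V; zopen C W; W \<subseteq> V; V \<subseteq> U; x \<in> carrier (msec F U)\<rbrakk>
      \<Longrightarrow> mres F V W (mres F U V x) = mres F U W x"
    and res_add: "\<lbrakk>zopen C U; zopen C V; V \<subseteq> U; x \<in> carrier (msec F U); y \<in> carrier (msec F U)\<rbrakk>
      \<Longrightarrow> mres F U V (x \<oplus>\<^bsub>msec F U\<^esub> y) = mres F U V x \<oplus>\<^bsub>msec F V\<^esub> mres F U V y"
    and res_smult: "\<lbrakk>zopen C U; zopen C V; V \<subseteq> U; regular C U f; x \<in> carrier (msec F U)\<rbrakk>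
      \<Longrightarrow> mres F U V (f \<odot>\<^bsub>msec F U\<^esub> x) = restrict f V \<odot>\<^bsub>msec F V\<^esub> mres F U V x"

text \<open>Covers and families of sections are indexed by the points of the open set, as they arise below
  from a choice near each point.\<close>

locale sheaf_of_modules = module_presheaf +
  assumes separated: "\<lbrakk>zopen C U; x \<in> carrier (msec F U); y \<in> carrier (msec F U);
      \<And>p. p \<in> U \<Longrightarrow> \<exists>V. zopen C V \<and> V \<subseteq> U \<and> p \<in> V \<and> mres F U V x = mres F U V y\<rbrakk> \<Longrightarrow> x = y"
    and gluing: "\<lbrakk>zopen C U;
      \<And>p. p \<in> U \<Longrightarrow> zopen C (V p) \<and> V p \<subseteq> U \<and> p \<in> V p \<and> s p \<in> carrier (msec F (V p));
      \<And>p q. p \<in> U \<Longrightarrow> q \<in> U \<Longrightarrow> mres F (V p) (V p \<inter> V q) (s p) = mres F (V q) (V p \<inter> V q) (s q)\<rbrakk>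
      \<Longrightarrow> \<exists>x\<in>carrier (msec F U). \<forall>p\<in>U. mres F U (V p) x = s p"

lemma UN_constant_pairs:
  assumes "\<And>V a. (V, a) \<in> A \<Longrightarrow> f V a = R" and "(V', a') \<in> A"
  shows "(\<Union>(V, a)\<in>A. f V a) = R"
proof -
  have "(\<Union>(V, a)\<in>A. f V a) = (\<Union>x\<in>A. R)"
    by (rule SUP_cong) (auto simp: assms(1))
  with assms(2) show ?thesis
    by auto
qed

context module_presheaf
begin

lemma germI:
  assumes "zopen C W" "p \<in> W" "r \<in> carrier (msec F W)" "zopen C Z" "Z \<subseteq> V" "Z \<subseteq> W" "p \<in> Z"
    "mres F V Z s = mres F W Z r"
  shows "(W, r) \<in> germ C F p V s"
  using assms zopen_subset[OF assms(1)] unfolding germ_def by auto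

lemma germD:
  assumes "(W, r) \<in> germ C F p V s"
  obtains Z where "zopen C W" "p \<in> W" "r \<in> carrier (msec F W)" "zopen C Z" "Z \<subseteq> V" "Z \<subseteq> W" "p \<in> Z"
    "mres F V Z s = mres F W Z r"
  using assms unfolding germ_def by auto

lemma germ_self:
  assumes "zopen C V" "p \<in> V" "s \<in> carrier (msec F V)"
  shows "(V, s) \<in> germ C F p V s"
  by (rule germI[where Z = V]) (use assms in auto)

lemma germ_eqI:
  assumes V: "zopen C V" "s \<in> carrier (msec F V)"
    and W: "zopen C W" "r \<in> carrier (msec F W)"
    and Z: "zopen C Z" "Z \<subseteq> V" "Z \<subseteq> W" "p \<in> Z"
    and eq: "mres F V Z s = mres F W Z r"
  shows "germ C F p V s = germ C F p W r"
proof -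
  have "germ C F p V s \<subseteq> germ C F p W r"
    if V: "zopen C V" "s \<in> carrier (msec F V)" and W: "zopen C W" "r \<in> carrier (msec F W)"
      and Z: "zopen C Z" "Z \<subseteq> V" "Z \<subseteq> W" "p \<in> Z" and eq: "mres F V Z s = mres F W Z r"
    for V W s r
  proof (rule subrelI)
    fix A a assume "(A, a) \<in> germ C F p V s"
    then obtain Y where Y: "zopen C A" "p \<in> A" "a \<in> carrier (msec F A)" "zopen C Y" "Y \<subseteq> V" "Y \<subseteq> A" "p \<in> Y"
      "mres F V Y s = mres F A Y a"
      by (rule germD)
    have "mres F W (Z \<inter> Y) r = mres F Z (Z \<inter> Y) (mres F W Z r)"
      using W Z Y by (intro res_res[symmetric]) auto
    also have "\<dots> = mres F V (Z \<inter> Y) s"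
      unfolding eq[symmetric] using V Z Y by (intro res_res) auto
    also have "\<dots> = mres F Y (Z \<inter> Y) (mres F V Y s)"
      using V Z Y by (intro res_res[symmetric]) auto
    also have "\<dots> = mres F A (Z \<inter> Y) a"
      unfolding Y(8) using V Z Y by (intro res_res) auto
    finally show "(A, a) \<in> germ C F p W r"
      using Y Z by (intro germI[where Z = "Z \<inter> Y"]) auto
  qed
  from this[OF V W Z eq] this[OF W V Z(1,3,2,4) eq[symmetric]] show ?thesis
    by blast
qed

lemma germ_restrict:
  assumes V: "zopen C V" "s \<in> carrier (msec F V)" and Z: "zopen C Z" "Z \<subseteq> V" "p \<in> Z"
  shows "germ C F p Z (mres F V Z s) = germ C F p V s"
  using assms by (intro germ_eqI[where Z = Z] res_closed res_res) auto

lemma germ_add: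
  assumes U: "zopen C U" "s \<in> carrier (msec F U)" "r \<in> carrier (msec F U)" "p \<in> U"
  shows "(\<Union>(V, a)\<in>germ C F p U s. \<Union>(W, b)\<in>germ C F p U r.
      germ C F p (V \<inter> W) (mres F V (V \<inter> W) a \<oplus>\<^bsub>msec F (V \<inter> W)\<^esub> mres F W (V \<inter> W) b))
    = germ C F p U (s \<oplus>\<^bsub>msec F U\<^esub> r)" (is "?L = ?R")
proof -
  have *: "germ C F p (V \<inter> W) (mres F V (V \<inter> W) a \<oplus>\<^bsub>msec F (V \<inter> W)\<^esub> mres F W (V \<inter> W) b) = ?R"
    if a: "(V, a) \<in> germ C F p U s" and b: "(W, b) \<in> germ C F p U r" for V W a b
  proof -
    from a obtain Y where Y: "zopen C V" "p \<in> V" "a \<in> carrier (msec F V)" "zopen C Y" "Y \<subseteq> U" "Y \<subseteq> V" "p \<in> Y"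
      "mres F U Y s = mres F V Y a"
      by (rule germD)
    from b obtain Z where Z: "zopen C W" "p \<in> W" "b \<in> carrier (msec F W)" "zopen C Z" "Z \<subseteq> U" "Z \<subseteq> W" "p \<in> Z"
      "mres F U Z r = mres F W Z b"
      by (rule germD)
    let ?X = "Y \<inter> Z"
    have X: "zopen C ?X" "?X \<subseteq> V \<inter> W" "zopen C (V \<inter> W)" "?X \<subseteq> U"
      using Y Z by auto
    have 1: "mres F V ?X a = mres F U ?X s"
      using res_res[of V Y ?X a] res_res[of U Y ?X s] U Y X by auto
    have 2: "mres F W ?X b = mres F U ?X r"
      using res_res[of W Z ?X b] res_res[of U Z ?X r] U Z X by auto
    have "mres F (V \<inter> W) ?X (mres F V (V \<inter> W) a \<oplus>\<^bsub>msec F (V \<inter> W)\<^esub> mres F W (V \<inter> W) b)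
        = mres F (V \<inter> W) ?X (mres F V (V \<inter> W) a) \<oplus>\<^bsub>msec F ?X\<^esub> mres F (V \<inter> W) ?X (mres F W (V \<inter> W) b)"
      using X Y Z by (intro res_add res_closed) auto
    also have "\<dots> = mres F V ?X a \<oplus>\<^bsub>msec F ?X\<^esub> mres F W ?X b"
      using X Y Z by (simp add: res_res)
    also have "\<dots> = mres F U ?X (s \<oplus>\<^bsub>msec F U\<^esub> r)"
      unfolding 1 2 using X U by (intro res_add[symmetric]) auto
    finally show ?thesis
      using U Y Z X by (intro germ_eqI[where Z = ?X] add_closed res_closed) auto
  qed
  have "(U, s) \<in> germ C F p U s" "(U, r) \<in> germ C F p U r"
    using U by (auto intro: germ_self)
  then show ?thesis
    by (intro UN_constant_pairs[where V' = U] *)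
qed

lemma germ_smult:
  assumes U: "zopen C U" "s \<in> carrier (msec F U)" "p \<in> U" and A: "zopen C A" "U \<subseteq> A"
    and f: "regular C A f"
  shows "(\<Union>(V, a)\<in>germ C F p U s.
      germ C F p (A \<inter> V) (restrict f (A \<inter> V) \<odot>\<^bsub>msec F (A \<inter> V)\<^esub> mres F V (A \<inter> V) a))
    = germ C F p U (restrict f U \<odot>\<^bsub>msec F U\<^esub> s)" (is "?L = ?R")
proof -
  have *: "germ C F p (A \<inter> V) (restrict f (A \<inter> V) \<odot>\<^bsub>msec F (A \<inter> V)\<^esub> mres F V (A \<inter> V) a) = ?R"
    if a: "(V, a) \<in> germ C F p U s" for V a
  proof -
    from a obtain Y where Y: "zopen C V" "p \<in> V" "a \<in> carrier (msec F V)" "zopen C Y" "Y \<subseteq> U" "Y \<subseteq> V" "p \<in> Y"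
      "mres F U Y s = mres F V Y a"
      by (rule germD)
    have X: "zopen C (A \<inter> V)" "Y \<subseteq> A \<inter> V" "A \<inter> V \<subseteq> A"
      using Y A by auto
    have Yf: "restrict (restrict f (A \<inter> V)) Y = restrict f Y" "restrict (restrict f U) Y = restrict f Y"
      using X Y by (auto simp: restrict_def fun_eq_iff)
    have "mres F (A \<inter> V) Y (restrict f (A \<inter> V) \<odot>\<^bsub>msec F (A \<inter> V)\<^esub> mres F V (A \<inter> V) a)
        = restrict (restrict f (A \<inter> V)) Y \<odot>\<^bsub>msec F Y\<^esub> mres F (A \<inter> V) Y (mres F V (A \<inter> V) a)"
      using X Y f by (intro res_smult res_closed regular_restrict[of C A]) auto
    also have "\<dots> = restrict (restrict f U) Y \<odot>\<^bsub>msec F Y\<^esub> mres F U Y s"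
      unfolding Yf Y(8) using X Y by (simp add: res_res)
    also have "\<dots> = mres F U Y (restrict f U \<odot>\<^bsub>msec F U\<^esub> s)"
      using U Y f A by (intro res_smult[symmetric] regular_restrict[of C A]) auto
    finally show ?thesis
      using U Y X f A
      by (intro germ_eqI[where Z = Y] smult_closed res_closed regular_restrict[of C A]) auto
  qed
  have "(U, s) \<in> germ C F p U s"
    using U by (auto intro: germ_self)
  then show ?thesis
    by (intro UN_constant_pairs[where V' = U] *)
qed

end

lemma sheafification_simps:
  "carrier (msec (sheafification C P) U) = {\<sigma> \<in> extensional U. \<forall>p\<in>U. \<exists>V\<in>opens C U. p \<in> V \<and>
       (\<exists>s\<in>carrier (msec P V). \<forall>q\<in>V. \<sigma> q = germ C P q V s)}"
  "\<sigma> \<oplus>\<^bsub>msec (sheafification C P) U\<^esub> \<tau> = (\<lambda>p\<in>U. \<Union>(V, s)\<in>\<sigma> p. \<Union>(W, r)\<in>\<tau> p.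
      germ C P p (V \<inter> W) (mres P V (V \<inter> W) s \<oplus>\<^bsub>msec P (V \<inter> W)\<^esub> mres P W (V \<inter> W) r))"
  "f \<odot>\<^bsub>msec (sheafification C P) U\<^esub> \<sigma> = (\<lambda>p\<in>U. \<Union>(V, s)\<in>\<sigma> p.
      germ C P p (U \<inter> V) (restrict f (U \<inter> V) \<odot>\<^bsub>msec P (U \<inter> V)\<^esub> mres P V (U \<inter> V) s))"
  "mres (sheafification C P) U V \<sigma> = restrict \<sigma> V"
  by (simp_all add: sheafification_def)

text \<open>A section \<open>y\<close> of \<open>G\<close> is sent to the family of the germs of its images under the local
  isomorphisms.  Injectivity is separatedness of \<open>G\<close>; conversely a section of the sheafification is
  locally the germ of a section of \<open>P\<close>, and the preimages of these sections glue.\<close>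

lemma sheafification_iso:
  fixes C :: "'n::finite pt set" and P :: "('n pt, 'e) module_sheaf" and G :: "('n pt, 'g) module_sheaf"
  assumes P: "module_presheaf C P" and G: "sheaf_of_modules C G"
    and N: "\<And>x. x \<in> C \<Longrightarrow> zopen C (N x)" "\<And>x. x \<in> C \<Longrightarrow> x \<in> N x"
    and bij: "\<And>x Z. x \<in> C \<Longrightarrow> zopen C Z \<Longrightarrow> Z \<subseteq> N x \<Longrightarrow>
      bij_betw (\<beta> x Z) (carrier (msec G Z)) (carrier (msec P Z))"
    and add: "\<And>x Z y y'. x \<in> C \<Longrightarrow> zopen C Z \<Longrightarrow> Z \<subseteq> N x \<Longrightarrow> y \<in> carrier (msec G Z) \<Longrightarrow> y' \<in> carrier (msec G Z) \<Longrightarrow>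
      \<beta> x Z (y \<oplus>\<^bsub>msec G Z\<^esub> y') = \<beta> x Z y \<oplus>\<^bsub>msec P Z\<^esub> \<beta> x Z y'"
    and smult: "\<And>x Z f y. x \<in> C \<Longrightarrow> zopen C Z \<Longrightarrow> Z \<subseteq> N x \<Longrightarrow> regular C Z f \<Longrightarrow> y \<in> carrier (msec G Z) \<Longrightarrow>
      \<beta> x Z (f \<odot>\<^bsub>msec G Z\<^esub> y) = f \<odot>\<^bsub>msec P Z\<^esub> \<beta> x Z y"
    and res: "\<And>x Z Z' y. x \<in> C \<Longrightarrow> zopen C Z \<Longrightarrow> Z \<subseteq> N x \<Longrightarrow> zopen C Z' \<Longrightarrow> Z' \<subseteq> Z \<Longrightarrow> y \<in> carrier (msec G Z) \<Longrightarrow>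
      mres P Z Z' (\<beta> x Z y) = \<beta> x Z' (mres G Z Z' y)"
    and compat: "\<And>x x' Z y. x \<in> C \<Longrightarrow> x' \<in> C \<Longrightarrow> zopen C Z \<Longrightarrow> Z \<subseteq> N x \<Longrightarrow> Z \<subseteq> N x' \<Longrightarrow> y \<in> carrier (msec G Z) \<Longrightarrow>
      \<beta> x Z y = \<beta> x' Z y"
  shows "module_sheaf_iso C G (sheafification C P)"
proof -
  interpret P: module_presheaf C P by (rule P)
  interpret G: sheaf_of_modules C G by (rule G)
  define S where "S = sheafification C P"
  define h where "h U y = (\<lambda>p\<in>U. germ C P p (U \<inter> N p) (\<beta> p (U \<inter> N p) (mres G U (U \<inter> N p) y)))" for U y
  have UC: "p \<in> C" if "zopen C U" "p \<in> U" for U p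
    using that zopen_subset by blast
  have \<beta>_closed: "\<beta> x Z y \<in> carrier (msec P Z)"
    if "x \<in> C" "zopen C Z" "Z \<subseteq> N x" "y \<in> carrier (msec G Z)" for x Z y
    using bij[OF that(1-3)] that(4) by (auto simp: bij_betw_def)
  have \<beta>_inj: "y = y'"
    if "\<beta> x Z y = \<beta> x Z y'" "x \<in> C" "zopen C Z" "Z \<subseteq> N x" "y \<in> carrier (msec G Z)" "y' \<in> carrier (msec G Z)" for x Z y y'
    using bij[OF that(2-4)] that by (auto simp: bij_betw_def inj_on_def)
  note Gres = G.res_closed
  \<comment> \<open>The germ at a point can be computed in any chart and on any small open set.\<close>
  have h_germ: "h U y q = germ C P q Z (\<beta> x Z (mres G U Z y))"
    if U: "zopen C U" "y \<in> carrier (msec G U)" and x: "x \<in> C" and Z: "zopen C Z" "Z \<subseteq> U" "Z \<subseteq> N x" "q \<in> Z"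
    for U y q x Z
  proof -
    have q: "q \<in> C" "q \<in> U"
      using UC Z by auto
    let ?W = "U \<inter> N q" let ?Y = "Z \<inter> N q"
    have W: "zopen C ?W" "zopen C ?Y" "?Y \<subseteq> ?W" "q \<in> ?Y"
      using U N q Z by auto
    have "mres P ?W ?Y (\<beta> q ?W (mres G U ?W y)) = \<beta> q ?Y (mres G ?W ?Y (mres G U ?W y))"
      using q W U by (intro res Gres) auto
    also have "\<dots> = \<beta> q ?Y (mres G Z ?Y (mres G U Z y))"
      using U Z W by (simp add: G.res_res)
    also have "\<dots> = \<beta> x ?Y (mres G Z ?Y (mres G U Z y))"
      using q W U Z x by (intro compat Gres) auto
    also have "\<dots> = mres P Z ?Y (\<beta> x Z (mres G U Z y))"
      using q W U Z x by (intro res[symmetric] Gres) auto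
    finally have "germ C P q ?W (\<beta> q ?W (mres G U ?W y)) = germ C P q Z (\<beta> x Z (mres G U Z y))"
      using q W U Z x by (intro P.germ_eqI[where Z = ?Y] \<beta>_closed Gres) auto
    then show ?thesis
      using q by (simp add: h_def)
  qed
  have h_closed: "h U y \<in> carrier (msec S U)" if U: "zopen C U" "y \<in> carrier (msec G U)" for U y
  proof -
    have "\<exists>V\<in>opens C U. p \<in> V \<and> (\<exists>s\<in>carrier (msec P V). \<forall>q\<in>V. h U y q = germ C P q V s)"
      if p: "p \<in> U" for p
    proof -
      have pC: "p \<in> C" using UC U p by blast
      have W: "zopen C (U \<inter> N p)"
        using U N pC by auto
      have "\<forall>q\<in>U \<inter> N p. h U y q = germ C P q (U \<inter> N p) (\<beta> p (U \<inter> N p) (mres G U (U \<inter> N p) y))"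
        using U W pC by (intro ballI h_germ) auto
      moreover have "\<beta> p (U \<inter> N p) (mres G U (U \<inter> N p) y) \<in> carrier (msec P (U \<inter> N p))"
        using U W pC by (intro \<beta>_closed Gres) auto
      ultimately show ?thesis
        using W p N pC by (intro bexI[of _ "U \<inter> N p"]) auto
    qed
    then show ?thesis
      by (simp add: S_def sheafification_simps h_def)
  qed
  have h_add: "h U (y \<oplus>\<^bsub>msec G U\<^esub> y') = h U y \<oplus>\<^bsub>msec S U\<^esub> h U y'"
    if U: "zopen C U" "y \<in> carrier (msec G U)" "y' \<in> carrier (msec G U)" for U y y'
    unfolding S_def sheafification_simps
  proof (rule ext)
    fix p
    show "h U (y \<oplus>\<^bsub>msec G U\<^esub> y') p = (\<lambda>p\<in>U. \<Union>(V, s)\<in>h U y p. \<Union>(W, r)\<in>h U y' p.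
      germ C P p (V \<inter> W) (mres P V (V \<inter> W) s \<oplus>\<^bsub>msec P (V \<inter> W)\<^esub> mres P W (V \<inter> W) r)) p"
    proof (cases "p \<in> U")
      case True
      let ?W = "U \<inter> N p"
      have p: "p \<in> C" using UC U True by blast
      have W: "zopen C ?W" "p \<in> ?W" using U N p True by auto
      have 1: "h U z p = germ C P p ?W (\<beta> p ?W (mres G U ?W z))" for z
        using True by (simp add: h_def)
      have "\<beta> p ?W (mres G U ?W (y \<oplus>\<^bsub>msec G U\<^esub> y')) = \<beta> p ?W (mres G U ?W y) \<oplus>\<^bsub>msec P ?W\<^esub> \<beta> p ?W (mres G U ?W y')"
        using U W p by (subst G.res_add) (auto intro!: add Gres)
      then show ?thesis
        unfolding restrict_apply'[OF True] 1 using U W p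
        by (subst P.germ_add) (auto intro!: \<beta>_closed Gres)
    qed (simp add: h_def)
  qed
  have h_smult: "h U (f \<odot>\<^bsub>msec G U\<^esub> y) = f \<odot>\<^bsub>msec S U\<^esub> h U y"
    if U: "zopen C U" "y \<in> carrier (msec G U)" and f: "regular C U f" for U y f
    unfolding S_def sheafification_simps
  proof (rule ext)
    fix p
    show "h U (f \<odot>\<^bsub>msec G U\<^esub> y) p = (\<lambda>p\<in>U. \<Union>(V, s)\<in>h U y p.
      germ C P p (U \<inter> V) (restrict f (U \<inter> V) \<odot>\<^bsub>msec P (U \<inter> V)\<^esub> mres P V (U \<inter> V) s)) p"
    proof (cases "p \<in> U")
      case True
      let ?W = "U \<inter> N p"
      have p: "p \<in> C" using UC U True by blast
      have W: "zopen C ?W" "p \<in> ?W" using U N p True by auto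
      have 1: "h U z p = germ C P p ?W (\<beta> p ?W (mres G U ?W z))" for z
        using True by (simp add: h_def)
      have "\<beta> p ?W (mres G U ?W (f \<odot>\<^bsub>msec G U\<^esub> y)) = restrict f ?W \<odot>\<^bsub>msec P ?W\<^esub> \<beta> p ?W (mres G U ?W y)"
        using U W p f by (subst G.res_smult) (auto intro!: smult Gres regular_restrict[of C U])
      then show ?thesis
        unfolding restrict_apply'[OF True] 1 using U W p f
        by (subst P.germ_smult) (auto intro!: \<beta>_closed Gres)
    qed (simp add: h_def)
  qed
  have h_res: "h V (mres G U V y) = restrict (h U y) V"
    if U: "zopen C U" "y \<in> carrier (msec G U)" and V: "zopen C V" "V \<subseteq> U" for U V y
  proof (rule ext)
    fix p
    show "h V (mres G U V y) p = restrict (h U y) V p"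
    proof (cases "p \<in> V")
      case True
      have p: "p \<in> C" using UC V True by blast
      have W: "zopen C (V \<inter> N p)" "p \<in> V \<inter> N p"
        using V N p True by auto
      have "h U y p = germ C P p (V \<inter> N p) (\<beta> p (V \<inter> N p) (mres G U (V \<inter> N p) y))"
        using U W V p by (intro h_germ) auto
      also have "\<dots> = h V (mres G U V y) p"
        using U V W True by (simp add: h_def G.res_res)
      finally show ?thesis
        using True by simp
    qed (simp add: h_def)
  qed
  have h_inj: "y = y'" if U: "zopen C U" "y \<in> carrier (msec G U)" "y' \<in> carrier (msec G U)"
    and eq: "h U y = h U y'" for U y y'
  proof (rule G.separated[OF U])
    fix p assume p: "p \<in> U"
    let ?W = "U \<inter> N p"
    have pC: "p \<in> C" using UC U p by blast
    have W: "zopen C ?W" "p \<in> ?W" using U N pC p by auto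
    have y: "mres G U ?W y \<in> carrier (msec G ?W)" "mres G U ?W y' \<in> carrier (msec G ?W)"
      using U W by (auto intro!: Gres)
    have "germ C P p ?W (\<beta> p ?W (mres G U ?W y)) = germ C P p ?W (\<beta> p ?W (mres G U ?W y'))"
      using fun_cong[OF eq, of p] p by (simp add: h_def)
    moreover have "(?W, \<beta> p ?W (mres G U ?W y')) \<in> germ C P p ?W (\<beta> p ?W (mres G U ?W y'))"
      using W y pC by (intro P.germ_self \<beta>_closed) auto
    ultimately have "(?W, \<beta> p ?W (mres G U ?W y')) \<in> germ C P p ?W (\<beta> p ?W (mres G U ?W y))"
      by simp
    then obtain Z where Z: "zopen C Z" "Z \<subseteq> ?W" "p \<in> Z"
      "mres P ?W Z (\<beta> p ?W (mres G U ?W y)) = mres P ?W Z (\<beta> p ?W (mres G U ?W y'))"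
      by (rule P.germD)
    then have "\<beta> p Z (mres G ?W Z (mres G U ?W y)) = \<beta> p Z (mres G ?W Z (mres G U ?W y'))"
      using W y pC by (simp add: res)
    then have "mres G ?W Z (mres G U ?W y) = mres G ?W Z (mres G U ?W y')"
      by (rule \<beta>_inj) (use W y pC Z in \<open>auto intro!: Gres[of ?W]\<close>)
    then have "mres G U Z y = mres G U Z y'"
      using W U Z by (simp add: G.res_res)
    with Z show "\<exists>V. zopen C V \<and> V \<subseteq> U \<and> p \<in> V \<and> mres G U V y = mres G U V y'"
      by blast
  qed
  have h_surj: "\<exists>y\<in>carrier (msec G U). h U y = \<sigma>"
    if U: "zopen C U" and \<sigma>: "\<sigma> \<in> carrier (msec S U)" for U \<sigma>
  proof -
    from \<sigma> have "\<sigma> \<in> extensional U \<and> (\<forall>p\<in>U. \<exists>V. zopen C V \<and> V \<subseteq> U \<and> p \<in> V \<and>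
        (\<exists>s. s \<in> carrier (msec P V) \<and> (\<forall>q\<in>V. \<sigma> q = germ C P q V s)))"
      unfolding S_def sheafification_simps mem_Collect_eq Bex_def opens_iff conj_assoc by assumption
    then obtain V s where Vs: "\<And>p. p \<in> U \<Longrightarrow> zopen C (V p) \<and> V p \<subseteq> U \<and> p \<in> V p \<and> s p \<in> carrier (msec P (V p))"
        "\<And>p q. p \<in> U \<Longrightarrow> q \<in> V p \<Longrightarrow> \<sigma> q = germ C P q (V p) (s p)"
      by metis
    define Z where "Z p = V p \<inter> N p" for p
    have Z: "zopen C (Z p)" "p \<in> Z p" "Z p \<subseteq> U" "Z p \<subseteq> N p" "Z p \<subseteq> V p" "p \<in> C" if "p \<in> U" for p
      using Vs(1)[OF that] N[OF UC[OF U that]] UC[OF U that] by (auto simp: Z_def)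
    have "\<exists>y\<in>carrier (msec G (Z p)). \<beta> p (Z p) y = mres P (V p) (Z p) (s p)" if "p \<in> U" for p
    proof -
      have "mres P (V p) (Z p) (s p) \<in> carrier (msec P (Z p))"
        using Vs(1)[OF that] Z[OF that] by (intro P.res_closed) auto
      then show ?thesis
        using bij_betw_imp_surj_on[OF bij[OF Z(6,1,4)[OF that]]] by (metis imageE)
    qed
    then obtain y where y: "\<And>p. p \<in> U \<Longrightarrow> y p \<in> carrier (msec G (Z p))"
      "\<And>p. p \<in> U \<Longrightarrow> \<beta> p (Z p) (y p) = mres P (V p) (Z p) (s p)"
      by metis
    have "\<exists>Y\<in>carrier (msec G U). \<forall>p\<in>U. mres G U (Z p) Y = y p"
    proof (rule G.gluing[OF U])
      fix p q assume pq: "p \<in> U" "q \<in> U"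
      note Zp = Z[OF pq(1)] and Zq = Z[OF pq(2)] and Vp = Vs(1)[OF pq(1)] and Vq = Vs(1)[OF pq(2)]
      note yp = y(1)[OF pq(1)] and yq = y(1)[OF pq(2)]
      let ?A = "Z p \<inter> Z q"
      have A: "zopen C ?A" using Zp Zq by auto
      show "mres G (Z p) ?A (y p) = mres G (Z q) ?A (y q)"
      proof (rule G.separated[OF A])
        show "mres G (Z p) ?A (y p) \<in> carrier (msec G ?A)" "mres G (Z q) ?A (y q) \<in> carrier (msec G ?A)"
          using A Zp Zq yp yq by (auto intro!: Gres)
        fix x assume x: "x \<in> ?A"
        have xV: "x \<in> V p" "x \<in> V q" using x Zp Zq by auto
        have "(V q, s q) \<in> germ C P x (V q) (s q)"
          using Vq xV by (intro P.germ_self) auto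
        also have "\<dots> = germ C P x (V p) (s p)"
          using Vs(2)[OF pq(1) xV(1)] Vs(2)[OF pq(2) xV(2)] by simp
        finally obtain B where B: "zopen C B" "B \<subseteq> V p" "B \<subseteq> V q" "x \<in> B" "mres P (V p) B (s p) = mres P (V q) B (s q)"
          by (rule P.germD)
        let ?B = "B \<inter> ?A"
        have B': "zopen C ?B" "?B \<subseteq> Z p" "?B \<subseteq> Z q" using A B by auto
        have "\<beta> p ?B (mres G (Z p) ?B (y p)) = mres P (Z p) ?B (\<beta> p (Z p) (y p))"
          using Zp yp B' by (intro res[symmetric]) auto
        also have "\<dots> = mres P B ?B (mres P (V p) B (s p))"
          using Zp Vp B(1-4) B' pq by (simp add: y P.res_res)
        also have "\<dots> = mres P (Z q) ?B (\<beta> q (Z q) (y q))"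
          unfolding B(5) using Zq Vq B(1-4) B' pq by (simp add: y P.res_res)
        also have "\<dots> = \<beta> q ?B (mres G (Z q) ?B (y q))"
          using Zq yq B' by (intro res) auto
        also have "\<dots> = \<beta> p ?B (mres G (Z q) ?B (y q))"
          using Zp Zq yq B' by (intro compat Gres[of "Z q"]) auto
        finally have "mres G (Z p) ?B (y p) = mres G (Z q) ?B (y q)"
          by (rule \<beta>_inj) (use Zp Zq yp yq B' in \<open>auto intro: Gres\<close>)
        then have "mres G ?A ?B (mres G (Z p) ?A (y p)) = mres G ?A ?B (mres G (Z q) ?A (y q))"
          using A B' Zp Zq yp yq by (simp add: G.res_res)
        with B' B(4) x show "\<exists>V. zopen C V \<and> V \<subseteq> ?A \<and> x \<in> V \<and>
            mres G ?A V (mres G (Z p) ?A (y p)) = mres G ?A V (mres G (Z q) ?A (y q))"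
          by (intro exI[of _ ?B]) auto
      qed
    qed (use Z y in auto)
    then obtain Y where Y: "Y \<in> carrier (msec G U)" "\<And>p. p \<in> U \<Longrightarrow> mres G U (Z p) Y = y p"
      by blast
    have "h U Y p = \<sigma> p" for p
    proof (cases "p \<in> U")
      case True
      note Zp = Z[OF True] and Vp = Vs(1)[OF True]
      have "h U Y p = germ C P p (Z p) (\<beta> p (Z p) (mres G U (Z p) Y))"
        using U Y Zp by (intro h_germ) auto
      also have "\<dots> = germ C P p (V p) (s p)"
        unfolding Y(2)[OF True] y(2)[OF True] using Vp Zp by (intro P.germ_restrict) auto
      also have "\<dots> = \<sigma> p"
        using Vs(2)[OF True, of p] Vp by simp
      finally show ?thesis .
    next
      case False
      then show ?thesis
        using \<sigma> unfolding S_def sheafification_simps by (auto simp: h_def extensional_def)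
    qed
    with Y(1) show ?thesis
      by blast
  qed
  have "module_sheaf_hom C C G S h"
    unfolding module_sheaf_hom_def opens_iff struct_sheaf_simps
    using h_closed h_add h_smult h_res by (simp add: S_def sheafification_simps(4))
  moreover have "bij_betw (h U) (carrier (msec G U)) (carrier (msec S U))" if "U \<in> opens C C" for U
  proof (rule bij_betw_imageI)
    have U: "zopen C U" using that by simp
    show "inj_on (h U) (carrier (msec G U))"
      using h_inj[OF U] by (rule inj_onI)
    show "h U ` carrier (msec G U) = carrier (msec S U)"
      using h_surj[OF U] h_closed[OF U] by blast
  qed
  ultimately show ?thesis
    unfolding module_sheaf_iso_def S_def by blast
qed

section \<open>Tensor products\<close>

lemmas free_Abelian_induct = free_Abelian_group_induct [consumes 1, case_names zero diff gen]

lemma generate_subset_induct: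
  assumes "c \<in> generate (free_Abelian_group S) H" "H \<subseteq> carrier (free_Abelian_group S)"
    and "P 0" "\<And>c. c \<in> H \<Longrightarrow> P c" "\<And>c d. P c \<Longrightarrow> P d \<Longrightarrow> P (c + d)" "\<And>c. P c \<Longrightarrow> P (- c)"
  shows "P c"
  using assms(1)
proof (induction rule: generate.induct)
  case (inv h)
  with assms(2) have "h \<in> carrier (free_Abelian_group S)"
    by blast
  then have "Poly_Mapping.keys h \<subseteq> S"
    by simp
  then show ?case
    using inv assms(4,6) by simp
qed (use assms in auto)

locale tensor_factors = module R M
  for R :: "('a, 'k) ring_scheme" and M :: "('a, 'e, 'm) module_scheme" +
  fixes N :: "('a, 'f, 'l) module_scheme"
  assumes N_add: "y \<in> carrier N \<Longrightarrow> y' \<in> carrier N \<Longrightarrow> y \<oplus>\<^bsub>N\<^esub> y' \<in> carrier N"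
    and N_smult: "a \<in> carrier R \<Longrightarrow> y \<in> carrier N \<Longrightarrow> a \<odot>\<^bsub>N\<^esub> y \<in> carrier N"
begin

definition pairs where "pairs = carrier M \<times> carrier N"

definition A where "A = free_Abelian_group pairs"

definition K where "K = tensor_kernel R M N"

abbreviation cls where "cls \<equiv> tensor_class R M N"

lemma A_simps [simp]: "x \<otimes>\<^bsub>A\<^esub> y = x + y" "\<one>\<^bsub>A\<^esub> = 0"
  "c \<in> carrier A \<longleftrightarrow> Poly_Mapping.keys c \<subseteq> pairs"
  by (simp_all add: A_def)

lemma A_group: "comm_group A"
  by (simp add: A_def abelian_free_Abelian_group)

lemma frag_of_A: "frag_of (x, y) \<in> carrier A \<longleftrightarrow> x \<in> carrier M \<and> y \<in> carrier N"
  by (simp add: pairs_def)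

lemma diff_A: "c \<in> carrier A \<Longrightarrow> d \<in> carrier A \<Longrightarrow> c - d \<in> carrier A"
  using keys_diff[of c d] by (simp only: A_simps) blast

lemma add_A: "c \<in> carrier A \<Longrightarrow> d \<in> carrier A \<Longrightarrow> c + d \<in> carrier A"
  using keys_add[of c d] by (simp only: A_simps) blast

lemma relations_A: "tensor_relations R M N \<subseteq> carrier A"
  unfolding tensor_relations_def
  by (auto simp only: Un_subset_iff subset_iff mem_Collect_eq
      intro!: diff_A frag_of_A[THEN iffD2] M.a_closed N_add smult_closed N_smult)

lemma K_eq: "K = generate A (tensor_relations R M N)"
  by (simp add: K_def tensor_kernel_def A_def pairs_def)

lemma K_subgroup: "subgroup K A"
  unfolding K_eq using A_group relations_A
  by (intro group.generate_is_subgroup) (auto simp: comm_group_def)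

lemma K_normal: "K \<lhd> A"
  using A_group K_subgroup by (rule comm_group.subgroup_imp_normal)

lemma K_zero: "0 \<in> K"
  using subgroup.one_closed[OF K_subgroup] by simp

lemma K_add: "c \<in> K \<Longrightarrow> d \<in> K \<Longrightarrow> c + d \<in> K"
  using subgroup.m_closed[OF K_subgroup] by simp

lemma K_A: "c \<in> K \<Longrightarrow> c \<in> carrier A"
  using subgroup.subset[OF K_subgroup] by blast

lemma K_uminus: "c \<in> K \<Longrightarrow> - c \<in> K"
  using subgroup.m_inv_closed[OF K_subgroup, of c] K_A[of c] by (simp add: A_def)

lemma K_diff: "c \<in> K \<Longrightarrow> d \<in> K \<Longrightarrow> c - d \<in> K"
  using K_add[of c "- d"] K_uminus[of d] by simp

lemma K_rel: "c \<in> tensor_relations R M N \<Longrightarrow> c \<in> K"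
  unfolding K_eq by (rule generate.incl)

lemma rel_add1: "x \<in> carrier M \<Longrightarrow> x' \<in> carrier M \<Longrightarrow> y \<in> carrier N \<Longrightarrow>
    frag_of (x \<oplus>\<^bsub>M\<^esub> x', y) - frag_of (x, y) - frag_of (x', y) \<in> tensor_relations R M N"
  unfolding tensor_relations_def by blast

lemma rel_add2: "x \<in> carrier M \<Longrightarrow> y \<in> carrier N \<Longrightarrow> y' \<in> carrier N \<Longrightarrow>
    frag_of (x, y \<oplus>\<^bsub>N\<^esub> y') - frag_of (x, y) - frag_of (x, y') \<in> tensor_relations R M N"
  unfolding tensor_relations_def by blast

lemma rel_smult: "a \<in> carrier R \<Longrightarrow> x \<in> carrier M \<Longrightarrow> y \<in> carrier N \<Longrightarrow>
    frag_of (a \<odot>\<^bsub>M\<^esub> x, y) - frag_of (x, a \<odot>\<^bsub>N\<^esub> y) \<in> tensor_relations R M N"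
  unfolding tensor_relations_def by blast

lemma relations_cases:
  assumes "c \<in> tensor_relations R M N"
    and "\<And>x x' y. c = frag_of (x \<oplus>\<^bsub>M\<^esub> x', y) - frag_of (x, y) - frag_of (x', y) \<Longrightarrow>
      x \<in> carrier M \<Longrightarrow> x' \<in> carrier M \<Longrightarrow> y \<in> carrier N \<Longrightarrow> thesis"
    and "\<And>x y y'. c = frag_of (x, y \<oplus>\<^bsub>N\<^esub> y') - frag_of (x, y) - frag_of (x, y') \<Longrightarrow>
      x \<in> carrier M \<Longrightarrow> y \<in> carrier N \<Longrightarrow> y' \<in> carrier N \<Longrightarrow> thesis"
    and "\<And>a x y. c = frag_of (a \<odot>\<^bsub>M\<^esub> x, y) - frag_of (x, a \<odot>\<^bsub>N\<^esub> y) \<Longrightarrow>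
      a \<in> carrier R \<Longrightarrow> x \<in> carrier M \<Longrightarrow> y \<in> carrier N \<Longrightarrow> thesis"
  shows thesis
  using assms(1) unfolding tensor_relations_def
  by (elim UnE CollectE exE conjE) (rule assms(2-4), assumption+)+

lemma cls_eq: "cls c = {k + c | k. k \<in> K}"
  unfolding tensor_class_def K_def[symmetric] r_coset_def by auto

lemma mem_cls: "d \<in> cls c \<longleftrightarrow> d - c \<in> K"
  unfolding cls_eq by (auto intro!: exI[of _ "d - c"])

lemma cls_self: "c \<in> cls c"
  by (simp add: mem_cls K_zero)

lemma cls_eqI: "c - d \<in> K \<Longrightarrow> cls c = cls d"
proof -
  assume cd: "c - d \<in> K"
  have "e - c \<in> K \<longleftrightarrow> e - d \<in> K" for e
    using K_add[of "e - c" "c - d"] K_diff[of "e - d" "c - d"] cd by auto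
  then show ?thesis
    by (auto simp: mem_cls set_eq_iff)
qed

lemma cls_eqD: "cls c = cls d \<Longrightarrow> c - d \<in> K"
  using cls_self[of c] by (simp add: mem_cls)

lemma tensor_carrier: "carrier (tensor_module R M N) = cls ` carrier A"
  unfolding tensor_module_def Let_def A_def pairs_def tensor_class_def
  by (auto simp: FactGroup_def RCOSETS_def)

lemma tensor_add:
  assumes "c \<in> carrier A" "d \<in> carrier A"
  shows "cls c \<oplus>\<^bsub>tensor_module R M N\<^esub> cls d = cls (c + d)"
  using normal.rcos_sum[OF K_normal assms]
  unfolding tensor_module_def Let_def A_def pairs_def tensor_class_def K_def
  by (simp add: FactGroup_def)

end

text \<open>A pair of maps that is semilinear along a map of scalars preserves the defining relations of
  the tensor product.  Both the scalar multiplication and the restriction maps are of this kind.\<close>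

locale tensor_map = S: tensor_factors R M N + T: tensor_factors R' M' N'
  for R :: "('a, 'k) ring_scheme" and M :: "('a, 'e, 'm) module_scheme" and N :: "('a, 'f, 'l) module_scheme"
    and R' :: "('a, 'k) ring_scheme" and M' :: "('a, 'e, 'm) module_scheme" and N' :: "('a, 'f, 'l) module_scheme" +
  fixes \<rho> :: "'a \<Rightarrow> 'a" and u :: "'e \<Rightarrow> 'e" and v :: "'f \<Rightarrow> 'f"
  assumes \<rho>_closed: "a \<in> carrier R \<Longrightarrow> \<rho> a \<in> carrier R'"
    and u_closed: "x \<in> carrier M \<Longrightarrow> u x \<in> carrier M'"
    and v_closed: "y \<in> carrier N \<Longrightarrow> v y \<in> carrier N'"
    and u_add: "x \<in> carrier M \<Longrightarrow> x' \<in> carrier M \<Longrightarrow> u (x \<oplus>\<^bsub>M\<^esub> x') = u x \<oplus>\<^bsub>M'\<^esub> u x'"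
    and v_add: "y \<in> carrier N \<Longrightarrow> y' \<in> carrier N \<Longrightarrow> v (y \<oplus>\<^bsub>N\<^esub> y') = v y \<oplus>\<^bsub>N'\<^esub> v y'"
    and u_smult: "a \<in> carrier R \<Longrightarrow> x \<in> carrier M \<Longrightarrow> u (a \<odot>\<^bsub>M\<^esub> x) = \<rho> a \<odot>\<^bsub>M'\<^esub> u x"
    and v_smult: "a \<in> carrier R \<Longrightarrow> y \<in> carrier N \<Longrightarrow> v (a \<odot>\<^bsub>N\<^esub> y) = \<rho> a \<odot>\<^bsub>N'\<^esub> v y"
begin

definition ext where "ext = frag_extend (\<lambda>(x, y). frag_of (u x, v y))"

lemma ext_frag_of [simp]: "ext (frag_of (x, y)) = frag_of (u x, v y)"
  by (simp add: ext_def)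

lemma ext_add: "ext (c + d) = ext c + ext d"
  and ext_diff: "ext (c - d) = ext c - ext d"
  and ext_uminus: "ext (- c) = - ext c"
  and ext_zero: "ext 0 = 0"
  by (simp_all add: ext_def frag_extend_add frag_extend_diff frag_extend_minus)

lemma ext_K: "c \<in> S.K \<Longrightarrow> ext c \<in> T.K"
proof -
  assume "c \<in> S.K"
  then have "c \<in> generate (free_Abelian_group S.pairs) (tensor_relations R M N)"
    by (simp add: S.K_eq S.A_def)
  then show ?thesis
  proof (rule generate_subset_induct)
    show "tensor_relations R M N \<subseteq> carrier (free_Abelian_group S.pairs)"
      using S.relations_A by (simp add: S.A_def)
    fix c assume "c \<in> tensor_relations R M N"
    then have "ext c \<in> tensor_relations R' M' N'"
    proof (rule S.relations_cases)
      fix x x' y assume "c = frag_of (x \<oplus>\<^bsub>M\<^esub> x', y) - frag_of (x, y) - frag_of (x', y)"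
        "x \<in> carrier M" "x' \<in> carrier M" "y \<in> carrier N"
      then show ?thesis
        by (simp add: ext_diff u_add T.rel_add1 u_closed v_closed)
    next
      fix x y y' assume "c = frag_of (x, y \<oplus>\<^bsub>N\<^esub> y') - frag_of (x, y) - frag_of (x, y')"
        "x \<in> carrier M" "y \<in> carrier N" "y' \<in> carrier N"
      then show ?thesis
        by (simp add: ext_diff v_add T.rel_add2 u_closed v_closed)
    next
      fix a x y assume "c = frag_of (a \<odot>\<^bsub>M\<^esub> x, y) - frag_of (x, a \<odot>\<^bsub>N\<^esub> y)"
        "a \<in> carrier R" "x \<in> carrier M" "y \<in> carrier N"
      then show ?thesis
        by (simp add: ext_diff u_smult v_smult T.rel_smult u_closed v_closed \<rho>_closed)
    qed
    then show "ext c \<in> T.K"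
      by (rule T.K_rel)
  qed (simp_all add: ext_zero ext_add ext_uminus T.K_zero T.K_add T.K_uminus)
qed

text \<open>The operations on tensors are unions over all representatives of a class; as relations go to
  relations, they can be computed on one representative.\<close>

lemma UN_ext: "(\<Union>d\<in>S.cls c. T.cls (frag_extend (\<lambda>(x, y). frag_of (u x, v y)) d)) = T.cls (ext c)"
proof -
  have "T.cls (ext d) = T.cls (ext c)" if "d \<in> S.cls c" for d
    using that ext_K[of "d - c"] by (intro T.cls_eqI) (simp add: S.mem_cls ext_diff)
  then have "(\<Union>d\<in>S.cls c. T.cls (ext d)) = (\<Union>d\<in>S.cls c. T.cls (ext c))"
    by (rule SUP_cong[OF refl])
  with S.cls_self[of c] show ?thesis
    by (auto simp: ext_def)
qed

end

context tensor_factors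
begin

lemma smult_map: "a \<in> carrier R \<Longrightarrow> tensor_map R M N R M N (\<lambda>b. b) (\<lambda>x. a \<odot>\<^bsub>M\<^esub> x) (\<lambda>y. y)"
proof unfold_locales
  fix b x assume "a \<in> carrier R" "b \<in> carrier R" "x \<in> carrier M"
  then show "a \<odot>\<^bsub>M\<^esub> (b \<odot>\<^bsub>M\<^esub> x) = b \<odot>\<^bsub>M\<^esub> (a \<odot>\<^bsub>M\<^esub> x)"
    by (simp add: smult_assoc1[symmetric] R.m_comm)
qed (auto simp: smult_r_distr)

lemma tensor_smult:
  assumes "a \<in> carrier R"
  shows "a \<odot>\<^bsub>tensor_module R M N\<^esub> cls c = cls (frag_extend (\<lambda>(x, y). frag_of (a \<odot>\<^bsub>M\<^esub> x, y)) c)"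
proof -
  interpret tensor_map R M N R M N "\<lambda>b. b" "\<lambda>x. a \<odot>\<^bsub>M\<^esub> x" "\<lambda>y. y"
    by (rule smult_map[OF assms])
  show ?thesis
    using UN_ext[of c] by (simp add: tensor_module_def Let_def ext_def)
qed

lemma cls_add1:
  assumes "x \<in> carrier M" "x' \<in> carrier M" "y \<in> carrier N"
  shows "cls (frag_of (x \<oplus>\<^bsub>M\<^esub> x', y)) = cls (frag_of (x, y)) \<oplus>\<^bsub>tensor_module R M N\<^esub> cls (frag_of (x', y))"
  using assms K_rel[OF rel_add1[OF assms]] frag_of_A
  by (subst tensor_add) (auto intro!: cls_eqI simp: diff_diff_eq)

lemma cls_smult:
  assumes "a \<in> carrier R"
  shows "cls (frag_of (a \<odot>\<^bsub>M\<^esub> x, y)) = a \<odot>\<^bsub>tensor_module R M N\<^esub> cls (frag_of (x, y))"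
  by (simp add: tensor_smult[OF assms])

lemma cls_balanced:
  assumes "a \<in> carrier R" "x \<in> carrier M" "y \<in> carrier N"
  shows "cls (frag_of (a \<odot>\<^bsub>M\<^esub> x, y)) = cls (frag_of (x, a \<odot>\<^bsub>N\<^esub> y))"
  by (rule cls_eqI[OF K_rel[OF rel_smult[OF assms]]])

text \<open>The relations move the coordinate \<open>\<kappa>(y)\<close> of \<open>y\<close> to the left factor, so every tensor is some
  \<open>x \<otimes> y\<^sub>0\<close>.  The element \<open>x\<close> is unique because \<open>x \<otimes> y \<mapsto> \<kappa>(y) x\<close> is a well-defined
  homomorphism to \<open>M\<close>, by the universal property of the free abelian group.\<close>

lemma tensor_free_factor:
  assumes y0: "y0 \<in> carrier N"
    and \<kappa>: "\<And>y. y \<in> carrier N \<Longrightarrow> \<kappa> y \<in> carrier R" "\<And>y. y \<in> carrier N \<Longrightarrow> \<kappa> y \<odot>\<^bsub>N\<^esub> y0 = y" "\<kappa> y0 = \<one>\<^bsub>R\<^esub>"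
    and \<kappa>_add: "\<And>y y'. y \<in> carrier N \<Longrightarrow> y' \<in> carrier N \<Longrightarrow> \<kappa> (y \<oplus>\<^bsub>N\<^esub> y') = \<kappa> y \<oplus>\<^bsub>R\<^esub> \<kappa> y'"
    and \<kappa>_smult: "\<And>a y. a \<in> carrier R \<Longrightarrow> y \<in> carrier N \<Longrightarrow> \<kappa> (a \<odot>\<^bsub>N\<^esub> y) = a \<otimes>\<^bsub>R\<^esub> \<kappa> y"
  shows "bij_betw (\<lambda>x. cls (frag_of (x, y0))) (carrier M) (carrier (tensor_module R M N))"
proof (rule bij_betw_imageI)
  have "comm_group (add_monoid M)"
    by (rule M.a_comm_group)
  moreover have "(\<lambda>(x, y). \<kappa> y \<odot>\<^bsub>M\<^esub> x) ` pairs \<subseteq> carrier (add_monoid M)"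
    using \<kappa> by (auto simp: pairs_def)
  ultimately have "\<exists>h\<in>hom A (add_monoid M). \<forall>z\<in>pairs. h (frag_of z) = (\<lambda>(x, y). \<kappa> y \<odot>\<^bsub>M\<^esub> x) z"
    unfolding A_def
  proof (rule comm_group.free_Abelian_group_universal)
    fix h assume "h \<in> hom (free_Abelian_group pairs) (add_monoid M)"
      "\<And>z. z \<in> pairs \<Longrightarrow> h (frag_of z) = (\<lambda>(x, y). \<kappa> y \<odot>\<^bsub>M\<^esub> x) z"
    then show "\<exists>h\<in>hom (free_Abelian_group pairs) (add_monoid M). \<forall>z\<in>pairs. h (frag_of z) = (\<lambda>(x, y). \<kappa> y \<odot>\<^bsub>M\<^esub> x) z"
      by blast
  qed
  then obtain h where h: "h \<in> hom A (add_monoid M)"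
    and h_of: "\<forall>z\<in>pairs. h (frag_of z) = (\<lambda>(x, y). \<kappa> y \<odot>\<^bsub>M\<^esub> x) z"
    by blast
  interpret h: group_hom A "add_monoid M" h
    using A_group M.a_group h by (simp add: group_hom_def group_hom_axioms_def comm_group_def)
  have h_frag: "h (frag_of (x, y)) = \<kappa> y \<odot>\<^bsub>M\<^esub> x" if "x \<in> carrier M" "y \<in> carrier N" for x y
    using bspec[OF h_of, of "(x, y)"] that by (simp add: pairs_def)
  have h_add: "h (c + d) = h c \<oplus>\<^bsub>M\<^esub> h d" if "c \<in> carrier A" "d \<in> carrier A" for c d
    using h.hom_mult[OF that] by simp
  have h_closed: "h c \<in> carrier M" if "c \<in> carrier A" for c
    using h.hom_closed[OF that] by simp
  have h_diff: "h (c - d) = h c \<ominus>\<^bsub>M\<^esub> h d" if "c \<in> carrier A" "d \<in> carrier A" for c d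
  proof -
    have "h c = h (c - d) \<oplus>\<^bsub>M\<^esub> h d"
      using h_add[OF diff_A[OF that] that(2)] by simp
    then show ?thesis
      using h_closed[OF diff_A[OF that]] h_closed[OF that(2)]
      by (simp add: M.minus_eq M.a_assoc M.r_neg)
  qed
  have h_zero: "h 0 = \<zero>\<^bsub>M\<^esub>"
    using h.hom_one by simp
  have h_rel: "h c = \<zero>\<^bsub>M\<^esub>" if "c \<in> tensor_relations R M N" for c
    using that
  proof (rule relations_cases)
    fix x x' y assume *: "x \<in> carrier M" "x' \<in> carrier M" "y \<in> carrier N"
      and c: "c = frag_of (x \<oplus>\<^bsub>M\<^esub> x', y) - frag_of (x, y) - frag_of (x', y)"
    have A: "frag_of (x \<oplus>\<^bsub>M\<^esub> x', y) \<in> carrier A" "frag_of (x, y) \<in> carrier A" "frag_of (x', y) \<in> carrier A"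
      using * by (simp_all only: frag_of_A M.a_closed simp_thms)
    show ?thesis
      unfolding c h_diff[OF diff_A[OF A(1,2)] A(3)] h_diff[OF A(1,2)]
      using * \<kappa> by (simp add: h_frag smult_r_distr M.minus_eq M.minus_add M.a_ac M.r_neg M.r_neg1)
  next
    fix x y y' assume *: "x \<in> carrier M" "y \<in> carrier N" "y' \<in> carrier N"
      and c: "c = frag_of (x, y \<oplus>\<^bsub>N\<^esub> y') - frag_of (x, y) - frag_of (x, y')"
    have A: "frag_of (x, y \<oplus>\<^bsub>N\<^esub> y') \<in> carrier A" "frag_of (x, y) \<in> carrier A" "frag_of (x, y') \<in> carrier A"
      using * by (simp_all only: frag_of_A N_add simp_thms)
    show ?thesis
      unfolding c h_diff[OF diff_A[OF A(1,2)] A(3)] h_diff[OF A(1,2)]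
      using * \<kappa> by (simp add: h_frag N_add \<kappa>_add smult_l_distr M.minus_eq M.a_ac M.r_neg M.r_neg1)
  next
    fix a x y assume *: "a \<in> carrier R" "x \<in> carrier M" "y \<in> carrier N"
      and c: "c = frag_of (a \<odot>\<^bsub>M\<^esub> x, y) - frag_of (x, a \<odot>\<^bsub>N\<^esub> y)"
    have A: "frag_of (a \<odot>\<^bsub>M\<^esub> x, y) \<in> carrier A" "frag_of (x, a \<odot>\<^bsub>N\<^esub> y) \<in> carrier A"
      using * by (simp_all only: frag_of_A N_smult smult_closed simp_thms)
    show ?thesis
      unfolding c h_diff[OF A]
      using * \<kappa> by (simp add: h_frag N_smult \<kappa>_smult smult_assoc1[symmetric] R.m_comm M.minus_eq M.r_neg)
  qed
  have h_K: "c \<in> carrier A \<and> h c = \<zero>\<^bsub>M\<^esub>" if "c \<in> K" for c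
  proof -
    from that have "c \<in> generate (free_Abelian_group pairs) (tensor_relations R M N)"
      by (simp add: K_eq A_def)
    then show ?thesis
    proof (rule generate_subset_induct)
      show "tensor_relations R M N \<subseteq> carrier (free_Abelian_group pairs)"
        using relations_A by (simp add: A_def)
      show "c \<in> carrier A \<and> h c = \<zero>\<^bsub>M\<^esub>" if "c \<in> tensor_relations R M N" for c
        using that relations_A h_rel by blast
      show "c + d \<in> carrier A \<and> h (c + d) = \<zero>\<^bsub>M\<^esub>"
        if "c \<in> carrier A \<and> h c = \<zero>\<^bsub>M\<^esub>" "d \<in> carrier A \<and> h d = \<zero>\<^bsub>M\<^esub>" for c d
        using that add_A h_add by simp
      show "- c \<in> carrier A \<and> h (- c) = \<zero>\<^bsub>M\<^esub>" if "c \<in> carrier A \<and> h c = \<zero>\<^bsub>M\<^esub>" for c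
        using that h_diff[of 0 c] h_zero by (simp add: M.minus_eq)
    qed (simp add: h_zero)
  qed
  show "inj_on (\<lambda>x. cls (frag_of (x, y0))) (carrier M)"
  proof (rule inj_onI)
    fix x x' assume x: "x \<in> carrier M" "x' \<in> carrier M" and "cls (frag_of (x, y0)) = cls (frag_of (x', y0))"
    then have "h (frag_of (x, y0) - frag_of (x', y0)) = \<zero>\<^bsub>M\<^esub>"
      using h_K cls_eqD by blast
    moreover have "h (frag_of (x, y0) - frag_of (x', y0)) = x \<ominus>\<^bsub>M\<^esub> x'"
      using x y0 \<kappa>(3) by (subst h_diff) (simp_all only: frag_of_A h_frag smult_one simp_thms)
    ultimately have "x \<oplus>\<^bsub>M\<^esub> \<ominus>\<^bsub>M\<^esub> x' = \<zero>\<^bsub>M\<^esub>"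
      by (simp add: M.minus_eq)
    then have "(x \<oplus>\<^bsub>M\<^esub> \<ominus>\<^bsub>M\<^esub> x') \<oplus>\<^bsub>M\<^esub> x' = x'"
      using x by simp
    then show "x = x'"
      using x by (simp add: M.a_assoc M.l_neg)
  qed
  have "\<exists>x\<in>carrier M. c - frag_of (x, y0) \<in> K" if "c \<in> carrier A" for c
  proof -
    from that have "Poly_Mapping.keys c \<subseteq> pairs" by simp
    then show ?thesis
    proof (induction c rule: free_Abelian_induct)
      case zero
      have "- (frag_of (\<zero>\<^bsub>M\<^esub> \<oplus>\<^bsub>M\<^esub> \<zero>\<^bsub>M\<^esub>, y0) - frag_of (\<zero>\<^bsub>M\<^esub>, y0) - frag_of (\<zero>\<^bsub>M\<^esub>, y0)) \<in> K"
        using y0 by (intro K_uminus K_rel rel_add1) auto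
      then have "frag_of (\<zero>\<^bsub>M\<^esub>, y0) \<in> K"
        by simp
      then show ?case
        using K_uminus by (intro bexI[of _ "\<zero>\<^bsub>M\<^esub>"]) auto
    next
      case (diff c d)
      then obtain x x' where x: "x \<in> carrier M" "x' \<in> carrier M" "c - frag_of (x, y0) \<in> K" "d - frag_of (x', y0) \<in> K"
        by blast
      let ?z = "x \<ominus>\<^bsub>M\<^esub> x'"
      have z: "?z \<in> carrier M" "?z \<oplus>\<^bsub>M\<^esub> x' = x"
        using x by (simp_all add: M.minus_eq M.a_assoc M.l_neg)
      have "frag_of (x, y0) - frag_of (?z, y0) - frag_of (x', y0) \<in> K"
        using K_rel[OF rel_add1[OF z(1) x(2) y0]] unfolding z(2) .
      from K_add[OF K_diff[OF x(3,4)] this] have "(c - d) - frag_of (?z, y0) \<in> K"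
        by (simp add: algebra_simps)
      with z show ?case
        by blast
    next
      case (gen w)
      then obtain x y where w: "w = (x, y)" and xy: "x \<in> carrier M" "y \<in> carrier N"
        by (auto simp: pairs_def)
      have "- (frag_of (\<kappa> y \<odot>\<^bsub>M\<^esub> x, y0) - frag_of (x, \<kappa> y \<odot>\<^bsub>N\<^esub> y0)) \<in> K"
        using xy y0 \<kappa> by (intro K_uminus K_rel rel_smult) auto
      then have "frag_of w - frag_of (\<kappa> y \<odot>\<^bsub>M\<^esub> x, y0) \<in> K"
        using xy \<kappa>(2) w by simp
      then show ?case
        using xy \<kappa>(1) by blast
    qed
  qed
  then have "\<exists>x\<in>carrier M. cls c = cls (frag_of (x, y0))" if "c \<in> carrier A" for c
    using that cls_eqI by blast
  then show "(\<lambda>x. cls (frag_of (x, y0))) ` carrier M = carrier (tensor_module R M N)"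
    unfolding tensor_carrier using y0 frag_of_A by fast
qed

end

text \<open>Scalars act on tensors through the left factor.\<close>

locale tensor_sheaf_factors = F: module_presheaf C F + G: module_presheaf C G
  for C :: "'n::finite pt set" and F :: "('n pt, 'e) module_sheaf" and G :: "('n pt, 'f) module_sheaf" +
  assumes modF: "zopen C U \<Longrightarrow> module (struct_sheaf C U) (msec F U)"
begin

lemma factors: "zopen C U \<Longrightarrow> tensor_factors (struct_sheaf C U) (msec F U) (msec G U)"
  by (intro tensor_factors.intro tensor_factors_axioms.intro modF) (auto intro: G.add_closed G.smult_closed)

lemma restrict_map:
  assumes "zopen C U" "zopen C V" "V \<subseteq> U"
  shows "tensor_map (struct_sheaf C U) (msec F U) (msec G U) (struct_sheaf C V) (msec F V) (msec G V)
    (\<lambda>f. restrict f V) (mres F U V) (mres G U V)"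
  using assms
  by (intro tensor_map.intro tensor_map_axioms.intro factors)
     (simp_all add: F.res_closed G.res_closed F.res_add G.res_add F.res_smult G.res_smult regular_restrict)

definition cls where
  "cls U = tensor_class (struct_sheaf C U) (msec F U) (msec G U)"

abbreviation P where "P \<equiv> tensor_presheaf C F G"

definition rext where "rext U V = frag_extend (\<lambda>(x, y). frag_of (mres F U V x, mres G U V y))"

definition sext :: "'n pt set \<Rightarrow> _" where "sext U f = frag_extend (\<lambda>(x, y). frag_of (f \<odot>\<^bsub>msec F U\<^esub> x, y))"

lemma P_sec: "msec P U = tensor_module (struct_sheaf C U) (msec F U) (msec G U)"
  by (simp add: tensor_presheaf_def)

lemma P_res:
  assumes "zopen C U" "zopen C V" "V \<subseteq> U"
  shows "mres P U V (cls U c) = cls V (rext U V c)"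
proof -
  interpret tensor_map "struct_sheaf C U" "msec F U" "msec G U" "struct_sheaf C V" "msec F V" "msec G V"
    "\<lambda>f. restrict f V" "mres F U V" "mres G U V"
    by (rule restrict_map[OF assms])
  show ?thesis
    using UN_ext[of c] by (simp add: tensor_presheaf_def cls_def ext_def rext_def)
qed

lemma P_smult: "zopen C U \<Longrightarrow> regular C U f \<Longrightarrow> f \<odot>\<^bsub>msec P U\<^esub> cls U c = cls U (sext U f c)"
  unfolding P_sec cls_def sext_def by (rule tensor_factors.tensor_smult[OF factors]) auto

definition chains where "chains U = {c. Poly_Mapping.keys c \<subseteq> carrier (msec F U) \<times> carrier (msec G U)}"

lemma chains_eq: "zopen C U \<Longrightarrow> chains U = carrier (tensor_factors.A (msec F U) (msec G U))"
  by (simp add: chains_def tensor_factors.A_def[OF factors] tensor_factors.pairs_def[OF factors] free_Abelian_group_def)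

lemma P_carrier: "zopen C U \<Longrightarrow> carrier (msec P U) = cls U ` chains U"
  unfolding P_sec cls_def chains_eq by (rule tensor_factors.tensor_carrier[OF factors])

lemma P_add: "zopen C U \<Longrightarrow> c \<in> chains U \<Longrightarrow> d \<in> chains U \<Longrightarrow>
    cls U c \<oplus>\<^bsub>msec P U\<^esub> cls U d = cls U (c + d)"
  unfolding P_sec cls_def chains_eq by (rule tensor_factors.tensor_add[OF factors])

lemma chains_add: "c \<in> chains U \<Longrightarrow> d \<in> chains U \<Longrightarrow> c + d \<in> chains U"
  using keys_add[of c d] unfolding chains_def by blast

lemma chainsE:
  assumes "c \<in> chains U" "z \<in> Poly_Mapping.keys c"
  obtains x y where "z = (x, y)" "x \<in> carrier (msec F U)" "y \<in> carrier (msec G U)"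
  using assms unfolding chains_def by blast

lemma rext_chains:
  assumes "zopen C U" "zopen C V" "V \<subseteq> U" "c \<in> chains U"
  shows "rext U V c \<in> chains V"
  unfolding chains_def mem_Collect_eq rext_def
proof (rule order_trans[OF keys_frag_extend UN_least])
  fix z assume "z \<in> Poly_Mapping.keys c"
  with assms(4) obtain x y where "z = (x, y)" "x \<in> carrier (msec F U)" "y \<in> carrier (msec G U)"
    by (rule chainsE)
  with assms(1-3) show "Poly_Mapping.keys (case z of (x, y) \<Rightarrow> frag_of (mres F U V x, mres G U V y))
      \<subseteq> carrier (msec F V) \<times> carrier (msec G V)"
    by (simp add: F.res_closed G.res_closed)
qed

lemma sext_chains:
  assumes "zopen C U" "regular C U f" "c \<in> chains U"
  shows "sext U f c \<in> chains U"
  unfolding chains_def mem_Collect_eq sext_def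
proof (rule order_trans[OF keys_frag_extend UN_least])
  fix z assume "z \<in> Poly_Mapping.keys c"
  with assms(3) obtain x y where "z = (x, y)" "x \<in> carrier (msec F U)" "y \<in> carrier (msec G U)"
    by (rule chainsE)
  with assms(1,2) show "Poly_Mapping.keys (case z of (x, y) \<Rightarrow> frag_of (f \<odot>\<^bsub>msec F U\<^esub> x, y))
      \<subseteq> carrier (msec F U) \<times> carrier (msec G U)"
    by (simp add: F.smult_closed)
qed

lemma rext_add: "rext U V (c + d) = rext U V c + rext U V d"
  by (simp add: rext_def frag_extend_add)

lemma frag_extend_rext:
  "frag_extend f (rext U V c) = frag_extend (f \<circ> (\<lambda>(x, y). (mres F U V x, mres G U V y))) c"
proof -
  have "rext U V c = frag_extend (frag_of \<circ> (\<lambda>(x, y). (mres F U V x, mres G U V y))) c"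
    by (simp add: rext_def comp_def case_prod_unfold)
  then show ?thesis
    by (simp only: frag_extend_compose)
qed

lemma frag_extend_sext:
  "frag_extend f (sext U a c) = frag_extend (f \<circ> (\<lambda>(x, y). (a \<odot>\<^bsub>msec F U\<^esub> x, y))) c"
proof -
  have "sext U a c = frag_extend (frag_of \<circ> (\<lambda>(x, y). (a \<odot>\<^bsub>msec F U\<^esub> x, y))) c"
    by (simp add: sext_def comp_def case_prod_unfold)
  then show ?thesis
    by (simp only: frag_extend_compose)
qed

lemma rext_rext:
  assumes "zopen C U" "zopen C V" "zopen C W" "W \<subseteq> V" "V \<subseteq> U" "c \<in> chains U"
  shows "rext V W (rext U V c) = rext U W c"
proof -
  have "rext V W (rext U V c) = frag_extend ((\<lambda>(x, y). frag_of (mres F V W x, mres G V W y)) \<circ> (\<lambda>(x, y). (mres F U V x, mres G U V y))) c"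
    unfolding rext_def[of V W] by (rule frag_extend_rext)
  also have "\<dots> = rext U W c"
    unfolding rext_def
  proof (rule frag_extend_eq)
    fix z assume "z \<in> Poly_Mapping.keys c"
    with assms(6) obtain x y where "z = (x, y)" "x \<in> carrier (msec F U)" "y \<in> carrier (msec G U)"
      by (rule chainsE)
    with assms(1-5) show "((\<lambda>(x, y). frag_of (mres F V W x, mres G V W y)) \<circ> (\<lambda>(x, y). (mres F U V x, mres G U V y))) z
        = (case z of (x, y) \<Rightarrow> frag_of (mres F U W x, mres G U W y))"
      by (simp add: F.res_res G.res_res)
  qed
  finally show ?thesis .
qed

lemma rext_sext:
  assumes "zopen C U" "zopen C V" "V \<subseteq> U" "regular C U f" "c \<in> chains U"
  shows "rext U V (sext U f c) = sext V (restrict f V) (rext U V c)"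
proof -
  have "rext U V (sext U f c) = frag_extend ((\<lambda>(x, y). frag_of (mres F U V x, mres G U V y)) \<circ> (\<lambda>(x, y). (f \<odot>\<^bsub>msec F U\<^esub> x, y))) c"
    unfolding rext_def by (rule frag_extend_sext)
  also have "\<dots> = frag_extend ((\<lambda>(x, y). frag_of (restrict f V \<odot>\<^bsub>msec F V\<^esub> x, y)) \<circ> (\<lambda>(x, y). (mres F U V x, mres G U V y))) c"
  proof (rule frag_extend_eq)
    fix z assume "z \<in> Poly_Mapping.keys c"
    with assms(5) obtain x y where "z = (x, y)" "x \<in> carrier (msec F U)" "y \<in> carrier (msec G U)"
      by (rule chainsE)
    with assms(1-4) show "((\<lambda>(x, y). frag_of (mres F U V x, mres G U V y)) \<circ> (\<lambda>(x, y). (f \<odot>\<^bsub>msec F U\<^esub> x, y))) z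
        = ((\<lambda>(x, y). frag_of (restrict f V \<odot>\<^bsub>msec F V\<^esub> x, y)) \<circ> (\<lambda>(x, y). (mres F U V x, mres G U V y))) z"
      by (simp add: F.res_smult)
  qed
  also have "\<dots> = sext V (restrict f V) (rext U V c)"
    unfolding sext_def by (rule frag_extend_rext[symmetric])
  finally show ?thesis .
qed

lemma tensor_module_presheaf: "module_presheaf C P"
proof
  fix U x y assume "zopen C U" "x \<in> carrier (msec P U)" "y \<in> carrier (msec P U)"
  then show "x \<oplus>\<^bsub>msec P U\<^esub> y \<in> carrier (msec P U)"
    by (auto simp: P_carrier P_add chains_add)
next
  fix U f x assume "zopen C U" "regular C U f" "x \<in> carrier (msec P U)"
  then show "f \<odot>\<^bsub>msec P U\<^esub> x \<in> carrier (msec P U)"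
    by (auto simp: P_carrier P_smult sext_chains)
next
  fix U V x assume "zopen C U" "zopen C V" "V \<subseteq> U" "x \<in> carrier (msec P U)"
  then show "mres P U V x \<in> carrier (msec P V)"
    by (auto simp: P_carrier P_res rext_chains)
next
  fix U V W x assume "zopen C U" "zopen C V" "zopen C W" "W \<subseteq> V" "V \<subseteq> U" "x \<in> carrier (msec P U)"
  then show "mres P V W (mres P U V x) = mres P U W x"
    by (auto simp: P_carrier P_res rext_chains rext_rext)
next
  fix U V x y assume "zopen C U" "zopen C V" "V \<subseteq> U" "x \<in> carrier (msec P U)" "y \<in> carrier (msec P U)"
  then show "mres P U V (x \<oplus>\<^bsub>msec P U\<^esub> y) = mres P U V x \<oplus>\<^bsub>msec P V\<^esub> mres P U V y"
    by (auto simp: P_carrier P_res P_add chains_add rext_chains rext_add)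
next
  fix U V f x assume "zopen C U" "zopen C V" "V \<subseteq> U" "regular C U f" "x \<in> carrier (msec P U)"
  then show "mres P U V (f \<odot>\<^bsub>msec P U\<^esub> x) = restrict f V \<odot>\<^bsub>msec P V\<^esub> mres P U V x"
    by (auto simp: P_carrier P_res P_smult regular_restrict[of C U] rext_chains rext_sext)
qed

definition pure where "pure U x y = cls U (frag_of (x, y))"

lemma pure_add:
  "\<lbrakk>zopen C U; x \<in> carrier (msec F U); x' \<in> carrier (msec F U); y \<in> carrier (msec G U)\<rbrakk>
    \<Longrightarrow> pure U (x \<oplus>\<^bsub>msec F U\<^esub> x') y = pure U x y \<oplus>\<^bsub>msec P U\<^esub> pure U x' y"
  unfolding pure_def cls_def P_sec by (rule tensor_factors.cls_add1[OF factors])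

lemma pure_smult:
  "\<lbrakk>zopen C U; regular C U f\<rbrakk> \<Longrightarrow> pure U (f \<odot>\<^bsub>msec F U\<^esub> x) y = f \<odot>\<^bsub>msec P U\<^esub> pure U x y"
  unfolding pure_def cls_def P_sec by (rule tensor_factors.cls_smult[OF factors]) simp_all

lemma pure_balanced:
  "\<lbrakk>zopen C U; regular C U f; x \<in> carrier (msec F U); y \<in> carrier (msec G U)\<rbrakk>
    \<Longrightarrow> pure U (f \<odot>\<^bsub>msec F U\<^esub> x) y = pure U x (f \<odot>\<^bsub>msec G U\<^esub> y)"
  unfolding pure_def cls_def by (rule tensor_factors.cls_balanced[OF factors]) simp_all

lemma pure_res:
  "\<lbrakk>zopen C U; zopen C V; V \<subseteq> U\<rbrakk> \<Longrightarrow> mres P U V (pure U x y) = pure V (mres F U V x) (mres G U V y)"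
  unfolding pure_def by (simp add: P_res rext_def)

lemma pure_bij:
  assumes "zopen C U" "y0 \<in> carrier (msec G U)"
    and "\<And>y. y \<in> carrier (msec G U) \<Longrightarrow> regular C U (\<kappa> y)" "\<And>y. y \<in> carrier (msec G U) \<Longrightarrow> \<kappa> y \<odot>\<^bsub>msec G U\<^esub> y0 = y"
      "\<kappa> y0 = (\<lambda>p\<in>U. 1)"
    and "\<And>y y'. y \<in> carrier (msec G U) \<Longrightarrow> y' \<in> carrier (msec G U) \<Longrightarrow> \<kappa> (y \<oplus>\<^bsub>msec G U\<^esub> y') = (\<lambda>p\<in>U. \<kappa> y p + \<kappa> y' p)"
    and "\<And>a y. regular C U a \<Longrightarrow> y \<in> carrier (msec G U) \<Longrightarrow> \<kappa> (a \<odot>\<^bsub>msec G U\<^esub> y) = (\<lambda>p\<in>U. a p * \<kappa> y p)"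
  shows "bij_betw (\<lambda>x. pure U x y0) (carrier (msec F U)) (carrier (msec P U))"
  unfolding pure_def cls_def P_sec
  by (rule tensor_factors.tensor_free_factor[OF factors, where \<kappa> = \<kappa>]) (simp_all add: assms)

end

section \<open>The tangent sheaf and the structure sheaf\<close>

lemma structure_module_simps [simp]:
  "f \<in> carrier (msec (structure_module C) U) \<longleftrightarrow> regular C U f"
  "f \<oplus>\<^bsub>msec (structure_module C) U\<^esub> g = (\<lambda>p\<in>U. f p + g p)"
  "a \<odot>\<^bsub>msec (structure_module C) U\<^esub> f = (\<lambda>p\<in>U. a p * f p)"
  "\<zero>\<^bsub>msec (structure_module C) U\<^esub> = (\<lambda>p\<in>U. 0)"
  "mres (structure_module C) U V f = restrict f V"
  by (simp_all add: structure_module_def)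

lemma structure_module_sheaf: "sheaf_of_modules C (structure_module C)"
proof (unfold_locales, goal_cases)
  case (7 U x y)
  show ?case
  proof (rule regular_ext[of C U])
    fix p assume "p \<in> U"
    then obtain V where V: "p \<in> V" "restrict x V = restrict y V"
      using 7(4)[of p] unfolding structure_module_simps by blast
    from fun_cong[OF V(2), of p] V(1) show "x p = y p"
      by simp
  qed (use 7 in auto)
next
  case (8 U V s)
  let ?f = "\<lambda>p\<in>U. s p p"
  have *: "s q q = s p q" if "p \<in> U" "q \<in> V p" for p q
  proof -
    have q: "q \<in> U" "q \<in> V q" using 8(2) that by blast+
    have "restrict (s p) (V p \<inter> V q) = restrict (s q) (V p \<inter> V q)"
      using 8(3)[OF that(1) q(1)] by simp
    from fun_cong[OF this, of q] that q show ?thesis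
      by simp
  qed
  have res: "restrict ?f (V p) = s p" if "p \<in> U" for p
  proof (rule extensionalityI[of _ "V p"])
    show "s p \<in> extensional (V p)"
      using 8(2)[OF that] by (auto intro: regular_extensional)
    fix q assume "q \<in> V p"
    moreover have "V p \<subseteq> U" using 8(2)[OF that] by simp
    ultimately show "restrict ?f (V p) q = s p q"
      using *[OF that] by auto
  qed auto
  have "regular C U ?f"
  proof (rule regular_local)
    fix p assume p: "p \<in> U"
    with 8(2)[OF p] res[OF p] show "\<exists>W. zopen C W \<and> W \<subseteq> U \<and> p \<in> W \<and> regular C W (restrict ?f W)"
      by (intro exI[of _ "V p"]) simp
  qed auto
  with res show ?case
    by (intro bexI[of _ ?f] ballI) (simp_all only: structure_module_simps)
next
  case (4 U V W x)
  then show ?case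
    by (simp add: Int_absorb1)
next
  case (5 U V x y)
  then show ?case
    unfolding structure_module_simps by (auto simp: fun_eq_iff)
next
  case (6 U V f x)
  then show ?case
    unfolding structure_module_simps by (auto simp: fun_eq_iff)
qed (simp_all add: regular_add regular_mult regular_restrict)

text \<open>Vector fields are determined by their values \<open>D V f p\<close> on open sets \<open>V\<close>, functions \<open>f\<close> on \<open>V\<close>
  and points \<open>p\<close> of \<open>V\<close>; \<open>vfield\<close> normalises the other values.\<close>

definition vfield :: "'n::finite pt set \<Rightarrow> 'n pt set \<Rightarrow> ('n pt set \<Rightarrow> ('n pt \<Rightarrow> complex) \<Rightarrow> 'n pt \<Rightarrow> complex) \<Rightarrow> 'n vfield"
  where "vfield C U \<phi> = (\<lambda>V\<in>opens C U. \<lambda>f\<in>carrier (struct_sheaf C V). \<lambda>p\<in>V. \<phi> V f p)"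

abbreviation tangent_sections :: "'n::finite pt set \<Rightarrow> 'n pt set \<Rightarrow> 'n vfield set"
  where "tangent_sections C U \<equiv> carrier (msec (tangent_sheaf C) U)"

lemma vfield_apply [simp]:
  "\<lbrakk>zopen C V; V \<subseteq> U; regular C V f; p \<in> V\<rbrakk> \<Longrightarrow> vfield C U \<phi> V f p = \<phi> V f p"
  by (simp add: vfield_def)

lemma tangent_ops:
  "D \<oplus>\<^bsub>msec (tangent_sheaf C) U\<^esub> D' = vfield C U (\<lambda>V f p. D V f p + D' V f p)"
  "a \<odot>\<^bsub>msec (tangent_sheaf C) U\<^esub> D = vfield C U (\<lambda>V f p. a p * D V f p)"
  "\<zero>\<^bsub>msec (tangent_sheaf C) U\<^esub> = vfield C U (\<lambda>V f p. 0)"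
  "mres (tangent_sheaf C) U V D = restrict D (opens C V)"
  by (simp_all add: tangent_sheaf_def vfield_def)

lemma tangent_carrier:
  "D \<in> tangent_sections C U \<longleftrightarrow> D \<in> (\<Pi>\<^sub>E V\<in>opens C U. derivations C V) \<and>
    (\<forall>V W f. zopen C V \<longrightarrow> V \<subseteq> U \<longrightarrow> zopen C W \<longrightarrow> W \<subseteq> V \<longrightarrow> regular C V f \<longrightarrow>
      restrict (D V f) W = D W (restrict f W))"
  by (auto simp: tangent_sheaf_def)

lemma tangentD:
  assumes "D \<in> tangent_sections C U" "zopen C V" "V \<subseteq> U"
  shows "regular C V f \<Longrightarrow> regular C V (D V f)"
    and "D V (\<lambda>p\<in>V. c) = (\<lambda>p\<in>V. 0)"
    and "regular C V f \<Longrightarrow> regular C V g \<Longrightarrow> D V (\<lambda>p\<in>V. f p + g p) = (\<lambda>p\<in>V. D V f p + D V g p)"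
    and "regular C V f \<Longrightarrow> regular C V g \<Longrightarrow> D V (\<lambda>p\<in>V. f p * g p) = (\<lambda>p\<in>V. f p * D V g p + g p * D V f p)"
    and "D V \<in> extensional (carrier (struct_sheaf C V))"
proof -
  have D: "D V \<in> derivations C V"
    using assms by (auto simp: tangent_carrier)
  then show "D V \<in> extensional (carrier (struct_sheaf C V))"
    unfolding derivations_def by (simp add: PiE_def)
  show "regular C V f \<Longrightarrow> regular C V (D V f)"
    using D unfolding derivations_def by auto
  show "D V (\<lambda>p\<in>V. c) = (\<lambda>p\<in>V. 0)"
    using D unfolding derivations_def by simp
  show "regular C V f \<Longrightarrow> regular C V g \<Longrightarrow> D V (\<lambda>p\<in>V. f p + g p) = (\<lambda>p\<in>V. D V f p + D V g p)"
    using D unfolding derivations_def by simp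
  show "regular C V f \<Longrightarrow> regular C V g \<Longrightarrow> D V (\<lambda>p\<in>V. f p * g p) = (\<lambda>p\<in>V. f p * D V g p + g p * D V f p)"
    using D unfolding derivations_def by (simp cong: restrict_cong)
qed

lemma tangent_extensional: "D \<in> tangent_sections C U \<Longrightarrow> D \<in> extensional (opens C U)"
  by (auto simp: tangent_carrier PiE_def)

lemma tangent_restrict:
  assumes "D \<in> tangent_sections C U" "zopen C V" "V \<subseteq> U" "zopen C W" "W \<subseteq> V" "regular C V f" "p \<in> W"
  shows "D W (restrict f W) p = D V f p"
proof -
  have "restrict (D V f) W = D W (restrict f W)"
    using assms unfolding tangent_carrier by blast
  from fun_cong[OF this, of p] assms(7) show ?thesis
    by simp
qed

lemma vfield_tangentI:
  assumes reg: "\<And>V f. zopen C V \<Longrightarrow> V \<subseteq> U \<Longrightarrow> regular C V f \<Longrightarrow> regular C V (\<lambda>p\<in>V. \<phi> V f p)"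
    and const: "\<And>V c p. zopen C V \<Longrightarrow> V \<subseteq> U \<Longrightarrow> p \<in> V \<Longrightarrow> \<phi> V (\<lambda>p\<in>V. c) p = 0"
    and add: "\<And>V f g p. zopen C V \<Longrightarrow> V \<subseteq> U \<Longrightarrow> regular C V f \<Longrightarrow> regular C V g \<Longrightarrow> p \<in> V \<Longrightarrow>
      \<phi> V (\<lambda>p\<in>V. f p + g p) p = \<phi> V f p + \<phi> V g p"
    and mult: "\<And>V f g p. zopen C V \<Longrightarrow> V \<subseteq> U \<Longrightarrow> regular C V f \<Longrightarrow> regular C V g \<Longrightarrow> p \<in> V \<Longrightarrow>
      \<phi> V (\<lambda>p\<in>V. f p * g p) p = f p * \<phi> V g p + g p * \<phi> V f p"
    and res: "\<And>V W f p. zopen C V \<Longrightarrow> V \<subseteq> U \<Longrightarrow> zopen C W \<Longrightarrow> W \<subseteq> V \<Longrightarrow> regular C V f \<Longrightarrow> p \<in> W \<Longrightarrow>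
      \<phi> W (restrict f W) p = \<phi> V f p"
  shows "vfield C U \<phi> \<in> tangent_sections C U"
proof -
  have eq: "vfield C U \<phi> V f = (\<lambda>p\<in>V. \<phi> V f p)" if "zopen C V" "V \<subseteq> U" "regular C V f" for V f
    using that by (simp add: vfield_def)
  have "vfield C U \<phi> V \<in> derivations C V" if V: "zopen C V" "V \<subseteq> U" for V
    unfolding derivations_def mem_Collect_eq
  proof (intro conjI allI ballI)
    show "vfield C U \<phi> V \<in> carrier (struct_sheaf C V) \<rightarrow>\<^sub>E carrier (struct_sheaf C V)"
      using V reg by (auto simp: vfield_def)
    fix c show "vfield C U \<phi> V (\<lambda>p\<in>V. c) = (\<lambda>p\<in>V. 0)"
      unfolding eq[OF V regular_const[OF V(1)]] using const[OF V] by (intro restrict_ext)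
  next
    fix f g assume fg: "f \<in> carrier (struct_sheaf C V)" "g \<in> carrier (struct_sheaf C V)"
    then have r: "regular C V (\<lambda>p\<in>V. f p + g p)" "regular C V (\<lambda>p\<in>V. f p * g p)" "regular C V f" "regular C V g"
      by (auto intro: regular_add regular_mult)
    show "vfield C U \<phi> V (f \<oplus>\<^bsub>struct_sheaf C V\<^esub> g) =
        vfield C U \<phi> V f \<oplus>\<^bsub>struct_sheaf C V\<^esub> vfield C U \<phi> V g"
      unfolding struct_sheaf_simps using r add[OF V] by (auto simp: eq[OF V] intro!: restrict_ext)
    show "vfield C U \<phi> V (f \<otimes>\<^bsub>struct_sheaf C V\<^esub> g) =
        (f \<otimes>\<^bsub>struct_sheaf C V\<^esub> vfield C U \<phi> V g) \<oplus>\<^bsub>struct_sheaf C V\<^esub> (g \<otimes>\<^bsub>struct_sheaf C V\<^esub> vfield C U \<phi> V f)"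
      unfolding struct_sheaf_simps using r mult[OF V] by (auto simp: eq[OF V] intro!: restrict_ext)
  qed
  moreover have "restrict (vfield C U \<phi> V f) W = vfield C U \<phi> W (restrict f W)"
    if "zopen C V" "V \<subseteq> U" "zopen C W" "W \<subseteq> V" "regular C V f" for V W f
  proof -
    have "W \<subseteq> U" "regular C W (restrict f W)"
      using that by (auto intro: regular_restrict)
    then show ?thesis
      using that res[OF that] by (auto simp: eq fun_eq_iff)
  qed
  ultimately show ?thesis
    unfolding tangent_carrier by (auto simp: vfield_def)
qed

lemma tangent_eqI:
  assumes D: "D \<in> tangent_sections C U" "D' \<in> tangent_sections C U"
    and eq: "\<And>V f p. zopen C V \<Longrightarrow> V \<subseteq> U \<Longrightarrow> regular C V f \<Longrightarrow> p \<in> V \<Longrightarrow> D V f p = D' V f p"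
  shows "D = D'"
proof (rule extensionalityI[OF D[THEN tangent_extensional]])
  fix V assume "V \<in> opens C U"
  then have V: "zopen C V" "V \<subseteq> U" by auto
  show "D V = D' V"
  proof (rule extensionalityI[OF tangentD(5)[OF D(1) V] tangentD(5)[OF D(2) V]])
    fix f assume "f \<in> carrier (struct_sheaf C V)"
    then have f: "regular C V f" by simp
    show "D V f = D' V f"
      by (rule regular_ext[OF tangentD(1)[OF D(1) V f] tangentD(1)[OF D(2) V f]]) (rule eq[OF V f])
  qed
qed

lemma tangent_lincomb:
  assumes U: "zopen C U" and D: "D \<in> tangent_sections C U" "D' \<in> tangent_sections C U"
    and a: "regular C U a" "regular C U b"
  shows "vfield C U (\<lambda>V f p. a p * D V f p + b p * D' V f p) \<in> tangent_sections C U"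
proof (rule vfield_tangentI)
  fix V f assume V: "zopen C V" "V \<subseteq> U" and f: "regular C V f"
  have "regular C V (\<lambda>p\<in>V. restrict a V p * D V f p)" "regular C V (\<lambda>p\<in>V. restrict b V p * D' V f p)"
    by (intro regular_mult regular_restrict[OF a(1) V] regular_restrict[OF a(2) V]
        tangentD(1)[OF D(1) V f] tangentD(1)[OF D(2) V f])+
  from regular_add[OF this] show "regular C V (\<lambda>p\<in>V. a p * D V f p + b p * D' V f p)"
    by (rule regular_cong) auto
qed (simp_all add: tangentD[OF D(1)] tangentD[OF D(2)] tangent_restrict[OF D(1)] tangent_restrict[OF D(2)] algebra_simps)

lemma tangent_res_apply: "zopen C W \<Longrightarrow> W \<subseteq> V \<Longrightarrow> mres (tangent_sheaf C) U V D W = D W"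
  by (simp add: tangent_ops)

lemma tangent_res_closed:
  assumes "zopen C V" "V \<subseteq> U" "D \<in> tangent_sections C U"
  shows "mres (tangent_sheaf C) U V D \<in> tangent_sections C V"
  using assms unfolding tangent_carrier tangent_ops
  by (auto simp: PiE_def Pi_def extensional_def)

lemma tangent_add_closed:
  assumes "zopen C U" "D \<in> tangent_sections C U" "D' \<in> tangent_sections C U"
  shows "D \<oplus>\<^bsub>msec (tangent_sheaf C) U\<^esub> D' \<in> tangent_sections C U"
proof -
  have "vfield C U (\<lambda>V f p. (\<lambda>p\<in>U. 1) p * D V f p + (\<lambda>p\<in>U. 1) p * D' V f p) = vfield C U (\<lambda>V f p. D V f p + D' V f p)"
    unfolding vfield_def by (auto intro!: restrict_ext)
  with tangent_lincomb[OF assms regular_const[OF assms(1), of 1] regular_const[OF assms(1), of 1]] show ?thesis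
    by (simp only: tangent_ops)
qed

lemma tangent_smult_closed:
  assumes "zopen C U" "regular C U a" "D \<in> tangent_sections C U"
  shows "a \<odot>\<^bsub>msec (tangent_sheaf C) U\<^esub> D \<in> tangent_sections C U"
proof -
  have "vfield C U (\<lambda>V f p. a p * D V f p + (\<lambda>p\<in>U. 0) p * D V f p) = vfield C U (\<lambda>V f p. a p * D V f p)"
    unfolding vfield_def by (auto intro!: restrict_ext)
  with tangent_lincomb[OF assms(1,3,3,2) regular_const[OF assms(1), of 0]] show ?thesis
    by (simp only: tangent_ops)
qed

text \<open>At a point \<open>x\<close> the glued field acts as the given field around \<open>x\<close>, on the restriction of the
  function to the neighbourhood of \<open>x\<close>.  All properties of a vector field can be tested pointwise,
  except regularity, which is local.\<close>

lemma tangent_sheaf_gluing: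
  assumes U: "zopen C U"
    and V: "\<And>p. p \<in> U \<Longrightarrow> zopen C (V p) \<and> V p \<subseteq> U \<and> p \<in> V p \<and> s p \<in> tangent_sections C (V p)"
    and compat: "\<And>p q. p \<in> U \<Longrightarrow> q \<in> U \<Longrightarrow>
      mres (tangent_sheaf C) (V p) (V p \<inter> V q) (s p) = mres (tangent_sheaf C) (V q) (V p \<inter> V q) (s q)"
  shows "\<exists>D\<in>tangent_sections C U. \<forall>p\<in>U. mres (tangent_sheaf C) U (V p) D = s p"
proof -
  let ?\<phi> = "\<lambda>W f x. s x (W \<inter> V x) (restrict f (W \<inter> V x)) x"
  define D where "D = vfield C U ?\<phi>"
  \<comment> \<open>Near \<open>q\<close> the glued field is the given one.\<close>
  have local_eq: "?\<phi> W f x = s q W' (restrict f W') x"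
    if q: "q \<in> U" and W: "zopen C W" "W \<subseteq> U" and f: "regular C W f" and W': "zopen C W'" "W' \<subseteq> W" "W' \<subseteq> V q"
      and x: "x \<in> W'" for q W W' f x
  proof -
    have xU: "x \<in> U" and xV: "x \<in> V x" using W W' V x by auto
    note Vx = V[OF xU] and Vq = V[OF q]
    let ?A = "W' \<inter> V x"
    have A: "zopen C ?A" "?A \<subseteq> W \<inter> V x" "?A \<subseteq> W'" "zopen C (W \<inter> V x)" "?A \<subseteq> V x \<inter> V q"
      using W W' Vx by auto
    have fA: "restrict (restrict f (W \<inter> V x)) ?A = restrict f ?A" "restrict (restrict f W') ?A = restrict f ?A"
      using A by (auto simp: restrict_def fun_eq_iff)
    have "?\<phi> W f x = s x ?A (restrict f ?A) x"
      using tangent_restrict[of "s x" C "V x" "W \<inter> V x" ?A "restrict f (W \<inter> V x)" x] Vx A xV x regular_restrict[OF f A(4)]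
      unfolding fA by auto
    also have "s x ?A = s q ?A"
      using fun_cong[OF compat[OF xU q], of ?A] A by (simp add: tangent_ops)
    also have "s q ?A (restrict f ?A) x = s q W' (restrict f W') x"
      using tangent_restrict[of "s q" C "V q" W' ?A "restrict f W'" x] Vq W' A xV x regular_restrict[OF f W'(1,2)]
      unfolding fA by auto
    finally show ?thesis .
  qed
  have 1: "?\<phi> W f x = s x W' (restrict f W') x"
    if "zopen C W" "W \<subseteq> U" "regular C W f" "W' = W \<inter> V x" "x \<in> W" for W W' f x
    using that by simp
  have Wx: "zopen C (W \<inter> V x)" "W \<inter> V x \<subseteq> V x" "x \<in> W \<inter> V x" "s x \<in> tangent_sections C (V x)" "x \<in> U" "W \<inter> V x \<subseteq> W"
    if "zopen C W" "W \<subseteq> U" "x \<in> W" for W x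
    using V that by auto
  have D: "D \<in> tangent_sections C U"
    unfolding D_def
  proof (rule vfield_tangentI)
    fix W f assume W: "zopen C W" "W \<subseteq> U" and f: "regular C W f"
    show "regular C W (\<lambda>x\<in>W. ?\<phi> W f x)"
    proof (rule regular_local)
      fix q assume q: "q \<in> W"
      note * = Wx[OF W q]
      have "regular C (W \<inter> V q) (s q (W \<inter> V q) (restrict f (W \<inter> V q)))"
        using tangentD(1)[OF *(4,1,2)] regular_restrict[OF f *(1)] by simp
      moreover have "restrict (\<lambda>x\<in>W. ?\<phi> W f x) (W \<inter> V q) = s q (W \<inter> V q) (restrict f (W \<inter> V q))"
      proof (rule extensionalityI[OF _ regular_extensional[OF calculation]])
        fix x assume x: "x \<in> W \<inter> V q"
        have "?\<phi> W f x = s q (W \<inter> V q) (restrict f (W \<inter> V q)) x"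
          using local_eq[OF *(5) W f *(1,6,2) x] .
        with x show "restrict (\<lambda>x\<in>W. ?\<phi> W f x) (W \<inter> V q) x = s q (W \<inter> V q) (restrict f (W \<inter> V q)) x"
          by simp
      qed simp
      ultimately show "\<exists>Y. zopen C Y \<and> Y \<subseteq> W \<and> q \<in> Y \<and> regular C Y (restrict (\<lambda>x\<in>W. ?\<phi> W f x) Y)"
        using * by (intro exI[of _ "W \<inter> V q"]) simp
    qed simp
  next
    fix W x and c :: complex assume W: "zopen C W" "W \<subseteq> U" "x \<in> W"
    note * = Wx[OF W]
    have "restrict (\<lambda>p\<in>W. c) (W \<inter> V x) = (\<lambda>p\<in>W \<inter> V x. c)"
      by auto
    with tangentD(2)[OF *(4,1,2)] * show "?\<phi> W (\<lambda>p\<in>W. c) x = 0"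
      by simp
  next
    fix W f g x assume W: "zopen C W" "W \<subseteq> U" "x \<in> W" and fg: "regular C W f" "regular C W g"
    note * = Wx[OF W]
    note r = regular_restrict[OF fg(1) *(1,6)] regular_restrict[OF fg(2) *(1,6)]
    have "restrict (\<lambda>p\<in>W. f p + g p) (W \<inter> V x) = (\<lambda>p\<in>W \<inter> V x. restrict f (W \<inter> V x) p + restrict g (W \<inter> V x) p)"
      by auto
    with tangentD(3)[OF *(4,1,2) r] * show "?\<phi> W (\<lambda>p\<in>W. f p + g p) x = ?\<phi> W f x + ?\<phi> W g x"
      by simp
    have "restrict (\<lambda>p\<in>W. f p * g p) (W \<inter> V x) = (\<lambda>p\<in>W \<inter> V x. restrict f (W \<inter> V x) p * restrict g (W \<inter> V x) p)"
      by auto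
    with tangentD(4)[OF *(4,1,2) r] * show "?\<phi> W (\<lambda>p\<in>W. f p * g p) x = f x * ?\<phi> W g x + g x * ?\<phi> W f x"
      by simp
  next
    fix W W' f x assume W: "zopen C W" "W \<subseteq> U" "zopen C W'" "W' \<subseteq> W" and f: "regular C W f" and x: "x \<in> W'"
    have x': "x \<in> W" "W' \<subseteq> U" using W x by auto
    have eq: "restrict (restrict f W') (W' \<inter> V x) = restrict f (W' \<inter> V x)"
      by (auto simp: restrict_def fun_eq_iff)
    note * = Wx[OF W(3) x'(2) x]
    show "?\<phi> W' (restrict f W') x = ?\<phi> W f x"
      unfolding eq by (rule local_eq[OF *(5) W(1,2) f *(1) _ *(2,3), symmetric]) (use W(4) in blast)
  qed
  moreover have "mres (tangent_sheaf C) U (V p) D = s p" if p: "p \<in> U" for p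
  proof (rule tangent_eqI)
    note Vp = V[OF p]
    show "mres (tangent_sheaf C) U (V p) D \<in> tangent_sections C (V p)" "s p \<in> tangent_sections C (V p)"
      using Vp D by (auto intro: tangent_res_closed)
    fix W f x assume W: "zopen C W" "W \<subseteq> V p" and f: "regular C W f" and x: "x \<in> W"
    have WU: "W \<subseteq> U" using W Vp by auto
    have "D W f x = s p W (restrict f W) x"
      unfolding D_def vfield_apply[OF W(1) WU f x] by (rule local_eq[OF p W(1) WU f W(1) subset_refl W(2) x])
    also have "restrict f W = f"
      by (rule regular_eta[OF f])
    finally show "mres (tangent_sheaf C) U (V p) D W f x = s p W f x"
      using W by (simp add: tangent_res_apply)
  qed
  ultimately show ?thesis
    by blast
qed

lemma vfield_cong:
  "(\<And>V f p. zopen C V \<Longrightarrow> V \<subseteq> U \<Longrightarrow> regular C V f \<Longrightarrow> p \<in> V \<Longrightarrow> \<phi> V f p = \<psi> V f p) \<Longrightarrow> vfield C U \<phi> = vfield C U \<psi>"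
  unfolding vfield_def by (auto intro!: restrict_ext)

lemma restrict_vfield:
  assumes "zopen C V" "V \<subseteq> U"
    and "\<And>W f p. zopen C W \<Longrightarrow> W \<subseteq> V \<Longrightarrow> regular C W f \<Longrightarrow> p \<in> W \<Longrightarrow> \<phi> W f p = \<psi> W f p"
  shows "restrict (vfield C U \<phi>) (opens C V) = vfield C V \<psi>"
proof (rule ext)
  fix W
  show "restrict (vfield C U \<phi>) (opens C V) W = vfield C V \<psi> W"
    using assms unfolding vfield_def by (auto intro!: restrict_ext)
qed

lemma tangent_sheaf_of_modules: "sheaf_of_modules C (tangent_sheaf C)"
proof (unfold_locales, goal_cases)
  case (1 U x y) then show ?case by (rule tangent_add_closed)
next
  case (2 U f x) then show ?case by (rule tangent_smult_closed)
next
  case (3 U V x) then show ?case by (intro tangent_res_closed)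
next
  case (4 U V W x)
  then show ?case
    by (auto simp: tangent_ops restrict_def fun_eq_iff)
next
  case (5 U V x y)
  then show ?case
    unfolding tangent_ops by (intro restrict_vfield) auto
next
  case (6 U V f x)
  then show ?case
    unfolding tangent_ops by (intro restrict_vfield) auto
next
  case (7 U D D')
  show ?case
  proof (rule tangent_eqI[OF 7(2,3)])
    fix W f p assume W: "zopen C W" "W \<subseteq> U" and f: "regular C W f" and p: "p \<in> W"
    then have "p \<in> U" by blast
    then obtain V where V: "zopen C V" "V \<subseteq> U" "p \<in> V" "restrict D (opens C V) = restrict D' (opens C V)"
      using 7(4) unfolding tangent_ops by blast
    let ?A = "W \<inter> V"
    have A: "zopen C ?A" "?A \<subseteq> W" "p \<in> ?A" using W V p by auto
    have "D ?A = D' ?A"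
      using fun_cong[OF V(4), of ?A] A by simp
    then show "D W f p = D' W f p"
      using tangent_restrict[OF 7(2) W A(1,2) f A(3)] tangent_restrict[OF 7(3) W A(1,2) f A(3)] by simp
  qed
next
  case (8 U V s)
  then show ?case
    by (rule tangent_sheaf_gluing)
qed

lemma module_sheaf_sum_simps:
  "z \<in> carrier (msec (module_sheaf_sum F G) U) \<longleftrightarrow> fst z \<in> carrier (msec F U) \<and> snd z \<in> carrier (msec G U)"
  "z \<oplus>\<^bsub>msec (module_sheaf_sum F G) U\<^esub> z' = (fst z \<oplus>\<^bsub>msec F U\<^esub> fst z', snd z \<oplus>\<^bsub>msec G U\<^esub> snd z')"
  "a \<odot>\<^bsub>msec (module_sheaf_sum F G) U\<^esub> z = (a \<odot>\<^bsub>msec F U\<^esub> fst z, a \<odot>\<^bsub>msec G U\<^esub> snd z)"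
  "mres (module_sheaf_sum F G) U V z = (mres F U V (fst z), mres G U V (snd z))"
  by (auto simp: module_sheaf_sum_def case_prod_unfold mem_Times_iff)

lemma sheaf_of_modules_sum:
  assumes "sheaf_of_modules C F" "sheaf_of_modules C G"
  shows "sheaf_of_modules C (module_sheaf_sum F G)"
proof -
  interpret F: sheaf_of_modules C F by fact
  interpret G: sheaf_of_modules C G by fact
  show ?thesis
  proof (unfold_locales, goal_cases)
    case (7 U x y)
    have "fst x = fst y"
      using 7 by (intro F.separated[of U]) (auto simp: module_sheaf_sum_simps)
    moreover have "snd x = snd y"
      using 7 by (intro G.separated[of U]) (auto simp: module_sheaf_sum_simps)
    ultimately show ?case
      by (rule prod_eqI)
  next
    case (8 U V s)
    have "\<exists>x\<in>carrier (msec F U). \<forall>p\<in>U. mres F U (V p) x = fst (s p)"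
      using 8 by (intro F.gluing) (auto simp: module_sheaf_sum_simps)
    then obtain x where x: "x \<in> carrier (msec F U)" "\<And>p. p \<in> U \<Longrightarrow> mres F U (V p) x = fst (s p)"
      by blast
    have "\<exists>x\<in>carrier (msec G U). \<forall>p\<in>U. mres G U (V p) x = snd (s p)"
      using 8 by (intro G.gluing) (auto simp: module_sheaf_sum_simps)
    then obtain y where y: "y \<in> carrier (msec G U)" "\<And>p. p \<in> U \<Longrightarrow> mres G U (V p) y = snd (s p)"
      by blast
    show ?case
      using x y by (intro bexI[of _ "(x, y)"]) (auto simp: module_sheaf_sum_simps)
  qed (auto simp: module_sheaf_sum_simps F.add_closed G.add_closed F.smult_closed G.smult_closed
      F.res_closed G.res_closed F.res_res G.res_res F.res_add G.res_add F.res_smult G.res_smult)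
qed

lemma tangent_plus_structure_sheaf: "sheaf_of_modules C (tangent_plus_structure C)"
  unfolding tangent_plus_structure_def
  by (intro sheaf_of_modules_sum tangent_sheaf_of_modules structure_module_sheaf)

lemma tangent_plus_structure_simps:
  "z \<in> carrier (msec (tangent_plus_structure C) U) \<longleftrightarrow> fst z \<in> tangent_sections C U \<and> regular C U (snd z)"
  "z \<oplus>\<^bsub>msec (tangent_plus_structure C) U\<^esub> z' =
    (vfield C U (\<lambda>V f p. fst z V f p + fst z' V f p), \<lambda>p\<in>U. snd z p + snd z' p)"
  "a \<odot>\<^bsub>msec (tangent_plus_structure C) U\<^esub> z =
    (vfield C U (\<lambda>V f p. a p * fst z V f p), \<lambda>p\<in>U. a p * snd z p)"
  "mres (tangent_plus_structure C) U V z = (restrict (fst z) (opens C V), restrict (snd z) V)"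
  by (simp_all add: tangent_plus_structure_def module_sheaf_sum_simps tangent_ops)

section \<open>Automorphisms of truncated jets\<close>

lemma regular_sum:
  assumes "zopen C U" "finite A" "\<And>i. i \<in> A \<Longrightarrow> regular C U (f i)"
  shows "regular C U (\<lambda>p\<in>U. \<Sum>i\<in>A. f i p)"
  using assms(2,3)
proof (induction A rule: finite_induct)
  case empty
  then show ?case
    using regular_const[OF assms(1), of 0] by (simp only: sum.empty)
next
  case (insert a A)
  have "regular C U (\<lambda>p\<in>U. f a p + (\<lambda>p\<in>U. \<Sum>i\<in>A. f i p) p)"
    using insert by (intro regular_add) auto
  then show ?case
    by (rule regular_cong) (use insert in \<open>auto intro!: restrict_ext\<close>)
qed

lemma jets_carrier: "x \<in> carrier (jets C m U) \<longleftrightarrow> x \<in> extensional {..<m} \<and> (\<forall>k<m. regular C U (x k))"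
  by (auto simp: jets_def PiE_def Pi_def)

lemma jets_ops:
  "x \<otimes>\<^bsub>jets C m U\<^esub> y = (\<lambda>k\<in>{..<m}. \<lambda>p\<in>U. \<Sum>i\<le>k. x i p * y (k - i) p)"
  "x \<oplus>\<^bsub>jets C m U\<^esub> y = (\<lambda>k\<in>{..<m}. \<lambda>p\<in>U. x k p + y k p)"
  "\<one>\<^bsub>jets C m U\<^esub> = (\<lambda>k\<in>{..<m}. \<lambda>p\<in>U. if k = 0 then 1 else 0)"
  by (simp_all add: jets_def)

lemma jets_regular: "x \<in> carrier (jets C m U) \<Longrightarrow> k < m \<Longrightarrow> regular C U (x k)"
  by (simp add: jets_carrier)

lemma jets_eqI:
  assumes "x \<in> carrier (jets C m U)" "y \<in> carrier (jets C m U)"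
    and "\<And>k p. k < m \<Longrightarrow> p \<in> U \<Longrightarrow> x k p = y k p"
  shows "x = y"
proof (rule extensionalityI[of _ "{..<m}"])
  fix k assume "k \<in> {..<m}"
  then show "x k = y k"
    using assms by (intro regular_ext[OF jets_regular[OF assms(1)] jets_regular[OF assms(2)]]) auto
qed (use assms in \<open>auto simp: jets_carrier\<close>)

lemma jetsI:
  assumes "\<And>k. k < m \<Longrightarrow> regular C U (\<lambda>p\<in>U. f k p)"
  shows "(\<lambda>k\<in>{..<m}. \<lambda>p\<in>U. f k p) \<in> carrier (jets C m U)"
  using assms by (simp add: jets_carrier)

text \<open>The jet \<open>f t\<^sup>j\<close>.\<close>

definition jet_term :: "'n pt set \<Rightarrow> nat \<Rightarrow> nat \<Rightarrow> ('n pt \<Rightarrow> complex) \<Rightarrow> 'n jet"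
  where "jet_term U m j f = (\<lambda>k\<in>{..<m}. \<lambda>p\<in>U. if k = j then f p else 0)"

context
  fixes C :: "'n::finite pt set" and U :: "'n pt set"
  assumes U: "zopen C U"
begin

lemma jets_add_closed:
  assumes "x \<in> carrier (jets C m U)" "y \<in> carrier (jets C m U)"
  shows "x \<oplus>\<^bsub>jets C m U\<^esub> y \<in> carrier (jets C m U)"
  unfolding jets_ops by (intro jetsI regular_add jets_regular[OF assms(1)] jets_regular[OF assms(2)])

lemma jets_mult_closed:
  assumes "x \<in> carrier (jets C m U)" "y \<in> carrier (jets C m U)"
  shows "x \<otimes>\<^bsub>jets C m U\<^esub> y \<in> carrier (jets C m U)"
  unfolding jets_ops
proof (rule jetsI)
  fix k assume k: "k < m"
  have "regular C U (\<lambda>p\<in>U. \<Sum>i\<le>k. (\<lambda>p\<in>U. x i p * y (k - i) p) p)"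
    using k by (intro regular_sum[OF U] regular_mult jets_regular[OF assms(1)] jets_regular[OF assms(2)]) auto
  then show "regular C U (\<lambda>p\<in>U. \<Sum>i\<le>k. x i p * y (k - i) p)"
    by (rule regular_cong) (auto intro!: restrict_ext)
qed

lemma jet_term_closed:
  assumes "regular C U f"
  shows "jet_term U m j f \<in> carrier (jets C m U)"
  unfolding jet_term_def
proof (rule jetsI)
  fix k show "regular C U (\<lambda>p\<in>U. if k = j then f p else 0)"
    using assms regular_const[OF U, of 0] by (cases "k = j") (simp_all add: regular_eta)
qed

lemma jet_const_eq: "jet_const m U f = jet_term U m 0 f"
  by (simp add: jet_const_def jet_term_def)

lemma jet_t_eq: "jet_t m U = jet_term U m 1 (\<lambda>p\<in>U. 1)"
  unfolding jet_t_def jet_term_def by (intro restrict_ext) auto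

lemma jet_const_closed: "regular C U f \<Longrightarrow> jet_const m U f \<in> carrier (jets C m U)"
  unfolding jet_const_eq by (rule jet_term_closed)

lemma jet_t_closed: "jet_t m U \<in> carrier (jets C m U)"
  unfolding jet_t_eq by (intro jet_term_closed regular_const U)

lemma jet_t_mult:
  assumes "m \<ge> 2" "k < m" "p \<in> U"
  shows "(jet_t m U \<otimes>\<^bsub>jets C m U\<^esub> y) k p = (if k = 0 then 0 else y (k - 1) p)"
proof -
  have "(jet_t m U \<otimes>\<^bsub>jets C m U\<^esub> y) k p = (\<Sum>i\<le>k. if i = 1 then y (k - i) p else 0)"
  proof -
    have "(\<Sum>i\<le>k. jet_t m U i p * y (k - i) p) = (\<Sum>i\<le>k. if i = 1 then y (k - i) p else 0)"
      by (rule sum.cong) (use assms in \<open>auto simp: jet_t_def\<close>)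
    then show ?thesis
      using assms by (simp add: jets_ops)
  qed
  also have "\<dots> = (if k = 0 then 0 else y (k - 1) p)"
    by (subst sum.delta) auto
  finally show ?thesis .
qed

lemma jet_autsD:
  assumes "\<phi> \<in> jet_auts C m U" and x: "x \<in> carrier (jets C m U)"
  shows "\<phi> x \<in> carrier (jets C m U)"
    and "y \<in> carrier (jets C m U) \<Longrightarrow> \<phi> (x \<otimes>\<^bsub>jets C m U\<^esub> y) = \<phi> x \<otimes>\<^bsub>jets C m U\<^esub> \<phi> y"
    and "y \<in> carrier (jets C m U) \<Longrightarrow> \<phi> (x \<oplus>\<^bsub>jets C m U\<^esub> y) = \<phi> x \<oplus>\<^bsub>jets C m U\<^esub> \<phi> y"
    and "\<phi> x 0 = x 0"
  using assms unfolding jet_auts_def ring_iso_def ring_hom_def by auto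

lemma jet_autsD':
  assumes "\<phi> \<in> jet_auts C m U"
  shows "\<phi> \<in> extensional (carrier (jets C m U))"
    and "bij_betw \<phi> (carrier (jets C m U)) (carrier (jets C m U))"
    and "\<phi> \<one>\<^bsub>jets C m U\<^esub> = \<one>\<^bsub>jets C m U\<^esub>"
    and "\<phi> (jet_const m U (\<lambda>p\<in>U. c)) = jet_const m U (\<lambda>p\<in>U. c)"
  using assms unfolding jet_auts_def ring_iso_def ring_hom_def by auto

lemma jet_autsI:
  assumes "\<phi> \<in> extensional (carrier (jets C m U))" "bij_betw \<phi> (carrier (jets C m U)) (carrier (jets C m U))"
    and "\<And>x y. x \<in> carrier (jets C m U) \<Longrightarrow> y \<in> carrier (jets C m U) \<Longrightarrow> \<phi> (x \<otimes>\<^bsub>jets C m U\<^esub> y) = \<phi> x \<otimes>\<^bsub>jets C m U\<^esub> \<phi> y"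
    and "\<And>x y. x \<in> carrier (jets C m U) \<Longrightarrow> y \<in> carrier (jets C m U) \<Longrightarrow> \<phi> (x \<oplus>\<^bsub>jets C m U\<^esub> y) = \<phi> x \<oplus>\<^bsub>jets C m U\<^esub> \<phi> y"
    and "\<phi> \<one>\<^bsub>jets C m U\<^esub> = \<one>\<^bsub>jets C m U\<^esub>"
    and "\<And>c. \<phi> (jet_const m U (\<lambda>p\<in>U. c)) = jet_const m U (\<lambda>p\<in>U. c)"
    and "\<And>x. x \<in> carrier (jets C m U) \<Longrightarrow> \<phi> x 0 = x 0"
  shows "\<phi> \<in> jet_auts C m U"
  using assms unfolding jet_auts_def ring_iso_def ring_hom_def by (auto simp: bij_betw_def)

lemma jets_one_closed: "\<one>\<^bsub>jets C m U\<^esub> \<in> carrier (jets C m U)"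
proof -
  have "\<one>\<^bsub>jets C m U\<^esub> = jet_const m U (\<lambda>p\<in>U. 1)"
    unfolding jets_ops jet_const_def by (intro restrict_ext) auto
  then show ?thesis
    by (simp add: jet_const_closed regular_const[OF U])
qed

lemma jet_const_regular_closed: "jet_const m U (\<lambda>p\<in>U. c) \<in> carrier (jets C m U)"
  by (intro jet_const_closed regular_const U)

lemma jet_auts_id: "(\<lambda>x\<in>carrier (jets C m U). x) \<in> jet_auts C m U"
  by (rule jet_autsI)
     (auto simp: jets_add_closed jets_mult_closed jets_one_closed jet_const_regular_closed bij_betw_def inj_on_def)

lemma jet_auts_compose:
  assumes "\<phi> \<in> jet_auts C m U" "\<psi> \<in> jet_auts C m U"
  shows "compose (carrier (jets C m U)) \<phi> \<psi> \<in> jet_auts C m U"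
proof (rule jet_autsI)
  show "bij_betw (compose (carrier (jets C m U)) \<phi> \<psi>) (carrier (jets C m U)) (carrier (jets C m U))"
    using jet_autsD'(2)[OF assms(1)] jet_autsD'(2)[OF assms(2)] by (intro bij_betw_compose)
qed (simp_all add: compose_def jets_add_closed jets_mult_closed jets_one_closed jet_const_regular_closed
    jet_autsD[OF assms(1)] jet_autsD[OF assms(2)] jet_autsD'(3,4)[OF assms(1)] jet_autsD'(3,4)[OF assms(2)])

lemma jet_auts_inverse:
  assumes "\<phi> \<in> jet_auts C m U"
  shows "(\<lambda>x\<in>carrier (jets C m U). inv_into (carrier (jets C m U)) \<phi> x) \<in> jet_auts C m U" (is "restrict ?\<eta> ?J \<in> _")
proof -
  have b: "bij_betw \<phi> ?J ?J"
    by (rule jet_autsD'(2)[OF assms])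
  note D = jet_autsD[OF assms] and D' = jet_autsD'[OF assms]
  have c: "?\<eta> x \<in> ?J" "\<phi> (?\<eta> x) = x" if "x \<in> ?J" for x
    using b that by (auto simp: bij_betw_def inv_into_into f_inv_into_f)
  have e: "?\<eta> y = x" if "\<phi> x = y" "x \<in> ?J" for x y
    using b that by (auto simp: bij_betw_def inv_into_f_f)
  show ?thesis
  proof (rule jet_autsI)
    show "bij_betw (restrict ?\<eta> ?J) ?J ?J"
      using bij_betw_inv_into[OF b] by (rule bij_betw_cong[THEN iffD1, rotated]) simp
    fix x y assume xy: "x \<in> ?J" "y \<in> ?J"
    show "restrict ?\<eta> ?J (x \<otimes>\<^bsub>jets C m U\<^esub> y) = restrict ?\<eta> ?J x \<otimes>\<^bsub>jets C m U\<^esub> restrict ?\<eta> ?J y"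
      using xy c by (simp add: jets_mult_closed, intro e) (auto simp: D jets_mult_closed)
    show "restrict ?\<eta> ?J (x \<oplus>\<^bsub>jets C m U\<^esub> y) = restrict ?\<eta> ?J x \<oplus>\<^bsub>jets C m U\<^esub> restrict ?\<eta> ?J y"
      using xy c by (simp add: jets_add_closed, intro e) (auto simp: D jets_add_closed)
  next
    fix x assume x: "x \<in> ?J"
    show "restrict ?\<eta> ?J x 0 = x 0"
      using D(4)[of "?\<eta> x"] c[OF x] x by simp
  next
    show "restrict ?\<eta> ?J \<one>\<^bsub>jets C m U\<^esub> = \<one>\<^bsub>jets C m U\<^esub>"
      using D'(3) jets_one_closed by (auto intro!: e)
    show "restrict ?\<eta> ?J (jet_const m U (\<lambda>p\<in>U. a)) = jet_const m U (\<lambda>p\<in>U. a)" for a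
      using D'(4) jet_const_regular_closed by (auto intro!: e)
  qed simp
qed

text \<open>Writing \<open>x = x\<^sub>0 + t y\<close>, the image of \<open>x\<close> is the image of \<open>x\<^sub>0\<close> plus \<open>\<phi>(t) \<phi>(y)\<close>; since \<open>\<phi>(t)\<close>
  is divisible by \<open>t\<close>, only the constant coefficient \<open>x\<^sub>1\<close> of \<open>\<phi>(y)\<close> contributes to degree one.\<close>

lemma jet_aut_coeff1:
  assumes \<phi>: "\<phi> \<in> jet_auts C m U" and x: "x \<in> carrier (jets C m U)" and m: "m \<ge> 2" and p: "p \<in> U"
  shows "\<phi> x 1 p = \<phi> (jet_const m U (x 0)) 1 p + \<phi> (jet_t m U) 1 p * x 1 p"
proof -
  define y where "y = (\<lambda>k\<in>{..<m}. \<lambda>p\<in>U. (if Suc k < m then x (Suc k) p else 0))"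
  have y: "y \<in> carrier (jets C m U)"
    unfolding y_def
  proof (rule jetsI)
    fix k show "regular C U (\<lambda>p\<in>U. if Suc k < m then x (Suc k) p else 0)"
      using jets_regular[OF x, of "Suc k"] regular_const[OF U, of 0]
      by (cases "Suc k < m") (simp_all add: regular_eta)
  qed
  have x0: "regular C U (x 0)"
    using m by (intro jets_regular[OF x]) auto
  note c = jet_const_closed[OF x0, of m] and t = jet_t_closed[of m]
  have ty: "jet_t m U \<otimes>\<^bsub>jets C m U\<^esub> y \<in> carrier (jets C m U)"
    by (rule jets_mult_closed[OF t y])
  have "x = jet_const m U (x 0) \<oplus>\<^bsub>jets C m U\<^esub> (jet_t m U \<otimes>\<^bsub>jets C m U\<^esub> y)"
  proof (rule jets_eqI[OF x jets_add_closed[OF c ty]])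
    fix k q assume k: "k < m" "q \<in> U"
    have "(jet_const m U (x 0) \<oplus>\<^bsub>jets C m U\<^esub> (jet_t m U \<otimes>\<^bsub>jets C m U\<^esub> y)) k q
        = jet_const m U (x 0) k q + (jet_t m U \<otimes>\<^bsub>jets C m U\<^esub> y) k q"
      using k by (simp add: jets_ops(2))
    also have "\<dots> = x k q"
      unfolding jet_t_mult[OF m k] using k by (auto simp: jet_const_def y_def)
    finally show "x k q = (jet_const m U (x 0) \<oplus>\<^bsub>jets C m U\<^esub> (jet_t m U \<otimes>\<^bsub>jets C m U\<^esub> y)) k q"
      by simp
  qed
  then have "\<phi> x = \<phi> (jet_const m U (x 0)) \<oplus>\<^bsub>jets C m U\<^esub> (\<phi> (jet_t m U) \<otimes>\<^bsub>jets C m U\<^esub> \<phi> y)"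
    using jet_autsD(3)[OF \<phi> c ty] jet_autsD(2)[OF \<phi> t y] by simp
  then have "\<phi> x 1 p = \<phi> (jet_const m U (x 0)) 1 p + (\<phi> (jet_t m U) 0 p * \<phi> y 1 p + \<phi> (jet_t m U) 1 p * \<phi> y 0 p)"
    using m p by (simp add: jets_ops)
  also have "\<phi> (jet_t m U) 0 p = 0"
    unfolding jet_autsD(4)[OF \<phi> t] using m p by (simp add: jet_t_def)
  also have "\<phi> y 0 p = x 1 p"
    unfolding jet_autsD(4)[OF \<phi> y] using m p by (simp add: y_def)
  finally show ?thesis
    by simp
qed

text \<open>The image of \<open>f t\<^sup>j\<close> is \<open>\<phi>(f) \<phi>(t)\<^sup>j\<close>, and \<open>\<phi>(t)\<close> is divisible by \<open>t\<close>: there is nothing in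
  degrees below \<open>j\<close>, and the leading coefficient is \<open>f \<nu>\<^sup>j\<close>.\<close>

lemma jet_aut_term:
  assumes \<phi>: "\<phi> \<in> jet_auts C m U" and f: "regular C U f" and m: "m \<ge> 2" and p: "p \<in> U"
  shows "j < m \<Longrightarrow> k \<le> j \<Longrightarrow>
    \<phi> (jet_term U m j f) k p = (if k = j then f p * \<phi> (jet_t m U) 1 p ^ j else 0)"
proof (induction j arbitrary: k)
  case 0
  have "jet_term U m 0 f 0 p = f p"
    using m p by (simp add: jet_term_def)
  then show ?case
    using fun_cong[OF jet_autsD(4)[OF \<phi> jet_term_closed[OF f, of m 0]], of p] 0 by simp
next
  case (Suc j)
  let ?z = "jet_term U m j f"
  note z = jet_term_closed[OF f, of m j] and t = jet_t_closed[of m]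
  have "jet_term U m (Suc j) f = jet_t m U \<otimes>\<^bsub>jets C m U\<^esub> ?z"
  proof (rule jets_eqI[OF jet_term_closed[OF f] jets_mult_closed[OF t z]])
    fix k q assume k: "k < m" "q \<in> U"
    show "jet_term U m (Suc j) f k q = (jet_t m U \<otimes>\<^bsub>jets C m U\<^esub> ?z) k q"
      unfolding jet_t_mult[OF m k] using k by (auto simp: jet_term_def)
  qed
  then have "\<phi> (jet_term U m (Suc j) f) k p = (\<Sum>i\<le>k. \<phi> (jet_t m U) i p * \<phi> ?z (k - i) p)"
    using jet_autsD(2)[OF \<phi> t z] Suc.prems p by (simp add: jets_ops)
  also have "\<dots> = (\<Sum>i\<le>k. if i = 1 then (if k = Suc j then f p * \<phi> (jet_t m U) 1 p ^ Suc j else 0) else 0)"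
  proof (rule sum.cong)
    fix i assume i: "i \<in> {..k}"
    have t0: "\<phi> (jet_t m U) 0 p = 0"
      unfolding jet_autsD(4)[OF \<phi> t] using m p by (simp add: jet_t_def)
    show "\<phi> (jet_t m U) i p * \<phi> ?z (k - i) p =
        (if i = 1 then (if k = Suc j then f p * \<phi> (jet_t m U) 1 p ^ Suc j else 0) else 0)"
    proof (cases "i = 0")
      case False
      then have "k - i \<le> j" "j < m" "k - i = j \<longleftrightarrow> k = Suc j \<and> i = 1"
        using i Suc.prems by auto
      then show ?thesis
        using Suc.IH[of "k - i"] by auto
    qed (simp add: t0)
  qed simp
  also have "\<dots> = (if k = Suc j then f p * \<phi> (jet_t m U) 1 p ^ Suc j else 0)"
    by (subst sum.delta) auto
  finally show ?case .
qed

end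

lemma jet_res_closed:
  assumes "zopen C W" "W \<subseteq> V" "x \<in> carrier (jets C m V)"
  shows "jet_res m W x \<in> carrier (jets C m W)"
  using assms by (simp add: jets_carrier jet_res_def regular_restrict[of C V])

lemma jet_res_const: "W \<subseteq> V \<Longrightarrow> jet_res m W (jet_const m V f) = jet_const m W (restrict f W)"
  by (auto simp: jet_res_def jet_const_def fun_eq_iff)

lemma jet_res_t: "W \<subseteq> V \<Longrightarrow> jet_res m W (jet_t m V) = jet_t m W"
  by (auto simp: jet_res_def jet_t_def fun_eq_iff)


locale group_presheaf =
  fixes C :: "'n::finite pt set" and S :: "('n pt, 'g) group_sheaf"
  assumes sec_group: "zopen C U \<Longrightarrow> group (gsec S U)"
    and gres_closed: "\<lbrakk>zopen C U; zopen C V; V \<subseteq> U; x \<in> carrier (gsec S U)\<rbrakk> \<Longrightarrow> gres S U V x \<in> carrier (gsec S V)"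
    and gres_mult: "\<lbrakk>zopen C U; zopen C V; V \<subseteq> U; x \<in> carrier (gsec S U); y \<in> carrier (gsec S U)\<rbrakk>
      \<Longrightarrow> gres S U V (x \<otimes>\<^bsub>gsec S U\<^esub> y) = gres S U V x \<otimes>\<^bsub>gsec S V\<^esub> gres S U V y"
    and gres_gres: "\<lbrakk>zopen C U; zopen C V; zopen C W; W \<subseteq> V; V \<subseteq> U; x \<in> carrier (gsec S U)\<rbrakk>
      \<Longrightarrow> gres S V W (gres S U V x) = gres S U W x"

abbreviation jet_aut_sections :: "'n::finite pt set \<Rightarrow> nat \<Rightarrow> 'n pt set \<Rightarrow> 'n jet_aut set"
  where "jet_aut_sections C m U \<equiv> carrier (gsec (aut_sheaf C m) U)"

lemma aut_sheaf_carrier: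
  "\<phi> \<in> jet_aut_sections C m U \<longleftrightarrow> \<phi> \<in> (\<Pi>\<^sub>E V\<in>opens C U. jet_auts C m V) \<and>
    (\<forall>V W x. zopen C V \<longrightarrow> V \<subseteq> U \<longrightarrow> zopen C W \<longrightarrow> W \<subseteq> V \<longrightarrow> x \<in> carrier (jets C m V) \<longrightarrow>
      jet_res m W (\<phi> V x) = \<phi> W (jet_res m W x))"
  by (auto simp: aut_sheaf_def)

lemma aut_sheaf_ops:
  "\<phi> \<otimes>\<^bsub>gsec (aut_sheaf C m) U\<^esub> \<psi> = (\<lambda>V\<in>opens C U. compose (carrier (jets C m V)) (\<phi> V) (\<psi> V))"
  "\<one>\<^bsub>gsec (aut_sheaf C m) U\<^esub> = (\<lambda>V\<in>opens C U. \<lambda>x\<in>carrier (jets C m V). x)"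
  "gres (aut_sheaf C m) U V \<phi> = restrict \<phi> (opens C V)"
  by (simp_all add: aut_sheaf_def)

lemma aut_sheafD:
  assumes "\<phi> \<in> jet_aut_sections C m U"
  shows "\<phi> \<in> extensional (opens C U)"
    and "zopen C V \<Longrightarrow> V \<subseteq> U \<Longrightarrow> \<phi> V \<in> jet_auts C m V"
    and "zopen C V \<Longrightarrow> V \<subseteq> U \<Longrightarrow> zopen C W \<Longrightarrow> W \<subseteq> V \<Longrightarrow> x \<in> carrier (jets C m V) \<Longrightarrow>
      jet_res m W (\<phi> V x) = \<phi> W (jet_res m W x)"
  using assms unfolding aut_sheaf_carrier by (auto simp: PiE_def Pi_def)

lemma aut_sheafI:
  assumes "\<phi> \<in> extensional (opens C U)"
    and "\<And>V. zopen C V \<Longrightarrow> V \<subseteq> U \<Longrightarrow> \<phi> V \<in> jet_auts C m V"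
    and "\<And>V W x. zopen C V \<Longrightarrow> V \<subseteq> U \<Longrightarrow> zopen C W \<Longrightarrow> W \<subseteq> V \<Longrightarrow> x \<in> carrier (jets C m V) \<Longrightarrow>
      jet_res m W (\<phi> V x) = \<phi> W (jet_res m W x)"
  shows "\<phi> \<in> jet_aut_sections C m U"
  using assms unfolding aut_sheaf_carrier by (auto simp: PiE_def Pi_def)

lemma aut_sheaf_closed:
  "\<phi> \<in> jet_aut_sections C m U \<Longrightarrow> zopen C V \<Longrightarrow> V \<subseteq> U \<Longrightarrow> x \<in> carrier (jets C m V) \<Longrightarrow> \<phi> V x \<in> carrier (jets C m V)"
  by (rule jet_autsD(1)[OF _ aut_sheafD(2)])

lemma aut_sheaf_mult_closed:
  assumes "\<phi> \<in> jet_aut_sections C m U" "\<psi> \<in> jet_aut_sections C m U"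
  shows "\<phi> \<otimes>\<^bsub>gsec (aut_sheaf C m) U\<^esub> \<psi> \<in> jet_aut_sections C m U"
proof (rule aut_sheafI)
  fix V assume V: "zopen C V" "V \<subseteq> U"
  then show "(\<phi> \<otimes>\<^bsub>gsec (aut_sheaf C m) U\<^esub> \<psi>) V \<in> jet_auts C m V"
    by (simp add: aut_sheaf_ops jet_auts_compose aut_sheafD(2)[OF assms(1)] aut_sheafD(2)[OF assms(2)])
  fix W x assume W: "zopen C W" "W \<subseteq> V" "x \<in> carrier (jets C m V)"
  have WU: "W \<subseteq> U" using W V by blast
  show "jet_res m W ((\<phi> \<otimes>\<^bsub>gsec (aut_sheaf C m) U\<^esub> \<psi>) V x) = (\<phi> \<otimes>\<^bsub>gsec (aut_sheaf C m) U\<^esub> \<psi>) W (jet_res m W x)"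
    using V W WU aut_sheaf_closed[OF assms(2) V W(3)] jet_res_closed[OF W]
    by (simp add: aut_sheaf_ops compose_def aut_sheafD(3)[OF assms(1) V W(1,2)] aut_sheafD(3)[OF assms(2) V W])
qed (simp add: aut_sheaf_ops)

lemma aut_sheaf_eqI:
  assumes "\<phi> \<in> jet_aut_sections C m U" "\<psi> \<in> jet_aut_sections C m U"
    and "\<And>V x. zopen C V \<Longrightarrow> V \<subseteq> U \<Longrightarrow> x \<in> carrier (jets C m V) \<Longrightarrow> \<phi> V x = \<psi> V x"
  shows "\<phi> = \<psi>"
proof (rule extensionalityI[OF aut_sheafD(1)[OF assms(1)] aut_sheafD(1)[OF assms(2)]])
  fix V assume "V \<in> opens C U"
  then have V: "zopen C V" "V \<subseteq> U" by auto
  show "\<phi> V = \<psi> V"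
    by (rule extensionalityI[OF jet_autsD'(1)[OF V(1) aut_sheafD(2)[OF assms(1) V]]
        jet_autsD'(1)[OF V(1) aut_sheafD(2)[OF assms(2) V]] assms(3)[OF V]])
qed

lemma aut_sheaf_mult_apply:
  "zopen C V \<Longrightarrow> V \<subseteq> U \<Longrightarrow> x \<in> carrier (jets C m V) \<Longrightarrow> (\<phi> \<otimes>\<^bsub>gsec (aut_sheaf C m) U\<^esub> \<psi>) V x = \<phi> V (\<psi> V x)"
  by (simp add: aut_sheaf_ops compose_def)

lemma aut_sheaf_one_closed:
  assumes "zopen C U"
  shows "\<one>\<^bsub>gsec (aut_sheaf C m) U\<^esub> \<in> jet_aut_sections C m U"
proof (rule aut_sheafI)
  fix V W x assume *: "zopen C V" "V \<subseteq> U" "zopen C W" "W \<subseteq> V" "x \<in> carrier (jets C m V)"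
  then have "W \<subseteq> U" "jet_res m W x \<in> carrier (jets C m W)"
    by (auto intro: jet_res_closed)
  with * show "jet_res m W (\<one>\<^bsub>gsec (aut_sheaf C m) U\<^esub> V x) = \<one>\<^bsub>gsec (aut_sheaf C m) U\<^esub> W (jet_res m W x)"
    by (simp add: aut_sheaf_ops)
qed (auto simp: aut_sheaf_ops jet_auts_id)

lemma aut_sheaf_inverse:
  assumes \<phi>: "\<phi> \<in> jet_aut_sections C m U"
  shows "\<exists>\<eta>\<in>jet_aut_sections C m U. \<eta> \<otimes>\<^bsub>gsec (aut_sheaf C m) U\<^esub> \<phi> = \<one>\<^bsub>gsec (aut_sheaf C m) U\<^esub>"
proof -
  define \<eta> where "\<eta> = (\<lambda>V\<in>opens C U. \<lambda>x\<in>carrier (jets C m V). inv_into (carrier (jets C m V)) (\<phi> V) x)"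
  have inv: "\<phi> V (\<eta> V x) = x" "\<eta> V x \<in> carrier (jets C m V)" "\<eta> V (\<phi> V x) = x"
    if "zopen C V" "V \<subseteq> U" "x \<in> carrier (jets C m V)" for V x
    using that jet_autsD'(2)[OF that(1) aut_sheafD(2)[OF \<phi> that(1,2)]] aut_sheaf_closed[OF \<phi> that]
    by (auto simp: \<eta>_def bij_betw_def f_inv_into_f inv_into_into)
  have "\<eta> \<in> jet_aut_sections C m U"
  proof (rule aut_sheafI)
    fix V assume "zopen C V" "V \<subseteq> U"
    then show "\<eta> V \<in> jet_auts C m V"
      using jet_auts_inverse[of C V "\<phi> V" m] aut_sheafD(2)[OF \<phi>] by (simp add: \<eta>_def)
  next
    fix V W x assume *: "zopen C V" "V \<subseteq> U" "zopen C W" "W \<subseteq> V" "x \<in> carrier (jets C m V)"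
    have WU: "W \<subseteq> U" using * by blast
    note c = inv[OF *(1,2,5)]
    have "\<phi> W (jet_res m W (\<eta> V x)) = jet_res m W x"
      using aut_sheafD(3)[OF \<phi> *(1-4) c(2)] c(1) by simp
    then show "jet_res m W (\<eta> V x) = \<eta> W (jet_res m W x)"
      using inv(3)[OF *(3) WU jet_res_closed[OF *(3,4) c(2)]] by simp
  qed (simp add: \<eta>_def)
  moreover have "\<eta> \<otimes>\<^bsub>gsec (aut_sheaf C m) U\<^esub> \<phi> = \<one>\<^bsub>gsec (aut_sheaf C m) U\<^esub>"
    unfolding aut_sheaf_ops compose_def using inv(3) by (auto intro!: restrict_ext)
  ultimately show ?thesis
    by blast
qed

lemma aut_sheaf_group:
  assumes "zopen C U"
  shows "group (gsec (aut_sheaf C m) U)"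
proof (rule groupI)
  fix \<phi> \<psi> \<eta> assume *: "\<phi> \<in> jet_aut_sections C m U" "\<psi> \<in> jet_aut_sections C m U" "\<eta> \<in> jet_aut_sections C m U"
  show "\<phi> \<otimes>\<^bsub>gsec (aut_sheaf C m) U\<^esub> \<psi> \<otimes>\<^bsub>gsec (aut_sheaf C m) U\<^esub> \<eta> =
      \<phi> \<otimes>\<^bsub>gsec (aut_sheaf C m) U\<^esub> (\<psi> \<otimes>\<^bsub>gsec (aut_sheaf C m) U\<^esub> \<eta>)"
    by (rule aut_sheaf_eqI[where C = C and m = m and U = U]) (simp_all add: * aut_sheaf_mult_closed aut_sheaf_mult_apply aut_sheaf_closed[OF *(3)])
next
  fix \<phi> assume *: "\<phi> \<in> jet_aut_sections C m U"
  show "\<one>\<^bsub>gsec (aut_sheaf C m) U\<^esub> \<otimes>\<^bsub>gsec (aut_sheaf C m) U\<^esub> \<phi> = \<phi>"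
    by (rule aut_sheaf_eqI[OF aut_sheaf_mult_closed[OF aut_sheaf_one_closed[OF assms] *] *])
       (simp add: aut_sheaf_mult_apply aut_sheaf_closed[OF *], simp add: aut_sheaf_ops aut_sheaf_closed[OF *])
qed (simp_all add: aut_sheaf_mult_closed aut_sheaf_one_closed assms aut_sheaf_inverse)

lemma aut_group_presheaf: "group_presheaf C (aut_sheaf C m)"
proof (rule group_presheaf.intro, goal_cases)
  case (1 U) then show ?case by (rule aut_sheaf_group)
next
  case (2 U V \<phi>)
  have VU: "W \<subseteq> U" if "W \<subseteq> V" for W using 2 that by blast
  show ?case
    unfolding aut_sheaf_ops
  proof (rule aut_sheafI)
    fix W Y x assume *: "zopen C W" "W \<subseteq> V" "zopen C Y" "Y \<subseteq> W" "x \<in> carrier (jets C m W)"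
    then have "Y \<subseteq> V" by blast
    with * show "jet_res m Y (restrict \<phi> (opens C V) W x) = restrict \<phi> (opens C V) Y (jet_res m Y x)"
      using aut_sheafD(3)[OF 2(4) *(1) VU[OF *(2)] *(3-5)] by simp
  qed (auto simp: aut_sheafD(2)[OF 2(4)] VU)
next
  case (3 U V x y)
  then show ?case
    unfolding aut_sheaf_ops by (auto simp: fun_eq_iff restrict_def)
next
  case (4 U V W x)
  then show ?case
    unfolding aut_sheaf_ops by (auto simp: fun_eq_iff restrict_def)
qed

section \<open>The affine group sheaf\<close>

definition aut_mu :: "'n::finite pt set \<Rightarrow> nat \<Rightarrow> 'n pt set \<Rightarrow> 'n jet_aut \<Rightarrow> 'n vfield"
  where "aut_mu C m U \<phi> = vfield C U (\<lambda>V f p. \<phi> V (jet_const m V f) 1 p)"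

lemma xi_regular:
  assumes "zopen C U" "m \<ge> 2" "\<phi> \<in> jet_aut_sections C m U"
  shows "regular C U (xi m U \<phi>)"
  unfolding xi_def using assms
  by (intro jets_regular[of _ C m] aut_sheaf_closed[OF assms(3)] jet_t_closed) auto

lemma xi_apply:
  assumes "zopen C U" "m \<ge> 2" "\<phi> \<in> jet_aut_sections C m U" and V: "zopen C V" "V \<subseteq> U" "p \<in> V"
  shows "\<phi> V (jet_t m V) 1 p = xi m U \<phi> p"
proof -
  have "jet_res m V (\<phi> U (jet_t m U)) = \<phi> V (jet_res m V (jet_t m U))"
    using assms by (intro aut_sheafD(3)[OF assms(3)] jet_t_closed) auto
  then have "jet_res m V (\<phi> U (jet_t m U)) = \<phi> V (jet_t m V)"
    using V by (simp add: jet_res_t)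
  from fun_cong[OF fun_cong[OF this, of 1], of p] assms show ?thesis
    by (simp add: jet_res_def xi_def)
qed

text \<open>The reduction of \<open>\<phi>\<close> to level two, in terms of the components \<open>\<mu>\<close> and \<open>\<nu>\<close>.  The group laws
  for these components follow by applying it to \<open>\<psi>(\<alpha>)\<close> and to \<open>\<psi>(t)\<close>.\<close>

lemma aut_coeff1:
  assumes U: "zopen C U" "m \<ge> 2" and \<phi>: "\<phi> \<in> jet_aut_sections C m U" and V: "zopen C V" "V \<subseteq> U"
    and x: "x \<in> carrier (jets C m V)" and p: "p \<in> V"
  shows "\<phi> V x 1 p = aut_mu C m U \<phi> V (x 0) p + xi m U \<phi> p * x 1 p"
proof -
  have "regular C V (x 0)"
    using U by (intro jets_regular[OF x]) auto
  then show ?thesis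
    using jet_aut_coeff1[OF V(1) aut_sheafD(2)[OF \<phi> V] x U(2) p] xi_apply[OF U \<phi> V p] V p
    by (simp add: aut_mu_def)
qed

lemma aut_coeff0:
  assumes "\<phi> \<in> jet_aut_sections C m U" "zopen C V" "V \<subseteq> U" "x \<in> carrier (jets C m V)"
  shows "\<phi> V x 0 = x 0"
  by (rule jet_autsD(4)[OF assms(2) aut_sheafD(2)[OF assms(1-3)] assms(4)])

lemma jet_const_0: "regular C V f \<Longrightarrow> m \<ge> 2 \<Longrightarrow> jet_const m V f 0 = f"
  by (simp add: jet_const_def regular_eta)

lemma jet_t_0: "m \<ge> 2 \<Longrightarrow> jet_t m V 0 = (\<lambda>p\<in>V. 0)"
  unfolding jet_t_def by auto

text \<open>The derivation rule is the coefficient of \<open>t\<close> in \<open>\<phi>(f g) = \<phi>(f) \<phi>(g)\<close>, where \<open>\<phi>(f)\<close> and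
  \<open>\<phi>(g)\<close> have the constant coefficients \<open>f\<close> and \<open>g\<close>.\<close>

lemma aut_mu_tangent:
  assumes U: "zopen C U" "m \<ge> 2" and \<phi>: "\<phi> \<in> jet_aut_sections C m U"
  shows "aut_mu C m U \<phi> \<in> tangent_sections C U"
  unfolding aut_mu_def
proof (rule vfield_tangentI)
  fix V f assume V: "zopen C V" "V \<subseteq> U" and f: "regular C V f"
  have "regular C V (\<phi> V (jet_const m V f) 1)"
    using U by (intro jets_regular[OF aut_sheaf_closed[OF \<phi> V jet_const_closed[OF V(1) f]]]) auto
  then show "regular C V (\<lambda>p\<in>V. \<phi> V (jet_const m V f) 1 p)"
    by (simp add: regular_eta)
next
  fix V p and c :: complex assume V: "zopen C V" "V \<subseteq> U" and p: "p \<in> V"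
  show "\<phi> V (jet_const m V (\<lambda>p\<in>V. c)) 1 p = 0"
    unfolding jet_autsD'(4)[OF V(1) aut_sheafD(2)[OF \<phi> V]] using U p by (simp add: jet_const_def)
next
  fix V f g p assume V: "zopen C V" "V \<subseteq> U" and f: "regular C V f" and g: "regular C V g" and p: "p \<in> V"
  note a = aut_sheafD(2)[OF \<phi> V] and fc = jet_const_closed[OF V(1) f, of m] and gc = jet_const_closed[OF V(1) g, of m]
  have "jet_const m V (\<lambda>p\<in>V. f p + g p) = jet_const m V f \<oplus>\<^bsub>jets C m V\<^esub> jet_const m V g"
    unfolding jets_ops jet_const_def by (intro restrict_ext) auto
  then show "\<phi> V (jet_const m V (\<lambda>p\<in>V. f p + g p)) 1 p = \<phi> V (jet_const m V f) 1 p + \<phi> V (jet_const m V g) 1 p"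
    using jet_autsD(3)[OF V(1) a fc gc] U p by (simp add: jets_ops)
  have "jet_const m V (\<lambda>p\<in>V. f p * g p) = jet_const m V f \<otimes>\<^bsub>jets C m V\<^esub> jet_const m V g"
  proof (rule jets_eqI[OF jet_const_closed[OF V(1) regular_mult[OF f g]] jets_mult_closed[OF V(1) fc gc]])
    fix k q assume k: "k < m" "q \<in> V"
    have "(\<Sum>i\<le>k. jet_const m V f i q * jet_const m V g (k - i) q)
        = (\<Sum>i\<le>k. if i = 0 then (if k = 0 then f q * g q else 0) else 0)"
      by (rule sum.cong) (use k in \<open>auto simp: jet_const_def\<close>)
    then show "jet_const m V (\<lambda>p\<in>V. f p * g p) k q = (jet_const m V f \<otimes>\<^bsub>jets C m V\<^esub> jet_const m V g) k q"
      using k by (simp add: jets_ops jet_const_def[of m V "\<lambda>p\<in>V. f p * g p"])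
  qed
  then have "\<phi> V (jet_const m V (\<lambda>p\<in>V. f p * g p)) 1 p =
      \<phi> V (jet_const m V f) 0 p * \<phi> V (jet_const m V g) 1 p + \<phi> V (jet_const m V f) 1 p * \<phi> V (jet_const m V g) 0 p"
    using jet_autsD(2)[OF V(1) a fc gc] U p by (simp add: jets_ops)
  then show "\<phi> V (jet_const m V (\<lambda>p\<in>V. f p * g p)) 1 p = f p * \<phi> V (jet_const m V g) 1 p + g p * \<phi> V (jet_const m V f) 1 p"
    using jet_autsD(4)[OF V(1) a fc] jet_autsD(4)[OF V(1) a gc] jet_const_0[OF f U(2)] jet_const_0[OF g U(2)]
    by simp
next
  fix V W f p assume V: "zopen C V" "V \<subseteq> U" "zopen C W" "W \<subseteq> V" and f: "regular C V f" and p: "p \<in> W"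
  have "jet_res m W (\<phi> V (jet_const m V f)) = \<phi> W (jet_const m W (restrict f W))"
    using aut_sheafD(3)[OF \<phi> V jet_const_closed[OF V(1) f]] jet_res_const[OF V(4)] by metis
  from fun_cong[OF fun_cong[OF this, of 1], of p] U p
  show "\<phi> W (jet_const m W (restrict f W)) 1 p = \<phi> V (jet_const m V f) 1 p"
    by (simp add: jet_res_def)
qed

lemma aut2_mu_eq:
  assumes U: "zopen C U" and \<psi>: "\<psi> \<in> jet_aut_sections C 2 U"
  shows "aut2_mu C U \<psi> = aut_mu C 2 U \<psi>"
  unfolding aut2_mu_def aut_mu_def vfield_def
proof (intro restrict_ext)
  fix V f assume "V \<in> opens C U" "f \<in> carrier (struct_sheaf C V)"
  then have V: "zopen C V" "V \<subseteq> U" and f: "regular C V f" by auto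
  have "regular C V (\<psi> V (jet_const 2 V f) 1)"
    by (intro jets_regular[OF aut_sheaf_closed[OF \<psi> V jet_const_closed[OF V(1) f]]]) auto
  then show "\<psi> V (jet_const 2 V f) 1 = (\<lambda>p\<in>V. \<psi> V (jet_const 2 V f) 1 p)"
    by (simp add: regular_eta)
qed

text \<open>The semidirect product of the units with the vector fields, isomorphic to the sheaf of
  automorphisms at level two.  The sheaves at all levels map to it, which makes it the common place
  for comparing the cocycles of \<open>g\<close> and of \<open>g\<^sub>2\<close>.\<close>

definition affine_sheaf :: "'n::finite pt set \<Rightarrow> ('n pt, 'n vfield \<times> ('n pt \<Rightarrow> complex)) group_sheaf"
  where "affine_sheaf C =
    \<lparr> gsec = (\<lambda>U. \<lparr> carrier = tangent_sections C U \<times> carrier (units_of (struct_sheaf C U)),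
        monoid.mult = (\<lambda>a b. (vfield C U (\<lambda>V f p. fst a V f p + snd a p * fst b V f p), \<lambda>p\<in>U. snd a p * snd b p)),
        one = (vfield C U (\<lambda>V f p. 0), \<lambda>p\<in>U. 1) \<rparr>),
      gres = (\<lambda>U V a. (restrict (fst a) (opens C V), restrict (snd a) V)) \<rparr>"

lemma affine_sheaf_simps:
  "zopen C U \<Longrightarrow> a \<in> carrier (gsec (affine_sheaf C) U) \<longleftrightarrow>
    fst a \<in> tangent_sections C U \<and> regular C U (snd a) \<and> (\<forall>p\<in>U. snd a p \<noteq> 0)"
  "a \<otimes>\<^bsub>gsec (affine_sheaf C) U\<^esub> b =
    (vfield C U (\<lambda>V f p. fst a V f p + snd a p * fst b V f p), \<lambda>p\<in>U. snd a p * snd b p)"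
  "\<one>\<^bsub>gsec (affine_sheaf C) U\<^esub> = (vfield C U (\<lambda>V f p. 0), \<lambda>p\<in>U. 1)"
  "gres (affine_sheaf C) U V a = (restrict (fst a) (opens C V), restrict (snd a) V)"
  by (auto simp: affine_sheaf_def mem_Times_iff)

lemma tangent_zero: "zopen C U \<Longrightarrow> vfield C U (\<lambda>V f p. 0) \<in> tangent_sections C U"
  by (rule vfield_tangentI) (simp_all add: regular_const)

lemma affine_mult_closed:
  assumes U: "zopen C U" and a: "a \<in> carrier (gsec (affine_sheaf C) U)" and b: "b \<in> carrier (gsec (affine_sheaf C) U)"
  shows "a \<otimes>\<^bsub>gsec (affine_sheaf C) U\<^esub> b \<in> carrier (gsec (affine_sheaf C) U)"
proof -
  note * = a[unfolded affine_sheaf_simps(1)[OF U]] b[unfolded affine_sheaf_simps(1)[OF U]]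
  have "vfield C U (\<lambda>V f p. (\<lambda>p\<in>U. 1) p * fst a V f p + snd a p * fst b V f p) \<in> tangent_sections C U"
    using * by (intro tangent_lincomb U regular_const) auto
  also have "vfield C U (\<lambda>V f p. (\<lambda>p\<in>U. 1) p * fst a V f p + snd a p * fst b V f p)
      = vfield C U (\<lambda>V f p. fst a V f p + snd a p * fst b V f p)"
    by (rule vfield_cong) auto
  finally show ?thesis
    using * U by (simp add: affine_sheaf_simps regular_mult)
qed

lemma affine_eqI:
  assumes "fst a \<in> tangent_sections C U" "fst b \<in> tangent_sections C U" "regular C U (snd a)" "regular C U (snd b)"
    and "\<And>V f p. zopen C V \<Longrightarrow> V \<subseteq> U \<Longrightarrow> regular C V f \<Longrightarrow> p \<in> V \<Longrightarrow> fst a V f p = fst b V f p"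
    and "\<And>p. p \<in> U \<Longrightarrow> snd a p = snd b p"
  shows "a = b"
  using tangent_eqI[OF assms(1,2,5)] regular_ext[OF assms(3,4,6)] by (rule prod_eqI)

lemma affine_group:
  assumes U: "zopen C U"
  shows "group (gsec (affine_sheaf C) U)"
proof (rule groupI)
  note closed = affine_mult_closed[OF U]
  note D = affine_sheaf_simps(1)[OF U, THEN iffD1]
  show one: "\<one>\<^bsub>gsec (affine_sheaf C) U\<^esub> \<in> carrier (gsec (affine_sheaf C) U)"
    unfolding affine_sheaf_simps(1)[OF U] by (simp add: affine_sheaf_simps(3) tangent_zero regular_const U)
  fix a b c
  assume a: "a \<in> carrier (gsec (affine_sheaf C) U)"
  show "\<one>\<^bsub>gsec (affine_sheaf C) U\<^esub> \<otimes>\<^bsub>gsec (affine_sheaf C) U\<^esub> a = a"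
  proof (rule affine_eqI[where C = C and U = U])
    fix V f p assume "zopen C V" "V \<subseteq> U" "regular C V f" "p \<in> V"
    then show "fst (\<one>\<^bsub>gsec (affine_sheaf C) U\<^esub> \<otimes>\<^bsub>gsec (affine_sheaf C) U\<^esub> a) V f p = fst a V f p"
      by (auto simp: affine_sheaf_simps)
  qed (use D[OF a] D[OF closed[OF one a]] in \<open>simp_all add: affine_sheaf_simps(2,3)\<close>)
  define a' where "a' = (vfield C U (\<lambda>V f p. - inverse (snd a p) * fst a V f p), \<lambda>p\<in>U. inverse (snd a p))"
  have r: "regular C U (\<lambda>p\<in>U. inverse (snd a p))"
    using D[OF a] by (intro regular_inverse) auto
  have "vfield C U (\<lambda>V f p. (\<lambda>p\<in>U. - (\<lambda>p\<in>U. inverse (snd a p)) p) p * fst a V f p + (\<lambda>p\<in>U. 0) p * fst a V f p) \<in> tangent_sections C U"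
    using D[OF a] by (intro tangent_lincomb[OF U _ _ regular_uminus[OF U r] regular_const[OF U]]) auto
  also have "vfield C U (\<lambda>V f p. (\<lambda>p\<in>U. - (\<lambda>p\<in>U. inverse (snd a p)) p) p * fst a V f p + (\<lambda>p\<in>U. 0) p * fst a V f p) = fst a'"
    unfolding a'_def fst_conv by (rule vfield_cong) auto
  finally have a': "a' \<in> carrier (gsec (affine_sheaf C) U)"
    unfolding affine_sheaf_simps(1)[OF U] using r D[OF a] by (simp add: a'_def)
  have "a' \<otimes>\<^bsub>gsec (affine_sheaf C) U\<^esub> a = \<one>\<^bsub>gsec (affine_sheaf C) U\<^esub>"
    unfolding affine_sheaf_simps(2,3) using D[OF a]
    by (auto simp: a'_def intro!: vfield_cong restrict_ext)
  with a' show "\<exists>b\<in>carrier (gsec (affine_sheaf C) U). b \<otimes>\<^bsub>gsec (affine_sheaf C) U\<^esub> a = \<one>\<^bsub>gsec (affine_sheaf C) U\<^esub>"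
    by blast
  assume b: "b \<in> carrier (gsec (affine_sheaf C) U)"
  show "a \<otimes>\<^bsub>gsec (affine_sheaf C) U\<^esub> b \<in> carrier (gsec (affine_sheaf C) U)"
    by (rule closed[OF a b])
  assume c: "c \<in> carrier (gsec (affine_sheaf C) U)"
  show "a \<otimes>\<^bsub>gsec (affine_sheaf C) U\<^esub> b \<otimes>\<^bsub>gsec (affine_sheaf C) U\<^esub> c
      = a \<otimes>\<^bsub>gsec (affine_sheaf C) U\<^esub> (b \<otimes>\<^bsub>gsec (affine_sheaf C) U\<^esub> c)"
    unfolding affine_sheaf_simps(2)
    by (auto intro!: vfield_cong restrict_ext simp: distrib_left mult.assoc)
qed

lemma affine_group_presheaf: "group_presheaf C (affine_sheaf C)"
proof (rule group_presheaf.intro, goal_cases)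
  case (1 U) then show ?case by (rule affine_group)
next
  case (2 U V a)
  then show ?case
    using tangent_res_closed[of C V U "fst a"] regular_restrict[of C U "snd a" V]
    by (auto simp: affine_sheaf_simps tangent_ops)
next
  case (3 U V a b)
  then show ?case
    unfolding affine_sheaf_simps fst_conv snd_conv
    by (intro arg_cong2[where f = Pair] restrict_vfield) (auto simp: fun_eq_iff)
next
  case (4 U V W a)
  then show ?case
    unfolding affine_sheaf_simps by (auto simp: fun_eq_iff restrict_def)
qed

lemma units_group_presheaf: "group_presheaf C (units_sheaf C)"
proof (rule group_presheaf.intro, goal_cases)
  case (1 U) then show ?case
    using group_units_struct_sheaf[OF 1] by (simp add: comm_group_def)
next
  case (2 U V a)
  then show ?case
    by (auto simp: regular_restrict[of C U a V])
next
  case (3 U V a b)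
  then show ?case
    unfolding units_sheaf_simps units_of_struct_sheaf_simps by (auto simp: fun_eq_iff)
next
  case (4 U V W a)
  then show ?case
    unfolding units_sheaf_simps by (auto simp: fun_eq_iff restrict_def)
qed

locale group_presheaf_hom = S: group_presheaf C S + T: group_presheaf C T
  for C :: "'n::finite pt set" and S :: "('n pt, 'g) group_sheaf" and T :: "('n pt, 'h) group_sheaf" +
  fixes f :: "'n pt set \<Rightarrow> 'g \<Rightarrow> 'h"
  assumes hom_closed: "zopen C U \<Longrightarrow> x \<in> carrier (gsec S U) \<Longrightarrow> f U x \<in> carrier (gsec T U)"
    and hom_mult: "zopen C U \<Longrightarrow> x \<in> carrier (gsec S U) \<Longrightarrow> y \<in> carrier (gsec S U) \<Longrightarrow>
      f U (x \<otimes>\<^bsub>gsec S U\<^esub> y) = f U x \<otimes>\<^bsub>gsec T U\<^esub> f U y"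
    and hom_res: "zopen C U \<Longrightarrow> zopen C V \<Longrightarrow> V \<subseteq> U \<Longrightarrow> x \<in> carrier (gsec S U) \<Longrightarrow>
      f V (gres S U V x) = gres T U V (f U x)"

definition affine_of_aut :: "'n::finite pt set \<Rightarrow> nat \<Rightarrow> 'n pt set \<Rightarrow> 'n jet_aut \<Rightarrow> 'n vfield \<times> ('n pt \<Rightarrow> complex)"
  where "affine_of_aut C m U \<phi> = (aut_mu C m U \<phi>, xi m U \<phi>)"

lemma aut_mu_mult:
  assumes U: "zopen C U" "m \<ge> 2" and \<phi>: "\<phi> \<in> jet_aut_sections C m U" and \<psi>: "\<psi> \<in> jet_aut_sections C m U"
    and V: "zopen C V" "V \<subseteq> U" and f: "regular C V f" and p: "p \<in> V"
  shows "aut_mu C m U (\<phi> \<otimes>\<^bsub>gsec (aut_sheaf C m) U\<^esub> \<psi>) V f p = aut_mu C m U \<phi> V f p + xi m U \<phi> p * aut_mu C m U \<psi> V f p"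
proof -
  note c = jet_const_closed[OF V(1) f, of m]
  have "aut_mu C m U (\<phi> \<otimes>\<^bsub>gsec (aut_sheaf C m) U\<^esub> \<psi>) V f p = \<phi> V (\<psi> V (jet_const m V f)) 1 p"
    unfolding aut_mu_def vfield_apply[OF V f p] aut_sheaf_mult_apply[OF V c] ..
  also have "\<dots> = aut_mu C m U \<phi> V f p + xi m U \<phi> p * \<psi> V (jet_const m V f) 1 p"
    unfolding aut_coeff1[OF U \<phi> V aut_sheaf_closed[OF \<psi> V c] p] aut_coeff0[OF \<psi> V c] jet_const_0[OF f U(2)] ..
  also have "\<psi> V (jet_const m V f) 1 p = aut_mu C m U \<psi> V f p"
    unfolding aut_mu_def vfield_apply[OF V f p] ..
  finally show ?thesis .
qed

lemma xi_mult:
  assumes U: "zopen C U" "m \<ge> 2" and \<phi>: "\<phi> \<in> jet_aut_sections C m U" and \<psi>: "\<psi> \<in> jet_aut_sections C m U"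
    and p: "p \<in> U"
  shows "xi m U (\<phi> \<otimes>\<^bsub>gsec (aut_sheaf C m) U\<^esub> \<psi>) p = xi m U \<phi> p * xi m U \<psi> p"
proof -
  note t = jet_t_closed[OF U(1), of m]
  have "xi m U (\<phi> \<otimes>\<^bsub>gsec (aut_sheaf C m) U\<^esub> \<psi>) p = \<phi> U (\<psi> U (jet_t m U)) 1 p"
    unfolding xi_def aut_sheaf_mult_apply[OF U(1) subset_refl t] ..
  also have "\<dots> = aut_mu C m U \<phi> U (\<lambda>p\<in>U. 0) p + xi m U \<phi> p * \<psi> U (jet_t m U) 1 p"
    unfolding aut_coeff1[OF U \<phi> U(1) subset_refl aut_sheaf_closed[OF \<psi> U(1) subset_refl t] p]
      aut_coeff0[OF \<psi> U(1) subset_refl t] jet_t_0[OF U(2)] ..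
  also have "aut_mu C m U \<phi> U (\<lambda>p\<in>U. 0) p = 0"
    using tangentD(2)[OF aut_mu_tangent[OF U \<phi>] U(1) subset_refl] p by simp
  finally show ?thesis
    by (simp add: xi_def)
qed

text \<open>The component \<open>\<nu>\<close> is multiplicative, so an inverse of \<open>\<phi>\<close> provides an inverse of \<open>\<nu>\<close>.\<close>

lemma xi_nonzero:
  assumes U: "zopen C U" "m \<ge> 2" and \<phi>: "\<phi> \<in> jet_aut_sections C m U" and p: "p \<in> U"
  shows "xi m U \<phi> p \<noteq> 0"
proof
  obtain \<eta> where \<eta>: "\<eta> \<in> jet_aut_sections C m U" "\<eta> \<otimes>\<^bsub>gsec (aut_sheaf C m) U\<^esub> \<phi> = \<one>\<^bsub>gsec (aut_sheaf C m) U\<^esub>"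
    using aut_sheaf_inverse[OF \<phi>] by blast
  have "xi m U \<one>\<^bsub>gsec (aut_sheaf C m) U\<^esub> p = 1"
    using U p jet_t_closed[OF U(1), of m] by (simp add: xi_def aut_sheaf_ops jet_t_def[of m U])
  moreover assume "xi m U \<phi> p = 0"
  ultimately show False
    using xi_mult[OF U \<eta>(1) \<phi> p] \<eta>(2) by simp
qed

lemma xi_restrict:
  assumes U: "zopen C U" "m \<ge> 2" and \<phi>: "\<phi> \<in> jet_aut_sections C m U" and V: "zopen C V" "V \<subseteq> U"
  shows "xi m V (gres (aut_sheaf C m) U V \<phi>) = restrict (xi m U \<phi>) V"
proof -
  interpret group_presheaf C "aut_sheaf C m" by (rule aut_group_presheaf)
  have r: "regular C V (xi m V (gres (aut_sheaf C m) U V \<phi>))"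
    by (rule xi_regular[OF V(1) U(2) gres_closed[OF U(1) V \<phi>]])
  show ?thesis
  proof (rule extensionalityI[OF regular_extensional[OF r]])
    fix p assume p: "p \<in> V"
    show "xi m V (gres (aut_sheaf C m) U V \<phi>) p = restrict (xi m U \<phi>) V p"
      using xi_apply[OF U \<phi> V p] V p by (simp add: xi_def[of m V] aut_sheaf_ops)
  qed simp
qed

lemma aut_mu_restrict:
  assumes U: "zopen C U" "m \<ge> 2" and \<phi>: "\<phi> \<in> jet_aut_sections C m U" and V: "zopen C V" "V \<subseteq> U"
  shows "aut_mu C m V (gres (aut_sheaf C m) U V \<phi>) = restrict (aut_mu C m U \<phi>) (opens C V)"
  unfolding aut_mu_def by (rule restrict_vfield[OF V, symmetric]) (simp add: aut_sheaf_ops)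

lemma affine_of_aut_hom:
  assumes m: "m \<ge> 2"
  shows "group_presheaf_hom C (aut_sheaf C m) (affine_sheaf C) (affine_of_aut C m)"
proof (intro group_presheaf_hom.intro aut_group_presheaf affine_group_presheaf group_presheaf_hom_axioms.intro)
  fix U \<phi> assume U: "zopen C U" and \<phi>: "\<phi> \<in> jet_aut_sections C m U"
  show *: "affine_of_aut C m U \<phi> \<in> carrier (gsec (affine_sheaf C) U)"
    unfolding affine_sheaf_simps(1)[OF U]
    by (simp add: affine_of_aut_def aut_mu_tangent[OF U m \<phi>] xi_regular[OF U m \<phi>] xi_nonzero[OF U m \<phi>])
next
  fix U \<phi> \<psi> assume U: "zopen C U" and \<phi>: "\<phi> \<in> jet_aut_sections C m U" and \<psi>: "\<psi> \<in> jet_aut_sections C m U"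
  note c = aut_sheaf_mult_closed[OF \<phi> \<psi>]
  have a: "affine_of_aut C m U \<phi> \<in> carrier (gsec (affine_sheaf C) U)" if "\<phi> \<in> jet_aut_sections C m U" for \<phi>
    unfolding affine_sheaf_simps(1)[OF U]
    by (simp add: affine_of_aut_def aut_mu_tangent[OF U m that] xi_regular[OF U m that] xi_nonzero[OF U m that])
  note D = affine_sheaf_simps(1)[OF U, THEN iffD1]
  show "affine_of_aut C m U (\<phi> \<otimes>\<^bsub>gsec (aut_sheaf C m) U\<^esub> \<psi>) =
      affine_of_aut C m U \<phi> \<otimes>\<^bsub>gsec (affine_sheaf C) U\<^esub> affine_of_aut C m U \<psi>"
  proof (rule affine_eqI[where C = C and U = U])
    fix V f p assume V: "zopen C V" "V \<subseteq> U" and f: "regular C V f" and p: "p \<in> V"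
    show "fst (affine_of_aut C m U (\<phi> \<otimes>\<^bsub>gsec (aut_sheaf C m) U\<^esub> \<psi>)) V f p =
        fst (affine_of_aut C m U \<phi> \<otimes>\<^bsub>gsec (affine_sheaf C) U\<^esub> affine_of_aut C m U \<psi>) V f p"
      using V f p by (simp add: affine_of_aut_def affine_sheaf_simps(2) aut_mu_mult[OF U m \<phi> \<psi> V f p])
  next
    fix p assume p: "p \<in> U"
    then show "snd (affine_of_aut C m U (\<phi> \<otimes>\<^bsub>gsec (aut_sheaf C m) U\<^esub> \<psi>)) p =
        snd (affine_of_aut C m U \<phi> \<otimes>\<^bsub>gsec (affine_sheaf C) U\<^esub> affine_of_aut C m U \<psi>) p"
      by (simp add: affine_of_aut_def affine_sheaf_simps(2) xi_mult[OF U m \<phi> \<psi> p])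
  qed (use D[OF a[OF c]] D[OF affine_mult_closed[OF U a[OF \<phi>] a[OF \<psi>]]] in auto)
next
  fix U V \<phi> assume U: "zopen C U" and V: "zopen C V" "V \<subseteq> U" and \<phi>: "\<phi> \<in> jet_aut_sections C m U"
  show "affine_of_aut C m V (gres (aut_sheaf C m) U V \<phi>) = gres (affine_sheaf C) U V (affine_of_aut C m U \<phi>)"
    unfolding affine_sheaf_simps(4)
    by (simp add: affine_of_aut_def xi_restrict[OF U m \<phi> V] aut_mu_restrict[OF U m \<phi> V])
qed

lemma snd_affine_hom: "group_presheaf_hom C (affine_sheaf C) (units_sheaf C) (\<lambda>U. snd)"
  by (intro group_presheaf_hom.intro affine_group_presheaf units_group_presheaf group_presheaf_hom_axioms.intro)
     (simp_all add: affine_sheaf_simps)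

lemma xi_hom:
  assumes m: "m \<ge> 2"
  shows "group_presheaf_hom C (aut_sheaf C m) (units_sheaf C) (xi m)"
proof -
  interpret group_presheaf_hom C "aut_sheaf C m" "affine_sheaf C" "affine_of_aut C m"
    by (rule affine_of_aut_hom[OF m])
  interpret s: group_presheaf_hom C "affine_sheaf C" "units_sheaf C" "\<lambda>U. snd"
    by (rule snd_affine_hom)
  have xi: "xi m U \<phi> = snd (affine_of_aut C m U \<phi>)" for U \<phi>
    by (simp add: affine_of_aut_def)
  show ?thesis
    by (intro group_presheaf_hom.intro aut_group_presheaf units_group_presheaf group_presheaf_hom_axioms.intro;
        simp only: xi hom_closed s.hom_closed hom_mult s.hom_mult hom_res s.hom_res)
qed

lemma power_hom: "group_presheaf_hom C (units_sheaf C) (units_sheaf C) (\<lambda>U \<nu>. \<nu> [^]\<^bsub>gsec (units_sheaf C) U\<^esub> (k::nat))"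
proof (intro group_presheaf_hom.intro units_group_presheaf group_presheaf_hom_axioms.intro)
  fix U x assume U: "zopen C U" and x: "x \<in> carrier (gsec (units_sheaf C) U)"
  then show "x [^]\<^bsub>gsec (units_sheaf C) U\<^esub> k \<in> carrier (gsec (units_sheaf C) U)"
    by (simp add: pow_units_struct_sheaf regular_power)
next
  fix U x y assume U: "zopen C U" and xy: "x \<in> carrier (gsec (units_sheaf C) U)" "y \<in> carrier (gsec (units_sheaf C) U)"
  then show "(x \<otimes>\<^bsub>gsec (units_sheaf C) U\<^esub> y) [^]\<^bsub>gsec (units_sheaf C) U\<^esub> k =
      x [^]\<^bsub>gsec (units_sheaf C) U\<^esub> k \<otimes>\<^bsub>gsec (units_sheaf C) U\<^esub> y [^]\<^bsub>gsec (units_sheaf C) U\<^esub> k"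
    by (auto simp: pow_units_struct_sheaf regular_mult power_mult_distrib intro!: restrict_ext)
next
  fix U V x assume U: "zopen C U" and V: "zopen C V" "V \<subseteq> U" and x: "x \<in> carrier (gsec (units_sheaf C) U)"
  then show "gres (units_sheaf C) U V x [^]\<^bsub>gsec (units_sheaf C) V\<^esub> k = gres (units_sheaf C) U V (x [^]\<^bsub>gsec (units_sheaf C) U\<^esub> k)"
    by (auto simp: pow_units_struct_sheaf regular_restrict[of C U] fun_eq_iff)
qed

text \<open>The representation of the affine group on \<open>T \<oplus> O\<close> that occurs both in the conjugation action
  and in the transition functions of the extension.\<close>

definition affine_act :: "'n::finite pt set \<Rightarrow> 'n pt set \<Rightarrow> 'n vfield \<times> ('n pt \<Rightarrow> complex) \<Rightarrow>
    'n vfield \<times> ('n pt \<Rightarrow> complex) \<Rightarrow> 'n vfield \<times> ('n pt \<Rightarrow> complex)"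
  where "affine_act C U a z = (vfield C U (\<lambda>V f p. fst z V f p - snd z p * fst a V f p / snd a p), \<lambda>p\<in>U. snd z p / snd a p)"

abbreviation TO_sections :: "'n::finite pt set \<Rightarrow> 'n pt set \<Rightarrow> ('n vfield \<times> ('n pt \<Rightarrow> complex)) set"
  where "TO_sections C U \<equiv> carrier (msec (tangent_plus_structure C) U)"

lemma affine_act_closed:
  assumes U: "zopen C U" and a: "a \<in> carrier (gsec (affine_sheaf C) U)" and z: "z \<in> TO_sections C U"
  shows "affine_act C U a z \<in> TO_sections C U"
proof -
  note D = a[unfolded affine_sheaf_simps(1)[OF U]] z[unfolded tangent_plus_structure_simps]
  have i: "regular C U (\<lambda>p\<in>U. inverse (snd a p))"
    using D by (intro regular_inverse) auto
  have q: "regular C U (\<lambda>p\<in>U. snd z p * (\<lambda>p\<in>U. inverse (snd a p)) p)"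
    using D by (intro regular_mult[OF _ i]) auto
  have "vfield C U (\<lambda>V f p. (\<lambda>p\<in>U. 1) p * fst z V f p + (\<lambda>p\<in>U. - (\<lambda>p\<in>U. snd z p * (\<lambda>p\<in>U. inverse (snd a p)) p) p) p * fst a V f p)
      \<in> tangent_sections C U"
    using D by (intro tangent_lincomb[OF U _ _ regular_const[OF U] regular_uminus[OF U q]]) auto
  also have "vfield C U (\<lambda>V f p. (\<lambda>p\<in>U. 1) p * fst z V f p + (\<lambda>p\<in>U. - (\<lambda>p\<in>U. snd z p * (\<lambda>p\<in>U. inverse (snd a p)) p) p) p * fst a V f p)
      = vfield C U (\<lambda>V f p. fst z V f p - snd z p * fst a V f p / snd a p)"
    by (rule vfield_cong) (auto simp: divide_inverse)
  finally have "vfield C U (\<lambda>V f p. fst z V f p - snd z p * fst a V f p / snd a p) \<in> tangent_sections C U" .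
  moreover have "regular C U (\<lambda>p\<in>U. snd z p / snd a p)"
    using q by (rule regular_cong) (auto simp: divide_inverse intro!: restrict_ext)
  ultimately show ?thesis
    by (simp add: affine_act_def tangent_plus_structure_simps)
qed

lemma affine_act_mult:
  assumes U: "zopen C U" and a: "a \<in> carrier (gsec (affine_sheaf C) U)" and b: "b \<in> carrier (gsec (affine_sheaf C) U)"
  shows "affine_act C U (a \<otimes>\<^bsub>gsec (affine_sheaf C) U\<^esub> b) z = affine_act C U a (affine_act C U b z)"
proof -
  have nz: "snd a p \<noteq> 0" "snd b p \<noteq> 0" if "p \<in> U" for p
    using a b that by (auto simp: affine_sheaf_simps(1)[OF U])
  show ?thesis
    unfolding affine_act_def affine_sheaf_simps(2) fst_conv snd_conv
  proof (intro arg_cong2[where f = Pair] vfield_cong restrict_ext)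
    fix V f p assume *: "zopen C V" "V \<subseteq> U" "regular C V f" "p \<in> V"
    then have p: "p \<in> U" by blast
    show "fst z V f p - snd z p * vfield C U (\<lambda>V f p. fst a V f p + snd a p * fst b V f p) V f p / (\<lambda>p\<in>U. snd a p * snd b p) p
      = vfield C U (\<lambda>V f p. fst z V f p - snd z p * fst b V f p / snd b p) V f p - (\<lambda>p\<in>U. snd z p / snd b p) p * fst a V f p / snd a p"
      using * p nz[OF p] by (simp add: field_simps)
  qed auto
qed

lemma affine_act_one:
  assumes z: "z \<in> TO_sections C U"
  shows "affine_act C U \<one>\<^bsub>gsec (affine_sheaf C) U\<^esub> z = z"
proof (rule prod_eqI)
  note D = z[unfolded tangent_plus_structure_simps]
  have eq: "fst (affine_act C U \<one>\<^bsub>gsec (affine_sheaf C) U\<^esub> z) = vfield C U (fst z)"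
    unfolding affine_act_def affine_sheaf_simps(3) fst_conv snd_conv by (rule vfield_cong) auto
  have "vfield C U (fst z) \<in> tangent_sections C U"
    using D by (intro vfield_tangentI) (auto simp: tangentD[of "fst z" C U] tangent_restrict[of "fst z" C U] regular_eta[where C = C])
  then show "fst (affine_act C U \<one>\<^bsub>gsec (affine_sheaf C) U\<^esub> z) = fst z"
    unfolding eq using D by (intro tangent_eqI[where C = C and U = U]) auto
  show "snd (affine_act C U \<one>\<^bsub>gsec (affine_sheaf C) U\<^esub> z) = snd z"
    unfolding affine_act_def affine_sheaf_simps(3) fst_conv snd_conv
    using regular_eta[of C U "snd z"] D by (auto cong: restrict_cong)
qed

section \<open>The kernel of the restriction to the previous level\<close>

definition top_coeff :: "'n::finite vfield \<times> ('n pt \<Rightarrow> complex) \<Rightarrow> 'n pt set \<Rightarrow> 'n jet \<Rightarrow> 'n pt \<Rightarrow> complex"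
  where "top_coeff z V x = (\<lambda>p\<in>V. fst z V (x 0) p + snd z p * x 1 p)"

context
  fixes C :: "'n::finite pt set" and U :: "'n pt set" and n :: nat
  assumes U: "zopen C U" and n: "n \<ge> 3"
begin

lemma kernel_iso_apply:
  "\<lbrakk>zopen C V; V \<subseteq> U; x \<in> carrier (jets C n V); k < n; p \<in> V\<rbrakk> \<Longrightarrow>
    kernel_iso C n U z V x k p = x k p + (if k = n - 1 then top_coeff z V x p else 0)"
  by (simp add: kernel_iso_def case_prod_unfold top_coeff_def)

context
  fixes z :: "'n vfield \<times> ('n pt \<Rightarrow> complex)"
  assumes z: "z \<in> TO_sections C U"
begin

lemma z_parts: "fst z \<in> tangent_sections C U" "regular C U (snd z)"
  using z by (simp_all add: tangent_plus_structure_simps)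

lemma top_coeff_regular:
  assumes V: "zopen C V" "V \<subseteq> U" and x: "x \<in> carrier (jets C n V)"
  shows "regular C V (top_coeff z V x)"
proof -
  have x01: "regular C V (x 0)" "regular C V (x 1)"
    using n by (auto intro: jets_regular[OF x])
  have "regular C V (\<lambda>p\<in>V. fst z V (x 0) p + (\<lambda>p\<in>V. restrict (snd z) V p * x 1 p) p)"
    by (rule regular_add[OF tangentD(1)[OF z_parts(1) V x01(1)] regular_mult[OF regular_restrict[OF z_parts(2) V] x01(2)]])
  then show ?thesis
    by (rule regular_cong) (auto simp: top_coeff_def intro!: restrict_ext)
qed

lemma kernel_iso_eq:
  assumes V: "zopen C V" "V \<subseteq> U" and x: "x \<in> carrier (jets C n V)"
  shows "kernel_iso C n U z V x = x \<oplus>\<^bsub>jets C n V\<^esub> jet_term V n (n - 1) (top_coeff z V x)"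
  using V x unfolding jets_ops kernel_iso_def jet_term_def
  by (auto simp: case_prod_unfold top_coeff_def intro!: restrict_ext)

lemma kernel_iso_closed:
  assumes V: "zopen C V" "V \<subseteq> U" and x: "x \<in> carrier (jets C n V)"
  shows "kernel_iso C n U z V x \<in> carrier (jets C n V)"
  unfolding kernel_iso_eq[OF assms]
  by (intro jets_add_closed V(1) x jet_term_closed top_coeff_regular V)

lemma kernel_iso_01:
  assumes V: "zopen C V" "V \<subseteq> U" and x: "x \<in> carrier (jets C n V)"
  shows "kernel_iso C n U z V x 0 = x 0" "kernel_iso C n U z V x 1 = x 1"
proof -
  have "kernel_iso C n U z V x k = x k" if "k < 2" for k
    using that n
    by (intro regular_ext[OF jets_regular[OF kernel_iso_closed[OF V x]] jets_regular[OF x]])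
       (auto simp: kernel_iso_apply[OF V x])
  from this[of 0] this[of 1] show "kernel_iso C n U z V x 0 = x 0" "kernel_iso C n U z V x 1 = x 1"
    by auto
qed

lemma top_coeff_mult:
  assumes V: "zopen C V" "V \<subseteq> U" and x: "x \<in> carrier (jets C n V)" and y: "y \<in> carrier (jets C n V)" and p: "p \<in> V"
  shows "top_coeff z V (x \<otimes>\<^bsub>jets C n V\<^esub> y) p = x 0 p * top_coeff z V y p + y 0 p * top_coeff z V x p"
proof -
  have r: "regular C V (x 0)" "regular C V (y 0)"
    using n by (auto intro: jets_regular[OF x] jets_regular[OF y])
  have 0: "(x \<otimes>\<^bsub>jets C n V\<^esub> y) 0 = (\<lambda>p\<in>V. x 0 p * y 0 p)"
    using n by (simp add: jets_ops)
  have 1: "(x \<otimes>\<^bsub>jets C n V\<^esub> y) 1 p = x 0 p * y 1 p + x 1 p * y 0 p"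
    using n p by (simp add: jets_ops)
  show ?thesis
    unfolding top_coeff_def 0 1 restrict_apply'[OF p] using tangentD(4)[OF z_parts(1) V r] p
    by (simp add: algebra_simps 1[unfolded One_nat_def])
qed

lemma top_coeff_add:
  assumes V: "zopen C V" "V \<subseteq> U" and x: "x \<in> carrier (jets C n V)" and y: "y \<in> carrier (jets C n V)" and p: "p \<in> V"
  shows "top_coeff z V (x \<oplus>\<^bsub>jets C n V\<^esub> y) p = top_coeff z V x p + top_coeff z V y p"
proof -
  have r: "regular C V (x 0)" "regular C V (y 0)"
    using n by (auto intro: jets_regular[OF x] jets_regular[OF y])
  have 0: "(x \<oplus>\<^bsub>jets C n V\<^esub> y) 0 = (\<lambda>p\<in>V. x 0 p + y 0 p)"
    using n by (simp add: jets_ops)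
  have 1: "(x \<oplus>\<^bsub>jets C n V\<^esub> y) 1 p = x 1 p + y 1 p"
    using n p by (simp add: jets_ops)
  show ?thesis
    unfolding top_coeff_def 0 1 restrict_apply'[OF p] using tangentD(3)[OF z_parts(1) V r] p
    by (simp add: algebra_simps 1[unfolded One_nat_def])
qed

text \<open>Multiplicativity is the product rule for \<open>x \<mapsto> \<theta>(x\<^sub>0) + \<beta> x\<^sub>1\<close>, with values in \<open>O\<close> regarded as a
  module over jets through the constant coefficient.  The correction terms of two factors do not
  interact, since \<open>2 (n - 1)\<close> exceeds the degrees present.\<close>

lemma kernel_iso_mult:
  assumes V: "zopen C V" "V \<subseteq> U" and x: "x \<in> carrier (jets C n V)" and y: "y \<in> carrier (jets C n V)"
  shows "kernel_iso C n U z V (x \<otimes>\<^bsub>jets C n V\<^esub> y) = kernel_iso C n U z V x \<otimes>\<^bsub>jets C n V\<^esub> kernel_iso C n U z V y"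
proof (rule jets_eqI)
  note xy = jets_mult_closed[OF V(1) x y]
  show "kernel_iso C n U z V (x \<otimes>\<^bsub>jets C n V\<^esub> y) \<in> carrier (jets C n V)"
    "kernel_iso C n U z V x \<otimes>\<^bsub>jets C n V\<^esub> kernel_iso C n U z V y \<in> carrier (jets C n V)"
    using V x y xy by (auto intro: kernel_iso_closed jets_mult_closed)
  fix k p assume k: "k < n" and p: "p \<in> V"
  let ?X = "top_coeff z V x p" and ?Y = "top_coeff z V y p"
  have "(kernel_iso C n U z V x \<otimes>\<^bsub>jets C n V\<^esub> kernel_iso C n U z V y) k p
      = (\<Sum>i\<le>k. (x i p + (if i = n - 1 then ?X else 0)) * (y (k - i) p + (if k - i = n - 1 then ?Y else 0)))"
    using k p by (auto simp: jets_ops kernel_iso_apply[OF V x] kernel_iso_apply[OF V y] intro!: sum.cong)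
  also have "\<dots> = (\<Sum>i\<le>k. x i p * y (k - i) p + ((if i = n - 1 then (if k = n - 1 then ?X * y 0 p else 0) else 0)
      + (if i = 0 then (if k = n - 1 then x 0 p * ?Y else 0) else 0)))"
  proof (rule sum.cong)
    fix i assume i: "i \<in> {..k}"
    consider "i = n - 1" | "i \<noteq> n - 1" "k - i = n - 1" | "i \<noteq> n - 1" "k - i \<noteq> n - 1"
      by blast
    then show "(x i p + (if i = n - 1 then ?X else 0)) * (y (k - i) p + (if k - i = n - 1 then ?Y else 0))
      = x i p * y (k - i) p + ((if i = n - 1 then (if k = n - 1 then ?X * y 0 p else 0) else 0)
      + (if i = 0 then (if k = n - 1 then x 0 p * ?Y else 0) else 0))"
    proof cases
      case 1
      then have "k = n - 1" "k - i = 0" "i \<noteq> 0" "n - 1 \<noteq> 0" using i k n by auto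
      then show ?thesis using 1 by (simp add: distrib_right)
    next
      case 2
      then have "i = 0" "k = n - 1" "n - 1 \<noteq> 0" using i k n by auto
      then show ?thesis by (simp add: distrib_left)
    next
      case 3
      then have "i = 0 \<longrightarrow> k \<noteq> n - 1" by auto
      then show ?thesis using 3 by simp
    qed
  qed simp
  also have "\<dots> = (\<Sum>i\<le>k. x i p * y (k - i) p) + (if k = n - 1 then x 0 p * ?Y + y 0 p * ?X else 0)"
    by (simp add: sum.distrib sum.delta)
  also have "\<dots> = kernel_iso C n U z V (x \<otimes>\<^bsub>jets C n V\<^esub> y) k p"
    unfolding kernel_iso_apply[OF V xy k p] top_coeff_mult[OF V x y p] using k p by (simp add: jets_ops(1))
  finally show "kernel_iso C n U z V (x \<otimes>\<^bsub>jets C n V\<^esub> y) k p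
      = (kernel_iso C n U z V x \<otimes>\<^bsub>jets C n V\<^esub> kernel_iso C n U z V y) k p"
    by simp
qed

lemma kernel_iso_add:
  assumes V: "zopen C V" "V \<subseteq> U" and x: "x \<in> carrier (jets C n V)" and y: "y \<in> carrier (jets C n V)"
  shows "kernel_iso C n U z V (x \<oplus>\<^bsub>jets C n V\<^esub> y) = kernel_iso C n U z V x \<oplus>\<^bsub>jets C n V\<^esub> kernel_iso C n U z V y"
proof (rule jets_eqI)
  note xy = jets_add_closed[OF V(1) x y]
  show "kernel_iso C n U z V (x \<oplus>\<^bsub>jets C n V\<^esub> y) \<in> carrier (jets C n V)"
    "kernel_iso C n U z V x \<oplus>\<^bsub>jets C n V\<^esub> kernel_iso C n U z V y \<in> carrier (jets C n V)"
    using V x y xy by (auto intro: kernel_iso_closed jets_add_closed)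
  fix k p assume k: "k < n" and p: "p \<in> V"
  then show "kernel_iso C n U z V (x \<oplus>\<^bsub>jets C n V\<^esub> y) k p
      = (kernel_iso C n U z V x \<oplus>\<^bsub>jets C n V\<^esub> kernel_iso C n U z V y) k p"
    unfolding kernel_iso_apply[OF V xy k p] top_coeff_add[OF V x y p]
    by (simp add: kernel_iso_apply[OF V x] kernel_iso_apply[OF V y] jets_ops(2))
qed

lemma kernel_iso_const:
  assumes V: "zopen C V" "V \<subseteq> U"
  shows "kernel_iso C n U z V (jet_const n V (\<lambda>p\<in>V. c)) = jet_const n V (\<lambda>p\<in>V. c)"
proof (rule jets_eqI)
  have r: "regular C V (\<lambda>p\<in>V. c)" by (rule regular_const[OF V(1)])
  note cc = jet_const_closed[OF V(1) r, of n]
  show "jet_const n V (\<lambda>p\<in>V. c) \<in> carrier (jets C n V)"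
    "kernel_iso C n U z V (jet_const n V (\<lambda>p\<in>V. c)) \<in> carrier (jets C n V)"
    using cc kernel_iso_closed[OF V cc] by auto
  fix k p assume k: "k < n" "p \<in> V"
  have "top_coeff z V (jet_const n V (\<lambda>p\<in>V. c)) p = fst z V (\<lambda>p\<in>V. c) p"
    using k n jet_const_0[OF r, of n] by (simp add: top_coeff_def) (simp add: jet_const_def)
  also have "\<dots> = 0"
    using tangentD(2)[OF z_parts(1) V] k by simp
  finally show "kernel_iso C n U z V (jet_const n V (\<lambda>p\<in>V. c)) k p = jet_const n V (\<lambda>p\<in>V. c) k p"
    using k by (simp add: kernel_iso_apply[OF V cc])
qed

end

lemma kernel_iso_inverse:
  assumes z: "z \<in> TO_sections C U" and z': "z' \<in> TO_sections C U"
    and neg: "\<And>V f p. zopen C V \<Longrightarrow> V \<subseteq> U \<Longrightarrow> regular C V f \<Longrightarrow> p \<in> V \<Longrightarrow> fst z' V f p = - fst z V f p"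
      "\<And>p. p \<in> U \<Longrightarrow> snd z' p = - snd z p"
    and V: "zopen C V" "V \<subseteq> U" and x: "x \<in> carrier (jets C n V)"
  shows "kernel_iso C n U z' V (kernel_iso C n U z V x) = x"
proof (rule jets_eqI)
  note c = kernel_iso_closed[OF z V x]
  show "kernel_iso C n U z' V (kernel_iso C n U z V x) \<in> carrier (jets C n V)" "x \<in> carrier (jets C n V)"
    by (rule kernel_iso_closed[OF z' V c], rule x)
  fix k p assume k: "k < n" and p: "p \<in> V"
  have "regular C V (x 0)"
    using n by (auto intro: jets_regular[OF x])
  then have "top_coeff z' V (kernel_iso C n U z V x) p = - top_coeff z V x p"
    using p V(2) neg(1)[OF V, of "x 0" p] neg(2)[of p] kernel_iso_01[OF z V x] by (auto simp: top_coeff_def)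
  then show "kernel_iso C n U z' V (kernel_iso C n U z V x) k p = x k p"
    using k p by (simp add: kernel_iso_apply[OF V x] kernel_iso_apply[OF V c])
qed

lemma kernel_iso_aut:
  assumes z: "z \<in> TO_sections C U"
  shows "kernel_iso C n U z \<in> jet_aut_sections C n U"
proof (rule aut_sheafI)
  show "kernel_iso C n U z \<in> extensional (opens C U)"
    by (simp add: kernel_iso_def case_prod_unfold)
  fix V assume V: "zopen C V" "V \<subseteq> U"
  define z' where "z' = (vfield C U (\<lambda>V f p. - fst z V f p), \<lambda>p\<in>U. - snd z p)"
  have "vfield C U (\<lambda>V f p. (\<lambda>p\<in>U. -1) p * fst z V f p + (\<lambda>p\<in>U. 0) p * fst z V f p) \<in> tangent_sections C U"
    using z_parts[OF z] by (intro tangent_lincomb[OF U _ _ regular_const[OF U] regular_const[OF U]])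
  also have "vfield C U (\<lambda>V f p. (\<lambda>p\<in>U. -1) p * fst z V f p + (\<lambda>p\<in>U. 0) p * fst z V f p) = fst z'"
    unfolding z'_def fst_conv by (rule vfield_cong) auto
  finally have z': "z' \<in> TO_sections C U"
    using regular_uminus[OF U z_parts(2)[OF z]] by (simp add: tangent_plus_structure_simps) (simp add: z'_def)
  show "kernel_iso C n U z V \<in> jet_auts C n V"
  proof (rule jet_autsI[OF V(1)])
    show "kernel_iso C n U z V \<in> extensional (carrier (jets C n V))"
      using V by (simp add: kernel_iso_def case_prod_unfold)
    show "bij_betw (kernel_iso C n U z V) (carrier (jets C n V)) (carrier (jets C n V))"
    proof (rule bij_betw_byWitness[where f' = "kernel_iso C n U z' V"])
      show "\<forall>x\<in>carrier (jets C n V). kernel_iso C n U z' V (kernel_iso C n U z V x) = x"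
        by (intro ballI kernel_iso_inverse[OF z z' _ _ V]) (auto simp: z'_def)
      show "\<forall>x\<in>carrier (jets C n V). kernel_iso C n U z V (kernel_iso C n U z' V x) = x"
        by (intro ballI kernel_iso_inverse[OF z' z _ _ V]) (auto simp: z'_def)
    qed (auto intro: kernel_iso_closed[OF z V] kernel_iso_closed[OF z' V])
    show "kernel_iso C n U z V \<one>\<^bsub>jets C n V\<^esub> = \<one>\<^bsub>jets C n V\<^esub>"
    proof -
      have "\<one>\<^bsub>jets C n V\<^esub> = jet_const n V (\<lambda>p\<in>V. 1)"
        unfolding jets_ops jet_const_def by (intro restrict_ext) auto
      then show ?thesis
        using kernel_iso_const[OF z V, of 1] by simp
    qed
  qed (simp_all add: kernel_iso_mult[OF z V] kernel_iso_add[OF z V] kernel_iso_const[OF z V] kernel_iso_01(1)[OF z V])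
  fix W x assume W: "zopen C W" "W \<subseteq> V" and x: "x \<in> carrier (jets C n V)"
  have WU: "W \<subseteq> U" using W V by blast
  note rx = jet_res_closed[OF W x]
  show "jet_res n W (kernel_iso C n U z V x) = kernel_iso C n U z W (jet_res n W x)"
  proof (rule jets_eqI[OF jet_res_closed[OF W kernel_iso_closed[OF z V x]] kernel_iso_closed[OF z W(1) WU rx]])
    fix k p assume k: "k < n" and p: "p \<in> W"
    have pV: "p \<in> V" using p W by blast
    have r: "regular C V (x 0)" using n by (auto intro: jets_regular[OF x])
    have top: "top_coeff z W (jet_res n W x) p = top_coeff z V x p"
      using p pV n tangent_restrict[OF z_parts(1)[OF z] V W r p] by (simp add: top_coeff_def jet_res_def)
    show "jet_res n W (kernel_iso C n U z V x) k p = kernel_iso C n U z W (jet_res n W x) k p"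
      unfolding kernel_iso_apply[OF W(1) WU rx k p] top
      using k p pV by (simp add: kernel_iso_apply[OF V x] jet_res_def)
  qed
qed

text \<open>The field \<open>\<theta>\<close> is recovered from the values on constant jets, and \<open>\<beta>\<close> from the value on \<open>t\<close>.\<close>

lemma kernel_iso_inj:
  assumes y: "y \<in> TO_sections C U" and z: "z \<in> TO_sections C U" and eq: "kernel_iso C n U y = kernel_iso C n U z"
  shows "y = z"
proof (rule affine_eqI[where C = C and U = U])
  have top: "top_coeff y V x p = top_coeff z V x p"
    if V: "zopen C V" "V \<subseteq> U" and x: "x \<in> carrier (jets C n V)" and p: "p \<in> V" for V x p
  proof -
    have "kernel_iso C n U y V x (n - 1) p = kernel_iso C n U z V x (n - 1) p"
      by (simp add: eq)
    then show ?thesis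
      using n p by (simp add: kernel_iso_apply[OF V x])
  qed
  fix V f p assume V: "zopen C V" "V \<subseteq> U" and f: "regular C V f" and p: "p \<in> V"
  have c1: "jet_const n V f 1 p = 0"
    using n p by (simp add: jet_const_def)
  show "fst y V f p = fst z V f p"
    using top[OF V jet_const_closed[OF V(1) f] p] p n jet_const_0[OF f, of n] c1
    by (simp add: top_coeff_def)
next
  fix p assume p: "p \<in> U"
  have t1: "jet_t n U 1 p = 1"
    using n p by (simp add: jet_t_def)
  have "kernel_iso C n U y U (jet_t n U) (n - 1) p = kernel_iso C n U z U (jet_t n U) (n - 1) p"
    by (simp add: eq)
  then have "top_coeff y U (jet_t n U) p = top_coeff z U (jet_t n U) p"
    using n p by (simp add: kernel_iso_apply[OF U subset_refl jet_t_closed[OF U]])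
  then show "snd y p = snd z p"
    using p n t1 jet_t_0[of n U] tangentD(2)[OF z_parts(1)[OF y] U subset_refl] tangentD(2)[OF z_parts(1)[OF z] U subset_refl]
    by (simp add: top_coeff_def)
qed (use z_parts[OF y] z_parts[OF z] in auto)

text \<open>Conjugation acts on the kernel through the image of \<open>\<phi>\<close> in the affine group, twisted by the
  power \<open>\<nu>\<^sup>n\<^sup>-\<^sup>1\<close> that \<open>\<phi>\<close> produces on \<open>t\<^sup>n\<^sup>-\<^sup>1\<close>.\<close>

lemma conj_action_eq:
  assumes \<phi>: "\<phi> \<in> jet_aut_sections C n U" and z: "z \<in> TO_sections C U"
  shows "conj_action C n U \<phi> z =
    (\<lambda>p\<in>U. xi n U \<phi> p ^ (n - 1)) \<odot>\<^bsub>msec (tangent_plus_structure C) U\<^esub> affine_act C U (affine_of_aut C n U \<phi>) z"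
    (is "_ = ?y")
proof -
  interpret sheaf_of_modules C "tangent_plus_structure C"
    by (rule tangent_plus_structure_sheaf)
  interpret G: group "gsec (aut_sheaf C n) U"
    by (rule aut_sheaf_group[OF U])
  have m: "n \<ge> 2" using n by simp
  interpret hom: group_presheaf_hom C "aut_sheaf C n" "affine_sheaf C" "affine_of_aut C n"
    by (rule affine_of_aut_hom[OF m])
  let ?\<nu> = "xi n U \<phi>" and ?\<mu> = "aut_mu C n U \<phi>"
  have y: "?y \<in> TO_sections C U"
    by (intro smult_closed U regular_power xi_regular m \<phi> affine_act_closed hom.hom_closed z)
  have k: "kernel_iso C n U ?y \<otimes>\<^bsub>gsec (aut_sheaf C n) U\<^esub> \<phi> = \<phi> \<otimes>\<^bsub>gsec (aut_sheaf C n) U\<^esub> kernel_iso C n U z"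
  proof (rule aut_sheaf_eqI)
    show "kernel_iso C n U ?y \<otimes>\<^bsub>gsec (aut_sheaf C n) U\<^esub> \<phi> \<in> jet_aut_sections C n U"
      "\<phi> \<otimes>\<^bsub>gsec (aut_sheaf C n) U\<^esub> kernel_iso C n U z \<in> jet_aut_sections C n U"
      by (rule aut_sheaf_mult_closed[OF kernel_iso_aut[OF y] \<phi>], rule aut_sheaf_mult_closed[OF \<phi> kernel_iso_aut[OF z]])
    fix V x assume V: "zopen C V" "V \<subseteq> U" and x: "x \<in> carrier (jets C n V)"
    note \<phi>x = aut_sheaf_closed[OF \<phi> V x] and kz = kernel_iso_closed[OF z V x]
    have x0: "regular C V (x 0)" using n by (auto intro: jets_regular[OF x])
    let ?w = "top_coeff z V x"
    note w = top_coeff_regular[OF z V x]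
    note T = jet_term_closed[OF V(1) w, of n "n - 1"]
    have "kernel_iso C n U ?y V (\<phi> V x) = \<phi> V (kernel_iso C n U z V x)"
    proof (rule jets_eqI[OF kernel_iso_closed[OF y V \<phi>x] aut_sheaf_closed[OF \<phi> V kz]])
      fix k p assume k: "k < n" and p: "p \<in> V"
      have pU: "p \<in> U" using p V by blast
      have nz: "?\<nu> p \<noteq> 0" by (rule xi_nonzero[OF U m \<phi> pU])
      have "top_coeff ?y V (\<phi> V x) p = fst ?y V (x 0) p + snd ?y p * (?\<mu> V (x 0) p + ?\<nu> p * x 1 p)"
        using p by (simp add: top_coeff_def aut_coeff0[OF \<phi> V x] aut_coeff1[OF U m \<phi> V x p, unfolded One_nat_def])
      also have "fst ?y V (x 0) p = ?\<nu> p ^ (n - 1) * (fst z V (x 0) p - snd z p * ?\<mu> V (x 0) p / ?\<nu> p)"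
        using V x0 p pU by (simp add: tangent_plus_structure_simps affine_act_def affine_of_aut_def)
      also have "snd ?y p = ?\<nu> p ^ (n - 1) * (snd z p / ?\<nu> p)"
        using pU by (simp add: tangent_plus_structure_simps affine_act_def affine_of_aut_def)
      also have "?\<nu> p ^ (n - 1) * (fst z V (x 0) p - snd z p * ?\<mu> V (x 0) p / ?\<nu> p) +
          ?\<nu> p ^ (n - 1) * (snd z p / ?\<nu> p) * (?\<mu> V (x 0) p + ?\<nu> p * x 1 p) = ?w p * ?\<nu> p ^ (n - 1)"
        using nz p by (simp add: top_coeff_def field_simps)
      finally have top: "top_coeff ?y V (\<phi> V x) p = ?w p * ?\<nu> p ^ (n - 1)" .
      have "\<phi> V (kernel_iso C n U z V x) k p = \<phi> V x k p + \<phi> V (jet_term V n (n - 1) ?w) k p"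
        unfolding kernel_iso_eq[OF z V x] jet_autsD(3)[OF V(1) aut_sheafD(2)[OF \<phi> V] x T]
        using k p by (simp add: jets_ops)
      also have "\<phi> V (jet_term V n (n - 1) ?w) k p = (if k = n - 1 then ?w p * ?\<nu> p ^ (n - 1) else 0)"
        using jet_aut_term[OF V(1) aut_sheafD(2)[OF \<phi> V] w m p, of "n - 1" k] k n xi_apply[OF U m \<phi> V p] by simp
      finally show "kernel_iso C n U ?y V (\<phi> V x) k p = \<phi> V (kernel_iso C n U z V x) k p"
        unfolding kernel_iso_apply[OF V \<phi>x k p] top by simp
    qed
    then show "(kernel_iso C n U ?y \<otimes>\<^bsub>gsec (aut_sheaf C n) U\<^esub> \<phi>) V x = (\<phi> \<otimes>\<^bsub>gsec (aut_sheaf C n) U\<^esub> kernel_iso C n U z) V x"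
      by (simp add: aut_sheaf_mult_apply[OF V x])
  qed
  have eq: "kernel_iso C n U ?y = \<phi> \<otimes>\<^bsub>gsec (aut_sheaf C n) U\<^esub> kernel_iso C n U z \<otimes>\<^bsub>gsec (aut_sheaf C n) U\<^esub> inv\<^bsub>gsec (aut_sheaf C n) U\<^esub> \<phi>"
    unfolding k[symmetric] by (simp only: G.m_assoc kernel_iso_aut[OF y] \<phi> G.inv_closed G.r_inv G.r_one)
  show ?thesis
    unfolding conj_action_def
  proof (rule the_equality)
    show "?y \<in> TO_sections C U \<and> kernel_iso C n U ?y = \<phi> \<otimes>\<^bsub>gsec (aut_sheaf C n) U\<^esub> kernel_iso C n U z
        \<otimes>\<^bsub>gsec (aut_sheaf C n) U\<^esub> inv\<^bsub>gsec (aut_sheaf C n) U\<^esub> \<phi>"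
      using y eq by (rule conjI)
    fix y' assume y': "y' \<in> TO_sections C U \<and> kernel_iso C n U y' = \<phi> \<otimes>\<^bsub>gsec (aut_sheaf C n) U\<^esub> kernel_iso C n U z
        \<otimes>\<^bsub>gsec (aut_sheaf C n) U\<^esub> inv\<^bsub>gsec (aut_sheaf C n) U\<^esub> \<phi>"
    show "y' = ?y"
      by (rule kernel_iso_inj[OF conjunct1[OF y'] y]) (simp only: conjunct2[OF y'] eq)
  qed
qed

end

section \<open>Cohomologous cocycles\<close>

text \<open>The relation \<open>g\<^sub>a\<^sub>b = h\<^sub>a g'\<^sub>a\<^sub>b h\<^sub>b\<^sup>-\<^sup>1\<close>, without inverses and on every smaller open set.\<close>

definition coh_data ::
  "'n::finite pt set \<Rightarrow> ('n pt, 'g) group_sheaf \<Rightarrow> ('i, 'n pt, 'g) cochain \<Rightarrow> ('j, 'n pt, 'g) cochain \<Rightarrow>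
    ('n pt \<Rightarrow> 'n pt set) \<Rightarrow> ('n pt \<Rightarrow> 'i) \<Rightarrow> ('n pt \<Rightarrow> 'j) \<Rightarrow> ('n pt \<Rightarrow> 'g) \<Rightarrow> bool"
  where "coh_data C S c c' W a b h \<longleftrightarrow>
    (\<forall>x\<in>C. x \<in> W x \<and> zopen C (W x) \<and> W x \<subseteq> fst c (a x) \<and> W x \<subseteq> fst c' (b x) \<and> h x \<in> carrier (gsec S (W x))) \<and>
    (\<forall>x\<in>C. \<forall>y\<in>C. \<forall>Z. zopen C Z \<longrightarrow> Z \<subseteq> W x \<longrightarrow> Z \<subseteq> W y \<longrightarrow>
      gres S (fst c (a x) \<inter> fst c (a y)) Z (snd c (a x) (a y)) \<otimes>\<^bsub>gsec S Z\<^esub> gres S (W y) Z (h y) =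
      gres S (W x) Z (h x) \<otimes>\<^bsub>gsec S Z\<^esub> gres S (fst c' (b x) \<inter> fst c' (b y)) Z (snd c' (b x) (b y)))"

lemma coh_dataD:
  assumes "coh_data C S c c' W a b h" "x \<in> C"
  shows "x \<in> W x" "zopen C (W x)" "W x \<subseteq> fst c (a x)" "W x \<subseteq> fst c' (b x)" "h x \<in> carrier (gsec S (W x))"
    and "y \<in> C \<Longrightarrow> zopen C Z \<Longrightarrow> Z \<subseteq> W x \<Longrightarrow> Z \<subseteq> W y \<Longrightarrow>
      gres S (fst c (a x) \<inter> fst c (a y)) Z (snd c (a x) (a y)) \<otimes>\<^bsub>gsec S Z\<^esub> gres S (W y) Z (h y) =
      gres S (W x) Z (h x) \<otimes>\<^bsub>gsec S Z\<^esub> gres S (fst c' (b x) \<inter> fst c' (b y)) Z (snd c' (b x) (b y))"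
  using assms unfolding coh_data_def by blast+

lemma cocyclesD:
  assumes "c \<in> cocycles C S"
  shows "zopen C (fst c i)" "(\<Union>i. fst c i) = C" "snd c i j \<in> carrier (gsec S (fst c i \<inter> fst c j))"
    and "gres S (fst c i \<inter> fst c j) (fst c i \<inter> fst c j \<inter> fst c k) (snd c i j)
        \<otimes>\<^bsub>gsec S (fst c i \<inter> fst c j \<inter> fst c k)\<^esub> gres S (fst c j \<inter> fst c k) (fst c i \<inter> fst c j \<inter> fst c k) (snd c j k)
      = gres S (fst c i \<inter> fst c k) (fst c i \<inter> fst c j \<inter> fst c k) (snd c i k)"
  using assms unfolding cocycles_def by (auto simp: Let_def split: prod.splits)

context group_presheaf
begin

lemma cocycle_closed:
  assumes "c \<in> cocycles C S" "zopen C Z" "Z \<subseteq> fst c i" "Z \<subseteq> fst c j"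
  shows "gres S (fst c i \<inter> fst c j) Z (snd c i j) \<in> carrier (gsec S Z)"
  using assms cocyclesD[OF assms(1)] by (intro gres_closed) auto

lemma cocycle_on:
  assumes c: "c \<in> cocycles C S" and Z: "zopen C Z" "Z \<subseteq> fst c i" "Z \<subseteq> fst c j" "Z \<subseteq> fst c k"
  shows "gres S (fst c i \<inter> fst c j) Z (snd c i j) \<otimes>\<^bsub>gsec S Z\<^esub> gres S (fst c j \<inter> fst c k) Z (snd c j k)
    = gres S (fst c i \<inter> fst c k) Z (snd c i k)"
proof -
  let ?W = "fst c i \<inter> fst c j \<inter> fst c k"
  note o = cocyclesD(1)[OF c] and s = cocyclesD(3)[OF c]
  have o2: "zopen C (fst c i \<inter> fst c j)" for i j
    using o by blast
  have W: "zopen C ?W" "Z \<subseteq> ?W" "?W \<subseteq> fst c i \<inter> fst c j" "?W \<subseteq> fst c j \<inter> fst c k" "?W \<subseteq> fst c i \<inter> fst c k"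
    using o Z by auto
  note r = gres_gres[OF o2 W(1) Z(1) W(2) _ s]
  note cl = gres_closed[OF o2 W(1) _ s]
  show ?thesis
    unfolding r[OF W(3), symmetric] r[OF W(4), symmetric] r[OF W(5), symmetric]
      gres_mult[OF W(1) Z(1) W(2) cl[OF W(3)] cl[OF W(4)], symmetric] cocyclesD(4)[OF c] ..
qed

lemma cocycle_id:
  assumes c: "c \<in> cocycles C S" and Z: "zopen C Z" "Z \<subseteq> fst c i"
  shows "gres S (fst c i \<inter> fst c i) Z (snd c i i) = \<one>\<^bsub>gsec S Z\<^esub>"
proof -
  interpret Z: group "gsec S Z" by (rule sec_group[OF Z(1)])
  from cocycle_on[OF c Z Z(2) Z(2)] cocycle_closed[OF c Z Z(2)] show ?thesis
    by (simp add: Z.l_cancel_one)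
qed

lemma gres_inv:
  assumes "zopen C U" "zopen C V" "V \<subseteq> U" "x \<in> carrier (gsec S U)"
  shows "gres S U V (inv\<^bsub>gsec S U\<^esub> x) = inv\<^bsub>gsec S V\<^esub> gres S U V x"
proof -
  have "gres S U V \<in> hom (gsec S U) (gsec S V)"
    using gres_closed[OF assms(1-3)] gres_mult[OF assms(1-3)] by (intro homI) auto
  then interpret group_hom "gsec S U" "gsec S V" "gres S U V"
    using sec_group assms(1,2) by (simp add: group_hom_def group_hom_axioms_def)
  show ?thesis
    by (rule hom_inv[OF assms(4)])
qed

lemma cohomologousE:
  assumes "(c, c') \<in> cohomologous C S"
  obtains W a b h where "c \<in> cocycles C S" "c' \<in> cocycles C S" "coh_data C S c c' W a b h"
proof -
  obtain U g U' g' where cc: "c = (U, g)" "c' = (U', g')"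
    by (metis surj_pair)
  from assms have c: "c \<in> cocycles C S" "c' \<in> cocycles C S"
    unfolding cc cohomologous_def by auto
  from assms obtain W a b h where
    W: "\<forall>x\<in>C. x \<in> W x \<and> W x \<in> opens C (U (a x) \<inter> U' (b x)) \<and> h x \<in> carrier (gsec S (W x))" and
    rel: "\<forall>x\<in>C. \<forall>y\<in>C. let V = W x \<inter> W y in
             gres S (U (a x) \<inter> U (a y)) V (g (a x) (a y)) =
               gres S (W x) V (h x)
                 \<otimes>\<^bsub>gsec S V\<^esub> gres S (U' (b x) \<inter> U' (b y)) V (g' (b x) (b y))
                 \<otimes>\<^bsub>gsec S V\<^esub> inv\<^bsub>gsec S V\<^esub> (gres S (W y) V (h y))"
    unfolding cc cohomologous_def by auto
  note U = cocyclesD[OF c(1)] and U' = cocyclesD[OF c(2)]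
  have "coh_data C S c c' W a b h"
    unfolding coh_data_def
  proof (intro conjI ballI allI impI)
    fix x y Z assume xy: "x \<in> C" "y \<in> C" and Z: "zopen C Z" "Z \<subseteq> W x" "Z \<subseteq> W y"
    let ?V = "W x \<inter> W y"
    have o: "zopen C (W x)" "zopen C (W y)" "W x \<subseteq> U (a x)" "W x \<subseteq> U' (b x)" "W y \<subseteq> U (a y)" "W y \<subseteq> U' (b y)"
      and h: "h x \<in> carrier (gsec S (W x))" "h y \<in> carrier (gsec S (W y))"
      using W xy by auto
    have V: "zopen C ?V" "Z \<subseteq> ?V" "?V \<subseteq> W x" "?V \<subseteq> W y" "?V \<subseteq> U (a x)" "?V \<subseteq> U (a y)" "?V \<subseteq> U' (b x)" "?V \<subseteq> U' (b y)"
      "?V \<subseteq> U (a x) \<inter> U (a y)" "?V \<subseteq> U' (b x) \<inter> U' (b y)"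
      using o Z by auto
    have UU: "zopen C (U (a x) \<inter> U (a y))" "zopen C (U' (b x) \<inter> U' (b y))"
      using U(1) U'(1) by (auto simp: cc)
    interpret V: group "gsec S ?V" by (rule sec_group[OF V(1)])
    let ?g = "gres S (U (a x) \<inter> U (a y)) ?V (g (a x) (a y))" and ?g' = "gres S (U' (b x) \<inter> U' (b y)) ?V (g' (b x) (b y))"
      and ?hx = "gres S (W x) ?V (h x)" and ?hy = "gres S (W y) ?V (h y)"
    have cl: "?g \<in> carrier (gsec S ?V)" "?g' \<in> carrier (gsec S ?V)" "?hx \<in> carrier (gsec S ?V)" "?hy \<in> carrier (gsec S ?V)"
      using cocycle_closed[OF c(1) V(1)] cocycle_closed[OF c(2) V(1)] V gres_closed[OF o(1) V(1,3) h(1)] gres_closed[OF o(2) V(1,4) h(2)]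
      by (auto simp: cc)
    have "?g = ?hx \<otimes>\<^bsub>gsec S ?V\<^esub> ?g' \<otimes>\<^bsub>gsec S ?V\<^esub> inv\<^bsub>gsec S ?V\<^esub> ?hy"
      using rel xy by (simp add: Let_def)
    then have "?g \<otimes>\<^bsub>gsec S ?V\<^esub> ?hy = ?hx \<otimes>\<^bsub>gsec S ?V\<^esub> ?g'"
      using cl by (simp add: V.m_assoc)
    then have "gres S ?V Z (?g \<otimes>\<^bsub>gsec S ?V\<^esub> ?hy) = gres S ?V Z (?hx \<otimes>\<^bsub>gsec S ?V\<^esub> ?g')"
      by simp
    moreover note gres_mult[OF V(1) Z(1) V(2) cl(1,4)] gres_mult[OF V(1) Z(1) V(2) cl(3,2)]
      gres_gres[OF o(1) V(1) Z(1) V(2,3) h(1)] gres_gres[OF o(2) V(1) Z(1) V(2,4) h(2)]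
      gres_gres[OF UU(1) V(1) Z(1) V(2,9) U(3)[of "a x" "a y", unfolded cc fst_conv snd_conv]]
      gres_gres[OF UU(2) V(1) Z(1) V(2,10) U'(3)[of "b x" "b y", unfolded cc fst_conv snd_conv]]
    ultimately show "gres S (fst c (a x) \<inter> fst c (a y)) Z (snd c (a x) (a y)) \<otimes>\<^bsub>gsec S Z\<^esub> gres S (W y) Z (h y) =
      gres S (W x) Z (h x) \<otimes>\<^bsub>gsec S Z\<^esub> gres S (fst c' (b x) \<inter> fst c' (b y)) Z (snd c' (b x) (b y))"
      unfolding cc fst_conv snd_conv by simp
  qed (use W in \<open>auto simp: cc\<close>)
  with c show ?thesis
    by (rule that)
qed

lemma cohomologousI:
  assumes c: "c \<in> cocycles C S" "c' \<in> cocycles C S" and d: "coh_data C S c c' W a b h"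
  shows "(c, c') \<in> cohomologous C S"
proof -
  obtain U g U' g' where cc: "c = (U, g)" "c' = (U', g')"
    by (metis surj_pair)
  note D = coh_dataD[OF d, unfolded cc fst_conv snd_conv]
  have rel: "gres S (U (a x) \<inter> U (a y)) (W x \<inter> W y) (g (a x) (a y)) =
      gres S (W x) (W x \<inter> W y) (h x)
        \<otimes>\<^bsub>gsec S (W x \<inter> W y)\<^esub> gres S (U' (b x) \<inter> U' (b y)) (W x \<inter> W y) (g' (b x) (b y))
        \<otimes>\<^bsub>gsec S (W x \<inter> W y)\<^esub> inv\<^bsub>gsec S (W x \<inter> W y)\<^esub> (gres S (W y) (W x \<inter> W y) (h y))"
    if xy: "x \<in> C" "y \<in> C" for x y
  proof -
    let ?V = "W x \<inter> W y"
    have V: "zopen C ?V" "?V \<subseteq> W x" "?V \<subseteq> W y" "?V \<subseteq> U (a x)" "?V \<subseteq> U (a y)"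
      using D(2)[OF xy(1)] D(2)[OF xy(2)] D(3)[OF xy(1)] D(3)[OF xy(2)] by auto
    interpret V: group "gsec S ?V" by (rule sec_group[OF V(1)])
    have cl: "gres S (U (a x) \<inter> U (a y)) ?V (g (a x) (a y)) \<in> carrier (gsec S ?V)" "gres S (W y) ?V (h y) \<in> carrier (gsec S ?V)"
      using cocycle_closed[OF c(1) V(1), unfolded cc fst_conv snd_conv, OF V(4,5)] gres_closed[OF D(2)[OF xy(2)] V(1,3) D(5)[OF xy(2)]]
      by auto
    show ?thesis
      unfolding D(6)[OF xy V(1-3), symmetric] using cl by (simp add: V.m_assoc)
  qed
  have "\<exists>W a b h.
          (\<forall>x\<in>C. x \<in> W x \<and> W x \<in> opens C (U (a x) \<inter> U' (b x)) \<and> h x \<in> carrier (gsec S (W x))) \<and>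
          (\<forall>x\<in>C. \<forall>y\<in>C. let V = W x \<inter> W y in
             gres S (U (a x) \<inter> U (a y)) V (g (a x) (a y)) =
               gres S (W x) V (h x)
                 \<otimes>\<^bsub>gsec S V\<^esub> gres S (U' (b x) \<inter> U' (b y)) V (g' (b x) (b y))
                 \<otimes>\<^bsub>gsec S V\<^esub> inv\<^bsub>gsec S V\<^esub> (gres S (W y) V (h y)))"
    by (rule exI[of _ W], rule exI[of _ a], rule exI[of _ b], rule exI[of _ h])
       (use D(1-5) rel in \<open>simp add: Let_def\<close>)
  with c show ?thesis
    unfolding cc cohomologous_def mem_Collect_eq case_prod_conv by (intro conjI)
qed

lemma coh_data_sym:
  assumes c: "c \<in> cocycles C S" "c' \<in> cocycles C S" and d: "coh_data C S c c' W a b h"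
  shows "coh_data C S c' c W b a (\<lambda>x. inv\<^bsub>gsec S (W x)\<^esub> h x)"
  unfolding coh_data_def
proof (intro conjI ballI allI impI)
  note D = coh_dataD[OF d]
  fix x assume x: "x \<in> C"
  show "inv\<^bsub>gsec S (W x)\<^esub> h x \<in> carrier (gsec S (W x))"
    by (rule group.inv_closed[OF sec_group[OF D(2)[OF x]] D(5)[OF x]])
  fix y Z assume y: "y \<in> C" and Z: "zopen C Z" "Z \<subseteq> W x" "Z \<subseteq> W y"
  interpret Z: group "gsec S Z" by (rule sec_group[OF Z(1)])
  let ?g = "gres S (fst c (a x) \<inter> fst c (a y)) Z (snd c (a x) (a y))"
    and ?g' = "gres S (fst c' (b x) \<inter> fst c' (b y)) Z (snd c' (b x) (b y))"
    and ?hx = "gres S (W x) Z (h x)" and ?hy = "gres S (W y) Z (h y)"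
  have cl: "?g \<in> carrier (gsec S Z)" "?g' \<in> carrier (gsec S Z)" "?hx \<in> carrier (gsec S Z)" "?hy \<in> carrier (gsec S Z)"
    using Z D(3,4)[OF x] D(3,4)[OF y]
    by (auto intro!: cocycle_closed[OF c(1)] cocycle_closed[OF c(2)] gres_closed D(2,5) x y)
  have "?g' \<otimes>\<^bsub>gsec S Z\<^esub> inv\<^bsub>gsec S Z\<^esub> ?hy = inv\<^bsub>gsec S Z\<^esub> ?hx \<otimes>\<^bsub>gsec S Z\<^esub> (?hx \<otimes>\<^bsub>gsec S Z\<^esub> ?g') \<otimes>\<^bsub>gsec S Z\<^esub> inv\<^bsub>gsec S Z\<^esub> ?hy"
    using cl by (simp add: Z.m_assoc[symmetric])
  also have "\<dots> = inv\<^bsub>gsec S Z\<^esub> ?hx \<otimes>\<^bsub>gsec S Z\<^esub> ?g"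
    unfolding D(6)[OF x y Z, symmetric] using cl by (simp add: Z.m_assoc)
  finally show "?g' \<otimes>\<^bsub>gsec S Z\<^esub> gres S (W y) Z (inv\<^bsub>gsec S (W y)\<^esub> h y) = gres S (W x) Z (inv\<^bsub>gsec S (W x)\<^esub> h x) \<otimes>\<^bsub>gsec S Z\<^esub> ?g"
    using gres_inv[OF D(2)[OF x] Z(1,2) D(5)[OF x]] gres_inv[OF D(2)[OF y] Z(1,3) D(5)[OF y]] by simp
qed (use coh_dataD[OF d] in auto)

text \<open>The refinement map \<open>a\<close> can be changed at will: \<open>g\<^sub>a\<^sub>'\<^sub>a h\<close> replaces \<open>h\<close>.\<close>

lemma coh_data_reindex:
  assumes c: "c \<in> cocycles C S" "c' \<in> cocycles C S" and d: "coh_data C S c c' W a b h"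
    and N: "\<And>x. x \<in> C \<Longrightarrow> zopen C (N x)" "\<And>x. x \<in> C \<Longrightarrow> x \<in> N x" "\<And>x. x \<in> C \<Longrightarrow> N x \<subseteq> W x" "\<And>x. x \<in> C \<Longrightarrow> N x \<subseteq> fst c (a' x)"
  shows "\<exists>k. coh_data C S c c' N a' b k"
proof -
  note D = coh_dataD[OF d]
  define k where "k x = gres S (fst c (a' x) \<inter> fst c (a x)) (N x) (snd c (a' x) (a x)) \<otimes>\<^bsub>gsec S (N x)\<^esub> gres S (W x) (N x) (h x)" for x
  have Na: "N x \<subseteq> fst c (a x)" "N x \<subseteq> fst c' (b x)" if "x \<in> C" for x
    using N(3)[OF that] D(3,4)[OF that] by auto
  have kc: "gres S (fst c (a' x) \<inter> fst c (a x)) (N x) (snd c (a' x) (a x)) \<in> carrier (gsec S (N x))"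
      "gres S (W x) (N x) (h x) \<in> carrier (gsec S (N x))" if "x \<in> C" for x
    using N[OF that] Na[OF that] D(2,5)[OF that] by (auto intro!: cocycle_closed[OF c(1)] gres_closed)
  have kN: "gres S (N x) Z (k x) = gres S (fst c (a' x) \<inter> fst c (a x)) Z (snd c (a' x) (a x)) \<otimes>\<^bsub>gsec S Z\<^esub> gres S (W x) Z (h x)"
    if x: "x \<in> C" and Z: "zopen C Z" "Z \<subseteq> N x" for x Z
    unfolding k_def gres_mult[OF N(1)[OF x] Z kc[OF x]]
    using gres_gres[OF D(2)[OF x] N(1)[OF x] Z(1,2) N(3)[OF x] D(5)[OF x]]
      gres_gres[OF zopen_Int[OF cocyclesD(1)[OF c(1)] cocyclesD(1)[OF c(1)]] N(1)[OF x] Z(1,2) _ cocyclesD(3)[OF c(1)], of "a' x" "a x"]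
      N(4)[OF x] Na(1)[OF x]
    by simp
  have "coh_data C S c c' N a' b k"
    unfolding coh_data_def
  proof (intro conjI ballI allI impI)
    fix x assume x: "x \<in> C"
    show "k x \<in> carrier (gsec S (N x))"
      unfolding k_def by (rule monoid.m_closed[OF group.is_monoid[OF sec_group[OF N(1)[OF x]]] kc[OF x]])
    fix y Z assume y: "y \<in> C" and Z: "zopen C Z" "Z \<subseteq> N x" "Z \<subseteq> N y"
    interpret Z: group "gsec S Z" by (rule sec_group[OF Z(1)])
    have ZU: "Z \<subseteq> fst c (a x)" "Z \<subseteq> fst c (a y)" "Z \<subseteq> fst c (a' x)" "Z \<subseteq> fst c (a' y)" "Z \<subseteq> fst c' (b x)" "Z \<subseteq> fst c' (b y)"
      and ZW: "Z \<subseteq> W x" "Z \<subseteq> W y"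
      using Z Na[OF x] Na[OF y] N(3,4)[OF x] N(3,4)[OF y] by auto
    let ?G = "\<lambda>i j. gres S (fst c i \<inter> fst c j) Z (snd c i j)"
    let ?g' = "gres S (fst c' (b x) \<inter> fst c' (b y)) Z (snd c' (b x) (b y))"
    let ?hx = "gres S (W x) Z (h x)" and ?hy = "gres S (W y) Z (h y)"
    have h: "?hx \<in> carrier (gsec S Z)" "?hy \<in> carrier (gsec S Z)"
      using Z ZW by (auto intro!: gres_closed D(2,5) x y)
    note cl = cocycle_closed[OF c(1) Z(1)] cocycle_closed[OF c(2) Z(1)]
    have "?G (a' x) (a' y) \<otimes>\<^bsub>gsec S Z\<^esub> (?G (a' y) (a y) \<otimes>\<^bsub>gsec S Z\<^esub> ?hy)
        = ?G (a' x) (a y) \<otimes>\<^bsub>gsec S Z\<^esub> ?hy"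
      unfolding cocycle_on[OF c(1) Z(1) ZU(3,4,2), symmetric] using cl ZU h by (intro Z.m_assoc[symmetric]) auto
    also have "\<dots> = ?G (a' x) (a x) \<otimes>\<^bsub>gsec S Z\<^esub> (?G (a x) (a y) \<otimes>\<^bsub>gsec S Z\<^esub> ?hy)"
      unfolding cocycle_on[OF c(1) Z(1) ZU(3,1,2), symmetric] using cl ZU h by (intro Z.m_assoc) auto
    also have "\<dots> = ?G (a' x) (a x) \<otimes>\<^bsub>gsec S Z\<^esub> ?hx \<otimes>\<^bsub>gsec S Z\<^esub> ?g'"
      unfolding D(6)[OF x y Z(1) ZW] using cl ZU h by (intro Z.m_assoc[symmetric]) auto
    finally show "?G (a' x) (a' y) \<otimes>\<^bsub>gsec S Z\<^esub> gres S (N y) Z (k y) = gres S (N x) Z (k x) \<otimes>\<^bsub>gsec S Z\<^esub> ?g'"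
      unfolding kN[OF x Z(1,2)] kN[OF y Z(1,3)] .
  qed (use N Na in auto)
  then show ?thesis
    by blast
qed

lemma coh_data_trans:
  assumes c: "c \<in> cocycles C S" "c' \<in> cocycles C S" "c'' \<in> cocycles C S"
    and d: "coh_data C S c c' W a b h" and d': "coh_data C S c' c'' W' a' b' h'"
  shows "\<exists>N k. coh_data C S c c'' N a b' k"
proof -
  note D = coh_dataD[OF d] and D' = coh_dataD[OF d']
  define N where "N x = W x \<inter> W' x" for x
  have N: "zopen C (N x)" "x \<in> N x" "N x \<subseteq> W x" "N x \<subseteq> W' x" "N x \<subseteq> fst c' (b x)" "N x \<subseteq> fst c (a x)" "N x \<subseteq> fst c'' (b' x)" if "x \<in> C" for x
    using D(1-4)[OF that] D'(1-4)[OF that] by (auto simp: N_def)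
  obtain k where k: "coh_data C S c' c'' N b b' k"
    using coh_data_reindex[OF c(2,3) d' N(1,2,4,5)] by blast
  note K = coh_dataD[OF k]
  define m where "m x = gres S (W x) (N x) (h x) \<otimes>\<^bsub>gsec S (N x)\<^esub> k x" for x
  have hN: "gres S (W x) (N x) (h x) \<in> carrier (gsec S (N x))" if "x \<in> C" for x
    using N[OF that] D(2,5)[OF that] by (auto intro: gres_closed)
  have mN: "gres S (N x) Z (m x) = gres S (W x) Z (h x) \<otimes>\<^bsub>gsec S Z\<^esub> gres S (N x) Z (k x)"
    if x: "x \<in> C" and Z: "zopen C Z" "Z \<subseteq> N x" for x Z
    unfolding m_def gres_mult[OF N(1)[OF x] Z hN[OF x] K(5)[OF x]] gres_gres[OF D(2)[OF x] N(1)[OF x] Z(1,2) N(3)[OF x] D(5)[OF x]] ..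
  have "coh_data C S c c'' N a b' m"
    unfolding coh_data_def
  proof (intro conjI ballI allI impI)
    fix x assume x: "x \<in> C"
    show "m x \<in> carrier (gsec S (N x))"
      unfolding m_def by (rule monoid.m_closed[OF group.is_monoid[OF sec_group[OF N(1)[OF x]]] hN[OF x] K(5)[OF x]])
    fix y Z assume y: "y \<in> C" and Z: "zopen C Z" "Z \<subseteq> N x" "Z \<subseteq> N y"
    interpret Z: group "gsec S Z" by (rule sec_group[OF Z(1)])
    have ZU: "Z \<subseteq> fst c (a x)" "Z \<subseteq> fst c (a y)" "Z \<subseteq> fst c' (b x)" "Z \<subseteq> fst c' (b y)" "Z \<subseteq> fst c'' (b' x)" "Z \<subseteq> fst c'' (b' y)"
      and ZW: "Z \<subseteq> W x" "Z \<subseteq> W y"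
      using Z N[OF x] N[OF y] by auto
    let ?g = "gres S (fst c (a x) \<inter> fst c (a y)) Z (snd c (a x) (a y))"
    let ?g' = "gres S (fst c' (b x) \<inter> fst c' (b y)) Z (snd c' (b x) (b y))"
    let ?g'' = "gres S (fst c'' (b' x) \<inter> fst c'' (b' y)) Z (snd c'' (b' x) (b' y))"
    let ?hx = "gres S (W x) Z (h x)" and ?hy = "gres S (W y) Z (h y)" and ?kx = "gres S (N x) Z (k x)" and ?ky = "gres S (N y) Z (k y)"
    have h: "?hx \<in> carrier (gsec S Z)" "?hy \<in> carrier (gsec S Z)" "?kx \<in> carrier (gsec S Z)" "?ky \<in> carrier (gsec S Z)"
      "?g \<in> carrier (gsec S Z)" "?g' \<in> carrier (gsec S Z)" "?g'' \<in> carrier (gsec S Z)"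
      using Z ZW ZU by (auto intro!: gres_closed D(2,5) K(5) N(1) x y cocycle_closed[OF c(1)] cocycle_closed[OF c(2)] cocycle_closed[OF c(3)])
    have "?g \<otimes>\<^bsub>gsec S Z\<^esub> (?hy \<otimes>\<^bsub>gsec S Z\<^esub> ?ky) = ?g \<otimes>\<^bsub>gsec S Z\<^esub> ?hy \<otimes>\<^bsub>gsec S Z\<^esub> ?ky"
      using h by (simp add: Z.m_assoc)
    also have "\<dots> = ?hx \<otimes>\<^bsub>gsec S Z\<^esub> (?g' \<otimes>\<^bsub>gsec S Z\<^esub> ?ky)"
      unfolding D(6)[OF x y Z(1) ZW] using h by (simp add: Z.m_assoc)
    also have "\<dots> = ?hx \<otimes>\<^bsub>gsec S Z\<^esub> ?kx \<otimes>\<^bsub>gsec S Z\<^esub> ?g''"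
      unfolding K(6)[OF x y Z] using h by (simp add: Z.m_assoc)
    finally show "?g \<otimes>\<^bsub>gsec S Z\<^esub> gres S (N y) Z (m y) = gres S (N x) Z (m x) \<otimes>\<^bsub>gsec S Z\<^esub> ?g''"
      unfolding mN[OF x Z(1,2)] mN[OF y Z(1,3)] .
  qed (use N in auto)
  then show ?thesis
    by blast
qed

lemma cohomologous_sym: "(c, c') \<in> cohomologous C S \<Longrightarrow> (c', c) \<in> cohomologous C S"
  by (erule cohomologousE) (rule cohomologousI[OF _ _ coh_data_sym])

lemma cohomologous_trans:
  assumes "(c, c') \<in> cohomologous C S" "(c', c'') \<in> cohomologous C S"
  shows "(c, c'') \<in> cohomologous C S"
proof -
  obtain W a b h where 1: "c \<in> cocycles C S" "c' \<in> cocycles C S" "coh_data C S c c' W a b h"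
    using assms(1) by (rule cohomologousE)
  obtain W' a' b' h' where 2: "c' \<in> cocycles C S" "c'' \<in> cocycles C S" "coh_data C S c' c'' W' a' b' h'"
    using assms(2) by (rule cohomologousE)
  obtain N k where "coh_data C S c c'' N a b' k"
    using coh_data_trans[OF 1(1,2) 2(2) 1(3) 2(3)] by blast
  with 1 2 show ?thesis
    by (intro cohomologousI)
qed

lemma H1_cohomologous:
  assumes "X \<in> H1 C S" "c \<in> X" "c' \<in> X"
  shows "(c, c') \<in> cohomologous C S"
proof -
  obtain c0 where "X = cohomologous C S `` {c0}"
    using assms(1) unfolding H1_def quotient_def by blast
  then have "(c0, c) \<in> cohomologous C S" "(c0, c') \<in> cohomologous C S"
    using assms(2,3) by auto
  then show ?thesis
    using cohomologous_sym cohomologous_trans by blast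
qed

end

context group_presheaf_hom
begin

lemma map_cocycle:
  assumes c: "c \<in> cocycles C S"
  shows "map_cochain f c \<in> cocycles C T"
proof -
  obtain U g where cc: "c = (U, g)" by (metis surj_pair)
  note D = cocyclesD[OF c, unfolded cc fst_conv snd_conv]
  have "gres T (U i \<inter> U j) (U i \<inter> U j \<inter> U k) (f (U i \<inter> U j) (g i j))
      \<otimes>\<^bsub>gsec T (U i \<inter> U j \<inter> U k)\<^esub> gres T (U j \<inter> U k) (U i \<inter> U j \<inter> U k) (f (U j \<inter> U k) (g j k))
      = gres T (U i \<inter> U k) (U i \<inter> U j \<inter> U k) (f (U i \<inter> U k) (g i k))" for i j k
  proof -
    let ?W = "U i \<inter> U j \<inter> U k"
    have o: "zopen C ?W" "zopen C (U i \<inter> U j)" "zopen C (U j \<inter> U k)" "zopen C (U i \<inter> U k)"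
      "?W \<subseteq> U i \<inter> U j" "?W \<subseteq> U j \<inter> U k" "?W \<subseteq> U i \<inter> U k"
      using D(1) by auto
    show ?thesis
      unfolding hom_res[OF o(2,1,5) D(3), symmetric] hom_res[OF o(3,1,6) D(3), symmetric] hom_res[OF o(4,1,7) D(3), symmetric]
        hom_mult[OF o(1) S.gres_closed[OF o(2,1,5) D(3)] S.gres_closed[OF o(3,1,6) D(3)], symmetric] D(4) ..
  qed
  then show ?thesis
    using D(1-3) zopen_subset unfolding cc map_cochain_def cocycles_def
    by (auto simp: Let_def intro!: hom_closed)
qed

lemma map_coh_data:
  assumes c: "c \<in> cocycles C S" "c' \<in> cocycles C S" and d: "coh_data C S c c' W a b h"
  shows "coh_data C T (map_cochain f c) (map_cochain f c') W a b (\<lambda>x. f (W x) (h x))"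
  unfolding coh_data_def
proof (intro conjI ballI allI impI)
  note D = coh_dataD[OF d]
  have m: "fst (map_cochain f c) = fst c" "snd (map_cochain f c) i j = f (fst c i \<inter> fst c j) (snd c i j)" for c :: "('x, _, _) cochain" and i j
    by (auto simp: map_cochain_def split: prod.splits)
  fix x assume x: "x \<in> C"
  show "x \<in> W x" "zopen C (W x)" "W x \<subseteq> fst (map_cochain f c) (a x)" "W x \<subseteq> fst (map_cochain f c') (b x)"
    using D(1-4)[OF x] by (auto simp: m)
  show "f (W x) (h x) \<in> carrier (gsec T (W x))"
    by (rule hom_closed[OF D(2,5)[OF x]])
  fix y Z assume y: "y \<in> C" and Z: "zopen C Z" "Z \<subseteq> W x" "Z \<subseteq> W y"
  have ZU: "Z \<subseteq> fst c (a x)" "Z \<subseteq> fst c (a y)" "Z \<subseteq> fst c' (b x)" "Z \<subseteq> fst c' (b y)"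
    using D(3,4)[OF x] D(3,4)[OF y] Z by auto
  have o: "zopen C (fst c i \<inter> fst c j)" "zopen C (fst c' i' \<inter> fst c' j')" for i j i' j'
    using cocyclesD(1)[OF c(1)] cocyclesD(1)[OF c(2)] by auto
  have Z2: "Z \<subseteq> fst c (a x) \<inter> fst c (a y)" "Z \<subseteq> fst c' (b x) \<inter> fst c' (b y)"
    using ZU by auto
  note s = cocyclesD(3)[OF c(1)] cocyclesD(3)[OF c(2)]
  show "gres T (fst (map_cochain f c) (a x) \<inter> fst (map_cochain f c) (a y)) Z (snd (map_cochain f c) (a x) (a y))
      \<otimes>\<^bsub>gsec T Z\<^esub> gres T (W y) Z (f (W y) (h y)) =
    gres T (W x) Z (f (W x) (h x)) \<otimes>\<^bsub>gsec T Z\<^esub>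
      gres T (fst (map_cochain f c') (b x) \<inter> fst (map_cochain f c') (b y)) Z (snd (map_cochain f c') (b x) (b y))"
    unfolding m hom_res[OF o(1) Z(1) Z2(1) s(1), symmetric] hom_res[OF o(2) Z(1) Z2(2) s(2), symmetric]
      hom_res[OF D(2)[OF x] Z(1,2) D(5)[OF x], symmetric] hom_res[OF D(2)[OF y] Z(1,3) D(5)[OF y], symmetric]
      hom_mult[OF Z(1) S.gres_closed[OF o(1) Z(1) Z2(1) s(1)] S.gres_closed[OF D(2)[OF y] Z(1,3) D(5)[OF y]], symmetric]
      hom_mult[OF Z(1) S.gres_closed[OF D(2)[OF x] Z(1,2) D(5)[OF x]] S.gres_closed[OF o(2) Z(1) Z2(2) s(2)], symmetric]
      D(6)[OF x y Z] ..
qed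

lemma map_cohomologous:
  assumes "(c, c') \<in> cohomologous C S"
  shows "(map_cochain f c, map_cochain f c') \<in> cohomologous C T"
proof -
  obtain W a b h where 1: "c \<in> cocycles C S" "c' \<in> cocycles C S" "coh_data C S c c' W a b h"
    using assms by (rule S.cohomologousE)
  then show ?thesis
    by (intro T.cohomologousI[OF _ _ map_coh_data] map_cocycle)
qed

lemma H1_map_cohomologous:
  assumes "X \<in> H1 C S" "c \<in> X" "d \<in> H1_map C T f X"
  shows "(map_cochain f c, d) \<in> cohomologous C T"
proof -
  obtain c' where c': "c' \<in> X" "(map_cochain f c', d) \<in> cohomologous C T"
    using assms(3) unfolding H1_map_def by auto
  have "(map_cochain f c, map_cochain f c') \<in> cohomologous C T"
    by (rule map_cohomologous[OF S.H1_cohomologous[OF assms(1,2) c'(1)]])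
  from this c'(2) show ?thesis
    by (rule T.cohomologous_trans)
qed

end

lemma affine_of_aut_reduce:
  assumes U: "zopen C U" and n: "n \<ge> 2" and \<phi>: "\<phi> \<in> jet_aut_sections C n U"
  shows "affine_of_aut C 2 U (aut_reduce C n 2 U \<phi>) = affine_of_aut C n U \<phi>"
proof -
  have c: "(\<lambda>i\<in>{..<n}. if i < 2 then jet_const 2 V f i else (\<lambda>p\<in>V. 0)) = jet_const n V f" for V f
    unfolding jet_const_def by (intro restrict_ext) auto
  have t: "(\<lambda>i\<in>{..<n}. if i < 2 then jet_t 2 U i else (\<lambda>p\<in>U. 0)) = jet_t n U"
    unfolding jet_t_def by (intro restrict_ext) auto
  have "aut_mu C 2 U (aut_reduce C n 2 U \<phi>) = aut_mu C n U \<phi>"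
    unfolding aut_mu_def
    by (rule vfield_cong) (simp add: aut_reduce_def jet_const_closed c)
  moreover have "xi 2 U (aut_reduce C n 2 U \<phi>) = xi n U \<phi>"
    unfolding xi_def using U by (simp add: aut_reduce_def jet_t_closed t)
  ultimately show ?thesis
    by (simp add: affine_of_aut_def)
qed

text \<open>Reduction to level two does not change \<open>\<mu>\<close> and \<open>\<nu>\<close>, so the images of \<open>g\<close> and of its reduction
  in the affine group have the same class.\<close>

lemma affine_class:
  assumes n: "n \<ge> 3" and g: "g \<in> H1 C (aut_sheaf C n)" "c \<in> g"
    and d: "d \<in> H1_map C (aut_sheaf C 2) (aut_reduce C n 2) g"
  shows "(map_cochain (affine_of_aut C n) c, map_cochain (affine_of_aut C 2) d) \<in> cohomologous C (affine_sheaf C)"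
proof -
  have n2: "n \<ge> 2" using n by simp
  interpret A: group_presheaf_hom C "aut_sheaf C n" "affine_sheaf C" "affine_of_aut C n"
    by (rule affine_of_aut_hom[OF n2])
  interpret B: group_presheaf_hom C "aut_sheaf C 2" "affine_sheaf C" "affine_of_aut C 2"
    by (rule affine_of_aut_hom) simp
  obtain c' where c': "c' \<in> g" "(map_cochain (aut_reduce C n 2) c', d) \<in> cohomologous C (aut_sheaf C 2)"
    using d unfolding H1_map_def by auto
  have 1: "(c, c') \<in> cohomologous C (aut_sheaf C n)"
    by (rule A.S.H1_cohomologous[OF g c'(1)])
  then have cc: "c' \<in> cocycles C (aut_sheaf C n)"
    by (rule A.S.cohomologousE)
  have "map_cochain (affine_of_aut C 2) (map_cochain (aut_reduce C n 2) c') = map_cochain (affine_of_aut C n) c'"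
  proof -
    obtain U g where c: "c' = (U, g)" by (metis surj_pair)
    have "affine_of_aut C 2 (U i \<inter> U j) (aut_reduce C n 2 (U i \<inter> U j) (g i j)) = affine_of_aut C n (U i \<inter> U j) (g i j)" for i j
      using cocyclesD(1,3)[OF cc] by (intro affine_of_aut_reduce n2) (auto simp: c)
    then show ?thesis
      by (simp add: c map_cochain_def)
  qed
  with A.map_cohomologous[OF 1] B.map_cohomologous[OF c'(2)] show ?thesis
    using A.T.cohomologous_trans by simp
qed

lemma line_bundle_class:
  assumes n: "n \<ge> 3" and g: "g \<in> H1 C (aut_sheaf C n)" "c \<in> g"
    and l: "l \<in> pic_power C (H1_map C (units_sheaf C) (xi n) g) k"
  shows "(map_cochain (\<lambda>V \<nu>. \<nu> [^]\<^bsub>gsec (units_sheaf C) V\<^esub> k) (map_cochain (xi n) c), l) \<in> cohomologous C (units_sheaf C)"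
proof -
  have n2: "n \<ge> 2" using n by simp
  interpret A: group_presheaf_hom C "aut_sheaf C n" "units_sheaf C" "xi n"
    by (rule xi_hom[OF n2])
  interpret P: group_presheaf_hom C "units_sheaf C" "units_sheaf C" "\<lambda>V \<nu>. \<nu> [^]\<^bsub>gsec (units_sheaf C) V\<^esub> k"
    by (rule power_hom)
  obtain l' where l': "l' \<in> H1_map C (units_sheaf C) (xi n) g"
    "(map_cochain (\<lambda>V \<nu>. \<nu> [^]\<^bsub>gsec (units_sheaf C) V\<^esub> k) l', l) \<in> cohomologous C (units_sheaf C)"
    using l unfolding pic_power_def H1_map_def by blast
  have "(map_cochain (xi n) c, l') \<in> cohomologous C (units_sheaf C)"
    by (rule A.H1_map_cohomologous[OF g l'(1)])
  from P.map_cohomologous[OF this] l'(2) show ?thesis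
    by (rule A.T.cohomologous_trans)
qed

section \<open>Twisted sheaves\<close>

lemma (in sheaf_of_modules) res_id:
  assumes "zopen C U" "x \<in> carrier (msec F U)"
  shows "mres F U U x = x"
proof (rule separated[OF assms(1)])
  show "mres F U U x \<in> carrier (msec F U)" "x \<in> carrier (msec F U)"
    using assms by (auto intro: res_closed)
  fix p assume "p \<in> U"
  then show "\<exists>V. zopen C V \<and> V \<subseteq> U \<and> p \<in> V \<and> mres F U V (mres F U U x) = mres F U V x"
    using assms res_res[OF assms(1,1,1) subset_refl subset_refl assms(2)] by (intro exI[of _ U]) auto
qed

lemma twist_simps:
  "s \<in> carrier (msec (twist S act F c) W) \<longleftrightarrow> (\<forall>i. s i \<in> carrier (msec F (W \<inter> fst c i))) \<and>
    (\<forall>i j. mres F (W \<inter> fst c i) (W \<inter> fst c i \<inter> fst c j) (s i) =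
      act (W \<inter> fst c i \<inter> fst c j) (gres S (fst c i \<inter> fst c j) (W \<inter> fst c i \<inter> fst c j) (snd c i j))
        (mres F (W \<inter> fst c j) (W \<inter> fst c i \<inter> fst c j) (s j)))"
  "s \<oplus>\<^bsub>msec (twist S act F c) W\<^esub> t = (\<lambda>i. s i \<oplus>\<^bsub>msec F (W \<inter> fst c i)\<^esub> t i)"
  "f \<odot>\<^bsub>msec (twist S act F c) W\<^esub> s = (\<lambda>i. restrict f (W \<inter> fst c i) \<odot>\<^bsub>msec F (W \<inter> fst c i)\<^esub> s i)"
  "\<zero>\<^bsub>msec (twist S act F c) W\<^esub> = (\<lambda>i. \<zero>\<^bsub>msec F (W \<inter> fst c i)\<^esub>)"
  "mres (twist S act F c) W W' s = (\<lambda>i. mres F (W \<inter> fst c i) (W' \<inter> fst c i) (s i))"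
  by (simp_all add: twist_def case_prod_unfold Let_def)

text \<open>A linear action of a sheaf of groups on a sheaf of modules, compatible with restriction.\<close>

locale sheaf_action = F: sheaf_of_modules C F + S: group_presheaf C S
  for C :: "'n::finite pt set" and F :: "('n pt, 'e) module_sheaf" and S :: "('n pt, 'g) group_sheaf" +
  fixes act :: "'n pt set \<Rightarrow> 'g \<Rightarrow> 'e \<Rightarrow> 'e"
  assumes act_closed: "\<lbrakk>zopen C V; a \<in> carrier (gsec S V); x \<in> carrier (msec F V)\<rbrakk> \<Longrightarrow> act V a x \<in> carrier (msec F V)"
    and act_add: "\<lbrakk>zopen C V; a \<in> carrier (gsec S V); x \<in> carrier (msec F V); y \<in> carrier (msec F V)\<rbrakk>
      \<Longrightarrow> act V a (x \<oplus>\<^bsub>msec F V\<^esub> y) = act V a x \<oplus>\<^bsub>msec F V\<^esub> act V a y"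
    and act_smult: "\<lbrakk>zopen C V; a \<in> carrier (gsec S V); regular C V f; x \<in> carrier (msec F V)\<rbrakk>
      \<Longrightarrow> act V a (f \<odot>\<^bsub>msec F V\<^esub> x) = f \<odot>\<^bsub>msec F V\<^esub> act V a x"
    and act_res: "\<lbrakk>zopen C U; zopen C V; V \<subseteq> U; a \<in> carrier (gsec S U); x \<in> carrier (msec F U)\<rbrakk>
      \<Longrightarrow> mres F U V (act U a x) = act V (gres S U V a) (mres F U V x)"
    and act_one: "\<lbrakk>zopen C V; x \<in> carrier (msec F V)\<rbrakk> \<Longrightarrow> act V \<one>\<^bsub>gsec S V\<^esub> x = x"
    and act_mult: "\<lbrakk>zopen C V; a \<in> carrier (gsec S V); b \<in> carrier (gsec S V); x \<in> carrier (msec F V)\<rbrakk>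
      \<Longrightarrow> act V (a \<otimes>\<^bsub>gsec S V\<^esub> b) x = act V a (act V b x)"
begin

context
  fixes c :: "('i, 'n pt, 'g) cochain"
  assumes c: "c \<in> cocycles C S"
begin

abbreviation "U \<equiv> fst c"
abbreviation "G V i j \<equiv> gres S (U i \<inter> U j) V (snd c i j)"
abbreviation "T \<equiv> twist S act F c"

lemma opens: "zopen C (U i)" "zopen C W \<Longrightarrow> zopen C (W \<inter> U i)" "zopen C W \<Longrightarrow> zopen C (W \<inter> U i \<inter> U j)"
  using cocyclesD(1)[OF c] by auto

lemma G_closed: "zopen C V \<Longrightarrow> V \<subseteq> U i \<Longrightarrow> V \<subseteq> U j \<Longrightarrow> G V i j \<in> carrier (gsec S V)"
  by (rule S.cocycle_closed[OF c])

lemma G_res: "zopen C V \<Longrightarrow> zopen C V' \<Longrightarrow> V' \<subseteq> V \<Longrightarrow> V \<subseteq> U i \<Longrightarrow> V \<subseteq> U j \<Longrightarrow> gres S V V' (G V i j) = G V' i j"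
  using opens(1) cocyclesD(3)[OF c] by (intro S.gres_gres) auto

lemma sec: "s \<in> carrier (msec T W) \<Longrightarrow> s i \<in> carrier (msec F (W \<inter> U i))"
  by (simp add: twist_simps)

lemma sec_rel:
  assumes s: "s \<in> carrier (msec T W)" and W: "zopen C W" and V: "zopen C V" "V \<subseteq> W" "V \<subseteq> U i" "V \<subseteq> U j"
  shows "mres F (W \<inter> U i) V (s i) = act V (G V i j) (mres F (W \<inter> U j) V (s j))"
proof -
  let ?Y = "W \<inter> U i \<inter> U j"
  have Y: "zopen C ?Y" "V \<subseteq> ?Y" "?Y \<subseteq> W \<inter> U i" "?Y \<subseteq> W \<inter> U j" "?Y \<subseteq> U i" "?Y \<subseteq> U j"
    using opens W V by auto
  have "mres F (W \<inter> U i) V (s i) = mres F ?Y V (mres F (W \<inter> U i) ?Y (s i))"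
    by (rule F.res_res[symmetric, OF opens(2)[OF W] Y(1) V(1) Y(2,3) sec[OF s]])
  also have "mres F (W \<inter> U i) ?Y (s i) = act ?Y (G ?Y i j) (mres F (W \<inter> U j) ?Y (s j))"
    using s by (simp add: twist_simps)
  also have "mres F ?Y V \<dots> = act V (gres S ?Y V (G ?Y i j)) (mres F ?Y V (mres F (W \<inter> U j) ?Y (s j)))"
    by (rule act_res[OF Y(1) V(1) Y(2) G_closed[OF Y(1,5,6)] F.res_closed[OF opens(2)[OF W] Y(1,4) sec[OF s]]])
  finally show ?thesis
    unfolding G_res[OF Y(1) V(1) Y(2,5,6)] F.res_res[OF opens(2)[OF W] Y(1) V(1) Y(2,4) sec[OF s]] .
qed

lemma secI:
  assumes "\<And>i. s i \<in> carrier (msec F (W \<inter> U i))"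
    and "\<And>i j. mres F (W \<inter> U i) (W \<inter> U i \<inter> U j) (s i) = act (W \<inter> U i \<inter> U j) (G (W \<inter> U i \<inter> U j) i j) (mres F (W \<inter> U j) (W \<inter> U i \<inter> U j) (s j))"
  shows "s \<in> carrier (msec T W)"
  using assms by (simp add: twist_simps)

lemma twist_presheaf: "module_presheaf C T"
proof (unfold_locales, goal_cases)
  case (1 W s t)
  show ?case
    unfolding twist_simps(2)
  proof (rule secI)
    fix i j
    let ?Y = "W \<inter> U i \<inter> U j"
    have Y: "zopen C ?Y" "?Y \<subseteq> W" "?Y \<subseteq> W \<inter> U i" "?Y \<subseteq> W \<inter> U j" "?Y \<subseteq> U i" "?Y \<subseteq> U j"
      using opens 1 by auto
    note o = opens(2)[OF 1(1)]
    show "s i \<oplus>\<^bsub>msec F (W \<inter> U i)\<^esub> t i \<in> carrier (msec F (W \<inter> U i))"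
      by (rule F.add_closed[OF o sec[OF 1(2)] sec[OF 1(3)]])
    show "mres F (W \<inter> U i) ?Y (s i \<oplus>\<^bsub>msec F (W \<inter> U i)\<^esub> t i) =
        act ?Y (G ?Y i j) (mres F (W \<inter> U j) ?Y (s j \<oplus>\<^bsub>msec F (W \<inter> U j)\<^esub> t j))"
      unfolding F.res_add[OF o Y(1,3) sec[OF 1(2)] sec[OF 1(3)]] F.res_add[OF o Y(1,4) sec[OF 1(2)] sec[OF 1(3)]]
        sec_rel[OF 1(2,1) Y(1,2,5,6)] sec_rel[OF 1(3,1) Y(1,2,5,6)]
      by (rule act_add[symmetric, OF Y(1) G_closed[OF Y(1,5,6)] F.res_closed[OF o Y(1,4) sec[OF 1(2)]] F.res_closed[OF o Y(1,4) sec[OF 1(3)]]])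
  qed
next
  case (2 W f s)
  show ?case
    unfolding twist_simps(3)
  proof (rule secI)
    fix i j
    let ?Y = "W \<inter> U i \<inter> U j"
    have Y: "zopen C ?Y" "?Y \<subseteq> W" "?Y \<subseteq> W \<inter> U i" "?Y \<subseteq> W \<inter> U j" "?Y \<subseteq> U i" "?Y \<subseteq> U j"
      using opens 2 by auto
    note o = opens(2)[OF 2(1)]
    have r: "regular C (W \<inter> U i) (restrict f (W \<inter> U i))" for i
      by (rule regular_restrict[OF 2(2) o]) auto
    have rY: "regular C ?Y (restrict f ?Y)"
      by (rule regular_restrict[OF 2(2) Y(1,2)])
    have ff: "restrict (restrict f (W \<inter> U i)) ?Y = restrict f ?Y" "restrict (restrict f (W \<inter> U j)) ?Y = restrict f ?Y"
      by (auto simp: fun_eq_iff restrict_def)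
    show "restrict f (W \<inter> U i) \<odot>\<^bsub>msec F (W \<inter> U i)\<^esub> s i \<in> carrier (msec F (W \<inter> U i))"
      by (rule F.smult_closed[OF o r sec[OF 2(3)]])
    show "mres F (W \<inter> U i) ?Y (restrict f (W \<inter> U i) \<odot>\<^bsub>msec F (W \<inter> U i)\<^esub> s i) =
        act ?Y (G ?Y i j) (mres F (W \<inter> U j) ?Y (restrict f (W \<inter> U j) \<odot>\<^bsub>msec F (W \<inter> U j)\<^esub> s j))"
      unfolding F.res_smult[OF o Y(1,3) r sec[OF 2(3)]] F.res_smult[OF o Y(1,4) r sec[OF 2(3)]] ff
        sec_rel[OF 2(3,1) Y(1,2,5,6)]
      by (rule act_smult[symmetric, OF Y(1) G_closed[OF Y(1,5,6)] rY F.res_closed[OF o Y(1,4) sec[OF 2(3)]]])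
  qed
next
  case (3 W W' s)
  show ?case
    unfolding twist_simps(5)
  proof (rule secI)
    fix i j
    let ?Y = "W' \<inter> U i \<inter> U j"
    have Y: "zopen C ?Y" "?Y \<subseteq> W" "?Y \<subseteq> W' \<inter> U i" "?Y \<subseteq> W' \<inter> U j" "?Y \<subseteq> U i" "?Y \<subseteq> U j"
      and W': "W' \<inter> U k \<subseteq> W \<inter> U k" for k
      using opens 3 by auto
    note o = opens(2)[OF 3(1)] and o' = opens(2)[OF 3(2)]
    show "mres F (W \<inter> U i) (W' \<inter> U i) (s i) \<in> carrier (msec F (W' \<inter> U i))"
      by (rule F.res_closed[OF o o' W' sec[OF 3(4)]])
    show "mres F (W' \<inter> U i) ?Y (mres F (W \<inter> U i) (W' \<inter> U i) (s i)) =
        act ?Y (G ?Y i j) (mres F (W' \<inter> U j) ?Y (mres F (W \<inter> U j) (W' \<inter> U j) (s j)))"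
      unfolding F.res_res[OF o o' Y(1,3) W' sec[OF 3(4)]] F.res_res[OF o o' Y(1,4) W' sec[OF 3(4)]]
      by (rule sec_rel[OF 3(4,1) Y(1,2,5,6)])
  qed
next
  case (4 W V V' s)
  then show ?case
    unfolding twist_simps(5) by (intro ext F.res_res opens sec) auto
next
  case (5 W V s t)
  then show ?case
    unfolding twist_simps(5,2) by (intro ext F.res_add opens sec) auto
next
  case (6 W V f s)
  have "restrict (restrict f (W \<inter> U i)) (V \<inter> U i) = restrict (restrict f V) (V \<inter> U i)" for i
    using 6 by (auto simp: fun_eq_iff restrict_def)
  moreover have "mres F (W \<inter> U i) (V \<inter> U i) (restrict f (W \<inter> U i) \<odot>\<^bsub>msec F (W \<inter> U i)\<^esub> s i)
      = restrict (restrict f (W \<inter> U i)) (V \<inter> U i) \<odot>\<^bsub>msec F (V \<inter> U i)\<^esub> mres F (W \<inter> U i) (V \<inter> U i) (s i)" for i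
    by (rule F.res_smult[OF opens(2)[OF 6(1)] opens(2)[OF 6(2)] _ regular_restrict[OF 6(4) opens(2)[OF 6(1)]] sec[OF 6(5)]])
       (use 6(3) in auto)
  ultimately show ?case
    unfolding twist_simps(5,3) by simp
qed

text \<open>Each component is glued separately.  The component over \<open>U\<^sub>i\<close> is glued from the points of \<open>U\<^sub>i\<close>
  only, so its restriction to the remaining members of the cover has to be found by separatedness.\<close>

lemma twist_sheaf: "sheaf_of_modules C T"
proof (intro sheaf_of_modules.intro twist_presheaf sheaf_of_modules_axioms.intro)
  fix W s t assume W: "zopen C W" and s: "s \<in> carrier (msec T W)" and t: "t \<in> carrier (msec T W)"
    and eq: "\<And>p. p \<in> W \<Longrightarrow> \<exists>V. zopen C V \<and> V \<subseteq> W \<and> p \<in> V \<and> mres T W V s = mres T W V t"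
  show "s = t"
  proof (rule ext)
    fix i show "s i = t i"
    proof (rule F.separated[OF opens(2)[OF W] sec[OF s] sec[OF t]])
      fix p assume p: "p \<in> W \<inter> U i"
      then obtain V where V: "zopen C V" "V \<subseteq> W" "p \<in> V" "mres T W V s = mres T W V t"
        using eq by blast
      have "mres F (W \<inter> U i) (V \<inter> U i) (s i) = mres F (W \<inter> U i) (V \<inter> U i) (t i)"
        using fun_cong[OF V(4), of i] by (simp add: twist_simps)
      then show "\<exists>V. zopen C V \<and> V \<subseteq> W \<inter> U i \<and> p \<in> V \<and> mres F (W \<inter> U i) V (s i) = mres F (W \<inter> U i) V (t i)"
        using V p opens(2)[OF V(1)] by (intro exI[of _ "V \<inter> U i"]) auto
    qed
  qed
next
  fix W V s assume W: "zopen C W"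
    and V: "\<And>p. p \<in> W \<Longrightarrow> zopen C (V p) \<and> V p \<subseteq> W \<and> p \<in> V p \<and> s p \<in> carrier (msec T (V p))"
    and compat: "\<And>p q. p \<in> W \<Longrightarrow> q \<in> W \<Longrightarrow> mres T (V p) (V p \<inter> V q) (s p) = mres T (V q) (V p \<inter> V q) (s q)"
  have o: "zopen C (V p)" "zopen C (V p \<inter> U i)" "s p \<in> carrier (msec T (V p))" "s p i \<in> carrier (msec F (V p \<inter> U i))"
     "V p \<subseteq> W" "p \<in> V p" if "p \<in> W" for p i
    using V[OF that] opens sec[of "s p" "V p" i] by auto
  have cp: "mres F (V p \<inter> U i) Y (s p i) = mres F (V q \<inter> U i) Y (s q i)"
    if pq: "p \<in> W" "q \<in> W" and Y: "zopen C Y" "Y \<subseteq> V p" "Y \<subseteq> V q" "Y \<subseteq> U i" for p q i Y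
  proof -
    let ?A = "V p \<inter> V q \<inter> U i"
    have A: "zopen C ?A" "Y \<subseteq> ?A" "?A \<subseteq> V p \<inter> U i" "?A \<subseteq> V q \<inter> U i"
      using o[OF pq(1)] o[OF pq(2)] Y opens(1) by auto
    have "mres F (V p \<inter> U i) ?A (s p i) = mres F (V q \<inter> U i) ?A (s q i)"
      using fun_cong[OF compat[OF pq], of i] by (simp add: twist_simps)
    then show ?thesis
      using F.res_res[OF o(2)[OF pq(1)] A(1) Y(1) A(2,3) o(4)[OF pq(1)]] F.res_res[OF o(2)[OF pq(2)] A(1) Y(1) A(2,4) o(4)[OF pq(2)]]
      by simp
  qed
  have "\<exists>x\<in>carrier (msec F (W \<inter> U i)). \<forall>p\<in>W \<inter> U i. mres F (W \<inter> U i) (V p \<inter> U i) x = s p i" for i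
  proof (rule F.gluing[OF opens(2)[OF W]])
    fix p assume "p \<in> W \<inter> U i"
    then show "zopen C (V p \<inter> U i) \<and> V p \<inter> U i \<subseteq> W \<inter> U i \<and> p \<in> V p \<inter> U i \<and> s p i \<in> carrier (msec F (V p \<inter> U i))"
      using o[of p] by auto
  next
    fix p q assume pq: "p \<in> W \<inter> U i" "q \<in> W \<inter> U i"
    show "mres F (V p \<inter> U i) (V p \<inter> U i \<inter> (V q \<inter> U i)) (s p i) = mres F (V q \<inter> U i) (V p \<inter> U i \<inter> (V q \<inter> U i)) (s q i)"
      using pq o(2)[of p i] o(2)[of q i] by (intro cp) auto
  qed
  then obtain x where x: "\<And>i. x i \<in> carrier (msec F (W \<inter> U i))"
    "\<And>i p. p \<in> W \<inter> U i \<Longrightarrow> mres F (W \<inter> U i) (V p \<inter> U i) (x i) = s p i"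
    by metis
  have xr: "mres F (W \<inter> U i) Y (x i) = mres F (V p \<inter> U i) Y (s p i)"
    if p: "p \<in> W \<inter> U i" and Y: "zopen C Y" "Y \<subseteq> V p" "Y \<subseteq> U i" for p i Y
    unfolding x(2)[OF p, symmetric] using p o[of p] Y by (intro F.res_res[symmetric] opens W x(1)) auto
  have "x \<in> carrier (msec T W)"
  proof (rule secI[OF x(1)])
    fix i j
    let ?Y = "W \<inter> U i \<inter> U j"
    have Y: "zopen C ?Y" "?Y \<subseteq> W" "?Y \<subseteq> W \<inter> U i" "?Y \<subseteq> W \<inter> U j" "?Y \<subseteq> U i" "?Y \<subseteq> U j"
      using opens W by auto
    show "mres F (W \<inter> U i) ?Y (x i) = act ?Y (G ?Y i j) (mres F (W \<inter> U j) ?Y (x j))"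
    proof (rule F.separated[OF Y(1)])
      show "mres F (W \<inter> U i) ?Y (x i) \<in> carrier (msec F ?Y)"
        by (rule F.res_closed[OF opens(2)[OF W] Y(1,3) x(1)])
      have xj: "mres F (W \<inter> U j) ?Y (x j) \<in> carrier (msec F ?Y)"
        by (rule F.res_closed[OF opens(2)[OF W] Y(1,4) x(1)])
      show "act ?Y (G ?Y i j) (mres F (W \<inter> U j) ?Y (x j)) \<in> carrier (msec F ?Y)"
        by (rule act_closed[OF Y(1) G_closed[OF Y(1,5,6)] xj])
      fix p assume p: "p \<in> ?Y"
      then have pW: "p \<in> W" and pi: "p \<in> W \<inter> U i" and pj: "p \<in> W \<inter> U j" by auto
      let ?Z = "V p \<inter> U i \<inter> U j"
      have Z: "zopen C ?Z" "?Z \<subseteq> ?Y" "?Z \<subseteq> V p" "?Z \<subseteq> U i" "?Z \<subseteq> U j" "p \<in> ?Z"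
        using o[OF pW] opens(3) p by auto
      have "mres F ?Y ?Z (mres F (W \<inter> U i) ?Y (x i)) = mres F (V p \<inter> U i) ?Z (s p i)"
        unfolding F.res_res[OF opens(2)[OF W] Y(1) Z(1,2) Y(3) x(1)] by (rule xr[OF pi Z(1,3,4)])
      also have "\<dots> = act ?Z (G ?Z i j) (mres F (V p \<inter> U j) ?Z (s p j))"
        by (rule sec_rel[OF o(3)[OF pW] o(1)[OF pW] Z(1,3,4,5)])
      also have "mres F (V p \<inter> U j) ?Z (s p j) = mres F ?Y ?Z (mres F (W \<inter> U j) ?Y (x j))"
        unfolding F.res_res[OF opens(2)[OF W] Y(1) Z(1,2) Y(4) x(1)] by (rule xr[OF pj Z(1,3,5), symmetric])
      also have "act ?Z (G ?Z i j) \<dots> = mres F ?Y ?Z (act ?Y (G ?Y i j) (mres F (W \<inter> U j) ?Y (x j)))"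
        unfolding act_res[OF Y(1) Z(1,2) G_closed[OF Y(1,5,6)] xj] G_res[OF Y(1) Z(1,2) Y(5,6)] ..
      finally show "\<exists>V. zopen C V \<and> V \<subseteq> ?Y \<and> p \<in> V \<and> mres F ?Y V (mres F (W \<inter> U i) ?Y (x i)) =
          mres F ?Y V (act ?Y (G ?Y i j) (mres F (W \<inter> U j) ?Y (x j)))"
        using Z by (intro exI[of _ ?Z] conjI)
    qed
  qed
  moreover have "mres T W (V p) x = s p" if p: "p \<in> W" for p
    unfolding twist_simps(5)
  proof (rule ext)
    fix i
    note op = o[OF p]
    have VU: "V p \<inter> U i \<subseteq> W \<inter> U i" using op by auto
    have cl: "mres F (W \<inter> U i) (V p \<inter> U i) (x i) \<in> carrier (msec F (V p \<inter> U i))"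
      by (rule F.res_closed[OF opens(2)[OF W] op(2) VU x(1)])
    show "mres F (W \<inter> U i) (V p \<inter> U i) (x i) = s p i"
    proof (rule F.separated[OF op(2) cl op(4)])
      fix q assume q: "q \<in> V p \<inter> U i"
      then have qW: "q \<in> W \<inter> U i" and qW': "q \<in> W" using op by auto
      let ?Z = "V p \<inter> V q \<inter> U i"
      have Z: "zopen C ?Z" "?Z \<subseteq> V p \<inter> U i" "?Z \<subseteq> V q" "?Z \<subseteq> V p" "?Z \<subseteq> U i" "q \<in> ?Z"
        using op(1) o(1,6)[OF qW'] opens(1) q by auto
      have "mres F (V p \<inter> U i) ?Z (mres F (W \<inter> U i) (V p \<inter> U i) (x i)) = mres F (V q \<inter> U i) ?Z (s q i)"
        unfolding F.res_res[OF opens(2)[OF W] op(2) Z(1,2) VU x(1)] by (rule xr[OF qW Z(1,3,5)])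
      also have "\<dots> = mres F (V p \<inter> U i) ?Z (s p i)"
        by (rule cp[OF qW' p Z(1,3,4,5)])
      finally show "\<exists>Y. zopen C Y \<and> Y \<subseteq> V p \<inter> U i \<and> q \<in> Y \<and>
          mres F (V p \<inter> U i) Y (mres F (W \<inter> U i) (V p \<inter> U i) (x i)) = mres F (V p \<inter> U i) Y (s p i)"
        using Z(1,2,6) by (intro exI[of _ ?Z] conjI)
    qed
  qed
  ultimately show "\<exists>x\<in>carrier (msec T W). \<forall>p\<in>W. mres T W (V p) x = s p"
    by blast
qed

lemma twist_chart_closed:
  assumes "Z \<subseteq> U j" "s \<in> carrier (msec T Z)"
  shows "s j \<in> carrier (msec F Z)"
  using sec[OF assms(2), of j] assms(1) by (simp add: Int_absorb2)

lemma twist_chart_rel: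
  assumes Z: "zopen C Z" "Z \<subseteq> U i" "Z \<subseteq> U j" and s: "s \<in> carrier (msec T Z)"
  shows "s i = act Z (G Z i j) (s j)"
  using sec_rel[OF s Z(1,1) subset_refl Z(2,3)] F.res_id[OF Z(1) twist_chart_closed[OF Z(2) s]]
    F.res_id[OF Z(1) twist_chart_closed[OF Z(3) s]] Z
  by (simp add: Int_absorb2)

text \<open>A twist is trivial over each member of the cover: the \<open>j\<close>-th component determines the others by
  \<open>s\<^sub>i = g\<^sub>i\<^sub>j s\<^sub>j\<close>, and the cocycle condition makes every choice of it admissible.\<close>

lemma twist_chart_bij:
  assumes Z: "zopen C Z" "Z \<subseteq> U j"
  shows "bij_betw (\<lambda>s. s j) (carrier (msec T Z)) (carrier (msec F Z))"
proof (rule bij_betw_imageI)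
  have ZU: "zopen C (Z \<inter> U i)" "Z \<inter> U i \<subseteq> Z" "Z \<inter> U i \<subseteq> U i" "Z \<inter> U i \<subseteq> U j" "Z \<inter> U i \<inter> U j = Z \<inter> U i" for i
    using opens Z by auto
  have s_eq: "s i = act (Z \<inter> U i) (G (Z \<inter> U i) i j) (mres F Z (Z \<inter> U i) (s j))" if s: "s \<in> carrier (msec T Z)" for s i
    using sec_rel[OF s Z(1) ZU(1,2,3,4)[of i]] F.res_id[OF ZU(1) sec[OF s]] Z(2) by (simp add: Int_absorb2)
  show "inj_on (\<lambda>s. s j) (carrier (msec T Z))"
  proof (intro inj_onI ext)
    fix s t i assume s: "s \<in> carrier (msec T Z)" and t: "t \<in> carrier (msec T Z)" and eq: "s j = t j"
    show "s i = t i"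
      unfolding s_eq[OF s, of i] s_eq[OF t, of i] eq ..
  qed
  show "(\<lambda>s. s j) ` carrier (msec T Z) = carrier (msec F Z)"
  proof (intro equalityI subsetI)
    fix z assume z: "z \<in> carrier (msec F Z)"
    define s where "s i = act (Z \<inter> U i) (G (Z \<inter> U i) i j) (mres F Z (Z \<inter> U i) z)" for i
    have zr: "mres F Z (Z \<inter> U i) z \<in> carrier (msec F (Z \<inter> U i))" for i
      by (rule F.res_closed[OF Z(1) ZU(1,2) z])
    have sr: "mres F (Z \<inter> U i) Y (s i) = act Y (G Y i j) (mres F Z Y z)" if Y: "zopen C Y" "Y \<subseteq> Z \<inter> U i" for i Y
      unfolding s_def act_res[OF ZU(1) Y G_closed[OF ZU(1,3,4)] zr] G_res[OF ZU(1) Y ZU(3,4)] F.res_res[OF Z(1) ZU(1) Y ZU(2) z] ..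
    have "s \<in> carrier (msec T Z)"
    proof (rule secI)
      fix i k
      let ?Y = "Z \<inter> U i \<inter> U k"
      have Y: "zopen C ?Y" "?Y \<subseteq> Z \<inter> U i" "?Y \<subseteq> Z \<inter> U k" "?Y \<subseteq> U i" "?Y \<subseteq> U k" "?Y \<subseteq> U j" "?Y \<subseteq> Z"
        using opens Z by auto
      show "s i \<in> carrier (msec F (Z \<inter> U i))"
        unfolding s_def by (rule act_closed[OF ZU(1) G_closed[OF ZU(1,3,4)] zr])
      show "mres F (Z \<inter> U i) ?Y (s i) = act ?Y (G ?Y i k) (mres F (Z \<inter> U k) ?Y (s k))"
        unfolding sr[OF Y(1,2)] sr[OF Y(1,3)] S.cocycle_on[OF c Y(1,4,5,6), symmetric]
        by (rule act_mult[OF Y(1) G_closed[OF Y(1,4,5)] G_closed[OF Y(1,5,6)] F.res_closed[OF Z(1) Y(1,7) z]])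
    qed
    moreover have "s j = z"
      using S.cocycle_id[OF c Z] F.res_id[OF Z(1) z] act_one[OF Z(1) z] Z(2) by (simp add: s_def Int_absorb2)
    ultimately show "z \<in> (\<lambda>s. s j) ` carrier (msec T Z)"
      by blast
  qed (use twist_chart_closed[OF Z(2)] in blast)
qed

end

end

lemma units_action: "sheaf_action C (structure_module C) (units_sheaf C) (\<lambda>V. (\<otimes>\<^bsub>struct_sheaf C V\<^esub>))"
proof (intro sheaf_action.intro structure_module_sheaf units_group_presheaf sheaf_action_axioms.intro, goal_cases)
  case (5 V x)
  then show ?case
    using regular_eta[of C V x] by (simp cong: restrict_cong)
qed (auto simp: regular_mult distrib_left mult_ac fun_eq_iff)

lemma affine_act_add:
  assumes V: "zopen C V" and a: "a \<in> carrier (gsec (affine_sheaf C) V)"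
  shows "affine_act C V a (x \<oplus>\<^bsub>msec (tangent_plus_structure C) V\<^esub> y) =
    affine_act C V a x \<oplus>\<^bsub>msec (tangent_plus_structure C) V\<^esub> affine_act C V a y"
  unfolding affine_act_def tangent_plus_structure_simps fst_conv snd_conv
  by (intro arg_cong2[where f = Pair] vfield_cong restrict_ext) (auto simp: add_divide_distrib distrib_right subset_iff)

lemma affine_act_smult:
  assumes V: "zopen C V" and a: "a \<in> carrier (gsec (affine_sheaf C) V)"
  shows "affine_act C V a (f \<odot>\<^bsub>msec (tangent_plus_structure C) V\<^esub> x) =
    f \<odot>\<^bsub>msec (tangent_plus_structure C) V\<^esub> affine_act C V a x"
  unfolding affine_act_def tangent_plus_structure_simps fst_conv snd_conv
  by (intro arg_cong2[where f = Pair] vfield_cong restrict_ext) (auto simp: algebra_simps subset_iff)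

lemma affine_act_res:
  assumes "zopen C V" "V \<subseteq> U"
  shows "mres (tangent_plus_structure C) U V (affine_act C U a x) =
    affine_act C V (gres (affine_sheaf C) U V a) (mres (tangent_plus_structure C) U V x)"
  unfolding affine_act_def tangent_plus_structure_simps affine_sheaf_simps(4) fst_conv snd_conv
  using assms by (intro arg_cong2[where f = Pair] restrict_vfield) (auto simp: fun_eq_iff)

lemma affine_action: "sheaf_action C (tangent_plus_structure C) (affine_sheaf C) (affine_act C)"
  by (intro sheaf_action.intro tangent_plus_structure_sheaf affine_group_presheaf sheaf_action_axioms.intro)
     (simp_all add: affine_act_closed affine_act_add affine_act_smult affine_act_res affine_act_one affine_act_mult)

lemma TO_smult_smult:
  assumes "z \<in> TO_sections C V"
  shows "f \<odot>\<^bsub>msec (tangent_plus_structure C) V\<^esub> (g \<odot>\<^bsub>msec (tangent_plus_structure C) V\<^esub> z) =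
    (\<lambda>p\<in>V. f p * g p) \<odot>\<^bsub>msec (tangent_plus_structure C) V\<^esub> z"
  unfolding tangent_plus_structure_simps fst_conv snd_conv
  by (intro arg_cong2[where f = Pair] vfield_cong restrict_ext) (auto simp: subset_iff)

lemma conj_sheaf_action:
  assumes n: "n \<ge> 3"
  shows "sheaf_action C (tangent_plus_structure C) (aut_sheaf C n) (conj_action C n)"
proof -
  have n2: "n \<ge> 2" using n by simp
  interpret A: sheaf_action C "tangent_plus_structure C" "affine_sheaf C" "affine_act C"
    by (rule affine_action)
  interpret H: group_presheaf_hom C "aut_sheaf C n" "affine_sheaf C" "affine_of_aut C n"
    by (rule affine_of_aut_hom[OF n2])
  note eq = conj_action_eq[OF _ n] and cl = H.hom_closed
  have pw: "regular C V (\<lambda>p\<in>V. xi n V \<phi> p ^ (n - 1))" if "zopen C V" "\<phi> \<in> jet_aut_sections C n V" for V \<phi>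
    using that by (intro regular_power xi_regular n2)
  show ?thesis
  proof (intro sheaf_action.intro tangent_plus_structure_sheaf aut_group_presheaf sheaf_action_axioms.intro, goal_cases)
    case (1 V a x)
    then show ?case
      unfolding eq[OF 1] by (intro A.F.smult_closed A.act_closed pw cl)
  next
    case (2 V a x y)
    show ?case
      unfolding eq[OF 2(1,2) A.F.add_closed[OF 2(1,3,4)]] eq[OF 2(1-3)] eq[OF 2(1,2,4)] A.act_add[OF 2(1) cl[OF 2(1,2)] 2(3,4)]
      unfolding tangent_plus_structure_simps fst_conv snd_conv
      by (intro arg_cong2[where f = Pair] vfield_cong restrict_ext) (auto simp: distrib_left subset_iff)
  next
    case (3 V a f x)
    show ?case
      unfolding eq[OF 3(1,2) A.F.smult_closed[OF 3(1,3,4)]] eq[OF 3(1,2,4)] A.act_smult[OF 3(1) cl[OF 3(1,2)] 3(3,4)]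
        TO_smult_smult[OF A.act_closed[OF 3(1) cl[OF 3(1,2)] 3(4)]]
      by (simp add: mult.commute)
  next
    case (4 U V a x)
    note g = H.S.gres_closed[OF 4(1-4)] and r = A.F.res_closed[OF 4(1-3,5)]
    have p: "restrict (\<lambda>p\<in>U. xi n U a p ^ (n - 1)) V = (\<lambda>p\<in>V. xi n V (gres (aut_sheaf C n) U V a) p ^ (n - 1))"
      unfolding xi_restrict[OF 4(1) n2 4(4,2,3)] using 4(3) by (auto simp: fun_eq_iff)
    show ?case
      unfolding eq[OF 4(1,4,5)] eq[OF 4(2) g r] A.F.res_smult[OF 4(1-3) pw[OF 4(1,4)] A.act_closed[OF 4(1) cl[OF 4(1,4)] 4(5)]]
        A.act_res[OF 4(1-3) cl[OF 4(1,4)] 4(5)] H.hom_res[OF 4(1-4)] p ..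
  next
    case (5 V x)
    interpret G: group "gsec (aut_sheaf C n) V" by (rule H.S.sec_group[OF 5(1)])
    interpret K: group "gsec (affine_sheaf C) V" by (rule affine_group[OF 5(1)])
    have "affine_of_aut C n V \<one>\<^bsub>gsec (aut_sheaf C n) V\<^esub> = \<one>\<^bsub>gsec (affine_sheaf C) V\<^esub>"
      using H.hom_mult[OF 5(1) G.one_closed G.one_closed] H.hom_closed[OF 5(1) G.one_closed]
      by (simp add: K.l_cancel_one)
    moreover from this have "xi n V \<one>\<^bsub>gsec (aut_sheaf C n) V\<^esub> = (\<lambda>p\<in>V. 1)"
      by (simp add: affine_of_aut_def affine_sheaf_simps)
    moreover have "(\<lambda>p\<in>V. 1) \<odot>\<^bsub>msec (tangent_plus_structure C) V\<^esub> x = x"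
    proof -
      have "(\<lambda>p\<in>V. 1) \<odot>\<^bsub>msec (tangent_plus_structure C) V\<^esub> affine_act C V \<one>\<^bsub>gsec (affine_sheaf C) V\<^esub> x
          = affine_act C V \<one>\<^bsub>gsec (affine_sheaf C) V\<^esub> x"
        unfolding affine_act_def tangent_plus_structure_simps fst_conv snd_conv
        by (intro arg_cong2[where f = Pair] vfield_cong restrict_ext) (auto simp: subset_iff)
      then show ?thesis
        using A.act_one[OF 5] by simp
    qed
    ultimately show ?case
      unfolding eq[OF 5(1) G.one_closed 5(2)] using A.act_one[OF 5] by (simp cong: restrict_cong)
  next
    case (6 V a b x)
    note ca = cl[OF 6(1,2)] and cb = cl[OF 6(1,3)]
    have ab: "a \<otimes>\<^bsub>gsec (aut_sheaf C n) V\<^esub> b \<in> jet_aut_sections C n V"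
      by (rule aut_sheaf_mult_closed[OF 6(2,3)])
    have bx: "affine_act C V (affine_of_aut C n V b) x \<in> TO_sections C V"
      by (rule A.act_closed[OF 6(1) cb 6(4)])
    have sbx: "(\<lambda>p\<in>V. xi n V b p ^ (n - 1)) \<odot>\<^bsub>msec (tangent_plus_structure C) V\<^esub> affine_act C V (affine_of_aut C n V b) x \<in> TO_sections C V"
      by (rule A.F.smult_closed[OF 6(1) pw[OF 6(1,3)] bx])
    have p: "(\<lambda>p\<in>V. xi n V (a \<otimes>\<^bsub>gsec (aut_sheaf C n) V\<^esub> b) p ^ (n - 1))
        = (\<lambda>p\<in>V. (\<lambda>p\<in>V. xi n V a p ^ (n - 1)) p * (\<lambda>p\<in>V. xi n V b p ^ (n - 1)) p)"
      by (rule restrict_ext) (simp add: xi_mult[OF 6(1) n2 6(2,3)] power_mult_distrib)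
    show ?case
      unfolding eq[OF 6(1) ab 6(4)] eq[OF 6(1,3,4)] eq[OF 6(1,2) sbx] A.act_smult[OF 6(1) ca pw[OF 6(1,3)] bx]
        TO_smult_smult[OF A.act_closed[OF 6(1) ca bx]] H.hom_mult[OF 6(1-3)] A.act_mult[OF 6(1) ca cb 6(4)] p ..
  qed
qed

section \<open>Line bundles\<close>

locale line_cocycle =
  fixes C :: "'n::finite pt set" and u :: "('i, 'n pt, 'n pt \<Rightarrow> complex) cochain"
  assumes u: "u \<in> cocycles C (units_sheaf C)"
begin

sublocale sheaf_action C "structure_module C" "units_sheaf C" "\<lambda>V. (\<otimes>\<^bsub>struct_sheaf C V\<^esub>)"
  by (rule units_action)

abbreviation L where "L \<equiv> line_bundle C u"

lemma u_open: "zopen C (fst u i)"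
  by (rule cocyclesD(1)[OF u])

lemma u_pt:
  shows u_nonzero: "p \<in> fst u i \<Longrightarrow> p \<in> fst u j \<Longrightarrow> snd u i j p \<noteq> 0"
    and u_mult: "p \<in> fst u i \<Longrightarrow> p \<in> fst u j \<Longrightarrow> p \<in> fst u k \<Longrightarrow> snd u i j p * snd u j k p = snd u i k p"
    and u_id: "p \<in> fst u i \<Longrightarrow> snd u i i p = 1"
proof -
  have o: "zopen C (fst u i \<inter> fst u j)" for i j
    using u_open by blast
  show nz: "p \<in> fst u i \<Longrightarrow> p \<in> fst u j \<Longrightarrow> snd u i j p \<noteq> 0" for i j
    using cocyclesD(3)[OF u, of i j] o by simp
  show m: "p \<in> fst u i \<Longrightarrow> p \<in> fst u j \<Longrightarrow> p \<in> fst u k \<Longrightarrow> snd u i j p * snd u j k p = snd u i k p" for i j k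
    using fun_cong[OF cocyclesD(4)[OF u, of i j k], of p] by simp
  show "p \<in> fst u i \<Longrightarrow> snd u i i p = 1"
    using m[of i i i] nz[of i i] by simp
qed

lemma u_regular: "regular C (fst u i \<inter> fst u j) (snd u i j)"
proof -
  have "zopen C (fst u i \<inter> fst u j)"
    using u_open by blast
  then show ?thesis
    using cocyclesD(3)[OF u, of i j] by simp
qed

lemma L_presheaf: "module_presheaf C L"
  unfolding line_bundle_def by (rule twist_presheaf[OF u])

lemma L_simps:
  "y \<oplus>\<^bsub>msec L W\<^esub> y' = (\<lambda>i. \<lambda>p\<in>W \<inter> fst u i. y i p + y' i p)"
  "a \<odot>\<^bsub>msec L W\<^esub> y = (\<lambda>i. \<lambda>p\<in>W \<inter> fst u i. restrict a (W \<inter> fst u i) p * y i p)"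
  "\<zero>\<^bsub>msec L W\<^esub> = (\<lambda>i. \<lambda>p\<in>W \<inter> fst u i. 0)"
  "mres L W W' y = (\<lambda>i. restrict (y i) (W' \<inter> fst u i))"
  unfolding line_bundle_def twist_simps structure_module_simps by (rule refl)+

lemma L_secD:
  assumes "y \<in> carrier (msec L W)"
  shows "regular C (W \<inter> fst u i) (y i)"
    and "p \<in> W \<Longrightarrow> p \<in> fst u i \<Longrightarrow> p \<in> fst u j \<Longrightarrow> y i p = snd u i j p * y j p"
proof -
  have y: "(\<forall>i. regular C (W \<inter> fst u i) (y i)) \<and> (\<forall>i j. restrict (y i) (W \<inter> fst u i \<inter> fst u j) =
      (\<lambda>p\<in>W \<inter> fst u i \<inter> fst u j. restrict (snd u i j) (W \<inter> fst u i \<inter> fst u j) p * restrict (y j) (W \<inter> fst u i \<inter> fst u j) p))"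
    using assms unfolding line_bundle_def twist_simps structure_module_simps struct_sheaf_simps units_sheaf_simps .
  show "regular C (W \<inter> fst u i) (y i)"
    using conjunct1[OF y] by (rule spec)
  show "p \<in> W \<Longrightarrow> p \<in> fst u i \<Longrightarrow> p \<in> fst u j \<Longrightarrow> y i p = snd u i j p * y j p"
    using fun_cong[OF spec[OF spec[OF conjunct2[OF y], of i], of j], of p] by simp
qed

lemma L_eqI:
  assumes "y \<in> carrier (msec L W)" "y' \<in> carrier (msec L W)"
    and "\<And>i p. p \<in> W \<Longrightarrow> p \<in> fst u i \<Longrightarrow> y i p = y' i p"
  shows "y = y'"
  by (rule ext, rule regular_ext[OF L_secD(1)[OF assms(1)] L_secD(1)[OF assms(2)]]) (use assms(3) in auto)

text \<open>The generator over \<open>U\<^sub>b\<close>: the section whose \<open>b\<close>-th component is 1.\<close>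

definition gen :: "'i \<Rightarrow> 'n pt set \<Rightarrow> 'i \<Rightarrow> 'n pt \<Rightarrow> complex"
  where "gen b Z = (\<lambda>i. \<lambda>p\<in>Z \<inter> fst u i. snd u i b p)"

context
  fixes b Z
  assumes Z: "zopen C Z" "Z \<subseteq> fst u b"
begin

lemma gen_closed: "gen b Z \<in> carrier (msec L Z)"
  unfolding line_bundle_def
proof (rule secI[OF u])
  fix i j
  have "regular C (Z \<inter> fst u i) (restrict (snd u i b) (Z \<inter> fst u i))"
    using Z u_open by (intro regular_restrict[OF u_regular]) auto
  then show "gen b Z i \<in> carrier (msec (structure_module C) (Z \<inter> fst u i))"
    by (simp add: gen_def)
  let ?Y = "Z \<inter> fst u i \<inter> fst u j"
  have "p \<in> ?Y \<Longrightarrow> snd u i b p = snd u i j p * snd u j b p" for p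
    using u_mult[of p i j b] Z by auto
  then show "mres (structure_module C) (Z \<inter> fst u i) ?Y (gen b Z i) =
      gres (units_sheaf C) (fst u i \<inter> fst u j) ?Y (snd u i j) \<otimes>\<^bsub>struct_sheaf C ?Y\<^esub> mres (structure_module C) (Z \<inter> fst u j) ?Y (gen b Z j)"
    by (auto simp: gen_def fun_eq_iff)
qed

lemma coord_regular: "y \<in> carrier (msec L Z) \<Longrightarrow> regular C Z (y b)"
  using L_secD(1)[of y Z b] Z by (simp add: Int_absorb2)

lemma coord_gen: "gen b Z b = (\<lambda>p\<in>Z. 1)"
  using Z u_id by (auto simp: gen_def fun_eq_iff Int_absorb2)

lemma smult_gen_apply: "p \<in> Z \<Longrightarrow> p \<in> fst u i \<Longrightarrow> (a \<odot>\<^bsub>msec L Z\<^esub> gen b Z) i p = a p * snd u i b p"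
  by (simp add: L_simps gen_def)

lemma gen_coord:
  assumes y: "y \<in> carrier (msec L Z)"
  shows "y b \<odot>\<^bsub>msec L Z\<^esub> gen b Z = y"
proof (rule L_eqI)
  show "y b \<odot>\<^bsub>msec L Z\<^esub> gen b Z \<in> carrier (msec L Z)" "y \<in> carrier (msec L Z)"
    using y by (auto intro!: module_presheaf.smult_closed[OF L_presheaf] Z gen_closed coord_regular)
  fix i p assume "p \<in> Z" "p \<in> fst u i"
  moreover from this have "p \<in> fst u b" using Z by blast
  ultimately show "(y b \<odot>\<^bsub>msec L Z\<^esub> gen b Z) i p = y i p"
    using L_secD(2)[OF y, of p i b] by (simp add: smult_gen_apply)
qed

lemma coord_add: "(y \<oplus>\<^bsub>msec L Z\<^esub> y') b = (\<lambda>p\<in>Z. y b p + y' b p)"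
  using Z by (simp add: L_simps Int_absorb2)

lemma coord_smult: "(a \<odot>\<^bsub>msec L Z\<^esub> y) b = (\<lambda>p\<in>Z. a p * y b p)"
  using Z by (auto simp: L_simps Int_absorb2 fun_eq_iff)

lemma gen_res: "zopen C Z' \<Longrightarrow> Z' \<subseteq> Z \<Longrightarrow> mres L Z Z' (gen b Z) = gen b Z'"
  by (auto simp: L_simps gen_def fun_eq_iff)

text \<open>The relation \<open>u\<^sub>i\<^sub>b\<^sub>' = u\<^sub>i\<^sub>b u\<^sub>b\<^sub>b\<^sub>'\<close> compares the generators over two members of the cover.\<close>

lemma gen_change:
  assumes "Z \<subseteq> fst u b'"
  shows "gen b' Z = restrict (snd u b b') Z \<odot>\<^bsub>msec L Z\<^esub> gen b Z"
proof -
  have "snd u i b' p = snd u b b' p * snd u i b p" if "p \<in> Z" "p \<in> fst u i" for i p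
  proof -
    have "p \<in> fst u b" "p \<in> fst u b'" using that assms Z by auto
    then show ?thesis
      using u_mult[of p i b b'] that by (simp add: mult.commute)
  qed
  then show ?thesis
    by (auto simp: L_simps gen_def fun_eq_iff)
qed

end

end

lemma inverse_hom: "group_presheaf_hom C (units_sheaf C) (units_sheaf C) (\<lambda>V \<nu>. inv\<^bsub>gsec (units_sheaf C) V\<^esub> \<nu>)"
proof (intro group_presheaf_hom.intro units_group_presheaf group_presheaf_hom_axioms.intro)
  fix U x y assume U: "zopen C U" and x: "x \<in> carrier (gsec (units_sheaf C) U)"
  interpret comm_group "gsec (units_sheaf C) U"
    using group_units_struct_sheaf[OF U] by simp
  show "inv\<^bsub>gsec (units_sheaf C) U\<^esub> x \<in> carrier (gsec (units_sheaf C) U)"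
    by (rule inv_closed[OF x])
  assume y: "y \<in> carrier (gsec (units_sheaf C) U)"
  show "inv\<^bsub>gsec (units_sheaf C) U\<^esub> (x \<otimes>\<^bsub>gsec (units_sheaf C) U\<^esub> y) =
      inv\<^bsub>gsec (units_sheaf C) U\<^esub> x \<otimes>\<^bsub>gsec (units_sheaf C) U\<^esub> inv\<^bsub>gsec (units_sheaf C) U\<^esub> y"
    by (rule inv_mult[OF x y])
next
  fix U V x assume "zopen C U" "zopen C V" "V \<subseteq> U" "x \<in> carrier (gsec (units_sheaf C) U)"
  then show "inv\<^bsub>gsec (units_sheaf C) V\<^esub> gres (units_sheaf C) U V x = gres (units_sheaf C) U V (inv\<^bsub>gsec (units_sheaf C) U\<^esub> x)"
    by (rule group_presheaf.gres_inv[OF units_group_presheaf, symmetric])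
qed

section \<open>Local coordinates of the extension\<close>

locale extension_charts =
  fixes C :: "'n::finite pt set" and E :: "('n pt, 'e) module_sheaf"
    and U :: "'i \<Rightarrow> 'n pt set" and \<psi> :: "'i \<Rightarrow> 'i \<Rightarrow> 'n jet_aut"
    and \<iota> :: "'n pt set \<Rightarrow> 'n vfield \<Rightarrow> 'e" and \<pi> :: "'n pt set \<Rightarrow> 'e \<Rightarrow> 'i \<Rightarrow> 'n pt \<Rightarrow> complex"
    and s :: "'i \<Rightarrow> 'n pt set \<Rightarrow> ('i \<Rightarrow> 'n pt \<Rightarrow> complex) \<Rightarrow> 'e"
  assumes cocycle: "(U, \<psi>) \<in> cocycles C (aut_sheaf C 2)"
    and E: "is_module_sheaf C E"
    and exact: "short_exact C (tangent_sheaf C) E (dual_line_bundle C (map_cochain (xi 2) (U, \<psi>))) \<iota> \<pi>"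
    and s_hom: "module_sheaf_hom C (U i) (dual_line_bundle C (map_cochain (xi 2) (U, \<psi>))) E (s i)"
    and s_split: "W \<in> opens C (U i) \<Longrightarrow> f \<in> carrier (msec (dual_line_bundle C (map_cochain (xi 2) (U, \<psi>))) W) \<Longrightarrow> \<pi> W (s i W f) = f"
    and s_diff: "W \<in> opens C (U i \<inter> U j) \<Longrightarrow> f \<in> carrier (msec (dual_line_bundle C (map_cochain (xi 2) (U, \<psi>))) W) \<Longrightarrow>
      s i W f = s j W f \<oplus>\<^bsub>msec E W\<^esub> \<iota> W (restrict (f i) W \<odot>\<^bsub>msec (tangent_sheaf C) W\<^esub>
        mres (tangent_sheaf C) (U i \<inter> U j) W (aut2_mu C (U i \<inter> U j) (\<psi> i j)))"
begin

text \<open>The cocycle of \<open>L\<^sup>*\<close>.\<close>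

definition w where "w = map_cochain (\<lambda>V \<nu>. inv\<^bsub>gsec (units_sheaf C) V\<^esub> \<nu>) (map_cochain (xi 2) (U, \<psi>))"

lemma w_cocycle: "w \<in> cocycles C (units_sheaf C)"
  unfolding w_def
  by (intro group_presheaf_hom.map_cocycle[OF inverse_hom] group_presheaf_hom.map_cocycle[OF xi_hom] cocycle order_refl)

sublocale w: line_cocycle C w
  by unfold_locales (rule w_cocycle)

abbreviation B where "B \<equiv> line_bundle C w"

lemma B_eq: "dual_line_bundle C (map_cochain (xi 2) (U, \<psi>)) = B"
  by (simp add: dual_line_bundle_def w_def)

lemma U_open: "zopen C (U i)" "zopen C (U i \<inter> U j)"
  using cocyclesD(1)[OF cocycle] by auto

lemma \<psi>_aut: "\<psi> i j \<in> jet_aut_sections C 2 (U i \<inter> U j)"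
  using cocyclesD(3)[OF cocycle, of i j] by simp

abbreviation \<nu> where "\<nu> i j \<equiv> xi 2 (U i \<inter> U j) (\<psi> i j)"
abbreviation \<mu> where "\<mu> i j \<equiv> aut_mu C 2 (U i \<inter> U j) (\<psi> i j)"

lemma fst_w [simp]: "fst w i = U i"
  by (simp add: w_def map_cochain_def)

lemma snd_w: "p \<in> U i \<Longrightarrow> p \<in> U j \<Longrightarrow> snd w i j p = inverse (\<nu> i j p)"
  using inv_units_struct_sheaf[OF U_open(2) xi_regular[OF U_open(2) order_refl \<psi>_aut] xi_nonzero[OF U_open(2) order_refl \<psi>_aut]]
  by (simp add: w_def map_cochain_def)

lemma E_module: "zopen C W \<Longrightarrow> module (struct_sheaf C W) (msec E W)"
  using E zopen_subset[of C W] unfolding is_module_sheaf_def by simp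

lemma E_presheaf: "module_presheaf C E"
proof (rule module_presheaf.intro, goal_cases)
  case (1 W x y)
  then show ?case by (intro abelian_groupE(1)[OF module.axioms(2)[OF E_module]])
next
  case (2 W f x)
  then show ?case by (intro module.smult_closed[OF E_module]) auto
next
  case (3 W V x)
  then show ?case using E zopen_subset[of C W] unfolding is_module_sheaf_def by simp
next
  case (4 W V V' x)
  then show ?case using E zopen_subset[of C W] unfolding is_module_sheaf_def by simp
next
  case (5 W V x y)
  then show ?case using E zopen_subset[of C W] unfolding is_module_sheaf_def by simp
next
  case (6 W V f x)
  then show ?case using E zopen_subset[of C W] unfolding is_module_sheaf_def by simp
qed

lemma hom_facts:
  assumes h: "module_sheaf_hom C A F G h" and W: "zopen C W" "W \<subseteq> A" and x: "x \<in> carrier (msec F W)"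
  shows "h W x \<in> carrier (msec G W)"
    and "y \<in> carrier (msec F W) \<Longrightarrow> h W (x \<oplus>\<^bsub>msec F W\<^esub> y) = h W x \<oplus>\<^bsub>msec G W\<^esub> h W y"
    and "regular C W f \<Longrightarrow> h W (f \<odot>\<^bsub>msec F W\<^esub> x) = f \<odot>\<^bsub>msec G W\<^esub> h W x"
    and "zopen C V \<Longrightarrow> V \<subseteq> W \<Longrightarrow> h V (mres F W V x) = mres G W V (h W x)"
  using h W x unfolding module_sheaf_hom_def by simp_all

lemma \<iota>_hom: "module_sheaf_hom C C (tangent_sheaf C) E \<iota>" and \<pi>_hom: "module_sheaf_hom C C E B \<pi>"
  and \<iota>_inj: "zopen C W \<Longrightarrow> inj_on (\<iota> W) (tangent_sections C W)"
  and \<iota>_image: "zopen C W \<Longrightarrow> \<iota> W ` tangent_sections C W = {e \<in> carrier (msec E W). \<pi> W e = \<zero>\<^bsub>msec B W\<^esub>}"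
  using exact zopen_subset[of C W] unfolding short_exact_def B_eq by simp_all

lemmas \<iota>_facts = hom_facts[OF \<iota>_hom _ zopen_subset]
lemmas \<pi>_facts = hom_facts[OF \<pi>_hom _ zopen_subset]
lemmas s_facts = hom_facts[OF s_hom[unfolded B_eq]]

text \<open>The splitting of the extension over \<open>U\<^sub>i\<close>, combined with the trivialisation of the quotient
  \<open>L\<^sup>*\<close> by its generator.\<close>

definition \<Theta> :: "'i \<Rightarrow> 'n pt set \<Rightarrow> 'n vfield \<times> ('n pt \<Rightarrow> complex) \<Rightarrow> 'e"
  where "\<Theta> i Z z = \<iota> Z (fst z) \<oplus>\<^bsub>msec E Z\<^esub> s i Z (snd z \<odot>\<^bsub>msec B Z\<^esub> w.gen i Z)"

context
  fixes Z i
  assumes Z: "zopen C Z" "Z \<subseteq> U i"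
begin

interpretation M: module "struct_sheaf C Z" "msec E Z"
  by (rule E_module[OF Z(1)])

interpretation BP: module_presheaf C B
  by (rule w.L_presheaf)

lemma Zw: "Z \<subseteq> fst w i"
  using Z by simp

lemma line_closed: "regular C Z \<beta> \<Longrightarrow> \<beta> \<odot>\<^bsub>msec B Z\<^esub> w.gen i Z \<in> carrier (msec B Z)"
  by (intro BP.smult_closed Z w.gen_closed Zw)

lemma line_coord: "regular C Z \<beta> \<Longrightarrow> (\<beta> \<odot>\<^bsub>msec B Z\<^esub> w.gen i Z) i = \<beta>"
  unfolding w.coord_smult[OF Z(1) Zw] w.coord_gen[OF Z(1) Zw]
  using regular_eta[of C Z \<beta>] by (simp cong: restrict_cong)

lemma \<Theta>_parts:
  assumes z: "z \<in> TO_sections C Z"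
  shows "\<iota> Z (fst z) \<in> carrier (msec E Z)" "s i Z (snd z \<odot>\<^bsub>msec B Z\<^esub> w.gen i Z) \<in> carrier (msec E Z)"
    "fst z \<in> tangent_sections C Z" "snd z \<odot>\<^bsub>msec B Z\<^esub> w.gen i Z \<in> carrier (msec B Z)" "regular C Z (snd z)"
  using z by (auto simp: tangent_plus_structure_simps intro!: \<iota>_facts(1) s_facts(1) Z line_closed)

lemma \<Theta>_closed: "z \<in> TO_sections C Z \<Longrightarrow> \<Theta> i Z z \<in> carrier (msec E Z)"
  unfolding \<Theta>_def using \<Theta>_parts[of z] by auto

lemma \<Theta>_add:
  assumes z: "z \<in> TO_sections C Z" and z': "z' \<in> TO_sections C Z"
  shows "\<Theta> i Z (z \<oplus>\<^bsub>msec (tangent_plus_structure C) Z\<^esub> z') = \<Theta> i Z z \<oplus>\<^bsub>msec E Z\<^esub> \<Theta> i Z z'"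
proof -
  note p = \<Theta>_parts[OF z] and p' = \<Theta>_parts[OF z']
  have 1: "fst (z \<oplus>\<^bsub>msec (tangent_plus_structure C) Z\<^esub> z') = fst z \<oplus>\<^bsub>msec (tangent_sheaf C) Z\<^esub> fst z'"
    by (simp add: tangent_plus_structure_simps tangent_ops)
  have 2: "snd (z \<oplus>\<^bsub>msec (tangent_plus_structure C) Z\<^esub> z') \<odot>\<^bsub>msec B Z\<^esub> w.gen i Z =
      (snd z \<odot>\<^bsub>msec B Z\<^esub> w.gen i Z) \<oplus>\<^bsub>msec B Z\<^esub> (snd z' \<odot>\<^bsub>msec B Z\<^esub> w.gen i Z)"
    unfolding w.L_simps tangent_plus_structure_simps snd_conv by (intro ext) (auto simp: distrib_right restrict_def)
  show ?thesis
    unfolding \<Theta>_def 1 2 \<iota>_facts(2)[OF Z(1,1) p(3) p'(3)] s_facts(2)[OF Z p(4) p'(4)]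
    using p p' by (simp add: M.M.a_ac)
qed

lemma \<Theta>_smult:
  assumes z: "z \<in> TO_sections C Z" and a: "regular C Z a"
  shows "\<Theta> i Z (a \<odot>\<^bsub>msec (tangent_plus_structure C) Z\<^esub> z) = a \<odot>\<^bsub>msec E Z\<^esub> \<Theta> i Z z"
proof -
  note p = \<Theta>_parts[OF z]
  have 1: "fst (a \<odot>\<^bsub>msec (tangent_plus_structure C) Z\<^esub> z) = a \<odot>\<^bsub>msec (tangent_sheaf C) Z\<^esub> fst z"
    by (simp add: tangent_plus_structure_simps tangent_ops)
  have 2: "snd (a \<odot>\<^bsub>msec (tangent_plus_structure C) Z\<^esub> z) \<odot>\<^bsub>msec B Z\<^esub> w.gen i Z =
      a \<odot>\<^bsub>msec B Z\<^esub> (snd z \<odot>\<^bsub>msec B Z\<^esub> w.gen i Z)"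
    unfolding w.L_simps tangent_plus_structure_simps snd_conv by (intro ext) (auto simp: mult.assoc restrict_def)
  show ?thesis
    unfolding \<Theta>_def 1 2 \<iota>_facts(3)[OF Z(1,1) p(3) a] s_facts(3)[OF Z p(4) a]
    using p a by (simp add: M.smult_r_distr)
qed

lemma \<Theta>_res:
  assumes z: "z \<in> TO_sections C Z" and Z': "zopen C Z'" "Z' \<subseteq> Z"
  shows "mres E Z Z' (\<Theta> i Z z) = \<Theta> i Z' (mres (tangent_plus_structure C) Z Z' z)"
proof -
  note p = \<Theta>_parts[OF z]
  have 1: "fst (mres (tangent_plus_structure C) Z Z' z) = mres (tangent_sheaf C) Z Z' (fst z)"
    by (simp add: tangent_plus_structure_simps tangent_ops)
  have 2: "snd (mres (tangent_plus_structure C) Z Z' z) \<odot>\<^bsub>msec B Z'\<^esub> w.gen i Z' = mres B Z Z' (snd z \<odot>\<^bsub>msec B Z\<^esub> w.gen i Z)"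
    unfolding BP.res_smult[OF Z(1) Z' p(5) w.gen_closed[OF Z(1) Zw]] w.gen_res[OF Z(1) Zw Z']
    by (simp add: tangent_plus_structure_simps)
  show ?thesis
    unfolding \<Theta>_def 1 2 \<iota>_facts(4)[OF Z(1,1) p(3) Z'] s_facts(4)[OF Z p(4) Z']
    by (rule module_presheaf.res_add[OF E_presheaf Z(1) Z' p(1,2)])
qed

lemma \<pi>_\<Theta>:
  assumes z: "z \<in> TO_sections C Z"
  shows "\<pi> Z (\<Theta> i Z z) = snd z \<odot>\<^bsub>msec B Z\<^esub> w.gen i Z"
proof -
  note p = \<Theta>_parts[OF z]
  have "\<pi> Z (\<iota> Z (fst z)) = \<zero>\<^bsub>msec B Z\<^esub>"
    using \<iota>_image[OF Z(1)] p(3) by blast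
  moreover have "\<pi> Z (s i Z (snd z \<odot>\<^bsub>msec B Z\<^esub> w.gen i Z)) = snd z \<odot>\<^bsub>msec B Z\<^esub> w.gen i Z"
    using s_split[of Z i] p(4) Z by (simp add: B_eq)
  ultimately show ?thesis
    unfolding \<Theta>_def \<pi>_facts(2)[OF Z(1,1) p(1,2)] by (auto simp: w.L_simps fun_eq_iff)
qed

lemma \<Theta>_bij: "bij_betw (\<Theta> i Z) (TO_sections C Z) (carrier (msec E Z))"
proof (rule bij_betw_imageI)
  show "inj_on (\<Theta> i Z) (TO_sections C Z)"
  proof (rule inj_onI)
    fix z z' assume z: "z \<in> TO_sections C Z" and z': "z' \<in> TO_sections C Z" and eq: "\<Theta> i Z z = \<Theta> i Z z'"
    note p = \<Theta>_parts[OF z] and p' = \<Theta>_parts[OF z']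
    have g: "snd z \<odot>\<^bsub>msec B Z\<^esub> w.gen i Z = snd z' \<odot>\<^bsub>msec B Z\<^esub> w.gen i Z"
      unfolding \<pi>_\<Theta>[OF z, symmetric] \<pi>_\<Theta>[OF z', symmetric] eq ..
    have "snd z = (snd z \<odot>\<^bsub>msec B Z\<^esub> w.gen i Z) i"
      by (rule line_coord[OF p(5), symmetric])
    also have "\<dots> = snd z'"
      unfolding g by (rule line_coord[OF p'(5)])
    finally have "snd z = snd z'" .
    moreover have "\<iota> Z (fst z) = \<iota> Z (fst z')"
      using eq[unfolded \<Theta>_def g] M.M.add.right_cancel[OF p'(2) p(1) p'(1)] by (rule iffD1[rotated])
    then have "fst z = fst z'"
      using \<iota>_inj[OF Z(1)] p(3) p'(3) by (simp add: inj_on_def)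
    ultimately show "z = z'"
      by (simp add: prod_eq_iff)
  qed
  show "\<Theta> i Z ` TO_sections C Z = carrier (msec E Z)"
  proof (intro equalityI subsetI)
    fix e assume e: "e \<in> carrier (msec E Z)"
    let ?f = "\<pi> Z e"
    have f: "?f \<in> carrier (msec B Z)"
      by (rule \<pi>_facts(1)[OF Z(1,1) e])
    have \<beta>: "regular C Z (?f i)" "?f i \<odot>\<^bsub>msec B Z\<^esub> w.gen i Z = ?f"
      by (rule w.coord_regular[OF Z(1) Zw f], rule w.gen_coord[OF Z(1) Zw f])
    have sf: "s i Z ?f \<in> carrier (msec E Z)" "\<pi> Z (s i Z ?f) = ?f"
      by (rule s_facts(1)[OF Z f], rule s_split[unfolded B_eq, OF _ f, of i]) (use Z in simp)
    define d where "d = e \<ominus>\<^bsub>msec E Z\<^esub> s i Z ?f"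
    have d: "d \<in> carrier (msec E Z)" "d \<oplus>\<^bsub>msec E Z\<^esub> s i Z ?f = e"
      unfolding d_def M.M.minus_eq
      by (rule M.M.a_closed[OF e M.M.a_inv_closed[OF sf(1)]],
          simp only: M.M.a_assoc[OF e M.M.a_inv_closed[OF sf(1)] sf(1)] M.M.l_neg[OF sf(1)] M.M.r_zero[OF e])
    have \<pi>d: "\<pi> Z d \<in> carrier (msec B Z)"
      by (rule \<pi>_facts(1)[OF Z(1,1) d(1)])
    have "?f = \<pi> Z d \<oplus>\<^bsub>msec B Z\<^esub> ?f"
      using \<pi>_facts(2)[OF Z(1,1) d(1) sf(1)] unfolding d(2) sf(2) .
    then have pw: "?f j p = (\<pi> Z d \<oplus>\<^bsub>msec B Z\<^esub> ?f) j p" for j p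
      by (rule fun_cong[OF fun_cong])
    have z0: "\<pi> Z d = \<zero>\<^bsub>msec B Z\<^esub>"
    proof (rule ext)
      fix j show "\<pi> Z d j = \<zero>\<^bsub>msec B Z\<^esub> j"
        unfolding w.L_simps
      proof (rule extensionalityI[OF regular_extensional[OF w.L_secD(1)[OF \<pi>d]]])
        fix p assume "p \<in> Z \<inter> fst w j"
        then show "\<pi> Z d j p = (\<lambda>p\<in>Z \<inter> fst w j. 0) p"
          using pw[of j p, unfolded w.L_simps] by simp
      qed simp
    qed
    have "d \<in> \<iota> Z ` tangent_sections C Z"
      unfolding \<iota>_image[OF Z(1)] by (intro CollectI conjI d(1) z0)
    then obtain \<theta> where \<theta>: "d = \<iota> Z \<theta>" "\<theta> \<in> tangent_sections C Z"
      by (rule imageE)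
    have "(\<theta>, ?f i) \<in> TO_sections C Z"
      unfolding tangent_plus_structure_simps fst_conv snd_conv using \<theta>(2) \<beta>(1) by (rule conjI)
    moreover have "e = \<Theta> i Z (\<theta>, ?f i)"
      unfolding \<Theta>_def fst_conv snd_conv \<beta>(2) \<theta>(1)[symmetric] by (rule d(2)[symmetric])
    ultimately show "e \<in> \<Theta> i Z ` TO_sections C Z"
      by (rule image_eqI[rotated])
  qed (use \<Theta>_closed in blast)
qed

text \<open>The class of the extension gives the transition functions: the section with coordinate \<open>\<beta>\<close>
  over \<open>U\<^sub>j\<close> has coordinate \<open>\<beta> / \<nu>\<^sub>i\<^sub>j\<close> over \<open>U\<^sub>i\<close>, so that \<open>s\<^sub>i\<close> and \<open>s\<^sub>j\<close> differ on it by the image of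
  \<open>\<beta> / \<nu>\<^sub>i\<^sub>j \<mu>\<^sub>i\<^sub>j\<close>, which the affine action subtracts from the vector field.\<close>

lemma \<Theta>_transition:
  assumes Zj: "Z \<subseteq> U j" and z: "z \<in> TO_sections C Z"
  shows "\<Theta> i Z (affine_act C Z (gres (affine_sheaf C) (U i \<inter> U j) Z (affine_of_aut C 2 (U i \<inter> U j) (\<psi> i j))) z) = \<iota> Z (fst z) \<oplus>\<^bsub>msec E Z\<^esub> s j Z (snd z \<odot>\<^bsub>msec B Z\<^esub> w.gen j Z)"
proof -
  interpret A: sheaf_action C "tangent_plus_structure C" "affine_sheaf C" "affine_act C"
    by (rule affine_action)
  interpret H: group_presheaf_hom C "aut_sheaf C 2" "affine_sheaf C" "affine_of_aut C 2"
    by (rule affine_of_aut_hom) simp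
  let ?a = "gres (affine_sheaf C) (U i \<inter> U j) Z (affine_of_aut C 2 (U i \<inter> U j) (\<psi> i j))"
  have Zij: "Z \<subseteq> U i \<inter> U j" "Z \<subseteq> fst w j" using Z Zj by auto
  have ac: "?a \<in> carrier (gsec (affine_sheaf C) Z)"
    by (rule A.S.gres_closed[OF U_open(2) Z(1) Zij(1) H.hom_closed[OF U_open(2) \<psi>_aut]])
  let ?z = "affine_act C Z ?a z"
  have z': "?z \<in> TO_sections C Z"
    by (rule A.act_closed[OF Z(1) ac z])
  note p' = \<Theta>_parts[OF z']
  have zp: "fst z \<in> tangent_sections C Z" "regular C Z (snd z)"
    using z by (simp_all add: tangent_plus_structure_simps)
  let ?f = "snd z \<odot>\<^bsub>msec B Z\<^esub> w.gen j Z"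
  have f: "?f \<in> carrier (msec B Z)"
    by (intro BP.smult_closed Z zp w.gen_closed Zij)
  have f_i: "?f i p = snd z p * inverse (\<nu> i j p)" if "p \<in> Z" for p
  proof -
    have "p \<in> U i" "p \<in> U j" using that Zij by auto
    then show ?thesis
      using w.smult_gen_apply[OF Z(1) Zij(2), of p i "snd z"] that snd_w[of p i j] by simp
  qed
  have "snd ?z = ?f i"
  proof (rule regular_ext[OF p'(5) w.coord_regular[OF Z(1) Zw f]])
    fix p assume p: "p \<in> Z"
    then show "snd ?z p = ?f i p"
      unfolding f_i[OF p] by (simp add: affine_act_def affine_sheaf_simps(4) affine_of_aut_def divide_inverse)
  qed
  then have line: "snd ?z \<odot>\<^bsub>msec B Z\<^esub> w.gen i Z = ?f"
    using w.gen_coord[OF Z(1) Zw f] by simp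
  let ?v = "restrict (?f i) Z \<odot>\<^bsub>msec (tangent_sheaf C) Z\<^esub> mres (tangent_sheaf C) (U i \<inter> U j) Z (aut2_mu C (U i \<inter> U j) (\<psi> i j))"
  have v: "?v \<in> tangent_sections C Z"
    unfolding aut2_mu_eq[OF U_open(2) \<psi>_aut]
    by (intro tangent_smult_closed tangent_res_closed Zij Z aut_mu_tangent U_open \<psi>_aut order_refl regular_restrict[OF w.coord_regular[OF Z(1) Zw f]] subset_refl)
  have sum: "fst ?z \<oplus>\<^bsub>msec (tangent_sheaf C) Z\<^esub> ?v = fst z"
  proof (rule tangent_eqI[OF tangent_add_closed[OF Z(1) p'(3) v] zp(1)])
    fix V g p assume V: "zopen C V" "V \<subseteq> Z" and g: "regular C V g" and p: "p \<in> V"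
    have pZ: "p \<in> Z" "V \<subseteq> U i \<inter> U j" using V p Zij by auto
    show "(fst ?z \<oplus>\<^bsub>msec (tangent_sheaf C) Z\<^esub> ?v) V g p = fst z V g p"
      unfolding aut2_mu_eq[OF U_open(2) \<psi>_aut] tangent_ops
      using V g p pZ f_i[OF pZ(1)]
      by (simp add: affine_act_def affine_sheaf_simps(4) affine_of_aut_def divide_inverse)
  qed
  have c: "\<iota> Z (fst ?z) \<in> carrier (msec E Z)" "\<iota> Z ?v \<in> carrier (msec E Z)" "s j Z ?f \<in> carrier (msec E Z)"
    using \<iota>_facts(1)[OF Z(1,1)] p'(3) v s_facts(1)[OF Z(1) Zj f] by auto
  have "\<Theta> i Z ?z = \<iota> Z (fst ?z) \<oplus>\<^bsub>msec E Z\<^esub> (s j Z ?f \<oplus>\<^bsub>msec E Z\<^esub> \<iota> Z ?v)"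
    unfolding \<Theta>_def line using s_diff[of Z i j ?f] f Z Zij by (simp add: B_eq)
  also have "\<dots> = (\<iota> Z (fst ?z) \<oplus>\<^bsub>msec E Z\<^esub> \<iota> Z ?v) \<oplus>\<^bsub>msec E Z\<^esub> s j Z ?f"
    using c by (simp add: M.M.a_ac)
  also have "\<iota> Z (fst ?z) \<oplus>\<^bsub>msec E Z\<^esub> \<iota> Z ?v = \<iota> Z (fst z)"
    unfolding \<iota>_facts(2)[OF Z(1,1) p'(3) v, symmetric] sum ..
  finally show ?thesis .
qed

end

end

section \<open>The comparison isomorphism\<close>

text \<open>The three cocycles, together with the sections \<open>h\<^sub>x\<close> and \<open>k\<^sub>x\<close> that compare them near each
  point \<open>x\<close>.  The neighbourhoods \<open>N\<close> and the refinement map \<open>a\<close> of the cover for \<open>g\<close> are common to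
  both comparisons.\<close>

locale comparison = extension_charts C E U \<psi> \<iota> \<pi> s
  for C :: "'n::finite pt set" and E :: "('n pt, 'e) module_sheaf"
    and U :: "'i \<Rightarrow> 'n pt set" and \<psi> :: "'i \<Rightarrow> 'i \<Rightarrow> 'n jet_aut" and \<iota> \<pi> s +
  fixes n :: nat and c :: "('i, 'n pt, 'n jet_aut) cochain" and l :: "('i, 'n pt, 'n pt \<Rightarrow> complex) cochain"
    and N :: "'n pt \<Rightarrow> 'n pt set" and a b b' :: "'n pt \<Rightarrow> 'i"
    and h :: "'n pt \<Rightarrow> 'n vfield \<times> ('n pt \<Rightarrow> complex)" and k :: "'n pt \<Rightarrow> 'n pt \<Rightarrow> complex"
  assumes n: "n \<ge> 3"
    and c: "c \<in> cocycles C (aut_sheaf C n)" and l: "l \<in> cocycles C (units_sheaf C)"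
    and h_data: "coh_data C (affine_sheaf C) (map_cochain (affine_of_aut C n) c) (map_cochain (affine_of_aut C 2) (U, \<psi>)) N a b h"
    and k_data: "coh_data C (units_sheaf C)
      (map_cochain (\<lambda>V \<nu>. \<nu> [^]\<^bsub>gsec (units_sheaf C) V\<^esub> (n - 1)) (map_cochain (xi n) c)) l N a b' k"
begin

sublocale l: line_cocycle C l
  by unfold_locales (rule l)

sublocale t: tensor_sheaf_factors C E "line_bundle C l"
  by (intro tensor_sheaf_factors.intro E_presheaf l.L_presheaf tensor_sheaf_factors_axioms.intro E_module)

sublocale A: sheaf_action C "tangent_plus_structure C" "affine_sheaf C" "affine_act C"
  by (rule affine_action)

sublocale K: sheaf_action C "tangent_plus_structure C" "aut_sheaf C n" "conj_action C n"
  by (rule conj_sheaf_action[OF n])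

sublocale H: group_presheaf_hom C "aut_sheaf C n" "affine_sheaf C" "affine_of_aut C n"
  by (rule affine_of_aut_hom) (use n in simp)

abbreviation TW where "TW \<equiv> twisted_kernel C n c"

lemma TW_eq: "TW = twist (aut_sheaf C n) (conj_action C n) (tangent_plus_structure C) c"
  by (simp add: twisted_kernel_def)

lemma TW_sheaf: "sheaf_of_modules C TW"
  unfolding TW_eq by (rule K.twist_sheaf[OF c])

lemma fst_map_cochain: "fst (map_cochain f x) = fst x"
  by (simp add: map_cochain_def split: prod.splits)

lemma snd_map_cochain: "snd (map_cochain f x) i j = f (fst x i \<inter> fst x j) (snd x i j)"
  by (simp add: map_cochain_def split: prod.splits)

lemma N:
  assumes "x \<in> C"
  shows "x \<in> N x" "zopen C (N x)" "N x \<subseteq> fst c (a x)" "N x \<subseteq> U (b x)" "N x \<subseteq> fst l (b' x)"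
    "h x \<in> carrier (gsec (affine_sheaf C) (N x))" "k x \<in> carrier (gsec (units_sheaf C) (N x))"
  using coh_dataD(1-5)[OF h_data assms] coh_dataD(1-5)[OF k_data assms] by (simp_all add: fst_map_cochain)

definition hinv where "hinv x Z = inv\<^bsub>gsec (affine_sheaf C) Z\<^esub> gres (affine_sheaf C) (N x) Z (h x)"

definition scalar :: "'n pt \<Rightarrow> 'n pt set \<Rightarrow> 'n pt \<Rightarrow> complex" where "scalar x Z = (\<lambda>p\<in>Z. inverse (k x p))"

definition coord where "coord x Z y = affine_act C Z (hinv x Z) (y (a x))"

text \<open>The correction by \<open>h\<^sub>x\<^sup>-\<^sup>1\<close> leads from the coordinates belonging to \<open>g\<close> to those belonging to
  \<open>E\<close>; the scalar \<open>k\<^sub>x\<^sup>-\<^sup>1\<close> accounts for the line bundle.\<close>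

definition chart where "chart x Z y = scalar x Z \<odot>\<^bsub>msec E Z\<^esub> \<Theta> (b x) Z (coord x Z y)"

definition \<beta> where "\<beta> x Z y = t.pure Z (chart x Z y) (l.gen (b' x) Z)"

context
  fixes x Z
  assumes x: "x \<in> C" and Z: "zopen C Z" "Z \<subseteq> N x"
begin

lemma ZU: "Z \<subseteq> fst c (a x)" "Z \<subseteq> U (b x)" "Z \<subseteq> fst l (b' x)"
  using N(3-5)[OF x] Z(2) by auto

lemma h_closed: "gres (affine_sheaf C) (N x) Z (h x) \<in> carrier (gsec (affine_sheaf C) Z)"
  by (rule A.S.gres_closed[OF N(2)[OF x] Z N(6)[OF x]])

lemma hinv_closed: "hinv x Z \<in> carrier (gsec (affine_sheaf C) Z)"
  unfolding hinv_def by (rule group.inv_closed[OF A.S.sec_group[OF Z(1)] h_closed])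

lemma k_regular: "regular C Z (restrict (k x) Z)" and k_nonzero: "p \<in> Z \<Longrightarrow> k x p \<noteq> 0"
  using N(7)[OF x] N(2)[OF x] Z regular_restrict[of C "N x" "k x" Z] by auto

lemma scalar_regular: "regular C Z (scalar x Z)"
proof -
  have "regular C Z (\<lambda>p\<in>Z. inverse (restrict (k x) Z p))"
    using k_nonzero by (intro regular_inverse k_regular) simp
  then show ?thesis
    unfolding scalar_def by (rule regular_cong) (auto intro!: restrict_ext)
qed

lemma comp_closed: "y \<in> carrier (msec TW Z) \<Longrightarrow> y (a x) \<in> TO_sections C Z"
  unfolding TW_eq by (rule K.twist_chart_closed[OF c ZU(1)])

lemma coord_closed: "y \<in> carrier (msec TW Z) \<Longrightarrow> coord x Z y \<in> TO_sections C Z"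
  unfolding coord_def by (rule A.act_closed[OF Z(1) hinv_closed comp_closed])

lemma chart_closed: "y \<in> carrier (msec TW Z) \<Longrightarrow> chart x Z y \<in> carrier (msec E Z)"
  unfolding chart_def
  by (rule t.F.smult_closed[OF Z(1) scalar_regular \<Theta>_closed[OF Z(1) ZU(2) coord_closed]])

lemma coord_bij: "bij_betw (coord x Z) (carrier (msec TW Z)) (TO_sections C Z)"
proof -
  interpret G: group "gsec (affine_sheaf C) Z"
    by (rule A.S.sec_group[OF Z(1)])
  have "bij_betw (affine_act C Z (hinv x Z)) (TO_sections C Z) (TO_sections C Z)"
  proof (rule bij_betw_byWitness[where f' = "affine_act C Z (gres (affine_sheaf C) (N x) Z (h x))"])
    show "\<forall>z\<in>TO_sections C Z. affine_act C Z (gres (affine_sheaf C) (N x) Z (h x)) (affine_act C Z (hinv x Z) z) = z"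
      unfolding hinv_def using A.act_mult[OF Z(1) h_closed G.inv_closed[OF h_closed], symmetric]
      by (simp add: G.r_inv[OF h_closed] A.act_one[OF Z(1)])
    show "\<forall>z\<in>TO_sections C Z. affine_act C Z (hinv x Z) (affine_act C Z (gres (affine_sheaf C) (N x) Z (h x)) z) = z"
      unfolding hinv_def using A.act_mult[OF Z(1) G.inv_closed[OF h_closed] h_closed, symmetric]
      by (simp add: G.l_inv[OF h_closed] A.act_one[OF Z(1)])
  qed (use A.act_closed[OF Z(1) h_closed] A.act_closed[OF Z(1) hinv_closed] in blast)+
  from bij_betw_trans[OF K.twist_chart_bij[OF c Z(1) ZU(1), folded TW_eq] this]
  show ?thesis
    by (simp add: coord_def[abs_def] comp_def)
qed

lemma scalar_bij: "bij_betw (\<lambda>e. scalar x Z \<odot>\<^bsub>msec E Z\<^esub> e) (carrier (msec E Z)) (carrier (msec E Z))"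
proof -
  interpret M: module "struct_sheaf C Z" "msec E Z"
    by (rule E_module[OF Z(1)])
  have s: "scalar x Z \<in> carrier (struct_sheaf C Z)" "restrict (k x) Z \<in> carrier (struct_sheaf C Z)"
    using scalar_regular k_regular by simp_all
  have "scalar x Z \<otimes>\<^bsub>struct_sheaf C Z\<^esub> restrict (k x) Z = \<one>\<^bsub>struct_sheaf C Z\<^esub>"
    "restrict (k x) Z \<otimes>\<^bsub>struct_sheaf C Z\<^esub> scalar x Z = \<one>\<^bsub>struct_sheaf C Z\<^esub>"
    unfolding struct_sheaf_simps scalar_def using k_nonzero by (auto intro!: restrict_ext)
  then have "scalar x Z \<odot>\<^bsub>msec E Z\<^esub> (restrict (k x) Z \<odot>\<^bsub>msec E Z\<^esub> e) = e"
      "restrict (k x) Z \<odot>\<^bsub>msec E Z\<^esub> (scalar x Z \<odot>\<^bsub>msec E Z\<^esub> e) = e" if "e \<in> carrier (msec E Z)" for e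
    unfolding M.smult_assoc1[OF s that, symmetric] M.smult_assoc1[OF s(2,1) that, symmetric]
    using M.smult_one[OF that] by simp_all
  with M.smult_closed[OF s(1)] M.smult_closed[OF s(2)] show ?thesis
    by (intro bij_betw_byWitness[where f' = "\<lambda>e. restrict (k x) Z \<odot>\<^bsub>msec E Z\<^esub> e"]) auto
qed

lemma \<beta>_bij: "bij_betw (\<beta> x Z) (carrier (msec TW Z)) (carrier (msec t.P Z))"
proof -
  note g = ZU(3)
  have p: "bij_betw (\<lambda>e. t.pure Z e (l.gen (b' x) Z)) (carrier (msec E Z)) (carrier (msec t.P Z))"
    by (rule t.pure_bij[where \<kappa> = "\<lambda>y. y (b' x)", OF Z(1) l.gen_closed[OF Z(1) g]])
       (simp_all only: l.coord_regular[OF Z(1) g] l.gen_coord[OF Z(1) g] l.coord_gen[OF Z(1) g]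
         l.coord_add[OF Z(1) g] l.coord_smult[OF Z(1) g])
  from bij_betw_trans[OF bij_betw_trans[OF bij_betw_trans[OF coord_bij \<Theta>_bij[OF Z(1) ZU(2)]] scalar_bij] p]
  show ?thesis
    by (simp add: \<beta>_def[abs_def] chart_def[abs_def] comp_def)
qed

lemma \<beta>_add:
  assumes y: "y \<in> carrier (msec TW Z)" and y': "y' \<in> carrier (msec TW Z)"
  shows "\<beta> x Z (y \<oplus>\<^bsub>msec TW Z\<^esub> y') = \<beta> x Z y \<oplus>\<^bsub>msec t.P Z\<^esub> \<beta> x Z y'"
proof -
  interpret M: module "struct_sheaf C Z" "msec E Z"
    by (rule E_module[OF Z(1)])
  have s: "scalar x Z \<in> carrier (struct_sheaf C Z)" using scalar_regular by simp
  have "(y \<oplus>\<^bsub>msec TW Z\<^esub> y') (a x) = y (a x) \<oplus>\<^bsub>msec (tangent_plus_structure C) Z\<^esub> y' (a x)"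
    unfolding TW_eq twist_simps using ZU(1) by (simp add: Int_absorb2)
  then have "coord x Z (y \<oplus>\<^bsub>msec TW Z\<^esub> y') = coord x Z y \<oplus>\<^bsub>msec (tangent_plus_structure C) Z\<^esub> coord x Z y'"
    unfolding coord_def using A.act_add[OF Z(1) hinv_closed comp_closed[OF y] comp_closed[OF y']] by simp
  then have "chart x Z (y \<oplus>\<^bsub>msec TW Z\<^esub> y') = chart x Z y \<oplus>\<^bsub>msec E Z\<^esub> chart x Z y'"
    unfolding chart_def
    using \<Theta>_add[OF Z(1) ZU(2) coord_closed[OF y] coord_closed[OF y']]
      M.smult_r_distr[OF s \<Theta>_closed[OF Z(1) ZU(2) coord_closed[OF y]] \<Theta>_closed[OF Z(1) ZU(2) coord_closed[OF y']]]
    by simp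
  then show ?thesis
    unfolding \<beta>_def
    using t.pure_add[OF Z(1) chart_closed[OF y] chart_closed[OF y'] l.gen_closed[OF Z(1) ZU(3)]] by simp
qed

lemma \<beta>_smult:
  assumes f: "regular C Z f" and y: "y \<in> carrier (msec TW Z)"
  shows "\<beta> x Z (f \<odot>\<^bsub>msec TW Z\<^esub> y) = f \<odot>\<^bsub>msec t.P Z\<^esub> \<beta> x Z y"
proof -
  interpret M: module "struct_sheaf C Z" "msec E Z"
    by (rule E_module[OF Z(1)])
  have s: "scalar x Z \<in> carrier (struct_sheaf C Z)" "f \<in> carrier (struct_sheaf C Z)" using scalar_regular f by simp_all
  note e = \<Theta>_closed[OF Z(1) ZU(2) coord_closed[OF y]]
  have "(f \<odot>\<^bsub>msec TW Z\<^esub> y) (a x) = f \<odot>\<^bsub>msec (tangent_plus_structure C) Z\<^esub> y (a x)"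
    unfolding TW_eq twist_simps using ZU(1) regular_eta[OF f] by (simp add: Int_absorb2)
  then have "coord x Z (f \<odot>\<^bsub>msec TW Z\<^esub> y) = f \<odot>\<^bsub>msec (tangent_plus_structure C) Z\<^esub> coord x Z y"
    unfolding coord_def using A.act_smult[OF Z(1) hinv_closed f comp_closed[OF y]] by simp
  then have "chart x Z (f \<odot>\<^bsub>msec TW Z\<^esub> y) = scalar x Z \<odot>\<^bsub>msec E Z\<^esub> (f \<odot>\<^bsub>msec E Z\<^esub> \<Theta> (b x) Z (coord x Z y))"
    unfolding chart_def using \<Theta>_smult[OF Z(1) ZU(2) coord_closed[OF y] f] by simp
  also have "\<dots> = f \<odot>\<^bsub>msec E Z\<^esub> chart x Z y"
    unfolding chart_def M.smult_assoc1[OF s e, symmetric] M.smult_assoc1[OF s(2,1) e, symmetric]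
    by (simp only: M.R.m_comm[OF s])
  finally show ?thesis
    unfolding \<beta>_def using t.pure_smult[OF Z(1) f] by simp
qed

lemma \<beta>_res:
  assumes Z': "zopen C Z'" "Z' \<subseteq> Z" and y: "y \<in> carrier (msec TW Z)"
  shows "mres t.P Z Z' (\<beta> x Z y) = \<beta> x Z' (mres TW Z Z' y)"
proof -
  have "(mres TW Z Z' y) (a x) = mres (tangent_plus_structure C) Z Z' (y (a x))"
    unfolding TW_eq twist_simps using ZU(1) Z'(2) by (simp add: Int_absorb2)
  moreover have "gres (affine_sheaf C) Z Z' (hinv x Z) = hinv x Z'"
    unfolding hinv_def A.S.gres_inv[OF Z(1) Z' h_closed] A.S.gres_gres[OF N(2)[OF x] Z(1) Z' Z(2) N(6)[OF x]] ..
  ultimately have "coord x Z' (mres TW Z Z' y) = mres (tangent_plus_structure C) Z Z' (coord x Z y)"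
    unfolding coord_def A.act_res[OF Z(1) Z' hinv_closed comp_closed[OF y]] by simp
  moreover have "restrict (scalar x Z) Z' = scalar x Z'"
    using Z'(2) by (auto simp: scalar_def fun_eq_iff)
  ultimately have "mres E Z Z' (chart x Z y) = chart x Z' (mres TW Z Z' y)"
    unfolding chart_def t.F.res_smult[OF Z(1) Z' scalar_regular \<Theta>_closed[OF Z(1) ZU(2) coord_closed[OF y]]]
      \<Theta>_res[OF Z(1) ZU(2) coord_closed[OF y] Z'] by simp
  then show ?thesis
    unfolding \<beta>_def t.pure_res[OF Z(1) Z'] l.gen_res[OF Z(1) ZU(3) Z'] by simp
qed

end

text \<open>Passing from \<open>x'\<close> to \<open>x\<close> multiplies the element of \<open>E\<close> by \<open>k\<^sub>x\<^sup>-\<^sup>1 \<nu>\<^sup>n\<^sup>-\<^sup>1 k\<^sub>x\<^sub>'\<close>, the affine part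
  of the transition being absorbed by the charts of \<open>E\<close>.  This scalar is the value of the cocycle of
  the line bundle, which is also the ratio of the two generators; it cancels in the tensor product.\<close>

lemma \<beta>_compat:
  assumes x: "x \<in> C" and x': "x' \<in> C" and Z: "zopen C Z" and Zx: "Z \<subseteq> N x" and Zx': "Z \<subseteq> N x'"
    and y: "y \<in> carrier (msec TW Z)"
  shows "\<beta> x Z y = \<beta> x' Z y"
proof -
  interpret M: module "struct_sheaf C Z" "msec E Z"
    by (rule E_module[OF Z])
  interpret G: group "gsec (affine_sheaf C) Z"
    by (rule A.S.sec_group[OF Z])
  have n2: "n \<ge> 2" using n by simp
  note ZU = ZU[OF x Z Zx] and ZU' = ZU[OF x' Z Zx']
  let ?V = "fst c (a x) \<inter> fst c (a x')" and ?V2 = "U (b x) \<inter> U (b x')"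
  have V: "zopen C ?V" "Z \<subseteq> ?V" "zopen C ?V2" "Z \<subseteq> ?V2"
    using cocyclesD(1)[OF c] U_open ZU ZU' by auto
  let ?g = "snd c (a x) (a x')"
  have g: "?g \<in> jet_aut_sections C n ?V"
    by (rule cocyclesD(3)[OF c])
  let ?gZ = "gres (aut_sheaf C n) ?V Z ?g"
  have gZ: "?gZ \<in> jet_aut_sections C n Z"
    by (rule K.S.gres_closed[OF V(1) Z V(2) g])
  let ?A = "gres (affine_sheaf C) ?V Z (affine_of_aut C n ?V ?g)"
    and ?\<Psi> = "gres (affine_sheaf C) ?V2 Z (affine_of_aut C 2 ?V2 (\<psi> (b x) (b x')))"
    and ?H = "gres (affine_sheaf C) (N x) Z (h x)" and ?H' = "gres (affine_sheaf C) (N x') Z (h x')"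
  let ?P = "\<lambda>p\<in>Z. xi n Z ?gZ p ^ (n - 1)" and ?l = "restrict (snd l (b' x) (b' x')) Z"
  have cl: "?A \<in> carrier (gsec (affine_sheaf C) Z)" "?\<Psi> \<in> carrier (gsec (affine_sheaf C) Z)"
    "?H \<in> carrier (gsec (affine_sheaf C) Z)" "?H' \<in> carrier (gsec (affine_sheaf C) Z)"
    by (intro A.S.gres_closed V Z H.hom_closed g group_presheaf_hom.hom_closed[OF affine_of_aut_hom] \<psi>_aut order_refl
        h_closed x x' Zx Zx')+
  have "?A \<otimes>\<^bsub>gsec (affine_sheaf C) Z\<^esub> ?H' = ?H \<otimes>\<^bsub>gsec (affine_sheaf C) Z\<^esub> ?\<Psi>"
    using coh_dataD(6)[OF h_data x x' Z Zx Zx'] by (simp add: fst_map_cochain snd_map_cochain)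
  then have A_eq: "?A = ?H \<otimes>\<^bsub>gsec (affine_sheaf C) Z\<^esub> ?\<Psi> \<otimes>\<^bsub>gsec (affine_sheaf C) Z\<^esub> inv\<^bsub>gsec (affine_sheaf C) Z\<^esub> ?H'"
    using G.inv_solve_right[OF cl(1) G.m_closed[OF cl(3,2)] cl(4)] by simp
  have rel: "hinv x Z \<otimes>\<^bsub>gsec (affine_sheaf C) Z\<^esub> ?A = ?\<Psi> \<otimes>\<^bsub>gsec (affine_sheaf C) Z\<^esub> hinv x' Z"
    unfolding A_eq hinv_def using cl by (simp add: G.m_assoc[symmetric])
  have P: "regular C Z ?P"
    by (intro regular_power xi_regular n2 gZ Z)
  \<comment> \<open>The two components of the twisted section are related by the conjugation action of \<open>g\<^sub>a\<^sub>a\<^sub>'\<close>,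
    whose affine part is \<open>h\<^sub>x \<psi> h\<^sub>x\<^sub>'\<^sup>-\<^sup>1\<close>.\<close>
  let ?w = "y (a x')"
  note w = comp_closed[OF x' Z Zx' y] and hi = hinv_closed[OF x Z Zx] and hi' = hinv_closed[OF x' Z Zx']
  have "y (a x) = conj_action C n Z ?gZ ?w"
    using y unfolding TW_eq by (rule K.twist_chart_rel[OF c Z ZU(1) ZU'(1)])
  also have "\<dots> = ?P \<odot>\<^bsub>msec (tangent_plus_structure C) Z\<^esub> affine_act C Z ?A ?w"
    unfolding conj_action_eq[OF Z n gZ w] H.hom_res[OF V(1) Z V(2) g] ..
  finally have "coord x Z y = ?P \<odot>\<^bsub>msec (tangent_plus_structure C) Z\<^esub> affine_act C Z ?\<Psi> (coord x' Z y)"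
    unfolding coord_def
    using A.act_smult[OF Z hi P A.act_closed[OF Z cl(1) w]] A.act_mult[OF Z hi cl(1) w] A.act_mult[OF Z cl(2) hi' w] rel
    by simp
  then have "\<Theta> (b x) Z (coord x Z y) = ?P \<odot>\<^bsub>msec E Z\<^esub> \<Theta> (b x') Z (coord x' Z y)"
    using \<Theta>_smult[OF Z ZU(2) A.act_closed[OF Z cl(2) coord_closed[OF x' Z Zx' y]] P]
      \<Theta>_transition[OF Z ZU(2) ZU'(2) coord_closed[OF x' Z Zx' y]]
    by (simp add: \<Theta>_def[of "b x'"])
  then have chart_x: "chart x Z y = scalar x Z \<odot>\<^bsub>msec E Z\<^esub> (?P \<odot>\<^bsub>msec E Z\<^esub> \<Theta> (b x') Z (coord x' Z y))"
    by (simp add: chart_def)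
  have l_reg: "regular C Z ?l"
    using ZU(3) ZU'(3) by (intro regular_restrict[OF l.u_regular Z]) auto
  have r: "scalar x Z \<in> carrier (struct_sheaf C Z)" "?P \<in> carrier (struct_sheaf C Z)"
     "?l \<in> carrier (struct_sheaf C Z)" "scalar x' Z \<in> carrier (struct_sheaf C Z)"
    using scalar_regular[OF x Z Zx] scalar_regular[OF x' Z Zx'] P l_reg by (simp_all only: struct_sheaf_simps)
  note e = \<Theta>_closed[OF Z ZU'(2) coord_closed[OF x' Z Zx' y]]
  have scal: "scalar x Z \<otimes>\<^bsub>struct_sheaf C Z\<^esub> ?P = ?l \<otimes>\<^bsub>struct_sheaf C Z\<^esub> scalar x' Z"
    unfolding struct_sheaf_simps
  proof (rule restrict_ext)
    fix p assume p: "p \<in> Z"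
    have "restrict (xi n ?V ?g [^]\<^bsub>units_of (struct_sheaf C ?V)\<^esub> (n - 1)) Z p * restrict (k x') Z p
        = restrict (k x) Z p * restrict (snd l (b' x) (b' x')) Z p"
      using fun_cong[OF coh_dataD(6)[OF k_data x x' Z Zx Zx'], of p] p by (simp add: fst_map_cochain snd_map_cochain)
    moreover have "p \<in> ?V" using p V(2) by blast
    ultimately have "xi n ?V ?g p ^ (n - 1) * k x' p = k x p * snd l (b' x) (b' x') p"
      using p unfolding pow_units_struct_sheaf[OF V(1) xi_regular[OF V(1) n2 g]] by simp
    moreover have "xi n Z ?gZ p = xi n ?V ?g p"
      using p unfolding xi_restrict[OF V(1) n2 g Z V(2)] by simp
    ultimately show "scalar x Z p * ?P p = ?l p * scalar x' Z p"
      using p k_nonzero[OF x Z Zx p] k_nonzero[OF x' Z Zx' p] by (simp add: scalar_def field_simps)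
  qed
  have "chart x Z y = ?l \<odot>\<^bsub>msec E Z\<^esub> chart x' Z y"
    unfolding chart_x chart_def[of x'] M.smult_assoc1[OF r(1,2) e, symmetric] M.smult_assoc1[OF r(3,4) e, symmetric] scal ..
  then have "\<beta> x Z y = t.pure Z (chart x' Z y) (?l \<odot>\<^bsub>msec (line_bundle C l) Z\<^esub> l.gen (b' x) Z)"
    unfolding \<beta>_def
    using t.pure_balanced[OF Z l_reg chart_closed[OF x' Z Zx' y] l.gen_closed[OF Z ZU(3)]] by simp
  then show ?thesis
    unfolding \<beta>_def[of x'] l.gen_change[OF Z ZU(3) ZU'(3)] by simp
qed

lemma twisted_kernel_iso: "module_sheaf_iso C TW (tensor_sheaf C E (line_bundle C l))"
  unfolding tensor_sheaf_def
  by (rule sheafification_iso[OF t.tensor_module_presheaf TW_sheaf, where N = N and \<beta> = \<beta>])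
     (assumption | rule N(1,2) \<beta>_bij \<beta>_add \<beta>_smult \<beta>_res \<beta>_compat)+

end

theorem mainTheorem6:
  fixes C :: "'n::finite pt set"
    and n :: nat
    and g :: "('i, 'n pt, 'n jet_aut) cochain set"
    and L :: "('i, 'n pt, 'n pt \<Rightarrow> complex) cochain set"
    and g2 :: "('i, 'n pt, 'n jet_aut) cochain set"
    and E :: "('n pt, 'e) module_sheaf"
    and c :: "('i, 'n pt, 'n jet_aut) cochain"
    and l :: "('i, 'n pt, 'n pt \<Rightarrow> complex) cochain"
  assumes "smooth_irreducible_projective_curve C"
    and "n \<ge> 3"
    and "g \<in> H1 C (aut_sheaf C n)"
    and "L = H1_map C (units_sheaf C) (xi n) g"
    and "g2 = H1_map C (aut_sheaf C 2) (aut_reduce C n 2) g"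
    and "is_E_bundle C g2 E"
    and "c \<in> g"
    and "l \<in> pic_power C L (n - 1)"
  shows "module_sheaf_iso C (twisted_kernel C n c) (tensor_sheaf C E (line_bundle C l))"
proof -
  interpret A: group_presheaf C "affine_sheaf C" by (rule affine_group_presheaf)
  interpret R: group_presheaf C "units_sheaf C" by (rule units_group_presheaf)
  interpret S: group_presheaf C "aut_sheaf C n" by (rule aut_group_presheaf)
  interpret S2: group_presheaf C "aut_sheaf C 2" by (rule aut_group_presheaf)
  obtain U \<psi> where U\<psi>: "(U, \<psi>) \<in> g2"
    and ext: "extension_of_class C (tangent_sheaf C) (dual_line_bundle C (map_cochain (xi 2) (U, \<psi>))) U
         (\<lambda>i j W f. restrict (f i) W \<odot>\<^bsub>msec (tangent_sheaf C) W\<^esub>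
            mres (tangent_sheaf C) (U i \<inter> U j) W (aut2_mu C (U i \<inter> U j) (\<psi> i j))) E"
    using assms(6) unfolding is_E_bundle_def by blast
  obtain \<iota> \<pi> s where E: "is_module_sheaf C E" and
    ex: "short_exact C (tangent_sheaf C) E (dual_line_bundle C (map_cochain (xi 2) (U, \<psi>))) \<iota> \<pi>" and
    split: "\<forall>i. module_sheaf_hom C (U i) (dual_line_bundle C (map_cochain (xi 2) (U, \<psi>))) E (s i) \<and>
       (\<forall>W\<in>opens C (U i). \<forall>f\<in>carrier (msec (dual_line_bundle C (map_cochain (xi 2) (U, \<psi>))) W). \<pi> W (s i W f) = f)" and
    diff: "\<forall>i j. \<forall>W\<in>opens C (U i \<inter> U j). \<forall>f\<in>carrier (msec (dual_line_bundle C (map_cochain (xi 2) (U, \<psi>))) W).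
       s i W f = s j W f \<oplus>\<^bsub>msec E W\<^esub> \<iota> W (restrict (f i) W \<odot>\<^bsub>msec (tangent_sheaf C) W\<^esub>
            mres (tangent_sheaf C) (U i \<inter> U j) W (aut2_mu C (U i \<inter> U j) (\<psi> i j)))"
    using ext unfolding extension_of_class_def by blast
  have "(U, \<psi>) \<in> cocycles C (aut_sheaf C 2)"
  proof -
    obtain c' where "(c', (U, \<psi>)) \<in> cohomologous C (aut_sheaf C 2)"
      using U\<psi> unfolding assms(5) H1_map_def by blast
    then show ?thesis by (rule S2.cohomologousE)
  qed
  then interpret E: extension_charts C E U \<psi> \<iota> \<pi> s
    using E ex split diff by (intro extension_charts.intro) blast+
  have cc: "(c, c) \<in> cohomologous C (aut_sheaf C n)"
    by (rule S.H1_cohomologous[OF assms(3,7,7)])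
  have c: "c \<in> cocycles C (aut_sheaf C n)"
    using cc by (rule S.cohomologousE)
  let ?cA = "map_cochain (affine_of_aut C n) c" and ?dA = "map_cochain (affine_of_aut C 2) (U, \<psi>)"
  let ?cL = "map_cochain (\<lambda>V \<nu>. \<nu> [^]\<^bsub>gsec (units_sheaf C) V\<^esub> (n - 1)) (map_cochain (xi n) c)"
  obtain W a b h where 1: "?cA \<in> cocycles C (affine_sheaf C)" "?dA \<in> cocycles C (affine_sheaf C)"
    "coh_data C (affine_sheaf C) ?cA ?dA W a b h"
    using affine_class[OF assms(2,3,7) U\<psi>[unfolded assms(5)]] by (rule A.cohomologousE)
  obtain W' a' b' h' where 2: "?cL \<in> cocycles C (units_sheaf C)" "l \<in> cocycles C (units_sheaf C)"
    "coh_data C (units_sheaf C) ?cL l W' a' b' h'"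
    using line_bundle_class[OF assms(2,3,7) assms(8)[unfolded assms(4)]] by (rule R.cohomologousE)
  \<comment> \<open>Both comparisons are made on the same sets and with the same refinement map for \<open>c\<close>.\<close>
  define N where "N x = W x \<inter> W' x" for x
  have fst_eq: "fst ?cA = fst c" "fst ?cL = fst c"
    by (simp_all add: map_cochain_def split: prod.splits)
  have N: "zopen C (N x)" "x \<in> N x" "N x \<subseteq> W x" "N x \<subseteq> W' x" "N x \<subseteq> fst c (a x)" if "x \<in> C" for x
    using coh_dataD(1-3)[OF 1(3) that] coh_dataD(1-3)[OF 2(3) that] unfolding fst_eq by (auto simp: N_def)
  obtain h1 where h1: "coh_data C (affine_sheaf C) ?cA ?dA N a b h1"
    using A.coh_data_reindex[OF 1 N(1-3), of a] N(5) unfolding fst_eq by blast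
  obtain k where k: "coh_data C (units_sheaf C) ?cL l N a b' k"
    using R.coh_data_reindex[OF 2 N(1,2,4), of a] N(5) unfolding fst_eq by blast
  interpret comparison C E U \<psi> \<iota> \<pi> s n c l N a b b' h1 k
    by unfold_locales (rule assms(2) c 2(2) h1 k)+
  show ?thesis
    by (rule twisted_kernel_iso)
qed

end
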